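(* Let $(p,q)\in\mathcal{C}^0$ be a path in $T^*Q$ and consider the minimization of $\Delta\mapsto\mathcal{F}(\Delta,p,q)$ over $\mathcal{M}_0(D)$. For $\Delta\in\mathcal{M}_0(D)$ set $$w=\eta\int_0^x\Big(\tfrac{D}{Dt}\dot q+\eta\,\pi_q^*(\mathcal{U}(\Delta,q))\Big)dy .$$ A necessary and sufficient condition for optimality at $\Delta$ is that both of the following conditions are satisfied: for any $\mu\in\mathcal{M}_0(D)$ such that $\partial_t\mu$ is a finite Radon measure on $D$, $$\mathrm{FR}_\eta(\mu,\partial_t\mu)\ge\langle\mu,-w\rangle,$$ and $$\mathrm{FR}_\eta(\Delta,\partial_t\Delta)+\langle\Delta,w\rangle=0 .$$
   Context: $D=[0,1]^2$ with points $(t,x)$ (time, space); dots are time derivatives. For $q\in L^2([0,1])$ put $\eta(q)(x)=\exp(\int_0^xq(u)\,du)$, $\varphi(q)(x)=\int_0^x\eta(q)(y)\,dy$ (argument $q$ often omitted). $Q=\{q\in L^2([0,1]):\int_0^1q\,dx=0,\ \int_0^1\eta(q)\,dx=1\}$, with Riemannian metric $G(q)(X,X)=\int_0^1X^2/\eta(q)\,dx$. Write $\langle f,g\rangle_\eta=\int_0^1fg\,\eta\,dx$, $H_2=\begin{bmatrix}1&1/2\\1/2&1/3\end{bmatrix}$, $\pi_q^*(p)=p-\begin{bmatrix}1&\varphi\end{bmatrix}H_2^{-1}\begin{bmatrix}\langle p,1\rangle_\eta\\ \langle p,\varphi\rangle_\eta\end{bmatrix}$. $T_q^*Q$ is identified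 with the range of $\pi_q^*$, i.e. $\{p\in L^2:\langle p,1\rangle_\eta=\langle p,\varphi\rangle_\eta=0\}$, with norm $\|p\|_q^2=\int_0^1\eta\,p^2dx$; $X^\flat=X/\eta$ for $X\in T_qQ$. Given $q_0\in Q$, $p_0\in T_{q_0}^*Q$, $\mathcal{C}^0$ is the set of curves $(p(t),q(t))\in T^*Q$, $t\in[0,1]$, with $q\in H^2([0,1],L^2([0,1]))$, $\dot q=\eta(q)p$, $q(0)=q_0$, $p(0)=p_0$. $\frac{D}{Dt}\dot q$ is the covariant derivative of $\dot q$ along $q$ for $(Q,G)$; explicitly, with $\mathcal{U}(f,q)(x)=\frac12\int_x^1\eta(q)f\,dy$ and $b=\frac32\int_0^1(\int_0^xp\circ\varphi^{-1}dy)^2dx$, $$\Big(\tfrac{D}{Dt}\dot q\Big)^\flat=\dot p+\mathcal{U}(p^2,q)-\begin{bmatrix}1&\varphi\end{bmatrix}H_2^{-1}\begin{bmatrix}0\\ b\end{bmatrix}-(\mathrm{id}-\pi_q^* )(\mathcal{U}(p^2,q)).$$ For a measure $\Delta=\Delta_t\,dt$ on $D$, $\mathcal{U}(\Delta,q)(t,x)=\frac12\int_x^1\eta(q(t))\,d\Delta_t$, and $\langle\Delta,w\rangle=\int_0^1\int_0^1w(t,x)\,d\Delta_t(x)\,dt$. Fisher-Rao functional: $r(x,y)=\frac14\frac{y^2}{x}$ if $x>0$, $r(0,0)=0$, $r=+\infty$ otherwise; for finite signed Radon measures $\mu,\nu$ on $D$ and $f\in C^0(D,(0,\infty))$, $\mathrm{FR}_f(\mu,\nu)=\int_Dr(\frac{d\mu}{d\lambda},\frac{d\nu}{d\lambda})f\,d\lambda$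 for any positive $\lambda$ dominating $\mu,\nu$. $\mathcal{M}_0(D)$ is the set of positive finite Radon measures $\Delta$ on $D$ with $\Delta_{t=0}=0$. The conditions $\Delta_{t=0}=0$ and $\partial_t\Delta=\delta$ are understood weakly: $\int_D\partial_tf\,d\Delta+\int_Df\,d\delta=0$ for all continuous $f$ on $D$ that are $C^1$ in $t$ with $f(1,x)=0$ for all $x$. The functional is $$\mathcal{F}(\Delta,p,q)=\mathrm{FR}_\eta(\Delta,\partial_t\Delta)+\int_0^1\Big\|\Big(\tfrac{D}{Dt}\dot q\Big)^\flat+\pi_q^*(\mathcal{U}(\Delta,q))\Big\|_q^2dt+P(p(1),q(1)),$$ with $\mathrm{FR}_\eta(\Delta,\partial_t\Delta)$ and $\mathcal{F}$ equal to $+\infty$ if $\partial_t\Delta$ is not a finite Radon measure; $P$ is a real-valued functional on $T^*Q$. "Optimality at $\Delta$" means that $\Delta$ minimizes $\mathcal{F}(\cdot,p,q)$ over $\mathcal{M}_0(D)$. *)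

theory Defs
  imports "HOL-Analysis.Analysis"
begin

text \<open>
  Elements of \<open>L\<^sup>2([0,1])\<close> are represented by functions, identified when equal almost everywhere;
  a path in \<open>L\<^sup>2([0,1])\<close> is a function \<open>real \<Rightarrow> real \<Rightarrow> real\<close>, time first.
\<close>

abbreviation leb01 :: "real measure" where
  "leb01 \<equiv> lebesgue_on {0..1}"

definition unit_sq :: "(real \<times> real) set" where
  "unit_sq = {0..1} \<times> {0..1}"

definition borel_sq :: "(real \<times> real) measure" where
  "borel_sq = restrict_space borel unit_sq"

definition L2 :: "(real \<Rightarrow> real) set" where
  "L2 = {f \<in> borel_measurable leb01. integrable leb01 (\<lambda>x. (f x)\<^sup>2)}"


section \<open>The manifold \<open>Q\<close> and its cotangent bundle\<close>

definition eta :: "(real \<Rightarrow> real) \<Rightarrow> real \<Rightarrow> real" where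
  "eta q x = exp (LINT u|lebesgue_on {0..x}. q u)"

definition phi :: "(real \<Rightarrow> real) \<Rightarrow> real \<Rightarrow> real" where
  "phi q x = (LINT y|lebesgue_on {0..x}. eta q y)"

definition Q :: "(real \<Rightarrow> real) set" where
  "Q = {q \<in> L2. (LINT x|leb01. q x) = 0 \<and> (LINT x|leb01. eta q x) = 1}"

definition inner_eta :: "(real \<Rightarrow> real) \<Rightarrow> (real \<Rightarrow> real) \<Rightarrow> (real \<Rightarrow> real) \<Rightarrow> real" where
  "inner_eta q f g = (LINT x|leb01. f x * g x * eta q x)"

definition cotangent :: "(real \<Rightarrow> real) \<Rightarrow> (real \<Rightarrow> real) set" where
  "cotangent q = {p \<in> L2. inner_eta q p (\<lambda>x. 1) = 0 \<and> inner_eta q p (phi q) = 0}"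

definition cotangent_bundle :: "((real \<Rightarrow> real) \<times> (real \<Rightarrow> real)) set" where
  "cotangent_bundle = {(p, q). q \<in> Q \<and> p \<in> cotangent q}"

text \<open>The squared norm of \<open>T\<^sub>q\<^sup>*Q\<close>, with value \<open>\<infinity>\<close> outside \<open>L\<^sup>2\<close>.\<close>

definition sqnorm_eta :: "(real \<Rightarrow> real) \<Rightarrow> (real \<Rightarrow> real) \<Rightarrow> ennreal" where
  "sqnorm_eta q p = (\<integral>\<^sup>+x. ennreal (eta q x * (p x)\<^sup>2) \<partial>leb01)"

definition H2 :: "real^2^2" where
  "H2 = vector [vector [1, 1/2], vector [1/2, 1/3]]"

definition H2_comb :: "(real \<Rightarrow> real) \<Rightarrow> real \<Rightarrow> real \<Rightarrow> real \<Rightarrow> real" where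
  "H2_comb q a b x = (vector [1, phi q x] :: real^2) \<bullet> (matrix_inv H2 *v vector [a, b])"

definition proj_cot :: "(real \<Rightarrow> real) \<Rightarrow> (real \<Rightarrow> real) \<Rightarrow> real \<Rightarrow> real" where
  "proj_cot q p x = p x - H2_comb q (inner_eta q p (\<lambda>x. 1)) (inner_eta q p (phi q)) x"


section \<open>Sobolev paths and the covariant acceleration\<close>

text \<open>
  \<open>H1_deriv f g\<close>: the path \<open>f\<close> is (the continuous representative of) an element of
  \<open>H\<^sup>1([0,1], L\<^sup>2([0,1]))\<close> with weak time derivative \<open>g\<close>, that is,
  \<open>g \<in> L\<^sup>2([0,1], L\<^sup>2([0,1])) = L\<^sup>2([0,1]\<^sup>2)\<close> and \<open>f(t) = f(0) + \<integral>\<^sub>0\<^sup>t g(s) ds\<close> in \<open>L\<^sup>2([0,1])\<close>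
  for every \<open>t\<close>. The Bochner integral of \<open>g\<close> agrees with the pointwise one for almost every \<open>x\<close>.
\<close>

definition H1_deriv :: "(real \<Rightarrow> real \<Rightarrow> real) \<Rightarrow> (real \<Rightarrow> real \<Rightarrow> real) \<Rightarrow> bool" where
  "H1_deriv f g \<longleftrightarrow>
     (\<forall>t\<in>{0..1}. f t \<in> L2) \<and>
     (\<lambda>(t, x). g t x) \<in> borel_measurable (lebesgue_on unit_sq) \<and>
     integrable (lebesgue_on unit_sq) (\<lambda>(t, x). (g t x)\<^sup>2) \<and>
     (\<forall>t\<in>{0..1}. AE x in leb01. f t x = f 0 x + (LINT s|lebesgue_on {0..t}. g s x))"

text \<open>Determined up to null sets of the unit square.\<close>

definition time_deriv :: "(real \<Rightarrow> real \<Rightarrow> real) \<Rightarrow> real \<Rightarrow> real \<Rightarrow> real" where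
  "time_deriv f = (SOME g. H1_deriv f g)"

definition C0 ::
  "(real \<Rightarrow> real) \<Rightarrow> (real \<Rightarrow> real) \<Rightarrow> ((real \<Rightarrow> real \<Rightarrow> real) \<times> (real \<Rightarrow> real \<Rightarrow> real)) set" where
  "C0 p0 q0 = {(p, q).
     (\<forall>t\<in>{0..1}. (p t, q t) \<in> cotangent_bundle) \<and>
     (\<exists>q' q''. H1_deriv q q' \<and> H1_deriv q' q'' \<and>
        (\<forall>t\<in>{0..1}. AE x in leb01. q' t x = eta (q t) x * p t x)) \<and>
     (AE x in leb01. q 0 x = q0 x) \<and> (AE x in leb01. p 0 x = p0 x)}"

definition U_fun :: "(real \<Rightarrow> real) \<Rightarrow> (real \<Rightarrow> real) \<Rightarrow> real \<Rightarrow> real" where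
  "U_fun f q x = 1/2 * (LINT y|lebesgue_on {x..1}. eta q y * f y)"

definition b_coeff :: "(real \<Rightarrow> real) \<Rightarrow> (real \<Rightarrow> real) \<Rightarrow> real" where
  "b_coeff p q =
     3/2 * (LINT x|leb01. (LINT y|lebesgue_on {0..x}. p (inv_into {0..1} (phi q) y))\<^sup>2)"

definition cov_acc_flat ::
  "(real \<Rightarrow> real \<Rightarrow> real) \<Rightarrow> (real \<Rightarrow> real \<Rightarrow> real) \<Rightarrow> real \<Rightarrow> real \<Rightarrow> real" where
  "cov_acc_flat p q t x =
     (let u = U_fun (\<lambda>y. (p t y)\<^sup>2) (q t) in
        time_deriv p t x + u x - H2_comb (q t) 0 (b_coeff (p t) (q t)) x
          - (u x - proj_cot (q t) u x))"

text \<open>The covariant derivative itself, recovered from \<open>X\<^sup>\<flat> = X / \<eta>\<close>.\<close>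

definition cov_acc ::
  "(real \<Rightarrow> real \<Rightarrow> real) \<Rightarrow> (real \<Rightarrow> real \<Rightarrow> real) \<Rightarrow> real \<Rightarrow> real \<Rightarrow> real" where
  "cov_acc p q t x = eta (q t) x * cov_acc_flat p q t x"


section \<open>Measures on the unit square\<close>

text \<open>
  Finite Borel measures on the compact square are automatically Radon. A pair \<open>(\<mu>, \<nu>)\<close> of finite
  positive measures stands for the finite signed measure \<open>\<mu> - \<nu>\<close>; by the Jordan decomposition every
  finite signed measure arises in this way. The pair is not unique, and everything below depends
  only on the difference.
\<close>

type_synonym signed_measure = "(real \<times> real) measure \<times> (real \<times> real) measure"

definition finite_pos_measure :: "(real \<times> real) measure \<Rightarrow> bool" where
  "finite_pos_measure \<mu> \<longleftrightarrow> finite_measure \<mu> \<and> sets \<mu> = sets borel_sq"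

definition finite_signed :: "signed_measure \<Rightarrow> bool" where
  "finite_signed \<delta> \<longleftrightarrow> finite_pos_measure (fst \<delta>) \<and> finite_pos_measure (snd \<delta>)"

definition signed_of :: "(real \<times> real) measure \<Rightarrow> signed_measure" where
  "signed_of \<mu> = (\<mu>, null_measure \<mu>)"

definition signed_integral :: "signed_measure \<Rightarrow> (real \<times> real \<Rightarrow> real) \<Rightarrow> real" where
  "signed_integral \<delta> f = (\<integral>z. f z \<partial>fst \<delta>) - (\<integral>z. f z \<partial>snd \<delta>)"

definition signed_density ::
  "(real \<times> real) measure \<Rightarrow> signed_measure \<Rightarrow> real \<times> real \<Rightarrow> real" where
  "signed_density \<rho> \<delta> z = enn2real (RN_deriv \<rho> (fst \<delta>) z) - enn2real (RN_deriv \<rho> (snd \<delta>) z)"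

definition fr_integrand :: "real \<Rightarrow> real \<Rightarrow> ennreal" where
  "fr_integrand x y =
     (if x > 0 then ennreal (1/4 * (y\<^sup>2 / x)) else if x = 0 \<and> y = 0 then 0 else \<infinity>)"

text \<open>
  Since \<open>r\<close> is positively 1-homogeneous, the integral is the same for all dominating \<open>\<rho>\<close>. Here
  \<open>\<rho>\<close> is the supremum, in the lattice of measures, of the four finite measures involved.
\<close>

definition fisher_rao ::
  "(real \<times> real \<Rightarrow> real) \<Rightarrow> signed_measure \<Rightarrow> signed_measure \<Rightarrow> ennreal" where
  "fisher_rao f \<mu> \<nu> =
     (let \<rho> = sup (sup (fst \<mu>) (snd \<mu>)) (sup (fst \<nu>) (snd \<nu>)) in
        \<integral>\<^sup>+z. fr_integrand (signed_density \<rho> \<mu> z) (signed_density \<rho> \<nu> z) * ennreal (f z) \<partial>\<rho>)"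

text \<open>\<open>f\<close> is continuous on the square and \<open>C\<^sup>1\<close> in \<open>t\<close>, with \<open>f'\<close> as its time derivative.\<close>

definition C1_in_time :: "(real \<times> real \<Rightarrow> real) \<Rightarrow> (real \<times> real \<Rightarrow> real) \<Rightarrow> bool" where
  "C1_in_time f f' \<longleftrightarrow>
     continuous_on unit_sq f \<and> continuous_on unit_sq f' \<and>
     (\<forall>t\<in>{0..1}. \<forall>x\<in>{0..1}. ((\<lambda>s. f (s, x)) has_real_derivative f' (t, x)) (at t within {0..1}))"

text \<open>
  Weak time derivative, tested against functions vanishing at the times in \<open>Z\<close>. Such functions do
  not see the mass of \<open>\<delta>\<close> at these times, so \<open>\<delta>\<close> is normalised to have none there; this makes
  \<open>\<delta>\<close> unique as a signed measure. With \<open>Z = {0,1}\<close> this is the derivative in the open time interval.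
  With \<open>Z = {1}\<close> the equation also carries the initial condition \<open>\<Delta>\<^sub>t\<^sub>=\<^sub>0 = 0\<close>.
\<close>

definition weak_dt :: "real set \<Rightarrow> (real \<times> real) measure \<Rightarrow> signed_measure \<Rightarrow> bool" where
  "weak_dt Z \<Delta> \<delta> \<longleftrightarrow>
     finite_signed \<delta> \<and>
     (\<forall>A\<in>sets borel_sq. A \<subseteq> Z \<times> {0..1} \<longrightarrow> measure (fst \<delta>) A = measure (snd \<delta>) A) \<and>
     (\<forall>f f'. C1_in_time f f' \<and> (\<forall>t\<in>Z. \<forall>x\<in>{0..1}. f (t, x) = 0) \<longrightarrow>
        (\<integral>z. f' z \<partial>\<Delta>) + signed_integral \<delta> f = 0)"

text \<open>
  \<open>\<Delta>\<^sub>t\<^sub>=\<^sub>0 = 0\<close>: if \<open>\<Delta>\<close> has a measure as time derivative in the open time interval, then the weak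
  equation persists for test functions that do not vanish at \<open>t = 0\<close>. Measures without such a
  derivative are not excluded.
\<close>

definition M0 :: "(real \<times> real) measure set" where
  "M0 = {\<Delta>. finite_pos_measure \<Delta> \<and> (\<forall>\<delta>. weak_dt {0, 1} \<Delta> \<delta> \<longrightarrow> weak_dt {1} \<Delta> \<delta>)}"

definition dt_is_measure :: "(real \<times> real) measure \<Rightarrow> bool" where
  "dt_is_measure \<Delta> \<longleftrightarrow> (\<exists>\<delta>. weak_dt {1} \<Delta> \<delta>)"

definition dt :: "(real \<times> real) measure \<Rightarrow> signed_measure" where
  "dt \<Delta> = (SOME \<delta>. weak_dt {1} \<Delta> \<delta>)"

definition FR_dt :: "(real \<Rightarrow> real \<Rightarrow> real) \<Rightarrow> (real \<times> real) measure \<Rightarrow> ennreal" where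
  "FR_dt q \<Delta> =
     (if dt_is_measure \<Delta> then fisher_rao (\<lambda>(t, x). eta (q t) x) (signed_of \<Delta>) (dt \<Delta>) else \<infinity>)"

text \<open>\<open>\<Delta> = \<Delta>\<^sub>t dt\<close>; the family is determined for almost every \<open>t\<close>, and exists when the time
  derivative of \<open>\<Delta>\<close> is a finite measure.\<close>

definition disintegrates :: "(real \<times> real) measure \<Rightarrow> (real \<Rightarrow> real measure) \<Rightarrow> bool" where
  "disintegrates \<Delta> \<kappa> \<longleftrightarrow>
     (\<forall>t. finite_measure (\<kappa> t) \<and> sets (\<kappa> t) = sets (restrict_space borel {0..1})) \<and>
     (\<forall>B\<in>sets (restrict_space borel {0..1}).
        (\<lambda>t. emeasure (\<kappa> t) B) \<in> borel_measurable (restrict_space borel {0..1})) \<and>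
     (\<forall>A\<in>sets borel_sq. emeasure \<Delta> A = (\<integral>\<^sup>+t. emeasure (\<kappa> t) {x. (t, x) \<in> A} \<partial>leb01))"

definition slice :: "(real \<times> real) measure \<Rightarrow> real \<Rightarrow> real measure" where
  "slice \<Delta> = (SOME \<kappa>. disintegrates \<Delta> \<kappa>)"

definition U_meas :: "(real \<times> real) measure \<Rightarrow> (real \<Rightarrow> real \<Rightarrow> real) \<Rightarrow> real \<Rightarrow> real \<Rightarrow> real" where
  "U_meas \<Delta> q t x = 1/2 * (LINT y:{x..1}|slice \<Delta> t. eta (q t) y)"

definition pairing :: "(real \<times> real) measure \<Rightarrow> (real \<Rightarrow> real \<Rightarrow> real) \<Rightarrow> real" where
  "pairing \<Delta> w = (LINT t|leb01. LINT x|slice \<Delta> t. w t x)"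


section \<open>The functional\<close>

text \<open>The first summand makes this \<open>\<infinity>\<close> when the time derivative of \<open>\<Delta>\<close> is not a finite measure.\<close>

definition relaxed_functional ::
  "((real \<Rightarrow> real) \<Rightarrow> (real \<Rightarrow> real) \<Rightarrow> real) \<Rightarrow> (real \<times> real) measure \<Rightarrow>
   (real \<Rightarrow> real \<Rightarrow> real) \<Rightarrow> (real \<Rightarrow> real \<Rightarrow> real) \<Rightarrow> ereal" where
  "relaxed_functional P \<Delta> p q =
     enn2ereal (FR_dt q \<Delta>
       + (\<integral>\<^sup>+t. sqnorm_eta (q t) (\<lambda>x. cov_acc_flat p q t x + proj_cot (q t) (U_meas \<Delta> q t) x) \<partial>leb01))
     + ereal (P (p 1) (q 1))"

end

theory Submission
  imports Defs
begin

text \<open>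
  Write \<open>A\<close> for the covector \<open>(D\<^sub>t q')\<^sup>\<flat>\<close> and \<open>B \<Delta> = \<pi>\<^sup>*(U(\<Delta>, q))\<close>, which is linear in \<open>\<Delta>\<close>. The
  functional is the sum of the Fisher-Rao term, convex and positively 1-homogeneous on the cone of
  measures in \<open>M\<^sub>0\<close> whose time derivative is a measure, and of the quadratic term \<open>\<integral>\<parallel>A + B \<Delta>\<parallel>\<^sup>2 dt\<close>. For
  such a sum, minimality at \<open>\<Delta>\<close> over a convex cone means that the Fisher-Rao term plus the differential
  of the quadratic term at \<open>\<Delta>\<close> is nonnegative on the cone and vanishes at \<open>\<Delta>\<close>.

  The differential in direction \<open>\<mu>\<close> is \<open>2 \<integral>\<integral> \<eta> (A + B \<Delta>) B \<mu>\<close>. Since \<open>\<pi>\<^sup>*\<close> is self-adjoint for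
  \<open>\<langle>\<cdot>,\<cdot>\<rangle>\<^sub>\<eta>\<close> and \<open>A + B \<Delta>\<close> lies in its range, \<open>B \<mu>\<close> may be replaced by \<open>U(\<mu>, q)\<close>, and Fubini turns the
  integral into \<open>\<langle>\<mu>, w\<rangle>\<close>. That \<open>A\<close> lies in the range of \<open>\<pi>\<^sup>*\<close> follows by differentiating the
  constraints \<open>\<langle>p, 1\<rangle>\<^sub>\<eta> = \<langle>p, \<phi>\<rangle>\<^sub>\<eta> = 0\<close> in time, which identifies \<open>b\<close> with \<open>\<langle>p', \<phi>\<rangle>\<^sub>\<eta>\<close>.
\<close>

section \<open>Lebesgue measure on the unit interval and the unit square\<close>

text \<open>Two difficulties lie below this convex-analytic core. The derivative
  \<open>time_deriv\<close>, the signed measure \<open>dt\<close> and the family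
  \<open>slice\<close> are picked by choice, and paths are given only up to null sets. Each choice
  has to be shown unique almost everywhere (for \<open>dt\<close>, as a signed measure), and
  functions known only for completed measures have to be replaced by Borel representatives before
  Fubini applies. Moreover, the quadratic term is finite and differentiable only if
  \<open>B \<mu>\<close> is square integrable, which is unclear for a general measure. The time
  derivative \<delta> provides this: the slice of \<mu> at time t is \<delta>([0,t] \<times> dx), so
  its mass is at most that of the positive part of \<delta>, and \<open>U\<close> and
  \<open>B\<close> are bounded. Finally, the condition defining \<open>M0\<close> is an implication
  about all derivatives in the open time interval, and its stability under sums is not apparent. For
  measures with a derivative it is shown equivalent to the existence of one derivative in the sense
  \<open>weak_dt {1}\<close> that has no mass at time 0; such derivatives can be added.\<close>

abbreviation leb_sq :: "(real \<times> real) measure" where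
  "leb_sq \<equiv> leb01 \<Otimes>\<^sub>M leb01"

interpretation leb01: finite_measure leb01
  by (rule finite_measure_lebesgue_on) simp

interpretation leb_sq: pair_sigma_finite leb01 leb01 ..

lemma emeasure_leb01_space: "emeasure leb01 {0..1} = 1"
  by (simp add: emeasure_restrict_space)

interpretation leb_sq: finite_measure leb_sq
proof
  show "emeasure leb_sq (space leb_sq) \<noteq> \<infinity>"
    by (simp add: space_pair_measure leb01.emeasure_pair_measure_Times emeasure_leb01_space)
qed

lemma space_leb_sq: "space leb_sq = {0..1} \<times> {0..1}"
  by (simp add: space_pair_measure)

lemma measurable_leb01_ident [measurable]: "(\<lambda>x. x) \<in> leb01 \<rightarrow>\<^sub>M borel"
  by (intro measurable_restrict_space1 measurable_completion) simp

lemma borel_measurable_leb01: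
  fixes f :: "real \<Rightarrow> 'a::topological_space"
  assumes "f \<in> borel_measurable borel" shows "f \<in> borel_measurable leb01"
  using measurable_compose[OF measurable_leb01_ident assms] by simp

lemma borel_measurable_leb_sq:
  fixes f :: "real \<times> real \<Rightarrow> 'a::topological_space"
  assumes "f \<in> borel_measurable borel" shows "f \<in> borel_measurable leb_sq"
proof -
  have "(\<lambda>z. (fst z, snd z)) \<in> leb_sq \<rightarrow>\<^sub>M borel"
    unfolding borel_prod[symmetric] by measurable
  from measurable_compose[OF this assms] show ?thesis by simp
qed

lemma borel_measurable_Pair_real:
  fixes f :: "real \<times> real \<Rightarrow> 'a::topological_space"
  assumes "f \<in> borel_measurable borel"
  shows "(\<lambda>x. f (t, x)) \<in> borel_measurable borel" "(\<lambda>t. f (t, x)) \<in> borel_measurable borel"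
  using assms unfolding borel_prod[symmetric] by measurable

lemma
  assumes "0 \<le> a" "b \<le> 1"
  shows integral_lebesgue_on_Icc:
      "(LINT u|lebesgue_on {a..b}. f u) = (LINT u|leb01. indicator {a..b} u * (f u :: real))"
    and integrable_lebesgue_on_Icc:
      "integrable (lebesgue_on {a..b}) f \<longleftrightarrow> integrable leb01 (\<lambda>u. indicator {a..b} u * (f u :: real))"
proof -
  have eq: "lebesgue_on {a..b} = restrict_space leb01 {a..b}"
    using assms by (subst restrict_restrict_space) (auto simp: inf_absorb2 Int_absorb1)
  have m: "{a..b} \<inter> space leb01 \<in> sets leb01"
    using assms by (simp add: sets_restrict_space_iff)
  show "(LINT u|lebesgue_on {a..b}. f u) = (LINT u|leb01. indicator {a..b} u * f u)"
    unfolding eq using integral_restrict_space[OF m, of f] by simp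
  show "integrable (lebesgue_on {a..b}) f \<longleftrightarrow> integrable leb01 (\<lambda>u. indicator {a..b} u * f u)"
    unfolding eq using integrable_restrict_space[OF m, of f] by simp
qed

lemma integrable_indicator_leb01:
  assumes "integrable leb01 f" "A \<in> sets borel"
  shows "integrable leb01 (\<lambda>u. indicator A u * (f u :: real))"
proof (rule Bochner_Integration.integrable_bound[OF assms(1)])
  have "(indicator A :: real \<Rightarrow> real) \<in> borel_measurable borel"
    using assms(2) by simp
  then show "(\<lambda>u. indicator A u * f u) \<in> borel_measurable leb01"
    using assms(1) borel_measurable_leb01 by (intro borel_measurable_times) auto
qed (auto split: split_indicator)

text \<open>\<open>P\<close> is not assumed measurable, so the exceptional set is first enclosed in
  a measurable null set; only for that set may the two quantifiers be exchanged.\<close>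

lemma AE_leb_sq_swap:
  assumes "AE z in leb_sq. P (fst z) (snd z)"
  shows "AE x in leb01. AE t in leb01. P t x"
proof -
  obtain N where N: "N \<in> null_sets leb_sq" "{z \<in> space leb_sq. \<not> P (fst z) (snd z)} \<subseteq> N"
    using assms unfolding eventually_ae_filter by auto
  have "AE z in leb_sq. z \<notin> N" using N(1) by (rule AE_not_in)
  then have "AE t in leb01. AE x in leb01. (t, x) \<notin> N"
    using leb_sq.AE_pair by force
  then have "AE x in leb01. AE t in leb01. (t, x) \<notin> N"
    using N(1) by (subst (asm) leb_sq.AE_commute) auto
  then show ?thesis
    using AE_space
  proof eventually_elim
    fix x assume ae: "AE t in leb01. (t, x) \<notin> N" and x: "x \<in> space leb01"
    show "AE t in leb01. P t x"
      using ae AE_space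
    proof eventually_elim
      fix t assume "(t, x) \<notin> N" "t \<in> space leb01"
      then show "P t x"
        using x subsetD[OF N(2), of "(t, x)"] by (auto simp: space_leb_sq)
    qed
  qed
qed

lemma nn_integral_leb01:
  assumes [measurable]: "f \<in> borel_measurable borel"
  shows "(\<integral>\<^sup>+x. f x \<partial>leb01) = (\<integral>\<^sup>+x. f x * indicator {0..1} x \<partial>lborel)"
  by (simp add: nn_integral_restrict_space nn_integral_completion)

lemma unit_sq_borel [measurable]: "unit_sq \<in> sets borel"
  unfolding unit_sq_def by (intro borel_closed closed_Times) auto

lemma unit_sq_lebesgue: "unit_sq \<in> sets lebesgue"
  using unit_sq_borel by (intro sets_completionI_sets) simp

text \<open>\<open>leb_sq\<close> is a product of completed measures and
  \<open>lebesgue_on unit_sq\<close> the completion of a product, so their \<sigma>-algebras differ.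
  On Borel functions both reduce to \<open>lborel\<close>; this carries hypotheses stated on
  \<open>unit_sq\<close> over to a product measure, where Fubini is available.\<close>

lemma nn_integral_leb_sq:
  fixes f :: "real \<times> real \<Rightarrow> ennreal"
  assumes [measurable]: "f \<in> borel_measurable borel"
  shows "(\<integral>\<^sup>+z. f z \<partial>leb_sq) = (\<integral>\<^sup>+z. f z \<partial>lebesgue_on unit_sq)"
proof -
  have m: "(\<lambda>z. f z * indicator unit_sq z) \<in> borel_measurable (lborel \<Otimes>\<^sub>M lborel)"
    unfolding lborel_prod by measurable
  have fp: "f \<in> borel_measurable (lborel \<Otimes>\<^sub>M lborel)"
    unfolding lborel_prod by measurable
  have "(\<integral>\<^sup>+z. f z \<partial>leb_sq) = (\<integral>\<^sup>+t. \<integral>\<^sup>+x. f (t, x) \<partial>leb01 \<partial>leb01)"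
    by (subst leb01.nn_integral_fst[symmetric]) (auto intro: borel_measurable_leb_sq)
  also have "\<dots> = (\<integral>\<^sup>+t. \<integral>\<^sup>+x. f (t, x) * indicator {0..1} x \<partial>lborel \<partial>leb01)"
    by (intro nn_integral_cong nn_integral_leb01) (simp add: borel_measurable_Pair_real)
  also have "\<dots> = (\<integral>\<^sup>+t. (\<integral>\<^sup>+x. f (t, x) * indicator {0..1} x \<partial>lborel) * indicator {0..1} t \<partial>lborel)"
  proof (rule nn_integral_leb01)
    have "(\<lambda>t. \<integral>\<^sup>+x. f (t, x) * indicator {0..1} x \<partial>lborel) \<in> borel_measurable lborel"
      using fp by (intro lborel.borel_measurable_nn_integral) (simp add: split_beta')
    then show "(\<lambda>t. \<integral>\<^sup>+x. f (t, x) * indicator {0..1} x \<partial>lborel) \<in> borel_measurable borel"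
      by simp
  qed
  also have "\<dots> = (\<integral>\<^sup>+t. \<integral>\<^sup>+x. f (t, x) * indicator unit_sq (t, x) \<partial>lborel \<partial>lborel)"
  proof (intro nn_integral_cong)
    fix t :: real
    show "(\<integral>\<^sup>+x. f (t, x) * indicator {0..1} x \<partial>lborel) * indicator {0..1} t
      = (\<integral>\<^sup>+x. f (t, x) * indicator unit_sq (t, x) \<partial>lborel)"
      by (cases "t \<in> {0..1}") (auto simp: unit_sq_def indicator_def intro!: nn_integral_cong)
  qed
  also have "\<dots> = (\<integral>\<^sup>+z. f z * indicator unit_sq z \<partial>(lborel \<Otimes>\<^sub>M lborel))"
    using lborel.nn_integral_fst[OF m] by simp
  also have "\<dots> = (\<integral>\<^sup>+z. f z \<partial>lebesgue_on unit_sq)"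
    unfolding lborel_prod using unit_sq_lebesgue
    by (simp add: nn_integral_restrict_space nn_integral_completion)
  finally show ?thesis .
qed

lemma borel_measurable_lebesgue_on_borel:
  fixes f :: "'a::euclidean_space \<Rightarrow> 'b::topological_space"
  assumes "f \<in> borel_measurable borel" shows "f \<in> borel_measurable (lebesgue_on S)"
  using assms by (intro measurable_restrict_space1 measurable_completion) simp

lemma integrable_leb_sq_iff:
  fixes f :: "real \<times> real \<Rightarrow> real"
  assumes f [measurable]: "f \<in> borel_measurable borel"
  shows "integrable leb_sq f \<longleftrightarrow> integrable (lebesgue_on unit_sq) f"
  using f by (simp add: integrable_iff_bounded borel_measurable_leb_sq
      borel_measurable_lebesgue_on_borel nn_integral_leb_sq)

text \<open>A null set of the completed plane may fail to be measurable for the product, hence the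
  detour through an enclosing Borel null set.\<close>

lemma AE_lebesgue_on_unit_sq:
  assumes "AE z in lebesgue_on unit_sq. P z"
  shows "AE z in leb_sq. P z"
proof -
  obtain N where N: "N \<in> null_sets (lebesgue_on unit_sq)"
      "{z \<in> space (lebesgue_on unit_sq). \<not> P z} \<subseteq> N"
    using assms unfolding eventually_ae_filter by auto
  have "N \<in> null_sets lebesgue"
    using N(1) unit_sq_lebesgue by (simp add: null_sets_restrict_space)
  then obtain N' where N': "N' \<in> null_sets lborel" "N \<subseteq> N'"
    unfolding null_sets_completion_iff2 by auto
  have [measurable]: "N' \<in> sets borel" using N'(1) by auto
  have "(\<lambda>z. indicator N' z :: real) \<in> borel_measurable leb_sq"
    by (intro borel_measurable_leb_sq) simp
  then have N'_sq: "N' \<inter> space leb_sq \<in> sets leb_sq"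
    by (simp add: borel_measurable_indicator_iff)
  then have "emeasure leb_sq (N' \<inter> space leb_sq) = (\<integral>\<^sup>+z. indicator N' z \<partial>leb_sq)"
    by (subst nn_integral_indicator') auto
  also have "\<dots> = (\<integral>\<^sup>+z. indicator N' z \<partial>lebesgue_on unit_sq)"
    by (rule nn_integral_leb_sq) simp
  also have "\<dots> = (\<integral>\<^sup>+z. indicator N' z * indicator unit_sq z \<partial>lborel)"
    using unit_sq_lebesgue by (simp add: nn_integral_restrict_space nn_integral_completion)
  also have "\<dots> \<le> (\<integral>\<^sup>+z. indicator N' z \<partial>lborel)"
    by (intro nn_integral_mono) (auto split: split_indicator)
  also have "\<dots> = 0" using N'(1) by auto
  finally have z: "emeasure leb_sq (N' \<inter> space leb_sq) = 0" by simp
  show ?thesis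
  proof (rule AE_I[OF _ z])
    show "{z \<in> space leb_sq. \<not> P z} \<subseteq> N' \<inter> space leb_sq"
      using N(2) N'(2) by (auto simp: space_leb_sq unit_sq_def)
    show "N' \<inter> space leb_sq \<in> sets leb_sq" by (rule N'_sq)
  qed
qed

text \<open>A function measurable for the completed square need not be measurable for
  \<open>leb_sq\<close>, so it is exchanged for a Borel function. Agreement is recorded for both
  measures: integrability is transferred on \<open>unit_sq\<close>, Fubini is applied on
  \<open>leb_sq\<close>.\<close>

lemma borel_version_unit_sq:
  fixes g :: "real \<times> real \<Rightarrow> real"
  assumes g: "g \<in> borel_measurable (lebesgue_on unit_sq)"
  obtains h where "h \<in> borel_measurable borel" "AE z in leb_sq. g z = h z"
    "AE z in lebesgue_on unit_sq. g z = h z"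
proof -
  have "(\<lambda>z. if z \<in> unit_sq then g z else 0) \<in> borel_measurable lebesgue"
    using g unit_sq_lebesgue by (simp add: borel_measurable_if)
  from completion_ex_borel_measurable_real[OF this]
  obtain h where h: "h \<in> borel_measurable lborel"
    "AE z in lborel. (if z \<in> unit_sq then g z else 0) = h z" by auto
  have "AE z in lebesgue. (if z \<in> unit_sq then g z else 0) = h z"
    by (rule AE_completion[OF h(2)])
  then have "AE z in lebesgue_on unit_sq. g z = h z"
    using unit_sq_lebesgue by (subst AE_restrict_space_iff) auto
  with AE_lebesgue_on_unit_sq[OF this] h(1) that show thesis by simp
qed

lemma borel_version_leb01:
  fixes g :: "real \<Rightarrow> real"
  assumes g: "g \<in> borel_measurable leb01"
  obtains h where "h \<in> borel_measurable borel" "AE x in leb01. g x = h x"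
proof -
  have "(\<lambda>z. if z \<in> {0..1} then g z else 0) \<in> borel_measurable lebesgue"
    using g by (subst borel_measurable_if) auto
  from completion_ex_borel_measurable_real[OF this]
  obtain h where h: "h \<in> borel_measurable lborel"
    "AE z in lborel. (if z \<in> {0..1} then g z else 0) = h z" by auto
  have "AE z in lebesgue. (if z \<in> {0..1} then g z else 0) = h z"
    by (rule AE_completion[OF h(2)])
  then have "AE z in leb01. g z = h z"
    by (subst AE_restrict_space_iff) auto
  with h(1) that show thesis by simp
qed

text \<open>
  As \<open>leb01\<close> abbreviates \<open>lebesgue_on {0..1}\<close>, the term \<open>prim f 1\<close> is literally the integral over
  \<open>leb01\<close>.
\<close>

abbreviation prim :: "(real \<Rightarrow> real) \<Rightarrow> real \<Rightarrow> real" where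
  "prim f x \<equiv> (LINT u|lebesgue_on {0..x}. f u)"

section \<open>Primitives: continuity, integration by parts, measurable dependence on
  parameters\<close>

lemma prim_eq: "x \<in> {0..1} \<Longrightarrow> prim f x = (LINT u|leb01. indicator {0..x} u * f u)"
  by (rule integral_lebesgue_on_Icc) auto

lemma prim_cong_AE:
  assumes "AE u in leb01. f u = g u" "x \<in> {0..1}"
    "f \<in> borel_measurable leb01" "g \<in> borel_measurable leb01"
  shows "prim f x = prim g x"
proof -
  have [measurable]: "(\<lambda>u. indicator {0..x} u :: real) \<in> borel_measurable leb01"
    by (rule borel_measurable_leb01) simp
  show ?thesis
    unfolding prim_eq[OF assms(2)] using assms
    by (intro integral_cong_AE) (auto intro: borel_measurable_times)
qed

lemma integrable_prim:
  fixes f :: "real \<Rightarrow> real"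
  assumes "integrable leb01 f" "x \<in> {0..1}"
  shows "integrable (lebesgue_on {0..x}) f"
proof (rule iffD2[OF integrable_lebesgue_on_Icc])
  show "integrable leb01 (\<lambda>u. indicator {0..x} u * f u)"
    using assms(1) by (rule integrable_indicator_leb01) simp
qed (use assms(2) in auto)

lemma prim_bound:
  assumes "integrable leb01 f" "x \<in> {0..1}"
  shows "\<bar>prim f x\<bar> \<le> (LINT u|leb01. \<bar>f u\<bar>)"
proof -
  have "\<bar>prim f x\<bar> \<le> (LINT u|leb01. \<bar>indicator {0..x} u * f u\<bar>)"
    unfolding prim_eq[OF assms(2)] by (rule integral_abs_bound)
  also have "\<dots> \<le> (LINT u|leb01. \<bar>f u\<bar>)"
    using assms by (intro integral_mono integrable_abs integrable_indicator_leb01)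
      (auto split: split_indicator)
  finally show ?thesis .
qed

lemma continuous_on_prim:
  assumes "integrable leb01 f"
  shows "continuous_on {0..1} (prim f)"
  using assms by (rule indefinite_integral_continuous_real)

lemma borel_measurable_continuous_leb01:
  fixes f :: "real \<Rightarrow> real"
  assumes "continuous_on {0..1} f" shows "f \<in> borel_measurable leb01"
  using assms by (intro continuous_imp_measurable_on_sets_lebesgue) auto

lemma integrable_continuous_leb01:
  fixes f :: "real \<Rightarrow> real"
  assumes "continuous_on {0..1} f" shows "integrable leb01 f"
  using continuous_imp_integrable_real assms by blast

lemma integrable_mult_continuous_leb01:
  fixes f g :: "real \<Rightarrow> real"
  assumes f: "integrable leb01 f" and g: "continuous_on {0..1} g"
  shows "integrable leb01 (\<lambda>u. f u * g u)"
proof -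
  obtain B where "\<forall>y\<in>g ` {0..1}. norm y \<le> B"
    using compact_imp_bounded[OF compact_continuous_image[OF g compact_Icc]]
    unfolding bounded_iff by metis
  then have B: "\<And>x. x \<in> {0..1} \<Longrightarrow> norm (g x) \<le> B" by auto
  show ?thesis
  proof (rule Bochner_Integration.integrable_bound)
    show "integrable leb01 (\<lambda>u. f u * B)" using f by simp
    show "(\<lambda>u. f u * g u) \<in> borel_measurable leb01"
      using f borel_measurable_continuous_leb01[OF g] by auto
    show "AE u in leb01. norm (f u * g u) \<le> norm (f u * B)"
    proof (intro AE_I2)
      fix u assume "u \<in> space leb01"
      then have "\<bar>g u\<bar> \<le> \<bar>B\<bar>" using B[of u] by auto
      then show "norm (f u * g u) \<le> norm (f u * B)"
        by (simp add: abs_mult mult_left_mono)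
    qed
  qed
qed

lemma AE_leb01_neq: "AE r in leb01. r \<noteq> (s::real)"
proof -
  have "{s} \<in> null_sets lebesgue" by auto
  then have "AE r in lebesgue. r \<noteq> s"
    using AE_not_in[of "{s}" lebesgue] by auto
  then show ?thesis by (subst AE_restrict_space_iff) auto
qed

text \<open>Fubini on triangles: the product of the integrals of \<open>F\<close> and
  \<open>G\<close> is an integral over the square, which the diagonal cuts into the two terms on the
  left. The functions are merely integrable, so this serves as the product rule for absolutely
  continuous functions, in time as well as in space.\<close>

lemma integral_by_parts_prim:
  assumes f: "integrable leb01 f" and g: "integrable leb01 g" and t: "t \<in> {0..1}"
  shows "(LINT s|lebesgue_on {0..t}. f s * (d + prim g s) + (c + prim f s) * g s)
    = (c + prim f t) * (d + prim g t) - c * d"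
proof -
  define F where "F = (\<lambda>s. indicator {0..t} s * f s)"
  define G where "G = (\<lambda>s. indicator {0..t} s * g s)"
  have F: "integrable leb01 F" and G: "integrable leb01 G"
    unfolding F_def G_def using f g by (auto intro: integrable_indicator_leb01)
  have [measurable]: "F \<in> borel_measurable leb01" "G \<in> borel_measurable leb01"
    using F G by auto
  have FG: "integrable leb_sq (\<lambda>z. F (fst z) * G (snd z))"
  proof (rule leb_sq.Fubini_integrable)
    show "integrable leb01 (\<lambda>x. LINT y|leb01. norm (F (fst (x, y)) * G (snd (x, y))))"
      using F by (simp add: abs_mult)
  qed (use G in auto)
  define H1 where "H1 = (\<lambda>z. F (fst z) * G (snd z) * indicator {z. snd z \<le> fst z} z)"
  define H2 where "H2 = (\<lambda>z. F (fst z) * G (snd z) * indicator {z. fst z \<le> snd z} z)"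
  have "indicator {z. snd z \<le> fst z} \<in> borel_measurable leb_sq"
    "indicator {z. fst z \<le> snd z} \<in> borel_measurable leb_sq"
    by (auto intro!: borel_measurable_leb_sq borel_measurable_indicator borel_closed closed_Collect_le
      continuous_intros)
  note [measurable] = this
  have H1: "integrable leb_sq H1" and H2: "integrable leb_sq H2"
    unfolding H1_def H2_def
    by (rule Bochner_Integration.integrable_bound[OF FG]; auto split: split_indicator)+
  have FG': "(LINT z|leb_sq. F (fst z) * G (snd z)) = (LINT s|leb01. F s) * (LINT r|leb01. G r)"
    using leb_sq.integral_fst'[OF FG] by simp
  have prim_g: "prim g s = (LINT r|leb01. indicator {0..s} r * G r)" if "s \<in> {0..t}" for s
    using that t by (subst prim_eq) (auto simp: G_def split: split_indicator intro!: Bochner_Integration.integral_cong)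
  have prim_f: "prim f s = (LINT r|leb01. indicator {0..s} r * F r)" if "s \<in> {0..t}" for s
    using that t by (subst prim_eq) (auto simp: F_def split: split_indicator intro!: Bochner_Integration.integral_cong)
  have int1: "integrable leb01 (\<lambda>s. F s * prim g s)" and int2: "integrable leb01 (\<lambda>s. prim f s * G s)"
    using integrable_mult_continuous_leb01[OF F continuous_on_prim[OF g]]
      integrable_mult_continuous_leb01[OF G continuous_on_prim[OF f]]
    by (simp_all add: mult.commute)
  have T1: "(LINT s|leb01. F s * prim g s) = (LINT z|leb_sq. H1 z)"
    unfolding leb_sq.integral_fst'[OF H1, symmetric]
  proof (intro Bochner_Integration.integral_cong refl)
    fix s assume "s \<in> space leb01"
    show "F s * prim g s = (LINT r|leb01. H1 (s, r))"
    proof (cases "s \<in> {0..t}")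
      case True
      have "F s * prim g s = (LINT r|leb01. F s * (indicator {0..s} r * G r))"
        unfolding prim_g[OF True] by simp
      also have "\<dots> = (LINT r|leb01. H1 (s, r))"
        by (intro Bochner_Integration.integral_cong) (auto simp: H1_def split: split_indicator)
      finally show ?thesis .
    qed (auto simp: F_def H1_def)
  qed
  have H2': "integrable leb_sq (\<lambda>(s, r). H2 (s, r))" using H2 by simp
  have T2: "(LINT r|leb01. prim f r * G r) = (LINT z|leb_sq. H2 z)"
    using leb_sq.integral_snd[OF H2', symmetric]
  proof (simp, intro Bochner_Integration.integral_cong refl)
    fix r assume "r \<in> space leb01"
    show "prim f r * G r = (LINT s|leb01. H2 (s, r))"
    proof (cases "r \<in> {0..t}")
      case True
      have "prim f r * G r = (LINT s|leb01. indicator {0..r} s * F s * G r)"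
        unfolding prim_f[OF True] by simp
      also have "\<dots> = (LINT s|leb01. H2 (s, r))"
        by (intro Bochner_Integration.integral_cong) (auto simp: H2_def split: split_indicator)
      finally show ?thesis .
    qed (auto simp: G_def H2_def)
  qed
  \<comment> \<open>The closed triangles of \<open>H1\<close> and \<open>H2\<close> overlap in the
    diagonal, which is a null set.\<close>
  have "AE z in leb_sq. fst z \<noteq> snd z"
  proof (rule leb_sq.AE_pair_measure)
    have "(\<lambda>z. fst z - snd z) \<in> borel_measurable leb_sq" by measurable
    then show "{z \<in> space leb_sq. fst z \<noteq> snd z} \<in> sets leb_sq"
      by measurable
    show "AE x in leb01. AE y in leb01. fst (x, y) \<noteq> snd (x, y)"
      using AE_leb01_neq by (auto simp: eq_commute)
  qed
  then have "(LINT z|leb_sq. H1 z + H2 z) = (LINT z|leb_sq. F (fst z) * G (snd z))"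
    using H1 H2 FG by (intro integral_cong_AE) (auto simp: H1_def H2_def split: split_indicator)
  then have T: "(LINT s|leb01. F s * prim g s) + (LINT r|leb01. prim f r * G r)
      = (LINT s|leb01. F s) * (LINT r|leb01. G r)"
    unfolding T1 T2 using H1 H2 FG' by simp
  have prim_t: "prim f t = (LINT s|leb01. F s)" "prim g t = (LINT s|leb01. G s)"
    unfolding prim_eq[OF t] F_def G_def by simp_all
  have "(LINT s|lebesgue_on {0..t}. f s * (d + prim g s) + (c + prim f s) * g s)
    = (LINT s|leb01. d * F s + F s * prim g s + (c * G s + prim f s * G s))"
    unfolding prim_eq[OF t, of "\<lambda>s. f s * (d + prim g s) + (c + prim f s) * g s"]
    by (intro Bochner_Integration.integral_cong) (auto simp: F_def G_def algebra_simps)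
  also have "\<dots> = d * (LINT s|leb01. F s) + c * (LINT s|leb01. G s)
      + ((LINT s|leb01. F s * prim g s) + (LINT r|leb01. prim f r * G r))"
    using F G int1 int2 by simp
  also have "\<dots> = (c + prim f t) * (d + prim g t) - c * d"
    unfolding T prim_t by (simp add: algebra_simps)
  finally show ?thesis .
qed

lemma lborel_integral_lebesgue_on:
  fixes f :: "real \<Rightarrow> real"
  assumes "f \<in> borel_measurable borel"
  shows "(LINT u|lebesgue_on {a..b}. f u) = (LINT u|lborel. indicator {a..b} u * f u)"
  using assms by (simp add: integral_restrict_space integral_completion)

text \<open>Written over \<open>lborel\<close>, with the interval as an indicator, the integrand is
  jointly measurable in all variables, and measurability of parametrised integrals applies on the
  whole plane.\<close>

lemma borel_measurable_prim_snd:
  fixes f :: "real \<times> real \<Rightarrow> real"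
  assumes f: "f \<in> borel_measurable borel"
  shows "(\<lambda>z. prim (\<lambda>u. f (fst z, u)) (snd z)) \<in> borel_measurable borel"
proof -
  have [measurable]: "f \<in> borel_measurable (borel \<Otimes>\<^sub>M borel)"
    using f by (simp add: borel_prod)
  have "(\<lambda>z. LINT u|lborel. indicator {0..snd z} u * f (fst z, u)) \<in> borel_measurable (borel \<Otimes>\<^sub>M borel)"
    unfolding indicator_def atLeastAtMost_iff by measurable
  then show ?thesis
    using f by (simp add: lborel_integral_lebesgue_on borel_measurable_Pair_real borel_prod)
qed

lemma borel_measurable_prim_fst:
  fixes f :: "real \<times> real \<Rightarrow> real"
  assumes f: "f \<in> borel_measurable borel"
  shows "(\<lambda>z. prim (\<lambda>s. f (s, snd z)) (fst z)) \<in> borel_measurable borel"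
proof -
  have [measurable]: "f \<in> borel_measurable (borel \<Otimes>\<^sub>M borel)"
    using f by (simp add: borel_prod)
  have "(\<lambda>z. LINT u|lborel. indicator {0..fst z} u * f (u, snd z)) \<in> borel_measurable (borel \<Otimes>\<^sub>M borel)"
    unfolding indicator_def atLeastAtMost_iff by measurable
  then show ?thesis
    using f by (simp add: lborel_integral_lebesgue_on borel_measurable_Pair_real borel_prod)
qed

lemma borel_measurable_integral_snd:
  fixes f :: "real \<times> real \<Rightarrow> real"
  assumes f: "f \<in> borel_measurable borel"
  shows "(\<lambda>t. LINT x|leb01. f (t, x)) \<in> borel_measurable borel"
proof -
  have [measurable]: "f \<in> borel_measurable (borel \<Otimes>\<^sub>M borel)"
    using f by (simp add: borel_prod)
  have "(\<lambda>t. LINT u|lborel. indicator {0..1} u * f (t, u)) \<in> borel_measurable borel"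
    unfolding indicator_def atLeastAtMost_iff by measurable
  then show ?thesis
    using f by (simp add: lborel_integral_lebesgue_on borel_measurable_Pair_real)
qed

text \<open>The positive and the negative part of \<open>h\<close> are densities of two finite
  measures that agree on half-lines, hence on Borel sets. Testing with the set where
  \<open>h\<close> is positive, and with the one where it is negative, removes both parts.\<close>

lemma AE_zero_if_prim_zero:
  fixes h :: "real \<Rightarrow> real"
  assumes [measurable]: "h \<in> borel_measurable borel" and h: "integrable leb01 h"
    and zero: "\<And>t. t \<in> {0..1} \<Longrightarrow> prim h t = 0"
  shows "AE x in leb01. h x = 0"
proof -
  \<comment> \<open>\<open>ennreal\<close> cuts off negative values, so the density is the positive
    part of \<open>k\<close>. The image under the identity moves the measure from the completed
    \<sigma>-algebra to \<open>borel\<close>, which half-lines generate.\<close>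
  define N where "N = (\<lambda>k :: real \<Rightarrow> real. distr (density leb01 (\<lambda>x. ennreal (k x))) borel (\<lambda>x. x))"
  have N: "emeasure (N k) A = (\<integral>\<^sup>+x. ennreal (k x) * indicator A x \<partial>leb01)"
    if [measurable]: "k \<in> borel_measurable borel" "A \<in> sets borel" for k A
  proof -
    have A: "A \<inter> {0..1} \<in> sets leb01"
      using measurable_sets[OF measurable_leb01_ident that(2)] by simp
    have "emeasure (N k) A = emeasure (density leb01 (\<lambda>x. ennreal (k x))) (A \<inter> {0..1})"
      unfolding N_def by (subst emeasure_distr) (auto intro!: measurable_leb01_ident)
    also have "\<dots> = (\<integral>\<^sup>+x. ennreal (k x) * indicator (A \<inter> {0..1}) x \<partial>leb01)"
      using A by (intro emeasure_density) (auto intro: borel_measurable_leb01)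
    also have "\<dots> = (\<integral>\<^sup>+x. ennreal (k x) * indicator A x \<partial>leb01)"
      by (intro nn_integral_cong) (auto split: split_indicator)
    finally show ?thesis .
  qed
  have *: "emeasure (N h) {..t} = emeasure (N (\<lambda>x. - h x)) {..t}" for t
  proof -
    define t' where "t' = min 1 t"
    define hi where "hi = (\<lambda>x. indicator {..t} x * h x)"
    have hi: "integrable leb01 hi"
      unfolding hi_def using h by (rule integrable_indicator_leb01) simp
    have "(LINT x|leb01. hi x) = 0"
    proof (cases "t < 0")
      case True
      then have "(LINT x|leb01. hi x) = (LINT x|leb01. 0)"
        by (intro Bochner_Integration.integral_cong) (auto simp: hi_def)
      then show ?thesis by simp
    next
      case False
      then have t': "t' \<in> {0..1}" by (auto simp: t'_def)
      have "(LINT x|leb01. hi x) = (LINT x|leb01. indicator {0..t'} x * h x)"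
        by (intro Bochner_Integration.integral_cong) (auto simp: hi_def t'_def split: split_indicator)
      also have "\<dots> = 0" using zero[OF t'] prim_eq[OF t'] by simp
      finally show ?thesis .
    qed
    moreover have "integrable leb01 (\<lambda>x. max 0 (hi x))" "integrable leb01 (\<lambda>x. max 0 (- hi x))"
      using hi by auto
    moreover have "(LINT x|leb01. hi x) = (LINT x|leb01. max 0 (hi x) - max 0 (- hi x))"
      by (intro Bochner_Integration.integral_cong) auto
    ultimately have "(LINT x|leb01. max 0 (hi x)) = (LINT x|leb01. max 0 (- hi x))"
      and "integrable leb01 (\<lambda>x. max 0 (hi x))" "integrable leb01 (\<lambda>x. max 0 (- hi x))"
      by simp_all
    then have "(\<integral>\<^sup>+x. ennreal (max 0 (hi x)) \<partial>leb01) = (\<integral>\<^sup>+x. ennreal (max 0 (- hi x)) \<partial>leb01)"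
      by (simp add: nn_integral_eq_integral)
    moreover have "(\<integral>\<^sup>+x. ennreal (k x) * indicator {..t} x \<partial>leb01)
      = (\<integral>\<^sup>+x. ennreal (max 0 (indicator {..t} x * k x)) \<partial>leb01)" for k
      by (intro nn_integral_cong) (auto split: split_indicator simp: max_def ennreal_neg)
    ultimately show ?thesis
      by (subst (1 2) N) (auto simp: hi_def)
  qed
  have eq: "N h = N (\<lambda>x. - h x)"
  proof (rule measure_eqI_generator_eq)
    show "Int_stable (range (\<lambda>a::real. {..a}))"
      by (auto simp: Int_stable_def)
    show "emeasure (N h) X = emeasure (N (\<lambda>x. - h x)) X" if "X \<in> range atMost" for X
      using that * by auto
    show "sets (N h) = sigma_sets UNIV (range atMost)" "sets (N (\<lambda>x. - h x)) = sigma_sets UNIV (range atMost)"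
      by (simp_all add: N_def borel_eq_atMost)
    show "range (\<lambda>i::nat. {..real i}) \<subseteq> range atMost" by auto
    show "(\<Union>i::nat. {..real i}) = UNIV"
      by (auto intro: real_arch_simple)
    fix i :: nat
    have "emeasure (N h) {..real i} \<le> (\<integral>\<^sup>+x. ennreal (norm (h x)) \<partial>leb01)"
      by (subst N) (auto intro!: nn_integral_mono split: split_indicator simp: ennreal_leI)
    also have "\<dots> < \<infinity>" using h by (simp add: integrable_iff_bounded)
    finally show "emeasure (N h) {..real i} \<noteq> \<infinity>" by simp
  qed simp
  have pos: "AE x in leb01. k x \<le> 0"
    if [measurable]: "k \<in> borel_measurable borel" and "N k = N (\<lambda>x. - k x)" for k
  proof -
    have [measurable]: "k \<in> borel_measurable leb01" by (rule borel_measurable_leb01) fact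
    have m: "{x. 0 < k x} \<in> sets borel" by measurable
    have "(\<integral>\<^sup>+x. ennreal (k x) * indicator {x. 0 < k x} x \<partial>leb01) = emeasure (N (\<lambda>x. - k x)) {x. 0 < k x}"
      using that(2) by (subst N[symmetric]) auto
    also have "\<dots> = (\<integral>\<^sup>+x. ennreal (- k x) * indicator {x. 0 < k x} x \<partial>leb01)"
      using m by (intro N) auto
    also have "\<dots> = (\<integral>\<^sup>+x. 0 \<partial>leb01)"
      by (intro nn_integral_cong) (auto split: split_indicator simp: ennreal_neg)
    finally have "(\<integral>\<^sup>+x. ennreal (k x) * indicator {x. 0 < k x} x \<partial>leb01) = 0" by simp
    moreover have "(\<integral>\<^sup>+x. ennreal (k x) * indicator {x. 0 < k x} x \<partial>leb01) = (\<integral>\<^sup>+x. ennreal (k x) \<partial>leb01)"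
      by (intro nn_integral_cong) (auto split: split_indicator simp: ennreal_neg)
    ultimately have "(\<integral>\<^sup>+x. ennreal (k x) \<partial>leb01) = 0" by simp
    then show ?thesis
      by (subst (asm) nn_integral_0_iff_AE) (auto simp: ennreal_eq_0_iff)
  qed
  from pos[of h, OF _ eq] pos[of "\<lambda>x. - h x"] eq show ?thesis by auto
qed

section \<open>Square-integrable functions\<close>

lemma (in finite_measure) integrable_if_square_integrable:
  fixes f :: "'a \<Rightarrow> real"
  assumes "f \<in> borel_measurable M" "integrable M (\<lambda>x. (f x)\<^sup>2)"
  shows "integrable M f"
proof (rule Bochner_Integration.integrable_bound)
  show "integrable M (\<lambda>x. 1 + (f x)\<^sup>2)" using assms by simp
  show "AE x in M. norm (f x) \<le> norm (1 + (f x)\<^sup>2)"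
  proof (intro AE_I2)
    fix x
    have "0 \<le> (\<bar>f x\<bar> - 1)\<^sup>2" by simp
    also have "(\<bar>f x\<bar> - 1)\<^sup>2 = (f x)\<^sup>2 - 2 * \<bar>f x\<bar> + 1" by (simp add: power2_diff)
    finally show "norm (f x) \<le> norm (1 + (f x)\<^sup>2)" by simp
  qed
qed (use assms in auto)

lemma integrable_mult_square_integrable:
  fixes f g :: "'a \<Rightarrow> real"
  assumes "f \<in> borel_measurable M" "g \<in> borel_measurable M"
    "integrable M (\<lambda>x. (f x)\<^sup>2)" "integrable M (\<lambda>x. (g x)\<^sup>2)"
  shows "integrable M (\<lambda>x. f x * g x)"
proof (rule Bochner_Integration.integrable_bound)
  show "integrable M (\<lambda>x. (f x)\<^sup>2 + (g x)\<^sup>2)" using assms by simp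
  show "AE x in M. norm (f x * g x) \<le> norm ((f x)\<^sup>2 + (g x)\<^sup>2)"
  proof (intro AE_I2)
    fix x
    have "2 * \<bar>f x * g x\<bar> \<le> (f x)\<^sup>2 + (g x)\<^sup>2"
      using sum_squares_bound[of "\<bar>f x\<bar>" "\<bar>g x\<bar>"] by (simp add: abs_mult)
    then show "norm (f x * g x) \<le> norm ((f x)\<^sup>2 + (g x)\<^sup>2)" by simp
  qed
qed (use assms in auto)

lemma square_integrable_add:
  fixes f g :: "'a \<Rightarrow> real"
  assumes "f \<in> borel_measurable M" "g \<in> borel_measurable M"
    "integrable M (\<lambda>x. (f x)\<^sup>2)" "integrable M (\<lambda>x. (g x)\<^sup>2)"
  shows "integrable M (\<lambda>x. (f x + g x)\<^sup>2)"
  using assms integrable_mult_square_integrable[OF assms]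
  by (simp add: power2_sum mult.assoc)

text \<open>Jensen for a probability measure, read off from the nonnegativity of the
  variance.\<close>

lemma square_integral_le:
  fixes f :: "real \<Rightarrow> real"
  assumes [measurable]: "f \<in> borel_measurable leb01" and f2: "integrable leb01 (\<lambda>x. (f x)\<^sup>2)"
  shows "(LINT x|leb01. f x)\<^sup>2 \<le> (LINT x|leb01. (f x)\<^sup>2)"
proof -
  define c where "c = (LINT x|leb01. f x)"
  have f: "integrable leb01 f"
    using assms by (rule leb01.integrable_if_square_integrable)
  have "0 \<le> (LINT x|leb01. (f x - c)\<^sup>2)" by simp
  also have "\<dots> = (LINT x|leb01. (f x)\<^sup>2 - 2 * c * f x + c\<^sup>2)"
    by (simp add: power2_diff algebra_simps)
  also have "\<dots> = (LINT x|leb01. (f x)\<^sup>2) - 2 * c * c + c\<^sup>2 * measure leb01 {0..1}"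
    using f f2 by (simp add: c_def)
  also have "measure leb01 {0..1} = 1"
    using emeasure_leb01_space by (simp add: measure_def)
  finally show ?thesis by (simp add: c_def power2_eq_square)
qed

lemma prim_square_le:
  assumes [measurable]: "f \<in> borel_measurable leb01" and f2: "integrable leb01 (\<lambda>x. (f x)\<^sup>2)"
    and x: "x \<in> {0..1}"
  shows "(prim f x)\<^sup>2 \<le> (LINT x|leb01. (f x)\<^sup>2)"
proof -
  have f: "integrable leb01 f"
    using assms(1,2) by (rule leb01.integrable_if_square_integrable)
  have eq: "(indicator {0..x} u * f u)\<^sup>2 = indicator {0..x} u * (f u)\<^sup>2" for u
    by (auto split: split_indicator)
  have "(prim f x)\<^sup>2 \<le> (LINT u|leb01. (indicator {0..x} u * f u)\<^sup>2)"
    unfolding prim_eq[OF x]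
    by (rule square_integral_le)
      (use f f2 in \<open>auto simp: eq intro!: integrable_indicator_leb01 borel_measurable_integrable\<close>)
  also have "\<dots> \<le> (LINT u|leb01. (f u)\<^sup>2)"
    unfolding eq using f2
    by (intro integral_mono integrable_indicator_leb01) (auto split: split_indicator)
  finally show ?thesis .
qed

section \<open>Primitives in one and in both variables of functions on the square\<close>

lemma AE_zero_if_prim_zero_sq:
  fixes h :: "real \<times> real \<Rightarrow> real"
  assumes h [measurable]: "h \<in> borel_measurable borel" and int: "integrable leb_sq h"
    and zero: "\<And>t. t \<in> {0..1} \<Longrightarrow> AE x in leb01. prim (\<lambda>s. h (s, x)) t = 0"
  shows "AE z in leb_sq. h z = 0"
proof -
  \<comment> \<open>The exceptional set of \<open>x\<close> depends on \<open>t\<close>. Rational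
    times leave only countably many such sets, and continuity of the primitive recovers every
    \<open>t\<close> outside their union.\<close>
  have "AE x in leb01. \<forall>t\<in>\<rat> \<inter> {0..1}. prim (\<lambda>s. h (s, x)) t = 0"
    using zero by (intro AE_ball_countable') (auto intro: countable_rat countable_Int1)
  moreover have "AE x in leb01. integrable leb01 (\<lambda>s. h (s, x))"
    using int leb_sq.AE_integrable_snd[of "\<lambda>s x. h (s, x)"] by simp
  ultimately have "AE x in leb01. AE s in leb01. h (s, x) = 0"
  proof eventually_elim
    fix x assume z: "\<forall>t\<in>\<rat> \<inter> {0..1}. prim (\<lambda>s. h (s, x)) t = 0"
      and i: "integrable leb01 (\<lambda>s. h (s, x))"
    show "AE s in leb01. h (s, x) = 0"
    proof (rule AE_zero_if_prim_zero[OF _ i])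
      show "(\<lambda>s. h (s, x)) \<in> borel_measurable borel"
        by (rule borel_measurable_Pair_real) (rule h)
      fix t :: real assume t: "t \<in> {0..1}"
      have c: "continuous_on {0..1} (prim (\<lambda>s. h (s, x)))"
        by (rule continuous_on_prim[OF i])
      show "prim (\<lambda>s. h (s, x)) t = 0"
      proof (rule ccontr)
        assume "prim (\<lambda>s. h (s, x)) t \<noteq> 0"
        then have "\<bar>prim (\<lambda>s. h (s, x)) t\<bar> > 0" by simp
        then obtain d where d: "d > 0" "\<And>y. y \<in> {0..1} \<Longrightarrow> dist y t < d \<Longrightarrow>
            dist (prim (\<lambda>s. h (s, x)) y) (prim (\<lambda>s. h (s, x)) t) < \<bar>prim (\<lambda>s. h (s, x)) t\<bar>"
          using c[unfolded continuous_on_iff, rule_format, OF t] by metis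
        have "max 0 (t - d) < min 1 (t + d)" using t d by auto
        then obtain r where "r \<in> \<rat>" "max 0 (t - d) < r" "r < min 1 (t + d)"
          using Rats_dense_in_real by blast
        then show False using z d(2)[of r] by (auto simp: dist_real_def abs_less_iff)
      qed
    qed
  qed
  then have "AE s in leb01. AE x in leb01. h (s, x) = 0"
    by (subst leb_sq.AE_commute) (use borel_measurable_leb_sq[OF h] in \<open>auto simp: split_beta'\<close>)
  then show ?thesis
    by (intro leb_sq.AE_pair_measure) (use borel_measurable_leb_sq[OF h] in auto)
qed

lemma borel_measurable_indicator_rect [measurable]:
  "indicat_real ({0..t} \<times> {0..x}) \<in> borel_measurable leb_sq"
  by (rule borel_measurable_leb_sq) (intro borel_measurable_indicator borel_closed closed_Times closed_atLeastAtMost)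

text \<open>The integral over a rectangle is the common value of both orders of integration. It is
  also the form in which joint continuity in \<open>t\<close> and \<open>x\<close> becomes
  visible.\<close>

lemma
  fixes W :: "real \<times> real \<Rightarrow> real"
  assumes W: "W \<in> borel_measurable borel" and int: "integrable leb_sq W"
    and t: "t \<in> {0..1}" and x: "x \<in> {0..1}"
  shows prim_prim_snd: "prim (\<lambda>u. prim (\<lambda>s. W (s, u)) t) x
      = (LINT w|leb_sq. indicator ({0..t} \<times> {0..x}) w * W w)" (is ?A)
    and prim_prim_fst: "prim (\<lambda>s. prim (\<lambda>u. W (s, u)) x) t
      = (LINT w|leb_sq. indicator ({0..t} \<times> {0..x}) w * W w)" (is ?B)
proof -
  define F where "F = (\<lambda>w. indicator ({0..t} \<times> {0..x}) w * W w)"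
  have F: "integrable leb_sq F"
    unfolding F_def using int
    by (intro Bochner_Integration.integrable_bound[OF int]) (auto split: split_indicator)
  then have F': "integrable leb_sq (\<lambda>(s, u). F (s, u))" by simp
  have "prim (\<lambda>s. prim (\<lambda>u. W (s, u)) x) t
      = (LINT s|leb01. indicator {0..t} s * (LINT u|leb01. indicator {0..x} u * W (s, u)))"
    unfolding prim_eq[OF t] prim_eq[OF x] ..
  also have "\<dots> = (LINT s|leb01. LINT u|leb01. F (s, u))"
    unfolding F_def
    by (intro Bochner_Integration.integral_cong refl) (auto simp: indicator_times split: split_indicator)
  also have "\<dots> = (LINT w|leb_sq. F w)" by (rule leb_sq.integral_fst'[OF F])
  finally show ?B by (simp add: F_def)
  have "prim (\<lambda>u. prim (\<lambda>s. W (s, u)) t) x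
      = (LINT u|leb01. indicator {0..x} u * (LINT s|leb01. indicator {0..t} s * W (s, u)))"
    unfolding prim_eq[OF t] prim_eq[OF x] ..
  also have "\<dots> = (LINT u|leb01. LINT s|leb01. F (s, u))"
    unfolding F_def
    by (intro Bochner_Integration.integral_cong refl) (auto simp: indicator_times split: split_indicator)
  also have "\<dots> = (LINT w|leb_sq. F w)" using leb_sq.integral_snd[OF F'] by simp
  finally show ?A by (simp add: F_def)
qed

text \<open>The indicators of the rectangles converge off the two lines through \<open>z\<close>
  parallel to the axes, a null set. Dominated convergence thus gives joint continuity although
  \<open>W\<close> is only integrable.\<close>

lemma continuous_on_prim_prim:
  fixes W :: "real \<times> real \<Rightarrow> real"
  assumes W: "W \<in> borel_measurable borel" and int: "integrable leb_sq W"
  shows "continuous_on unit_sq (\<lambda>z. LINT w|leb_sq. indicator ({0..fst z} \<times> {0..snd z}) w * W w)"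
  unfolding continuous_on_sequentially comp_def
proof (intro allI ballI impI)
  fix X :: "nat \<Rightarrow> real \<times> real" and z
  assume "z \<in> unit_sq" and X: "(\<forall>n. X n \<in> unit_sq) \<and> X \<longlonglongrightarrow> z"
  have Wm [measurable]: "W \<in> borel_measurable leb_sq" using int by auto
  have "AE w in leb_sq. fst w \<noteq> fst z \<and> snd w \<noteq> snd z"
  proof (rule leb_sq.AE_pair_measure)
    show "{w \<in> space leb_sq. fst w \<noteq> fst z \<and> snd w \<noteq> snd z} \<in> sets leb_sq"
    proof -
      have "(\<lambda>w. (fst w - fst z) * (snd w - snd z)) \<in> borel_measurable leb_sq" by measurable
      then have "{w \<in> space leb_sq. (fst w - fst z) * (snd w - snd z) \<noteq> 0} \<in> sets leb_sq"
        by measurable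
      then show ?thesis by simp
    qed
    show "AE s in leb01. AE u in leb01. fst (s, u) \<noteq> fst z \<and> snd (s, u) \<noteq> snd z"
      using AE_leb01_neq[of "fst z"] AE_leb01_neq[of "snd z"] by auto
  qed
  then have conv: "AE w in leb_sq. (\<lambda>n. indicator ({0..fst (X n)} \<times> {0..snd (X n)}) w * W w)
      \<longlonglongrightarrow> indicator ({0..fst z} \<times> {0..snd z}) w * W w"
  proof eventually_elim
    fix w :: "real \<times> real" assume w: "fst w \<noteq> fst z \<and> snd w \<noteq> snd z"
    have *: "\<forall>\<^sub>F n in sequentially. (a \<le> x n) = (a \<le> (c::real))" if "x \<longlonglongrightarrow> c" "a \<noteq> c" for a c x
    proof (cases "a < c")
      case True
      show ?thesis using order_tendstoD(1)[OF that(1) True]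
        by eventually_elim (use True in simp)
    next
      case False
      then have ca: "c < a" using that by simp
      show ?thesis using order_tendstoD(2)[OF that(1) ca]
        by eventually_elim (use ca in simp)
    qed
    have "\<forall>\<^sub>F n in sequentially. (fst w \<le> fst (X n)) = (fst w \<le> fst z)"
      "\<forall>\<^sub>F n in sequentially. (snd w \<le> snd (X n)) = (snd w \<le> snd z)"
      using X w by (auto intro!: * tendsto_intros)
    then have "\<forall>\<^sub>F n in sequentially. indicator ({0..fst (X n)} \<times> {0..snd (X n)}) w * W w
      = indicator ({0..fst z} \<times> {0..snd z}) w * W w"
      by eventually_elim (cases w, auto simp: indicator_def)
    then show "(\<lambda>n. indicator ({0..fst (X n)} \<times> {0..snd (X n)}) w * W w)
      \<longlonglongrightarrow> indicator ({0..fst z} \<times> {0..snd z}) w * W w"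
      by (rule tendsto_eventually)
  qed
  show "(\<lambda>n. LINT w|leb_sq. indicator ({0..fst (X n)} \<times> {0..snd (X n)}) w * W w)
    \<longlonglongrightarrow> (LINT w|leb_sq. indicator ({0..fst z} \<times> {0..snd z}) w * W w)"
  proof (rule integral_dominated_convergence[OF _ _ _ conv])
    show "integrable leb_sq (\<lambda>w. norm (W w))" using int by simp
  qed (auto split: split_indicator)
qed

text \<open>The simplifier turns \<open>{0..0}\<close> into \<open>{0}\<close>, so the value at the
  left end is stated in that normal form.\<close>

lemma prim_0 [simp]: "(LINT u|lebesgue_on {0::real}. f u :: real) = 0"
proof -
  have "prim f 0 = (LINT u|leb01. indicator {0..0} u * f u)"
    by (rule prim_eq) simp
  also have "\<dots> = 0"
    using AE_leb01_neq[of 0] by (intro integral_eq_zero_AE) (auto elim!: eventually_mono)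
  finally show ?thesis by simp
qed

lemma prim_add:
  assumes "integrable leb01 f" "integrable leb01 g" "x \<in> {0..1}"
  shows "prim (\<lambda>u. f u + g u) x = prim f x + prim g x"
  using integrable_prim[OF assms(1,3)] integrable_prim[OF assms(2,3)]
  by (rule Bochner_Integration.integral_add)

lemma has_real_derivative_prim:
  assumes "continuous_on {0..1} f" "t \<in> {0..1}"
  shows "(prim f has_real_derivative f t) (at t within {0..1})"
proof -
  have "((\<lambda>x. integral {0..x} f) has_real_derivative f t) (at t within {0..1})"
    by (rule integral_has_real_derivative[OF assms])
  then show ?thesis
  proof (rule has_field_derivative_transform_within[OF _ zero_less_one assms(2)])
    fix x :: real assume "x \<in> {0..1}"
    then show "integral {0..x} f = prim f x"
      using integrable_prim[OF integrable_continuous_leb01[OF assms(1)]]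
      by (simp add: lebesgue_integral_eq_integral)
  qed
qed

lemma prim_FTC:
  assumes F: "\<And>t. t \<in> {0..1} \<Longrightarrow> (F has_real_derivative f t) (at t within {0..1})"
    and f: "continuous_on {0..1} f" and t: "t \<in> {0..1}"
  shows "F t = F 0 + prim f t"
proof -
  have "(f has_integral F t - F 0) {0..t}"
  proof (rule fundamental_theorem_of_calculus)
    fix x assume "x \<in> {0..t}"
    then show "(F has_vector_derivative f x) (at x within {0..t})"
      using F[of x] t unfolding has_real_derivative_iff_has_vector_derivative
      by (auto intro: has_vector_derivative_within_subset)
  qed (use t in auto)
  moreover have "prim f t = integral {0..t} f"
    using integrable_prim[OF integrable_continuous_leb01[OF f] t]
    by (simp add: lebesgue_integral_eq_integral)
  ultimately show ?thesis by (simp add: integral_unique)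
qed

lemma bounded_on_unit_sq:
  fixes g :: "real \<times> real \<Rightarrow> real"
  assumes "continuous_on unit_sq g"
  obtains B where "\<And>z. z \<in> unit_sq \<Longrightarrow> \<bar>g z\<bar> \<le> B" "B \<ge> 0"
proof -
  have "compact unit_sq" unfolding unit_sq_def by (intro compact_Times) auto
  then obtain B where B: "\<forall>y\<in>g ` unit_sq. norm y \<le> B"
    using compact_imp_bounded[OF compact_continuous_image[OF assms]] unfolding bounded_iff by metis
  show thesis by (rule that[of "\<bar>B\<bar>"]) (use B in force)+
qed

lemma continuous_on_unit_sq_slice:
  fixes g :: "real \<times> real \<Rightarrow> real"
  assumes "continuous_on unit_sq g"
  shows "t \<in> {0..1} \<Longrightarrow> continuous_on {0..1} (\<lambda>x. g (t, x))"
    and "x \<in> {0..1} \<Longrightarrow> continuous_on {0..1} (\<lambda>t. g (t, x))"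
  using assms
  by (auto intro!: continuous_on_compose2[OF assms] continuous_intros simp: unit_sq_def)

lemma borel_measurable_continuous_leb_sq:
  fixes g :: "real \<times> real \<Rightarrow> real"
  assumes g: "continuous_on unit_sq g"
  shows "g \<in> borel_measurable leb_sq"
proof -
  have "(\<lambda>z. if z \<in> unit_sq then g z else 0) \<in> borel_measurable borel"
    using g by (intro borel_measurable_continuous_on_if) auto
  then have "(\<lambda>z. if z \<in> unit_sq then g z else 0) \<in> borel_measurable leb_sq"
    by (rule borel_measurable_leb_sq)
  then show ?thesis
    by (subst (asm) measurable_cong[where g = g]) (auto simp: space_leb_sq unit_sq_def)
qed

lemma integrable_mult_continuous_leb_sq:
  fixes f g :: "real \<times> real \<Rightarrow> real"
  assumes f: "integrable leb_sq f" and g: "continuous_on unit_sq g"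
  shows "integrable leb_sq (\<lambda>z. f z * g z)"
proof -
  obtain B where B: "\<And>z. z \<in> unit_sq \<Longrightarrow> \<bar>g z\<bar> \<le> B" "B \<ge> 0"
    using bounded_on_unit_sq[OF g] by blast
  show ?thesis
  proof (rule Bochner_Integration.integrable_bound)
    show "integrable leb_sq (\<lambda>z. f z * B)" using f by simp
    show "(\<lambda>z. f z * g z) \<in> borel_measurable leb_sq"
      using f borel_measurable_continuous_leb_sq[OF g] by auto
    show "AE z in leb_sq. norm (f z * g z) \<le> norm (f z * B)"
      using B by (intro AE_I2) (auto simp: space_leb_sq unit_sq_def abs_mult intro!: mult_left_mono)
  qed
qed

lemma integrable_fst_leb_sq:
  fixes f :: "real \<Rightarrow> real"
  assumes "integrable leb01 f" shows "integrable leb_sq (\<lambda>z. f (fst z))"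
proof (rule leb_sq.Fubini_integrable)
  show "(\<lambda>z. f (fst z)) \<in> borel_measurable leb_sq"
    using assms by (intro measurable_compose[OF measurable_fst]) auto
qed (use assms in auto)

lemma integrable_snd_leb_sq:
  fixes f :: "real \<Rightarrow> real"
  assumes "integrable leb01 f" shows "integrable leb_sq (\<lambda>z. f (snd z))"
proof (rule leb_sq.Fubini_integrable)
  show "(\<lambda>z. f (snd z)) \<in> borel_measurable leb_sq"
    using assms by (intro measurable_compose[OF measurable_snd]) auto
qed (use assms in auto)

section \<open>Paths of class \<open>H\<^sup>2\<close>\<close>

text \<open>
  Here \<open>v0\<close> and \<open>W\<close> are Borel representatives of \<open>q'(0)\<close> and of the second derivative of \<open>q\<close>, and \<open>a0\<close>
  is the primitive of \<open>q(0)\<close>. Then \<open>V\<close> represents \<open>q'\<close>, its primitive \<open>S\<close> has time derivative \<open>T\<close>,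
  \<open>e\<close> is \<open>\<eta>(q)\<close> with time derivative \<open>e S\<close>, and \<open>pdot\<close> is the time derivative of \<open>p = V / e\<close>. The
  function \<open>H\<close> dominates \<open>V\<^sup>2\<close> uniformly in time.
\<close>

locale sobolev_path =
  fixes v0 a0 :: "real \<Rightarrow> real" and W :: "real \<times> real \<Rightarrow> real"
  assumes v0: "v0 \<in> borel_measurable borel" and v0_sq: "integrable leb01 (\<lambda>x. (v0 x)\<^sup>2)"
    and W: "W \<in> borel_measurable borel" and W_sq: "integrable leb_sq (\<lambda>z. (W z)\<^sup>2)"
    and a0: "a0 \<in> borel_measurable borel" and a0_cont: "continuous_on {0..1} a0"
begin

definition "V z = v0 (snd z) + prim (\<lambda>s. W (s, snd z)) (fst z)"
definition "S z = prim (\<lambda>u. V (fst z, u)) (snd z)"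
definition "T z = prim (\<lambda>u. W (fst z, u)) (snd z)"
definition "e z = exp (a0 (snd z) + prim (\<lambda>s. S (s, snd z)) (fst z))"
definition "Ph z = prim (\<lambda>u. e (fst z, u)) (snd z)"
definition "H x = 2 * (v0 x)\<^sup>2 + 2 * (LINT s|leb01. (W (s, x))\<^sup>2)"
definition "pdot z = W z / e z - V z * S z / e z"

lemma compose_snd:
  fixes f :: "real \<Rightarrow> real"
  assumes "f \<in> borel_measurable borel"
  shows "(\<lambda>z::real \<times> real. f (snd z)) \<in> borel_measurable borel"
  unfolding borel_prod[symmetric] by (rule measurable_compose[OF measurable_snd assms])

lemma V_borel [measurable]: "V \<in> borel_measurable borel"
  unfolding V_def by (intro borel_measurable_add borel_measurable_prim_fst W compose_snd v0)

lemma S_borel [measurable]: "S \<in> borel_measurable borel"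
  unfolding S_def by (rule borel_measurable_prim_snd) simp

lemma T_borel [measurable]: "T \<in> borel_measurable borel"
  unfolding T_def by (rule borel_measurable_prim_snd) (rule W)

lemma e_borel [measurable]: "e \<in> borel_measurable borel"
  unfolding e_def
  by (intro borel_measurable_exp[THEN measurable_compose[rotated]] borel_measurable_add
      borel_measurable_prim_fst compose_snd a0) simp

lemma Ph_borel [measurable]: "Ph \<in> borel_measurable borel"
  unfolding Ph_def by (rule borel_measurable_prim_snd) simp

lemma pdot_borel [measurable]: "pdot \<in> borel_measurable borel"
  unfolding pdot_def using W by measurable

lemma e_pos: "e z > 0"
  by (simp add: e_def)

lemma v0_int: "integrable leb01 v0"
  by (rule leb01.integrable_if_square_integrable[OF borel_measurable_leb01[OF v0] v0_sq])

lemma W_int: "integrable leb_sq W"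
  by (rule leb_sq.integrable_if_square_integrable[OF borel_measurable_leb_sq[OF W] W_sq])

text \<open>Cauchy-Schwarz bounds the primitive of \<open>W\<close> at any time by the full energy
  of \<open>W\<close> in time. One null set of \<open>x\<close> and one integrable \<open>H\<close>
  then serve all times, which makes \<open>V\<close> square integrable in \<open>x\<close> at every
  time rather than at almost every one.\<close>

lemma V_sq_le: "AE x in leb01. \<forall>t\<in>{0..1}. (V (t, x))\<^sup>2 \<le> H x"
proof -
  have "AE x in leb01. integrable leb01 (\<lambda>s. (W (s, x))\<^sup>2)"
    using leb_sq.AE_integrable_snd[of "\<lambda>s x. (W (s, x))\<^sup>2"] W_sq
  by (simp add: split_beta')
  then show ?thesis
  proof eventually_elim
    fix x assume i: "integrable leb01 (\<lambda>s. (W (s, x))\<^sup>2)"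
    show "\<forall>t\<in>{0..1}. (V (t, x))\<^sup>2 \<le> H x"
    proof
      fix t :: real assume t: "t \<in> {0..1}"
      have "(prim (\<lambda>s. W (s, x)) t)\<^sup>2 \<le> (LINT s|leb01. (W (s, x))\<^sup>2)"
        by (rule prim_square_le[OF _ i t])
          (intro borel_measurable_leb01 borel_measurable_Pair_real W)
      moreover have "(V (t, x))\<^sup>2 \<le> 2 * (v0 x)\<^sup>2 + 2 * (prim (\<lambda>s. W (s, x)) t)\<^sup>2"
        using sum_squares_bound[of "v0 x" "prim (\<lambda>s. W (s, x)) t"]
        by (simp add: V_def power2_sum)
      ultimately show "(V (t, x))\<^sup>2 \<le> H x" by (simp add: H_def)
    qed
  qed
qed

lemma H_borel: "H \<in> borel_measurable borel"
proof -
  have "(\<lambda>z. (W z)\<^sup>2) \<in> borel_measurable borel" using W by measurable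
  from borel_measurable_Pair_real(1)[OF borel_measurable_prim_fst[OF this], of 1]
  show ?thesis unfolding H_def using v0 by simp
qed

lemma H_int: "integrable leb01 H"
  unfolding H_def using v0_sq leb_sq.integrable_snd[of "\<lambda>s x. (W (s, x))\<^sup>2"] W_sq
  by (simp add: split_beta')

lemma V_sq_int:
  assumes "t \<in> {0..1}" shows "integrable leb01 (\<lambda>x. (V (t, x))\<^sup>2)"
proof (rule Bochner_Integration.integrable_bound[OF H_int])
  show "(\<lambda>x. (V (t, x))\<^sup>2) \<in> borel_measurable leb01"
    by (intro borel_measurable_leb01 borel_measurable_power borel_measurable_Pair_real V_borel)
  show "AE x in leb01. norm ((V (t, x))\<^sup>2) \<le> norm (H x)"
    using V_sq_le by eventually_elim (use assms in force)
qed

lemma V_leb01: "(\<lambda>x. V (t, x)) \<in> borel_measurable leb01"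
  by (intro borel_measurable_leb01 borel_measurable_Pair_real V_borel)

lemma V_int: "t \<in> {0..1} \<Longrightarrow> integrable leb01 (\<lambda>x. V (t, x))"
  by (rule leb01.integrable_if_square_integrable[OF V_leb01 V_sq_int])

lemma V_sq_le_sq: "AE z in leb_sq. (V z)\<^sup>2 \<le> H (snd z)"
proof -
  have m: "{z \<in> space leb_sq. (V z)\<^sup>2 \<le> H (snd z)} \<in> sets leb_sq"
    using borel_measurable_leb_sq[OF V_borel] borel_measurable_leb_sq[OF compose_snd[OF H_borel]]
    by measurable
  have "AE x in leb01. AE t in leb01. (V (t, x))\<^sup>2 \<le> H x"
    using V_sq_le by eventually_elim (auto intro!: AE_I2)
  then have "AE t in leb01. AE x in leb01. (V (t, x))\<^sup>2 \<le> H x"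
    by (subst leb_sq.AE_commute) (use m in simp_all)
  then show ?thesis
    by (intro leb_sq.AE_pair_measure[OF m]) simp
qed

lemma V_sq_int_sq: "integrable leb_sq (\<lambda>z. (V z)\<^sup>2)"
proof (rule Bochner_Integration.integrable_bound[OF integrable_snd_leb_sq[OF H_int]])
  show "(\<lambda>z. (V z)\<^sup>2) \<in> borel_measurable leb_sq"
    using borel_measurable_leb_sq[OF V_borel] by simp
  show "AE z in leb_sq. norm ((V z)\<^sup>2) \<le> norm (H (snd z))"
    using V_sq_le_sq by eventually_elim simp
qed

lemma V_int_sq: "integrable leb_sq V"
  by (rule leb_sq.integrable_if_square_integrable[OF borel_measurable_leb_sq[OF V_borel] V_sq_int_sq])

text \<open>\<open>V\<close> has no regularity in \<open>x\<close>, but its primitive is that of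
  \<open>v0\<close> plus an integral of \<open>W\<close> over a rectangle. Joint continuity of
  \<open>S\<close> and its time derivative are read off from this form.\<close>

lemma S_rect:
  assumes t: "t \<in> {0..1}" and x: "x \<in> {0..1}"
  shows "S (t, x) = prim v0 x + (LINT w|leb_sq. indicator ({0..t} \<times> {0..x}) w * W w)"
proof -
  have "integrable leb01 (\<lambda>u. V (t, u) - v0 u)"
    using V_int[OF t] v0_int by simp
  then have "integrable leb01 (\<lambda>u. prim (\<lambda>s. W (s, u)) t)"
    by (simp add: V_def)
  then have "S (t, x) = prim v0 x + prim (\<lambda>u. prim (\<lambda>s. W (s, u)) t) x"
    unfolding S_def V_def using prim_add[OF v0_int _ x] by simp
  then show ?thesis using prim_prim_snd[OF W W_int t x] by simp
qed

lemma S_time: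
  assumes t: "t \<in> {0..1}" and x: "x \<in> {0..1}"
  shows "S (t, x) = prim v0 x + prim (\<lambda>s. T (s, x)) t"
  using S_rect[OF assms] prim_prim_fst[OF W W_int t x] by (simp add: T_def)

lemma S_cont: "continuous_on unit_sq S"
proof -
  have "continuous_on unit_sq (\<lambda>z. prim v0 (snd z))"
    by (rule continuous_on_compose2[OF continuous_on_prim[OF v0_int]])
      (auto intro!: continuous_intros simp: unit_sq_def)
  then have "continuous_on unit_sq
      (\<lambda>z. prim v0 (snd z) + (LINT w|leb_sq. indicator ({0..fst z} \<times> {0..snd z}) w * W w))"
    by (intro continuous_on_add continuous_on_prim_prim W W_int)
  then show ?thesis
    by (rule continuous_on_eq) (auto simp: unit_sq_def S_rect)
qed

text \<open>Needed to identify \<open>eta (q t)\<close> with \<open>e\<close>: the exponent of the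
  former integrates the time primitive of \<open>V\<close> in space, that of the latter integrates
  \<open>S\<close> in time.\<close>

lemma prim_S:
  assumes "t \<in> {0..1}" "x \<in> {0..1}"
  shows "prim (\<lambda>s. S (s, x)) t = prim (\<lambda>u. prim (\<lambda>s. V (s, u)) t) x"
  using prim_prim_fst[OF V_borel V_int_sq assms] prim_prim_snd[OF V_borel V_int_sq assms]
  by (simp add: S_def)

lemma prim_S_rect:
  assumes "t \<in> {0..1}" "x \<in> {0..1}"
  shows "prim (\<lambda>s. S (s, x)) t = (LINT w|leb_sq. indicator ({0..t} \<times> {0..x}) w * V w)"
  using prim_prim_fst[OF V_borel V_int_sq assms] by (simp add: S_def)

lemma e_cont: "continuous_on unit_sq e"
proof -
  have "continuous_on unit_sq (\<lambda>z. a0 (snd z))"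
    by (rule continuous_on_compose2[OF a0_cont])
      (auto intro!: continuous_intros simp: unit_sq_def)
  then have "continuous_on unit_sq
      (\<lambda>z. exp (a0 (snd z) + (LINT w|leb_sq. indicator ({0..fst z} \<times> {0..snd z}) w * V w)))"
    by (intro continuous_on_exp continuous_on_add continuous_on_prim_prim V_borel V_int_sq)
  then show ?thesis
    by (rule continuous_on_eq) (auto simp: unit_sq_def e_def prim_S_rect)
qed

lemma inverse_e_cont: "continuous_on unit_sq (\<lambda>z. 1 / e z)"
  using e_cont by (intro continuous_intros) (use e_pos in \<open>auto simp: less_le\<close>)

lemma e_deriv:
  assumes "t \<in> {0..1}" "x \<in> {0..1}"
  shows "((\<lambda>t. e (t, x)) has_real_derivative e (t, x) * S (t, x)) (at t within {0..1})"
proof -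
  note has_real_derivative_prim[OF continuous_on_unit_sq_slice(2)[OF S_cont assms(2)] assms(1), derivative_intros]
  show ?thesis unfolding e_def by (auto intro!: derivative_eq_intros)
qed

lemma e_time:
  assumes "t \<in> {0..1}" "x \<in> {0..1}"
  shows "e (t, x) = e (0, x) + prim (\<lambda>s. e (s, x) * S (s, x)) t"
  using assms S_cont e_cont
  by (intro prim_FTC e_deriv continuous_on_mult continuous_on_unit_sq_slice)

lemma inverse_e_time:
  assumes "t \<in> {0..1}" "x \<in> {0..1}"
  shows "1 / e (t, x) = 1 / e (0, x) + prim (\<lambda>s. - S (s, x) / e (s, x)) t"
proof (rule prim_FTC[where F = "\<lambda>t. 1 / e (t, x)" and f = "\<lambda>s. - S (s, x) / e (s, x)"])
  fix t :: real assume t: "t \<in> {0..1}"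
  show "((\<lambda>t. 1 / e (t, x)) has_real_derivative - S (t, x) / e (t, x)) (at t within {0..1})"
    using e_deriv[OF t assms(2)] e_pos[of "(t, x)"]
    by (auto intro!: derivative_eq_intros simp: field_simps power2_eq_square)
next
  have "continuous_on unit_sq (\<lambda>z. - S z * (1 / e z))"
    by (intro continuous_on_mult continuous_on_minus S_cont inverse_e_cont)
  from continuous_on_unit_sq_slice(2)[OF this assms(2)]
  show "continuous_on {0..1} (\<lambda>s. - S (s, x) / e (s, x))" by simp
qed (rule assms)

lemma AE_W_int: "AE x in leb01. integrable leb01 (\<lambda>s. W (s, x))"
  "AE t in leb01. integrable leb01 (\<lambda>u. W (t, u))"
  using leb_sq.AE_integrable_snd[of "\<lambda>s x. W (s, x)"] leb_sq.AE_integrable_fst'[OF W_int] W_int by simp_all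

lemma V_0: "V (0, x) = v0 x"
  by (simp add: V_def)

text \<open>The integrated product rule for \<open>V\<close>, which is absolutely continuous in time
  with derivative \<open>W\<close>, and \<open>1 / e\<close>, which is continuously differentiable.
  The only condition on \<open>x\<close> is that \<open>W\<close> be integrable in time, so the null
  set is the same for all \<open>t\<close>.\<close>

lemma p_time:
  "AE x in leb01. \<forall>t\<in>{0..1}. V (t, x) / e (t, x) = V (0, x) / e (0, x) + prim (\<lambda>s. pdot (s, x)) t"
  using AE_W_int(1) AE_space
proof eventually_elim
  fix x assume i: "integrable leb01 (\<lambda>s. W (s, x))" and "x \<in> space leb01"
  then have x: "x \<in> {0..1}" by simp
  have "continuous_on unit_sq (\<lambda>z. - S z * (1 / e z))"
    by (intro continuous_on_mult continuous_on_minus S_cont inverse_e_cont)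
  from continuous_on_unit_sq_slice(2)[OF this x]
  have g: "integrable leb01 (\<lambda>s. - S (s, x) / e (s, x))"
    by (intro integrable_continuous_leb01) simp
  show "\<forall>t\<in>{0..1}. V (t, x) / e (t, x) = V (0, x) / e (0, x) + prim (\<lambda>s. pdot (s, x)) t"
  proof
    fix t :: real assume t: "t \<in> {0..1}"
    have "prim (\<lambda>s. pdot (s, x)) t = (LINT s|lebesgue_on {0..t}. W (s, x) * (1 / e (0, x) + prim (\<lambda>s. - S (s, x) / e (s, x)) s)
        + (v0 x + prim (\<lambda>s. W (s, x)) s) * (- S (s, x) / e (s, x)))"
    proof (intro Bochner_Integration.integral_cong refl)
      fix s assume "s \<in> space (lebesgue_on {0..t})"
      then have s: "s \<in> {0..1}" using t by simp
      show "pdot (s, x) = W (s, x) * (1 / e (0, x) + prim (\<lambda>s. - S (s, x) / e (s, x)) s)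
        + (v0 x + prim (\<lambda>s. W (s, x)) s) * (- S (s, x) / e (s, x))"
        unfolding inverse_e_time[OF s x, symmetric] by (simp add: pdot_def V_def)
    qed
    also have "\<dots> = V (t, x) * (1 / e (t, x)) - v0 x * (1 / e (0, x))"
      unfolding integral_by_parts_prim[OF i g t] inverse_e_time[OF t x, symmetric] by (simp add: V_def)
    finally show "V (t, x) / e (t, x) = V (0, x) / e (0, x) + prim (\<lambda>s. pdot (s, x)) t"
      by (simp add: V_0)
  qed
qed

lemma square_integrable_mult_continuous:
  assumes f: "integrable leb_sq (\<lambda>z. (f z)\<^sup>2)" and g: "continuous_on unit_sq g"
  shows "integrable leb_sq (\<lambda>z. (f z * g z :: real)\<^sup>2)"
  using integrable_mult_continuous_leb_sq[OF f continuous_on_power[OF g, of 2]]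
  by (simp add: power_mult_distrib)

text \<open>\<open>W\<close> and \<open>V\<close> are square integrable, and their coefficients are
  continuous, hence bounded, on the compact square.\<close>

lemma pdot_sq: "integrable leb_sq (\<lambda>z. (pdot z)\<^sup>2)"
proof -
  have "continuous_on unit_sq (\<lambda>z. - S z * (1 / e z))"
    by (intro continuous_on_mult continuous_on_minus S_cont inverse_e_cont)
  then have "integrable leb_sq (\<lambda>z. (W z * (1 / e z) + V z * (- S z * (1 / e z)))\<^sup>2)"
    using borel_measurable_leb_sq[OF W] borel_measurable_leb_sq[OF V_borel]
      borel_measurable_leb_sq[OF S_borel] borel_measurable_leb_sq[OF e_borel]
    by (intro square_integrable_add square_integrable_mult_continuous W_sq V_sq_int_sq inverse_e_cont) auto
  then show ?thesis by (simp add: pdot_def)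
qed

end

context sobolev_path
begin

lemma T_int_sq: "integrable leb_sq T"
proof (rule Bochner_Integration.integrable_bound)
  show "integrable leb_sq (\<lambda>z. LINT u|leb01. \<bar>W (fst z, u)\<bar>)"
    using leb_sq.integrable_fst'[OF integrable_abs[OF W_int]]
    by (rule integrable_fst_leb_sq)
  show "T \<in> borel_measurable leb_sq" by (rule borel_measurable_leb_sq) simp
  have m: "{z \<in> space leb_sq. \<bar>T z\<bar> \<le> (LINT u|leb01. \<bar>W (fst z, u)\<bar>)} \<in> sets leb_sq"
  proof -
    have [measurable]: "T \<in> borel_measurable leb_sq" by (rule borel_measurable_leb_sq) simp
    have [measurable]: "(\<lambda>z. LINT u|leb01. \<bar>W (fst z, u)\<bar>) \<in> borel_measurable leb_sq"
      by (rule borel_measurable_integrable) fact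
    show ?thesis by measurable
  qed
  have "AE t in leb01. AE x in leb01. \<bar>T (t, x)\<bar> \<le> (LINT u|leb01. \<bar>W (t, u)\<bar>)"
    using AE_W_int(2)
  proof eventually_elim
    fix t assume i: "integrable leb01 (\<lambda>u. W (t, u))"
    show "AE x in leb01. \<bar>T (t, x)\<bar> \<le> (LINT u|leb01. \<bar>W (t, u)\<bar>)"
      by (intro AE_I2) (use prim_bound[OF i] in \<open>simp add: T_def\<close>)
  qed
  then have "AE z in leb_sq. \<bar>T z\<bar> \<le> (LINT u|leb01. \<bar>W (fst z, u)\<bar>)"
    by (intro leb_sq.AE_pair_measure[OF m]) simp
  then show "AE z in leb_sq. norm (T z) \<le> norm (LINT u|leb01. \<bar>W (fst z, u)\<bar>)"
    by eventually_elim simp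
qed

text \<open>Valid for every \<open>x\<close>, because \<open>T\<close> at fixed \<open>x\<close> is
  a marginal of \<open>W\<close> restricted to a rectangle. An almost-everywhere version from the
  integrability of \<open>T\<close> on the square would say nothing at \<open>x = 1\<close>, where
  the constraint is differentiated.\<close>

lemma T_int:
  assumes x: "x \<in> {0..1}" shows "integrable leb01 (\<lambda>s. T (s, x))"
proof -
  have "integrable leb_sq (\<lambda>z. indicator ({0..1} \<times> {0..x}) z * W z)"
    using W_int by (intro Bochner_Integration.integrable_bound[OF W_int]) (auto split: split_indicator)
  from leb_sq.integrable_fst'[OF this]
  have "integrable leb01 (\<lambda>s. LINT u|leb01. indicator ({0..1} \<times> {0..x}) (s, u) * W (s, u))" .
  moreover have "(LINT u|leb01. indicator ({0..1} \<times> {0..x}) (s, u) * W (s, u)) = T (s, x)"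
    if "s \<in> space leb01" for s
    unfolding T_def fst_conv snd_conv prim_eq[OF x] using that
    by (intro Bochner_Integration.integral_cong) (auto split: split_indicator)
  ultimately show ?thesis by (subst (asm) Bochner_Integration.integrable_cong) auto
qed

lemma S_0: "S (0, x) = prim v0 x"
  by (simp add: S_def V_0)

text \<open>Product rule with \<open>e S\<close> as the time derivative of \<open>e\<close> and
  \<open>T\<close> as that of \<open>S\<close>; \<open>T\<close> is only integrable in time, so the
  rule is again used in integrated form.\<close>

lemma eS_time:
  assumes t: "t \<in> {0..1}" and x: "x \<in> {0..1}"
  shows "e (t, x) * S (t, x) = e (0, x) * S (0, x)
    + prim (\<lambda>s. e (s, x) * (S (s, x))\<^sup>2 + e (s, x) * T (s, x)) t"
proof -
  have g: "integrable leb01 (\<lambda>s. e (s, x) * S (s, x))"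
    by (intro integrable_continuous_leb01 continuous_on_mult continuous_on_unit_sq_slice e_cont S_cont x)
  have "prim (\<lambda>s. e (s, x) * (S (s, x))\<^sup>2 + e (s, x) * T (s, x)) t
    = (LINT s|lebesgue_on {0..t}. T (s, x) * (e (0, x) + prim (\<lambda>s. e (s, x) * S (s, x)) s)
      + (prim v0 x + prim (\<lambda>s. T (s, x)) s) * (e (s, x) * S (s, x)))"
  proof (intro Bochner_Integration.integral_cong refl)
    fix s assume "s \<in> space (lebesgue_on {0..t})"
    then have s: "s \<in> {0..1}" using t by simp
    show "e (s, x) * (S (s, x))\<^sup>2 + e (s, x) * T (s, x)
      = T (s, x) * (e (0, x) + prim (\<lambda>s. e (s, x) * S (s, x)) s)
      + (prim v0 x + prim (\<lambda>s. T (s, x)) s) * (e (s, x) * S (s, x))"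
      unfolding e_time[OF s x, symmetric] S_time[OF s x, symmetric]
      by (simp add: power2_eq_square)
  qed
  also have "\<dots> = S (t, x) * e (t, x) - S (0, x) * e (0, x)"
    unfolding integral_by_parts_prim[OF T_int[OF x] g t] e_time[OF t x, symmetric] S_time[OF t x, symmetric]
    by (simp add: S_0)
  finally show ?thesis by (simp add: mult.commute)
qed

end

text \<open>The assumptions encode membership in the cotangent bundle. \<open>S_1\<close> is
  orthogonality of \<open>p\<close> to 1, \<open>Ph_1\<close> is the normalisation of \<phi>, and
  \<open>eS_0\<close> is orthogonality of \<open>p\<close> to \<phi> after an integration by parts
  in \<open>x\<close>, whose boundary term vanishes by \<open>S_1\<close>.\<close>

locale constrained_path = sobolev_path +
  assumes S_1: "t \<in> {0..1} \<Longrightarrow> S (t, 1) = 0"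
    and eS_0: "t \<in> {0..1} \<Longrightarrow> (LINT x|leb01. e (t, x) * S (t, x)) = 0"
    and Ph_1: "t \<in> {0..1} \<Longrightarrow> Ph (t, 1) = 1"
begin

lemma T_1: "AE t in leb01. T (t, 1) = 0"
proof (rule AE_zero_if_prim_zero)
  show "(\<lambda>t. T (t, 1)) \<in> borel_measurable borel"
    by (rule borel_measurable_Pair_real) simp
  fix t :: real assume t: "t \<in> {0..1}"
  show "prim (\<lambda>t. T (t, 1)) t = 0"
    using S_time[OF t, of 1] S_1[OF t] S_1[of 0] by (simp add: S_0)
qed (simp add: T_int)

text \<open>The constraint \<open>eS_0\<close> differentiated under the integral: by Fubini the time
  primitive of the left-hand side is the increment of a quantity that vanishes at all times.\<close>

lemma eS_sq_T: "AE t in leb01. (LINT x|leb01. e (t, x) * (S (t, x))\<^sup>2 + e (t, x) * T (t, x)) = 0"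
proof (rule AE_zero_if_prim_zero)
  define K where "K = (\<lambda>z. e z * (S z)\<^sup>2 + e z * T z)"
  have K: "K \<in> borel_measurable borel" unfolding K_def by measurable
  have "continuous_on unit_sq (\<lambda>z. e z * (S z)\<^sup>2)"
    by (intro continuous_on_mult continuous_on_power e_cont S_cont)
  from integrable_mult_continuous_leb_sq[OF _ this, of "\<lambda>_. 1"]
    integrable_mult_continuous_leb_sq[OF T_int_sq e_cont]
  have K_int: "integrable leb_sq K" by (simp add: K_def mult.commute)
  show "(\<lambda>t. LINT x|leb01. e (t, x) * (S (t, x))\<^sup>2 + e (t, x) * T (t, x)) \<in> borel_measurable borel"
    using borel_measurable_integral_snd[OF K] by (simp add: K_def)
  show "integrable leb01 (\<lambda>t. LINT x|leb01. e (t, x) * (S (t, x))\<^sup>2 + e (t, x) * T (t, x))"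
    using leb_sq.integrable_fst'[OF K_int] by (simp add: K_def)
  fix t :: real assume t: "t \<in> {0..1}"
  have "prim (\<lambda>s. LINT x|leb01. K (s, x)) t = (LINT x|leb01. prim (\<lambda>s. K (s, x)) t)"
    using prim_prim_fst[OF K K_int t, of 1] prim_prim_snd[OF K K_int t, of 1] by simp
  also have "\<dots> = (LINT x|leb01. e (t, x) * S (t, x) - e (0, x) * S (0, x))"
    by (intro Bochner_Integration.integral_cong) (auto simp: K_def eS_time[OF t])
  also have "\<dots> = (LINT x|leb01. e (t, x) * S (t, x)) - (LINT x|leb01. e (0, x) * S (0, x))"
    using t by (intro Bochner_Integration.integral_diff integrable_continuous_leb01 continuous_on_mult
        continuous_on_unit_sq_slice e_cont S_cont) auto
  also have "\<dots> = 0" using eS_0[OF t] eS_0[of 0] by simp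
  finally show "prim (\<lambda>t. LINT x|leb01. e (t, x) * (S (t, x))\<^sup>2 + e (t, x) * T (t, x)) t = 0"
    by (simp add: K_def)
qed

text \<open>
  Integration by parts in \<open>x\<close> reduces both pairings to the time derivative of \<open>\<integral> e S dx = 0\<close>, which
  reads \<open>\<integral> e S\<^sup>2 + e T dx = 0\<close>.
\<close>

lemma pdot_orthogonal:
  "AE t in leb01. (LINT x|leb01. pdot (t, x) * e (t, x)) = 0
    \<and> (LINT x|leb01. pdot (t, x) * Ph (t, x) * e (t, x)) = 3/2 * (LINT x|leb01. (S (t, x))\<^sup>2 * e (t, x))"
  using T_1 eS_sq_T AE_W_int(2) AE_space leb_sq.AE_integrable_fst'[OF T_int_sq]
proof eventually_elim
  fix t assume T1: "T (t, 1) = 0"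
    and eST: "(LINT x|leb01. e (t, x) * (S (t, x))\<^sup>2 + e (t, x) * T (t, x)) = 0"
    and Wt: "integrable leb01 (\<lambda>u. W (t, u))" and "t \<in> space leb01"
    and Tt: "integrable leb01 (\<lambda>x. T (t, x))"
  then have t: "t \<in> {0..1}" by simp
  have one: "(1::real) \<in> {0..1}" by simp
  have Sc: "continuous_on {0..1} (\<lambda>x. S (t, x))" and ec: "continuous_on {0..1} (\<lambda>x. e (t, x))"
    using t by (auto intro: continuous_on_unit_sq_slice S_cont e_cont)
  have ei: "integrable leb01 (\<lambda>x. e (t, x))" by (rule integrable_continuous_leb01[OF ec])
  have Phc: "continuous_on {0..1} (\<lambda>x. Ph (t, x))"
    using continuous_on_prim[OF ei] by (simp add: Ph_def)
  \<comment> \<open>The factor 2 makes this integrand the \<open>x\<close>-derivative of the square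
    of \<open>S\<close>, which vanishes at both ends of the interval.\<close>
  have VS: "integrable leb01 (\<lambda>x. 2 * (V (t, x) * S (t, x)))"
    using integrable_mult_continuous_leb01[OF V_int[OF t] Sc] by simp
  have primVS: "prim (\<lambda>x. 2 * (V (t, x) * S (t, x))) x = (S (t, x))\<^sup>2" if "x \<in> {0..1}" for x
    using integral_by_parts_prim[OF V_int[OF t] V_int[OF t] that, of 0 0]
    by (simp add: S_def power2_eq_square mult.commute)
  have VS0: "(LINT x|leb01. V (t, x) * S (t, x)) = 0"
    using primVS[OF one] S_1[OF t] by simp
  have W0: "(LINT x|leb01. W (t, x)) = 0"
    using T1 by (simp add: T_def)
  have WPh: "integrable leb01 (\<lambda>x. W (t, x) * Ph (t, x))"
    by (rule integrable_mult_continuous_leb01[OF Wt Phc])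
  have Te: "integrable leb01 (\<lambda>x. T (t, x) * e (t, x))"
    by (rule integrable_mult_continuous_leb01[OF Tt ec])
  have VSPh: "integrable leb01 (\<lambda>x. V (t, x) * S (t, x) * Ph (t, x))"
    using integrable_mult_continuous_leb01[OF integrable_mult_continuous_leb01[OF V_int[OF t] Sc] Phc] .
  have S2e: "integrable leb01 (\<lambda>x. (S (t, x))\<^sup>2 * e (t, x))"
    by (intro integrable_continuous_leb01 continuous_on_mult continuous_on_power Sc ec)
  have "(LINT x|leb01. W (t, x) * Ph (t, x) + T (t, x) * e (t, x)) = T (t, 1) * Ph (t, 1)"
    using integral_by_parts_prim[OF Wt ei one, of 0 0] by (simp add: T_def Ph_def)
  then have "(LINT x|leb01. W (t, x) * Ph (t, x)) = - (LINT x|leb01. T (t, x) * e (t, x))"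
    using WPh Te T1 by simp
  moreover have "(LINT x|leb01. (S (t, x))\<^sup>2 * e (t, x)) = - (LINT x|leb01. T (t, x) * e (t, x))"
    using eST S2e Te by (simp add: mult.commute)
  ultimately have WPh': "(LINT x|leb01. W (t, x) * Ph (t, x)) = (LINT x|leb01. (S (t, x))\<^sup>2 * e (t, x))"
    by simp
  have "(LINT x|leb01. 2 * (V (t, x) * S (t, x)) * Ph (t, x) + (S (t, x))\<^sup>2 * e (t, x))
    = (LINT x|leb01. 2 * (V (t, x) * S (t, x)) * (0 + prim (\<lambda>x. e (t, x)) x)
      + (0 + prim (\<lambda>x. 2 * (V (t, x) * S (t, x))) x) * e (t, x))"
  proof (intro Bochner_Integration.integral_cong refl)
    fix x :: real assume "x \<in> space leb01"
    then have x: "x \<in> {0..1}" by simp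
    show "2 * (V (t, x) * S (t, x)) * Ph (t, x) + (S (t, x))\<^sup>2 * e (t, x)
      = 2 * (V (t, x) * S (t, x)) * (0 + prim (\<lambda>x. e (t, x)) x)
        + (0 + prim (\<lambda>x. 2 * (V (t, x) * S (t, x))) x) * e (t, x)"
      unfolding primVS[OF x] by (simp add: Ph_def)
  qed
  also have "\<dots> = (0 + prim (\<lambda>x. 2 * (V (t, x) * S (t, x))) 1) * (0 + prim (\<lambda>x. e (t, x)) 1) - 0 * 0"
    by (rule integral_by_parts_prim[OF VS ei one])
  also have "\<dots> = 0" unfolding primVS[OF one] using S_1[OF t] by simp
  finally have "(LINT x|leb01. 2 * (V (t, x) * S (t, x) * Ph (t, x)) + (S (t, x))\<^sup>2 * e (t, x)) = 0"
    by (simp add: mult.assoc)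
  then have VSPh': "2 * (LINT x|leb01. V (t, x) * S (t, x) * Ph (t, x)) = - (LINT x|leb01. (S (t, x))\<^sup>2 * e (t, x))"
    using VSPh S2e by simp
  have e_ne: "e z \<noteq> 0" for z using e_pos[of z] by simp
  have pe: "pdot (t, x) * e (t, x) = W (t, x) - V (t, x) * S (t, x)" for x
    using e_ne[of "(t, x)"] by (simp add: pdot_def field_simps)
  have VSi: "integrable leb01 (\<lambda>x. V (t, x) * S (t, x))"
    by (rule integrable_mult_continuous_leb01[OF V_int[OF t] Sc])
  have 1: "(LINT x|leb01. pdot (t, x) * e (t, x)) = 0"
    unfolding pe Bochner_Integration.integral_diff[OF Wt VSi] W0 VS0 by simp
  have pPe: "pdot (t, x) * Ph (t, x) * e (t, x) = W (t, x) * Ph (t, x) - V (t, x) * S (t, x) * Ph (t, x)" for x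
    using pe[of x] by algebra
  \<comment> \<open>The coefficient is 1 + 1/2: the term with \<open>W\<close> contributes the full
    integral of \<open>S\<close>-squared times \<open>e\<close>, and the term with
    \<open>V * S\<close>, half of a derivative, contributes half of it.\<close>
  have 2: "(LINT x|leb01. pdot (t, x) * Ph (t, x) * e (t, x)) = 3/2 * (LINT x|leb01. (S (t, x))\<^sup>2 * e (t, x))"
    unfolding pPe Bochner_Integration.integral_diff[OF WPh VSPh] WPh' using VSPh' by linarith
  show "(LINT x|leb01. pdot (t, x) * e (t, x)) = 0
    \<and> (LINT x|leb01. pdot (t, x) * Ph (t, x) * e (t, x)) = 3/2 * (LINT x|leb01. (S (t, x))\<^sup>2 * e (t, x))"
    using 1 2 by simp
qed

end

section \<open>Covectors at a point of \<open>Q\<close>\<close>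

text \<open>\<open>H2\<close> has determinant 1/12, and the coefficients are the entries 4, -6, 12
  of its inverse. \<open>matrix_inv\<close> is defined by choice, so both one-sided identities are
  needed to pin it down.\<close>

lemma H2_comb_eq: "H2_comb q a b x = (4 * a - 6 * b) + (12 * b - 6 * a) * phi q x"
proof -
  define K :: "real^2^2" where "K = vector [vector [4, -6], vector [-6, 12]]"
  have HK: "H2 ** K = mat 1" and KH: "K ** H2 = mat 1"
    by (simp_all add: vec_eq_iff forall_2 matrix_matrix_mult_def sum_2 H2_def K_def mat_def)
  then have "H2 ** matrix_inv H2 = mat 1 \<and> matrix_inv H2 ** H2 = mat 1"
    unfolding matrix_inv_def by (intro someI_ex[of "\<lambda>A'. H2 ** A' = mat 1 \<and> A' ** H2 = mat 1"]) blast
  then have "matrix_inv H2 = K"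
    using HK KH by (metis matrix_mul_assoc matrix_mul_lid matrix_mul_rid)
  then show ?thesis
    by (simp add: H2_comb_def K_def inner_vec_def sum_2 matrix_vector_mult_def algebra_simps)
qed

lemma eta_pos: "eta q x > 0"
  by (simp add: eta_def)

text \<open>Completeness of Lebesgue measure. It permits passing to almost-everywhere equal
  functions whose measurability is otherwise unknown.\<close>

lemma borel_measurable_AE_leb01:
  fixes f g :: "real \<Rightarrow> real"
  assumes f: "f \<in> borel_measurable leb01" and ae: "AE x in leb01. f x = g x"
  shows "g \<in> borel_measurable leb01"
proof -
  have "(\<lambda>x. if x \<in> {0..1} then f x else 0) \<in> borel_measurable lebesgue"
    using f by (subst borel_measurable_if) auto
  moreover have "AE x in lebesgue. (if x \<in> {0..1} then f x else 0) = (if x \<in> {0..1} then g x else 0)"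
    using ae by (subst (asm) AE_restrict_space_iff) (auto elim!: eventually_mono)
  ultimately have "(\<lambda>x. if x \<in> {0..1} then g x else 0) \<in> borel_measurable lebesgue"
    by (rule borel_measurable_AE)
  then show ?thesis by (rule borel_measurable_if[THEN iffD1, rotated]) simp
qed

lemma prim_AE:
  assumes f: "f \<in> borel_measurable leb01" and ae: "AE u in leb01. f u = g u" and x: "x \<in> {0..1}"
  shows "prim f x = prim g x"
  by (rule prim_cong_AE[OF ae x f borel_measurable_AE_leb01[OF f ae]])

locale Q_point =
  fixes q :: "real \<Rightarrow> real"
  assumes q: "q \<in> Q"
begin

lemma q_int: "integrable leb01 q"
proof -
  have "q \<in> borel_measurable leb01 \<and> integrable leb01 (\<lambda>x. (q x)\<^sup>2)"
    using q unfolding Q_def L2_def by blast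
  then show ?thesis
    using leb01.integrable_if_square_integrable by blast
qed

lemma eta_cont: "continuous_on {0..1} (eta q)"
  unfolding eta_def by (intro continuous_on_exp continuous_on_prim q_int)

lemma eta_int: "integrable leb01 (eta q)"
  by (rule integrable_continuous_leb01[OF eta_cont])

lemma phi_cont: "continuous_on {0..1} (phi q)"
  using continuous_on_prim[OF eta_int] by (simp add: phi_def)

lemma phi_1: "phi q 1 = 1"
  using q by (simp add: phi_def Q_def)

lemma phi_0: "phi q 0 = 0"
  by (simp add: phi_def)

lemma phi_deriv:
  assumes "x \<in> {0..1}" shows "(phi q has_real_derivative eta q x) (at x within {0..1})"
  using has_real_derivative_prim[OF eta_cont assms] by (simp add: phi_def[abs_def])

lemma phi_strict_mono:
  assumes "0 \<le> x" "x < y" "y \<le> 1" shows "phi q x < phi q y"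
proof (rule DERIV_pos_imp_increasing_open[OF assms(2)])
  show "continuous_on {x..y} (phi q)"
    using phi_cont by (rule continuous_on_subset) (use assms in auto)
  fix z assume z: "x < z" "z < y"
  then have "at z within {0..1} = at z"
    using assms by (intro at_within_interior) simp
  then have "DERIV (phi q) z :> eta q z"
    using phi_deriv[of z] z assms by simp
  then show "\<exists>l. DERIV (phi q) z :> l \<and> 0 < l"
    using eta_pos by blast
qed

lemma phi_inj: "inj_on (phi q) {0..1}"
  by (rule linorder_inj_onI) (use phi_strict_mono in \<open>force+\<close>)

lemma phi_image:
  assumes z: "z \<in> {0..1}" shows "phi q ` {0..z} = {0..phi q z}"
proof
  show "phi q ` {0..z} \<subseteq> {0..phi q z}"
  proof
    fix y assume "y \<in> phi q ` {0..z}"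
    then obtain x where x: "0 \<le> x" "x \<le> z" "y = phi q x" by auto
    have "phi q 0 \<le> phi q x" "phi q x \<le> phi q z"
      using phi_strict_mono[of 0 x] phi_strict_mono[of x z] x z by (force simp: less_le)+
    then show "y \<in> {0..phi q z}" using x by (simp add: phi_0)
  qed
  show "{0..phi q z} \<subseteq> phi q ` {0..z}"
  proof
    fix y assume y: "y \<in> {0..phi q z}"
    have "continuous_on {0..z} (phi q)"
      using phi_cont by (rule continuous_on_subset) (use z in auto)
    then obtain x where "0 \<le> x" "x \<le> z" "phi q x = y"
      using IVT'[of "phi q" 0 y z] y z by (auto simp: phi_0)
    then show "y \<in> phi q ` {0..z}" by auto
  qed
qed

text \<open>The substitution \<open>y = phi q x\<close> turns these into moments of \<open>y\<close>
  on the unit interval, so \<open>H2\<close> is the Gram matrix of 1 and \<phi>. The substitution is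
  carried out by integrating derivatives of powers of \<phi> by parts.\<close>

lemma gram:
  "inner_eta q (\<lambda>x. 1) (\<lambda>x. 1) = 1" "inner_eta q (phi q) (\<lambda>x. 1) = 1/2"
  "inner_eta q (\<lambda>x. 1) (phi q) = 1/2" "inner_eta q (phi q) (phi q) = 1/3"
proof -
  have one: "(1::real) \<in> {0..1}" by simp
  show "inner_eta q (\<lambda>x. 1) (\<lambda>x. 1) = 1"
    using phi_1 by (simp add: inner_eta_def phi_def)
  have pe: "integrable leb01 (\<lambda>x. 2 * (phi q x * eta q x))"
    by (intro integrable_continuous_leb01 continuous_intros phi_cont eta_cont)
  have sq: "prim (\<lambda>x. 2 * (phi q x * eta q x)) x = (phi q x)\<^sup>2" if "x \<in> {0..1}" for x
    using integral_by_parts_prim[OF eta_int eta_int that, of 0 0]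
    by (simp add: phi_def power2_eq_square mult.commute)
  show h: "inner_eta q (phi q) (\<lambda>x. 1) = 1/2"
    using sq[OF one] by (simp add: inner_eta_def phi_1)
  then show "inner_eta q (\<lambda>x. 1) (phi q) = 1/2"
    by (simp add: inner_eta_def)
  have "3 * inner_eta q (phi q) (phi q) = (LINT x|leb01. 3 * (phi q x * phi q x * eta q x))"
    by (simp add: inner_eta_def)
  also have "\<dots> = (LINT x|leb01. 2 * (phi q x * eta q x) * (0 + prim (eta q) x)
      + (0 + prim (\<lambda>x. 2 * (phi q x * eta q x)) x) * eta q x)"
  proof (intro Bochner_Integration.integral_cong refl)
    fix x :: real assume "x \<in> space leb01"
    then have x: "x \<in> {0..1}" by simp
    show "3 * (phi q x * phi q x * eta q x) = 2 * (phi q x * eta q x) * (0 + prim (eta q) x)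
      + (0 + prim (\<lambda>x. 2 * (phi q x * eta q x)) x) * eta q x"
      unfolding sq[OF x] phi_def[of q x, symmetric] by (simp add: power2_eq_square)
  qed
  also have "\<dots> = (0 + prim (\<lambda>x. 2 * (phi q x * eta q x)) 1) * (0 + prim (eta q) 1) - 0 * 0"
    by (rule integral_by_parts_prim[OF pe eta_int one])
  also have "\<dots> = 1"
    unfolding sq[OF one] using phi_1 by (simp add: phi_def)
  finally show "inner_eta q (phi q) (phi q) = 1/3" by simp
qed

lemma H2_comb_cont: "continuous_on {0..1} (H2_comb q a b)"
  unfolding H2_comb_eq[abs_def] by (intro continuous_intros phi_cont)

lemma integrable_times_continuous_eta:
  assumes "integrable leb01 f" "continuous_on {0..1} g"
  shows "integrable leb01 (\<lambda>x. f x * g x * eta q x)"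
  by (intro integrable_mult_continuous_leb01 assms eta_cont)

lemma inner_H2_comb:
  assumes f: "integrable leb01 f"
  shows "inner_eta q f (H2_comb q a b) = (4 * a - 6 * b) * inner_eta q f (\<lambda>x. 1)
    + (12 * b - 6 * a) * inner_eta q f (phi q)"
proof -
  have "inner_eta q f (H2_comb q a b)
    = (LINT x|leb01. (4 * a - 6 * b) * (f x * 1 * eta q x) + (12 * b - 6 * a) * (f x * phi q x * eta q x))"
    unfolding inner_eta_def H2_comb_eq by (intro Bochner_Integration.integral_cong) (auto simp: algebra_simps)
  also have "\<dots> = (4 * a - 6 * b) * inner_eta q f (\<lambda>x. 1) + (12 * b - 6 * a) * inner_eta q f (phi q)"
    unfolding inner_eta_def
    using integrable_times_continuous_eta[OF f continuous_on_const[of _ 1]] integrable_times_continuous_eta[OF f phi_cont]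
    by simp
  finally show ?thesis .
qed

lemma inner_eta_commute: "inner_eta q f g = inner_eta q g f"
  by (simp add: inner_eta_def mult.commute)

text \<open>The purpose of inverting the Gram matrix: the combination of 1 and \<phi> has the
  prescribed moments \<open>a\<close> and \<open>b\<close>.\<close>

lemma inner_H2_comb_1: "inner_eta q (H2_comb q a b) (\<lambda>x. 1) = a"
  and inner_H2_comb_phi: "inner_eta q (H2_comb q a b) (phi q) = b"
  using inner_H2_comb[of "\<lambda>x. 1" a b] inner_H2_comb[OF integrable_continuous_leb01[OF phi_cont], of a b]
  by (simp_all add: gram inner_eta_commute[of "H2_comb q a b"] field_simps)

lemma inner_eta_diff:
  assumes "integrable leb01 f" "integrable leb01 g" "continuous_on {0..1} h"
  shows "inner_eta q (\<lambda>x. f x - g x) h = inner_eta q f h - inner_eta q g h"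
  unfolding inner_eta_def using integrable_times_continuous_eta[OF assms(1,3)] integrable_times_continuous_eta[OF assms(2,3)]
  by (simp add: left_diff_distrib)

lemma proj_cot_eq:
  "proj_cot q u = (\<lambda>x. u x - H2_comb q (inner_eta q u (\<lambda>x. 1)) (inner_eta q u (phi q)) x)"
  by (simp add: proj_cot_def[abs_def])

lemma
  assumes u: "integrable leb01 u"
  shows proj_cot_1: "inner_eta q (proj_cot q u) (\<lambda>x. 1) = 0"
    and proj_cot_phi: "inner_eta q (proj_cot q u) (phi q) = 0"
  unfolding proj_cot_eq
  using inner_eta_diff[OF u integrable_continuous_leb01[OF H2_comb_cont] continuous_on_const[of _ 1]]
    inner_eta_diff[OF u integrable_continuous_leb01[OF H2_comb_cont] phi_cont]
  by (simp_all add: inner_H2_comb_1 inner_H2_comb_phi)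

text \<open>The projection subtracts a combination of 1 and \<phi>, to which \<open>f\<close> is
  orthogonal. This is the form of self-adjointness that the first variation requires.\<close>

lemma inner_proj_cot:
  assumes f: "integrable leb01 f" and fu: "integrable leb01 (\<lambda>x. f x * u x * eta q x)"
    and ort: "inner_eta q f (\<lambda>x. 1) = 0" "inner_eta q f (phi q) = 0"
  shows "inner_eta q f (proj_cot q u) = inner_eta q f u"
proof -
  define a where "a = inner_eta q u (\<lambda>x. 1)"
  define b where "b = inner_eta q u (phi q)"
  have P: "proj_cot q u = (\<lambda>x. u x - H2_comb q a b x)"
    unfolding proj_cot_eq a_def b_def ..
  have "inner_eta q f (H2_comb q a b) = 0"
    unfolding inner_H2_comb[OF f] ort by simp
  moreover have "inner_eta q f (proj_cot q u) = inner_eta q f u - inner_eta q f (H2_comb q a b)"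
    unfolding P inner_eta_def
    using fu integrable_times_continuous_eta[OF f H2_comb_cont[of a b]]
    by (simp add: right_diff_distrib left_diff_distrib)
  ultimately show ?thesis by simp
qed

lemma change_of_variables_phi:
  assumes z: "z \<in> {0..1}" and f: "integrable leb01 (\<lambda>x. eta q x * f (phi q x))"
  shows "prim f (phi q z) = prim (\<lambda>x. eta q x * f (phi q x)) z"
proof -
  \<comment> \<open>The trivially true second conjunct fixes the value of the integral in the
    change-of-variables equivalence; the other side then yields both integrability on the image and
    the value.\<close>
  have "(\<lambda>x. \<bar>eta q x\<bar> * f (phi q x)) absolutely_integrable_on {0..z} \<and>
      integral {0..z} (\<lambda>x. \<bar>eta q x\<bar> * f (phi q x)) = integral {0..z} (\<lambda>x. \<bar>eta q x\<bar> * f (phi q x))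
     \<longleftrightarrow> f absolutely_integrable_on (phi q ` {0..z})
      \<and> integral (phi q ` {0..z}) f = integral {0..z} (\<lambda>x. \<bar>eta q x\<bar> * f (phi q x))"
  proof (rule has_absolute_integral_change_of_variables_1')
    fix x assume "x \<in> {0..z}"
    then show "(phi q has_real_derivative eta q x) (at x within {0..z})"
      using phi_deriv[of x] z by (auto intro: has_field_derivative_subset)
  next
    show "inj_on (phi q) {0..z}" using phi_inj by (rule inj_on_subset) (use z in auto)
  qed simp
  moreover have "(\<lambda>x. \<bar>eta q x\<bar> * f (phi q x)) = (\<lambda>x. eta q x * f (phi q x))"
    using eta_pos[of q] by (simp add: abs_of_pos)
  moreover have i: "integrable (lebesgue_on {0..z}) (\<lambda>x. eta q x * f (phi q x))"
    by (rule integrable_prim[OF f z])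
  then have "(\<lambda>x. eta q x * f (phi q x)) absolutely_integrable_on {0..z}"
    by (simp add: absolutely_integrable_on_def integrable_on_lebesgue_on)
  ultimately have f': "f absolutely_integrable_on {0..phi q z}"
    "integral {0..phi q z} f = integral {0..z} (\<lambda>x. eta q x * f (phi q x))"
    by (simp_all add: phi_image[OF z])
  have "integrable (lebesgue_on {0..phi q z}) f"
    using f'(1) by (rule absolutely_integrable_imp_integrable) simp
  then show ?thesis using f'(2) i
    by (simp add: lebesgue_integral_eq_integral)
qed

text \<open>The substitution by \<phi> is made twice, in the inner primitive and in the outer
  integral, and removes the inverse of \<phi>. For \<open>eta q * p = V\<close> the inner primitive
  is \<open>S\<close>.\<close>

lemma b_coeff_eq:
  assumes p: "integrable leb01 (\<lambda>x. eta q x * p x)"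
  shows "b_coeff p q = 3/2 * (LINT x|leb01. (prim (\<lambda>x. eta q x * p x) x)\<^sup>2 * eta q x)"
proof -
  define g where "g = (\<lambda>y. p (inv_into {0..1} (phi q) y))"
  have g_phi: "g (phi q x) = p x" if "x \<in> {0..1}" for x
    using inv_into_f_f[OF phi_inj that] by (simp add: g_def)
  have "integrable leb01 (\<lambda>x. eta q x * g (phi q x))"
    using p by (subst Bochner_Integration.integrable_cong) (auto simp: g_phi)
  note cv = change_of_variables_phi[OF _ this]
  have primg: "prim g (phi q z) = prim (\<lambda>x. eta q x * p x) z" if z: "z \<in> {0..1}" for z
    unfolding cv[OF z]
    by (intro Bochner_Integration.integral_cong refl) (use z in \<open>simp add: g_phi\<close>)
  have "integrable leb01 (\<lambda>x. eta q x * (prim (\<lambda>x. eta q x * p x) x)\<^sup>2)"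
    by (intro integrable_continuous_leb01 continuous_intros continuous_on_prim eta_cont p)
  then have "integrable leb01 (\<lambda>x. eta q x * (prim g (phi q x))\<^sup>2)"
    by (subst Bochner_Integration.integrable_cong) (auto simp: primg)
  from change_of_variables_phi[OF _ this, of 1]
  have "(LINT x|leb01. (prim g x)\<^sup>2) = (LINT x|leb01. eta q x * (prim g (phi q x))\<^sup>2)"
    by (simp add: phi_1)
  also have "\<dots> = (LINT x|leb01. (prim (\<lambda>x. eta q x * p x) x)\<^sup>2 * eta q x)"
    by (intro Bochner_Integration.integral_cong) (auto simp: primg)
  finally show ?thesis by (simp add: b_coeff_def g_def)
qed

end

section \<open>The covariant acceleration\<close>

lemma abs_integral_leb01_le:
  assumes "\<And>x. x \<in> {0..1} \<Longrightarrow> \<bar>f x :: real\<bar> \<le> B"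
  shows "\<bar>LINT x|leb01. f x\<bar> \<le> B"
proof (cases "integrable leb01 f")
  case True
  have "\<bar>LINT x|leb01. f x\<bar> \<le> (LINT x|leb01. \<bar>f x\<bar>)" by (rule integral_abs_bound)
  also have "\<dots> \<le> (LINT x|leb01. B)"
    using True assms by (intro integral_mono) auto
  also have "\<dots> = B" using emeasure_leb01_space by (simp add: measure_def)
  finally show ?thesis .
next
  case False
  \<comment> \<open>A non-integrable function has integral 0, and \<open>B\<close> is nonnegative
    because it bounds an absolute value at 0.\<close>
  then show ?thesis using assms[of 0] by (simp add: not_integrable_integral_eq)
qed

lemma integral_lebesgue_on_upper:
  assumes f: "integrable leb01 f" and x: "x \<in> {0..1}"
  shows "(LINT y|lebesgue_on {x..1}. f y) = prim f 1 - prim f x"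
proof -
  have f': "f \<in> borel_measurable leb01" using f by simp
  have [measurable]: "indicat_real {a..b} \<in> borel_measurable leb01" for a b
    by (rule borel_measurable_leb01) simp
  have "(LINT y|lebesgue_on {x..1}. f y) = (LINT y|leb01. indicator {x..1} y * f y)"
    by (rule integral_lebesgue_on_Icc) (use x in auto)
  also have "\<dots> = (LINT y|leb01. f y - indicator {0..x} y * f y)"
  proof (rule integral_cong_AE)
    show "AE y in leb01. indicator {x..1} y * f y = f y - indicator {0..x} y * f y"
      using AE_leb01_neq[of x] AE_space
      by eventually_elim (use x in \<open>auto split: split_indicator\<close>)
  qed (use f' in measurable)
  also have "\<dots> = prim f 1 - prim f x"
    unfolding prim_eq[OF x] using integrable_indicator_leb01[OF f, of "{0..x}"] f by simp
  finally show ?thesis .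
qed

lemma AE_leb_sqI:
  assumes f: "f \<in> borel_measurable borel" and g: "g \<in> borel_measurable borel"
    and ae: "AE t in leb01. AE x in leb01. f (t, x) = (g (t, x) :: real)"
  shows "AE z in leb_sq. f z = g z"
proof (rule leb_sq.AE_pair_measure)
  have "f \<in> borel_measurable leb_sq" "g \<in> borel_measurable leb_sq"
    by (intro borel_measurable_leb_sq f g)+
  then show "{z \<in> space leb_sq. f z = g z} \<in> sets leb_sq" by measurable
qed (rule ae)

text \<open>\<open>time_deriv\<close> is an arbitrary witness, and this identifies it. The
  difference between a Borel version of \<open>g1\<close> and \<open>g2\<close> has vanishing time
  primitives, for each time at almost every \<open>x\<close>.\<close>

lemma H1_deriv_unique:
  assumes g1: "H1_deriv f g1" and g2: "H1_deriv f (\<lambda>t x. g2 (t, x))"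
    and g2m: "g2 \<in> borel_measurable borel"
  shows "AE z in leb_sq. g1 (fst z) (snd z) = g2 z"
proof -
  have g1m: "(\<lambda>(t, x). g1 t x) \<in> borel_measurable (lebesgue_on unit_sq)"
    and g1i: "integrable (lebesgue_on unit_sq) (\<lambda>(t, x). (g1 t x)\<^sup>2)"
    using g1 by (simp_all add: H1_deriv_def)
  obtain h where h: "h \<in> borel_measurable borel" "AE z in leb_sq. (\<lambda>(t, x). g1 t x) z = h z"
    "AE z in lebesgue_on unit_sq. (\<lambda>(t, x). g1 t x) z = h z"
    by (rule borel_version_unit_sq[OF g1m])
  have hm: "h \<in> borel_measurable leb_sq" and g2m': "g2 \<in> borel_measurable leb_sq"
    by (intro borel_measurable_leb_sq h g2m)+
  have h2: "integrable leb_sq (\<lambda>z. (h z)\<^sup>2)"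
  proof -
    have "integrable (lebesgue_on unit_sq) (\<lambda>z. (h z)\<^sup>2)"
      using g1i
    proof (rule Bochner_Integration.integrable_cong_AE[THEN iffD1, rotated -1])
      show "AE z in lebesgue_on unit_sq. (case z of (t, x) \<Rightarrow> (g1 t x)\<^sup>2) = (h z)\<^sup>2"
        using h(3) by eventually_elim (auto simp: split_beta')
      show "(\<lambda>z. (h z)\<^sup>2) \<in> borel_measurable (lebesgue_on unit_sq)"
        using borel_measurable_lebesgue_on_borel[OF h(1)] by simp
    qed (use g1i in auto)
    then show ?thesis by (subst integrable_leb_sq_iff) (use h(1) in auto)
  qed
  have g22: "integrable leb_sq (\<lambda>z. (g2 z)\<^sup>2)"
    using g2 g2m by (subst integrable_leb_sq_iff) (auto simp: H1_deriv_def split_beta')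
  have hi: "integrable leb_sq h" and g2i: "integrable leb_sq g2"
    using leb_sq.integrable_if_square_integrable hm h2 g2m' g22 by blast+
  have "AE x in leb01. AE s in leb01. g1 s x = h (s, x)"
    by (rule AE_leb_sq_swap) (use h(2) in \<open>simp add: split_beta'\<close>)
  then have h_g1: "AE x in leb01. \<forall>t\<in>{0..1}. prim (\<lambda>s. h (s, x)) t = prim (\<lambda>s. g1 s x) t"
  proof eventually_elim
    fix x assume ae: "AE s in leb01. g1 s x = h (s, x)"
    then have ae': "AE s in leb01. h (s, x) = g1 s x" by eventually_elim simp
    show "\<forall>t\<in>{0..1}. prim (\<lambda>s. h (s, x)) t = prim (\<lambda>s. g1 s x) t"
      by (intro ballI prim_AE ae' borel_measurable_leb01 borel_measurable_Pair_real h(1))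
  qed
  have ih: "AE x in leb01. integrable leb01 (\<lambda>s. h (s, x))"
    and ig: "AE x in leb01. integrable leb01 (\<lambda>s. g2 (s, x))"
    using leb_sq.AE_integrable_snd[of "\<lambda>s x. h (s, x)"] leb_sq.AE_integrable_snd[of "\<lambda>s x. g2 (s, x)"] hi g2i
    by (simp_all add: split_beta')
  have "AE z in leb_sq. h z - g2 z = 0"
  proof (rule AE_zero_if_prim_zero_sq)
    fix t :: real assume t: "t \<in> {0..1}"
    have e1: "AE x in leb01. f t x = f 0 x + prim (\<lambda>s. g1 s x) t"
      and e2: "AE x in leb01. f t x = f 0 x + prim (\<lambda>s. g2 (s, x)) t"
      using g1 g2 t by (simp_all add: H1_deriv_def)
    show "AE x in leb01. prim (\<lambda>s. h (s, x) - g2 (s, x)) t = 0"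
      using e1 e2 h_g1 ih ig
    proof eventually_elim
      fix x assume a: "f t x = f 0 x + prim (\<lambda>s. g1 s x) t" "f t x = f 0 x + prim (\<lambda>s. g2 (s, x)) t"
        "\<forall>t\<in>{0..1}. prim (\<lambda>s. h (s, x)) t = prim (\<lambda>s. g1 s x) t"
        "integrable leb01 (\<lambda>s. h (s, x))" "integrable leb01 (\<lambda>s. g2 (s, x))"
      have "prim (\<lambda>s. h (s, x) - g2 (s, x)) t = prim (\<lambda>s. h (s, x)) t - prim (\<lambda>s. g2 (s, x)) t"
        using integrable_prim[OF a(4) t] integrable_prim[OF a(5) t] by (rule Bochner_Integration.integral_diff)
      then show "prim (\<lambda>s. h (s, x) - g2 (s, x)) t = 0"
        using a(1-3) t by simp
    qed
  qed (use h(1) g2m hi g2i in auto)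
  with h(2) show ?thesis by eventually_elim (simp add: split_beta')
qed

text \<open>\<open>eta_q\<close> holds at every point, whereas \<open>p_V\<close> holds at each time
  only for almost every \<open>x\<close>. So \<eta> and \<phi> may be replaced by \<open>e\<close>
  and \<open>Ph\<close> under any measure, but \<open>p\<close> by \<open>V / e\<close> only under
  Lebesgue integrals.\<close>

locale cotangent_path = sobolev_path +
  fixes p q :: "real \<Rightarrow> real \<Rightarrow> real"
  assumes eta_q: "t \<in> {0..1} \<Longrightarrow> x \<in> {0..1} \<Longrightarrow> eta (q t) x = e (t, x)"
    and pq_bundle: "t \<in> {0..1} \<Longrightarrow> (p t, q t) \<in> cotangent_bundle"
    and p_V: "t \<in> {0..1} \<Longrightarrow> AE x in leb01. eta (q t) x * p t x = V (t, x)"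
begin

lemma Q_point: "t \<in> {0..1} \<Longrightarrow> Q_point (q t)"
  using pq_bundle[of t] by (simp add: Q_point_def cotangent_bundle_def)

lemma p_L2: "t \<in> {0..1} \<Longrightarrow> p t \<in> L2"
  using pq_bundle[of t] unfolding cotangent_bundle_def cotangent_def by blast

lemma p_measurable: "t \<in> {0..1} \<Longrightarrow> p t \<in> borel_measurable leb01"
  using p_L2[of t] unfolding L2_def by blast

lemma phi_q: "t \<in> {0..1} \<Longrightarrow> x \<in> {0..1} \<Longrightarrow> phi (q t) x = Ph (t, x)"
  unfolding phi_def Ph_def fst_conv snd_conv
  by (intro Bochner_Integration.integral_cong refl) (simp add: eta_q)

lemma e_slice_cont: "t \<in> {0..1} \<Longrightarrow> continuous_on {0..1} (\<lambda>x. e (t, x))"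
  by (rule continuous_on_unit_sq_slice(1)[OF e_cont])

lemma Ph_slice_cont: "t \<in> {0..1} \<Longrightarrow> continuous_on {0..1} (\<lambda>x. Ph (t, x))"
  unfolding Ph_def fst_conv snd_conv
  by (intro continuous_on_prim integrable_continuous_leb01 e_slice_cont)

lemma inner_p:
  assumes t: "t \<in> {0..1}" and g: "continuous_on {0..1} g"
  shows "inner_eta (q t) (p t) g = (LINT x|leb01. V (t, x) * g x)"
  unfolding inner_eta_def
proof (rule integral_cong_AE)
  have [measurable]: "g \<in> borel_measurable leb01" by (rule borel_measurable_continuous_leb01[OF g])
  have [measurable]: "eta (q t) \<in> borel_measurable leb01"
    by (rule borel_measurable_continuous_leb01[OF Q_point.eta_cont[OF Q_point[OF t]]])
  have [measurable]: "p t \<in> borel_measurable leb01" by (rule p_measurable[OF t])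
  show "(\<lambda>x. p t x * g x * eta (q t) x) \<in> borel_measurable leb01" by measurable
  show "(\<lambda>x. V (t, x) * g x) \<in> borel_measurable leb01"
    using V_leb01[of t] by measurable
  show "AE x in leb01. p t x * g x * eta (q t) x = V (t, x) * g x"
    using p_V[OF t] by eventually_elim (metis mult.assoc mult.commute)
qed

lemma p_orthogonal:
  assumes t: "t \<in> {0..1}"
  shows "(LINT x|leb01. V (t, x)) = 0" "(LINT x|leb01. V (t, x) * Ph (t, x)) = 0"
proof -
  have "inner_eta (q t) (p t) (\<lambda>x. 1) = 0" "inner_eta (q t) (p t) (phi (q t)) = 0"
    using pq_bundle[OF t] unfolding cotangent_bundle_def cotangent_def by blast+
  moreover have "(LINT x|leb01. V (t, x) * Ph (t, x)) = (LINT x|leb01. V (t, x) * phi (q t) x)"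
    by (intro Bochner_Integration.integral_cong refl) (simp add: phi_q[OF t])
  ultimately show "(LINT x|leb01. V (t, x)) = 0" "(LINT x|leb01. V (t, x) * Ph (t, x)) = 0"
    unfolding inner_p[OF t continuous_on_const] inner_p[OF t Q_point.phi_cont[OF Q_point[OF t]]]
    by simp_all
qed

sublocale constrained_path
proof
  fix t :: real assume t: "t \<in> {0..1}"
  have one: "(1::real) \<in> {0..1}" by simp
  show S1: "S (t, 1) = 0" using p_orthogonal(1)[OF t] by (simp add: S_def)
  show "Ph (t, 1) = 1" using Q_point.phi_1[OF Q_point[OF t]] phi_q[OF t one] by simp
  have ei: "integrable leb01 (\<lambda>x. e (t, x))"
    by (rule integrable_continuous_leb01[OF e_slice_cont[OF t]])
  have "(LINT x|leb01. V (t, x) * Ph (t, x) + S (t, x) * e (t, x)) = S (t, 1) * Ph (t, 1)"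
    using integral_by_parts_prim[OF V_int[OF t] ei one, of 0 0] by (simp add: S_def Ph_def)
  moreover have "integrable leb01 (\<lambda>x. V (t, x) * Ph (t, x))"
    by (rule integrable_mult_continuous_leb01[OF V_int[OF t] Ph_slice_cont[OF t]])
  moreover have "integrable leb01 (\<lambda>x. S (t, x) * e (t, x))"
    by (intro integrable_continuous_leb01 continuous_on_mult e_slice_cont[OF t]
        continuous_on_unit_sq_slice(1)[OF S_cont t])
  ultimately show "(LINT x|leb01. e (t, x) * S (t, x)) = 0"
    using p_orthogonal(2)[OF t] S1 by (simp add: mult.commute)
qed

lemma p_H1_deriv: "H1_deriv p (\<lambda>t x. pdot (t, x))"
  unfolding H1_deriv_def
proof (intro conjI ballI)
  show "p t \<in> L2" if "t \<in> {0..1}" for t using that by (rule p_L2)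
  show "(\<lambda>(t, x). pdot (t, x)) \<in> borel_measurable (lebesgue_on unit_sq)"
    using borel_measurable_lebesgue_on_borel[OF pdot_borel] by simp
  show "integrable (lebesgue_on unit_sq) (\<lambda>(t, x). (pdot (t, x))\<^sup>2)"
    using pdot_sq by (subst (asm) integrable_leb_sq_iff) (auto simp: split_beta')
  fix t :: real assume t: "t \<in> {0..1}"
  have z: "(0::real) \<in> {0..1}" by simp
  show "AE x in leb01. p t x = p 0 x + prim (\<lambda>s. pdot (s, x)) t"
    using p_time p_V[OF t] p_V[OF z] AE_space
  proof eventually_elim
    fix x assume a: "\<forall>t\<in>{0..1}. V (t, x) / e (t, x) = V (0, x) / e (0, x) + prim (\<lambda>s. pdot (s, x)) t"
      "eta (q t) x * p t x = V (t, x)" "eta (q 0) x * p 0 x = V (0, x)" and "x \<in> space leb01"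
    then have x: "x \<in> {0..1}" by simp
    have "p t x = V (t, x) / e (t, x)" "p 0 x = V (0, x) / e (0, x)"
      using a(2,3) e_pos[of "(t, x)"] e_pos[of "(0, x)"] eta_q[OF t x] eta_q[OF z x]
      by (auto simp: field_simps)
    then show "p t x = p 0 x + prim (\<lambda>s. pdot (s, x)) t" using bspec[OF a(1) t] by simp
  qed
qed

lemma time_deriv_p: "AE z in leb_sq. time_deriv p (fst z) (snd z) = pdot z"
proof (rule H1_deriv_unique[OF _ p_H1_deriv pdot_borel])
  show "H1_deriv p (time_deriv p)"
    unfolding time_deriv_def using p_H1_deriv by (rule someI[of "H1_deriv p"])
qed

section \<open>An explicit Borel representative of the covariant acceleration\<close>

definition "U z = 1/2 * (prim (\<lambda>y. (V (fst z, y))\<^sup>2 / e (fst z, y)) 1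
  - prim (\<lambda>y. (V (fst z, y))\<^sup>2 / e (fst z, y)) (snd z))"
definition "U_mean t = (LINT x|leb01. U (t, x) * e (t, x))"
definition "U_moment t = (LINT x|leb01. U (t, x) * Ph (t, x) * e (t, x))"
definition "S_energy t = (LINT x|leb01. (S (t, x))\<^sup>2 * e (t, x))"
text \<open>The projection of \<open>U\<close> and the term with \<open>b\<close> are written out
  with the inverse of \<open>H2\<close>. As \<open>b\<close> is 3/2 times \<open>S_energy\<close>,
  its coefficients -6 and 12 become 9 and -18 after subtraction.\<close>

definition "acc z = pdot z + (U z - (4 * U_mean (fst z) - 6 * U_moment (fst z))
  - (12 * U_moment (fst z) - 6 * U_mean (fst z)) * Ph z
  + 9 * S_energy (fst z) - 18 * S_energy (fst z) * Ph z)"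

lemma U_borel [measurable]: "U \<in> borel_measurable borel"
proof -
  have "(\<lambda>z. (V z)\<^sup>2 / e z) \<in> borel_measurable borel" by measurable
  note k = borel_measurable_prim_snd[OF this]
  have "(\<lambda>z::real \<times> real. (fst z, 1::real)) \<in> borel_measurable borel"
    unfolding borel_prod[symmetric] by measurable
  from measurable_compose[OF this k] k show ?thesis
    unfolding U_def by simp
qed

lemma compose_fst:
  fixes f :: "real \<Rightarrow> real"
  assumes "f \<in> borel_measurable borel"
  shows "(\<lambda>z::real \<times> real. f (fst z)) \<in> borel_measurable borel"
  unfolding borel_prod[symmetric] by (rule measurable_compose[OF measurable_fst assms])

lemma moments_borel:
  "U_mean \<in> borel_measurable borel" "U_moment \<in> borel_measurable borel" "S_energy \<in> borel_measurable borel"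
proof -
  have "(\<lambda>z. U z * e z) \<in> borel_measurable borel" by measurable
  from borel_measurable_integral_snd[OF this] show "U_mean \<in> borel_measurable borel"
    by (simp add: U_mean_def[abs_def])
  have "(\<lambda>z. U z * Ph z * e z) \<in> borel_measurable borel" by measurable
  from borel_measurable_integral_snd[OF this] show "U_moment \<in> borel_measurable borel"
    by (simp add: U_moment_def[abs_def])
  have "(\<lambda>z. (S z)\<^sup>2 * e z) \<in> borel_measurable borel" by measurable
  from borel_measurable_integral_snd[OF this] show "S_energy \<in> borel_measurable borel"
    by (simp add: S_energy_def[abs_def])
qed

lemma acc_borel [measurable]: "acc \<in> borel_measurable borel"
  unfolding acc_def using moments_borel[THEN compose_fst] by measurable

lemma kinetic_int:
  assumes t: "t \<in> {0..1}"
  shows "integrable leb01 (\<lambda>y. (V (t, y))\<^sup>2 / e (t, y))"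
  using integrable_mult_continuous_leb01[OF V_sq_int[OF t] continuous_on_unit_sq_slice(1)[OF inverse_e_cont t]]
  by simp

text \<open>The square of \<open>V\<close> need not be bounded, but \<open>H\<close> dominates it
  uniformly in time and \<open>1 / e\<close> is bounded, so its spatial primitives are
  bounded.\<close>

lemma U_bounded: obtains B where "\<And>z. z \<in> unit_sq \<Longrightarrow> \<bar>U z\<bar> \<le> B" "B \<ge> 0"
proof -
  obtain C where C: "\<And>z. z \<in> unit_sq \<Longrightarrow> \<bar>1 / e z\<bar> \<le> C" "C \<ge> 0"
    using bounded_on_unit_sq[OF inverse_e_cont] by blast
  show thesis
  proof (rule that)
    fix z assume "z \<in> unit_sq"
    then obtain t x where z: "z = (t, x)" and t: "t \<in> {0..1}" and x: "x \<in> {0..1}"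
      by (auto simp: unit_sq_def)
    define k where "k = (\<lambda>y. (V (t, y))\<^sup>2 / e (t, y))"
    have k: "integrable leb01 k" unfolding k_def by (rule kinetic_int[OF t])
    have "(LINT y|leb01. \<bar>k y\<bar>) \<le> (LINT y|leb01. \<bar>C * H y\<bar>)"
    proof (rule integral_mono_AE)
      show "AE y in leb01. \<bar>k y\<bar> \<le> \<bar>C * H y\<bar>"
        using V_sq_le AE_space
      proof eventually_elim
        fix y assume V: "\<forall>t\<in>{0..1}. (V (t, y))\<^sup>2 \<le> H y" and y: "y \<in> space leb01"
        have "\<bar>k y\<bar> = (V (t, y))\<^sup>2 * \<bar>1 / e (t, y)\<bar>" by (simp add: k_def abs_mult)
        also have "\<dots> \<le> H y * C"
          using V t C(1)[of "(t, y)"] y by (intro mult_mono) (auto simp: unit_sq_def intro: order_trans[OF zero_le_power2])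
        finally show "\<bar>k y\<bar> \<le> \<bar>C * H y\<bar>" by (simp add: mult.commute)
      qed
    qed (use k H_int in auto)
    moreover have "\<bar>prim k 1\<bar> \<le> (LINT y|leb01. \<bar>k y\<bar>)" "\<bar>prim k x\<bar> \<le> (LINT y|leb01. \<bar>k y\<bar>)"
      using prim_bound[OF k, of 1] prim_bound[OF k x] by auto
    moreover have "U z = 1/2 * (prim k 1 - prim k x)" by (simp add: U_def z k_def)
    moreover have "\<bar>1/2 * (a - b)\<bar> \<le> M" if "m \<le> M" "\<bar>a\<bar> \<le> m" "\<bar>b\<bar> \<le> m" for a b m M :: real
      using that unfolding abs_le_iff by (auto simp: field_simps)
    ultimately show "\<bar>U z\<bar> \<le> (LINT y|leb01. \<bar>C * H y\<bar>)" by metis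
  qed simp
qed

text \<open>All terms other than \<open>pdot\<close> are bounded on the square, since
  \<open>Ph\<close> takes values in the unit interval and the moments inherit the bounds of
  \<open>U\<close>, \<open>S\<close> and \<open>e\<close>.\<close>

lemma acc_sq: "integrable leb_sq (\<lambda>z. (acc z)\<^sup>2)"
proof -
  define R where "R = (\<lambda>z. U z - (4 * U_mean (fst z) - 6 * U_moment (fst z))
    - (12 * U_moment (fst z) - 6 * U_mean (fst z)) * Ph z
    + 9 * S_energy (fst z) - 18 * S_energy (fst z) * Ph z)"
  have acc: "acc = (\<lambda>z. pdot z + R z)" by (simp add: acc_def[abs_def] R_def)
  have Rm: "R \<in> borel_measurable borel"
    unfolding R_def using moments_borel[THEN compose_fst] by measurable
  obtain B where B: "\<And>z. z \<in> unit_sq \<Longrightarrow> \<bar>U z\<bar> \<le> B" "B \<ge> 0" using U_bounded by blast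
  obtain E where E: "\<And>z. z \<in> unit_sq \<Longrightarrow> \<bar>e z\<bar> \<le> E" "E \<ge> 0" using bounded_on_unit_sq[OF e_cont] by blast
  obtain D where D: "\<And>z. z \<in> unit_sq \<Longrightarrow> \<bar>S z\<bar> \<le> D" "D \<ge> 0" using bounded_on_unit_sq[OF S_cont] by blast
  have Ph: "\<bar>Ph (t, x)\<bar> \<le> 1" if t: "t \<in> {0..1}" and x: "x \<in> {0..1}" for t x
  proof -
    have "\<bar>prim (\<lambda>u. e (t, u)) x\<bar> \<le> (LINT u|leb01. \<bar>e (t, u)\<bar>)"
      by (rule prim_bound[OF integrable_continuous_leb01[OF e_slice_cont[OF t]] x])
    also have "\<dots> = 1" using Ph_1[OF t] e_pos by (simp add: Ph_def abs_of_pos)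
    finally show ?thesis by (simp add: Ph_def)
  qed
  have "\<bar>R z\<bar> \<le> B + (4 * (B * E) + 6 * (B * E)) + (12 * (B * E) + 6 * (B * E)) + 9 * (D\<^sup>2 * E) + 18 * (D\<^sup>2 * E)"
    if zu: "z \<in> unit_sq" for z
  proof -
    obtain t x where z: "z = (t, x)" and t: "t \<in> {0..1}" and x: "x \<in> {0..1}"
      using zu by (auto simp: unit_sq_def)
    have sq: "(t, y) \<in> unit_sq" if "y \<in> {0..1}" for y using t that by (simp add: unit_sq_def)
    have m: "\<bar>U_mean t\<bar> \<le> B * E"
      unfolding U_mean_def using B E sq
      by (intro abs_integral_leb01_le) (auto simp: abs_mult intro!: mult_mono)
    have m2: "\<bar>U_moment t\<bar> \<le> B * E"
      unfolding U_moment_def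
    proof (intro abs_integral_leb01_le)
      fix y :: real assume y: "y \<in> {0..1}"
      have "\<bar>U (t, y)\<bar> * \<bar>Ph (t, y)\<bar> * \<bar>e (t, y)\<bar> \<le> B * 1 * E"
        using B E sq[OF y] Ph[OF t y] by (intro mult_mono) auto
      then show "\<bar>U (t, y) * Ph (t, y) * e (t, y)\<bar> \<le> B * E" by (simp add: abs_mult)
    qed
    have s: "\<bar>S_energy t\<bar> \<le> D\<^sup>2 * E"
      unfolding S_energy_def
    proof (intro abs_integral_leb01_le)
      fix y :: real assume y: "y \<in> {0..1}"
      have "\<bar>S (t, y)\<bar>\<^sup>2 * \<bar>e (t, y)\<bar> \<le> D\<^sup>2 * E"
        using D E sq[OF y] by (intro mult_mono power_mono) auto
      then show "\<bar>(S (t, y))\<^sup>2 * e (t, y)\<bar> \<le> D\<^sup>2 * E" by (simp add: abs_mult)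
    qed
    have h: "\<bar>c * Ph (t, x)\<bar> \<le> \<bar>c\<bar>" for c
      using mult_left_mono[OF Ph[OF t x], of "\<bar>c\<bar>"] by (simp add: abs_mult)
    have "\<bar>U z\<bar> \<le> B" using B zu by simp
    moreover have "\<bar>(12 * U_moment t - 6 * U_mean t) * Ph (t, x)\<bar> \<le> 12 * (B * E) + 6 * (B * E)"
      using h[of "12 * U_moment t - 6 * U_mean t"] m m2 by linarith
    moreover have "\<bar>18 * S_energy t * Ph (t, x)\<bar> \<le> 18 * (D\<^sup>2 * E)"
      using h[of "18 * S_energy t"] s by linarith
    ultimately show ?thesis
      using m m2 s unfolding R_def z fst_conv by linarith
  qed
  then have Rb: "(R z)\<^sup>2 \<le> (B + (4 * (B * E) + 6 * (B * E)) + (12 * (B * E) + 6 * (B * E)) + 9 * (D\<^sup>2 * E) + 18 * (D\<^sup>2 * E))\<^sup>2"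
    if "z \<in> unit_sq" for z using that abs_le_square_iff[of "R z"] by (smt (verit))
  have "integrable leb_sq (\<lambda>z. (R z)\<^sup>2)"
  proof (rule leb_sq.integrable_const_bound)
    show "AE z in leb_sq. norm ((R z)\<^sup>2) \<le> (B + (4 * (B * E) + 6 * (B * E)) + (12 * (B * E) + 6 * (B * E)) + 9 * (D\<^sup>2 * E) + 18 * (D\<^sup>2 * E))\<^sup>2"
      using Rb by (intro AE_I2) (auto simp: space_leb_sq unit_sq_def)
    show "(\<lambda>z. (R z)\<^sup>2) \<in> borel_measurable leb_sq"
      using borel_measurable_leb_sq[OF Rm] by simp
  qed
  then show ?thesis
    unfolding acc using borel_measurable_leb_sq[OF Rm] borel_measurable_leb_sq[OF pdot_borel] pdot_sq
    by (intro square_integrable_add)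
qed

lemma U_fun_eq:
  assumes t: "t \<in> {0..1}" and x: "x \<in> {0..1}"
  shows "U_fun (\<lambda>y. (p t y)\<^sup>2) (q t) x = U (t, x)"
proof -
  define k where "k = (\<lambda>y. (V (t, y))\<^sup>2 / e (t, y))"
  have k: "integrable leb01 k" unfolding k_def by (rule kinetic_int[OF t])
  have ae: "AE y in leb01. k y = eta (q t) y * (p t y)\<^sup>2"
    using p_V[OF t] AE_space
  proof eventually_elim
    fix y assume a: "eta (q t) y * p t y = V (t, y)" and "y \<in> space leb01"
    then have y: "y \<in> {0..1}" by simp
    show "k y = eta (q t) y * (p t y)\<^sup>2"
      unfolding k_def a[symmetric] eta_q[OF t y] using e_pos[of "(t, y)"]
      by (simp add: power2_eq_square)
  qed
  have k': "integrable leb01 (\<lambda>y. eta (q t) y * (p t y)\<^sup>2)"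
    using k borel_measurable_AE_leb01[OF borel_measurable_integrable[OF k] ae] ae
    by (rule integrable_cong_AE_imp)
  have eq: "prim (\<lambda>y. eta (q t) y * (p t y)\<^sup>2) x = prim k x" if "x \<in> {0..1}" for x
    by (rule prim_AE[OF borel_measurable_integrable[OF k] ae that, symmetric])
  show ?thesis
    unfolding U_fun_def U_def integral_lebesgue_on_upper[OF k' x] fst_conv snd_conv
    using eq[OF x] eq[of 1] by (simp add: k_def)
qed

lemma U_slice_int:
  assumes t: "t \<in> {0..1}" shows "integrable leb01 (\<lambda>x. U (t, x))"
  unfolding U_def fst_conv snd_conv
  by (intro integrable_continuous_leb01 continuous_intros continuous_on_prim kinetic_int[OF t])

lemma b_coeff_q:
  assumes t: "t \<in> {0..1}"
  shows "b_coeff (p t) (q t) = 3/2 * S_energy t"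
proof -
  have ae: "AE x in leb01. V (t, x) = eta (q t) x * p t x"
    using p_V[OF t] by eventually_elim simp
  have "integrable leb01 (\<lambda>x. eta (q t) x * p t x)"
    using V_int[OF t] borel_measurable_AE_leb01[OF V_leb01 ae] ae by (rule integrable_cong_AE_imp)
  from Q_point.b_coeff_eq[OF Q_point[OF t] this]
  have "b_coeff (p t) (q t) = 3/2 * (LINT x|leb01. (prim (\<lambda>x. eta (q t) x * p t x) x)\<^sup>2 * eta (q t) x)" .
  also have "(LINT x|leb01. (prim (\<lambda>x. eta (q t) x * p t x) x)\<^sup>2 * eta (q t) x) = S_energy t"
    unfolding S_energy_def
    by (intro Bochner_Integration.integral_cong refl)
      (simp add: S_def eta_q[OF t] prim_AE[OF V_leb01 ae, symmetric])
  finally show ?thesis .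
qed

lemma proj_cot_U:
  assumes t: "t \<in> {0..1}" and x: "x \<in> {0..1}"
  shows "proj_cot (q t) (\<lambda>x. U (t, x)) x
    = U (t, x) - (4 * U_mean t - 6 * U_moment t) - (12 * U_moment t - 6 * U_mean t) * Ph (t, x)"
proof -
  have "inner_eta (q t) (\<lambda>x. U (t, x)) (\<lambda>x. 1) = U_mean t"
    unfolding inner_eta_def U_mean_def
    by (intro Bochner_Integration.integral_cong refl) (simp add: eta_q[OF t])
  moreover have "inner_eta (q t) (\<lambda>x. U (t, x)) (phi (q t)) = U_moment t"
    unfolding inner_eta_def U_moment_def
    by (intro Bochner_Integration.integral_cong refl) (simp add: eta_q[OF t] phi_q[OF t])
  ultimately show ?thesis
    unfolding proj_cot_def H2_comb_eq phi_q[OF t x] by simp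
qed

lemma acc_eq:
  assumes t: "t \<in> {0..1}" and x: "x \<in> {0..1}"
  shows "acc (t, x) = pdot (t, x) + proj_cot (q t) (\<lambda>x. U (t, x)) x - H2_comb (q t) 0 (3/2 * S_energy t) x"
  unfolding proj_cot_U[OF assms] H2_comb_eq phi_q[OF assms] acc_def by simp

text \<open>In the definition the terms \<open>u x - (u x - proj_cot (q t) u x)\<close> collapse to
  the projection. The exceptional set is that of \<open>time_deriv\<close> alone.\<close>

lemma cov_acc_flat_AE: "AE z in leb_sq. cov_acc_flat p q (fst z) (snd z) = acc z"
  using time_deriv_p AE_space
proof eventually_elim
  fix z assume td: "time_deriv p (fst z) (snd z) = pdot z" and "z \<in> space leb_sq"
  then obtain t x where z: "z = (t, x)" and t: "t \<in> {0..1}" and x: "x \<in> {0..1}"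
    by (auto simp: space_leb_sq)
  define u where "u = U_fun (\<lambda>y. (p t y)\<^sup>2) (q t)"
  have u: "u x = U (t, x)" if "x \<in> {0..1}" for x unfolding u_def by (rule U_fun_eq[OF t that])
  have i: "inner_eta (q t) u f = inner_eta (q t) (\<lambda>x. U (t, x)) f" for f
    unfolding inner_eta_def by (intro Bochner_Integration.integral_cong refl) (simp add: u)
  have "proj_cot (q t) u x = proj_cot (q t) (\<lambda>x. U (t, x)) x"
    unfolding proj_cot_def i u[OF x] ..
  then have "cov_acc_flat p q t x = time_deriv p t x + proj_cot (q t) (\<lambda>x. U (t, x)) x - H2_comb (q t) 0 (3/2 * S_energy t) x"
    unfolding cov_acc_flat_def Let_def u_def[symmetric] b_coeff_q[OF t] by simp
  then show "cov_acc_flat p q (fst z) (snd z) = acc z"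
    using td unfolding z fst_conv snd_conv acc_eq[OF t x] by simp
qed

text \<open>The projected part is orthogonal to 1 and \<phi> by construction. Of the rest,
  \<open>pdot\<close> has moments 0 and \<open>b\<close>, exactly those of the subtracted
  combination.\<close>

lemma acc_orthogonal:
  "AE t in leb01. inner_eta (q t) (\<lambda>x. acc (t, x)) (\<lambda>x. 1) = 0
    \<and> inner_eta (q t) (\<lambda>x. acc (t, x)) (phi (q t)) = 0"
proof -
  have "integrable leb_sq pdot"
    using leb_sq.integrable_if_square_integrable[OF borel_measurable_leb_sq[OF pdot_borel] pdot_sq] .
  from leb_sq.AE_integrable_fst'[OF this] pdot_orthogonal AE_space show ?thesis
  proof eventually_elim
    fix t assume pi: "integrable leb01 (\<lambda>x. pdot (t, x))"
      and po: "(LINT x|leb01. pdot (t, x) * e (t, x)) = 0 \<and>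
        (LINT x|leb01. pdot (t, x) * Ph (t, x) * e (t, x)) = 3/2 * (LINT x|leb01. (S (t, x))\<^sup>2 * e (t, x))"
      and "t \<in> space leb01"
    then have t: "t \<in> {0..1}" by simp
    interpret Q_point "q t" by (rule Q_point[OF t])
    define P where "P = proj_cot (q t) (\<lambda>x. U (t, x))"
    define h where "h = H2_comb (q t) 0 (3/2 * S_energy t)"
    have Pi: "integrable leb01 P"
      unfolding P_def proj_cot_eq
      by (intro Bochner_Integration.integrable_diff U_slice_int[OF t] integrable_continuous_leb01 H2_comb_cont)
    have hi: "integrable leb01 h"
      unfolding h_def by (intro integrable_continuous_leb01 H2_comb_cont)
    have main: "inner_eta (q t) (\<lambda>x. acc (t, x)) f
        = inner_eta (q t) (\<lambda>x. pdot (t, x)) f + inner_eta (q t) P f - inner_eta (q t) h f"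
      if f: "continuous_on {0..1} f" for f
    proof -
      have "inner_eta (q t) (\<lambda>x. acc (t, x)) f = (LINT x|leb01. pdot (t, x) * f x * eta (q t) x
          + P x * f x * eta (q t) x - h x * f x * eta (q t) x)"
        unfolding inner_eta_def
        by (intro Bochner_Integration.integral_cong refl)
          (simp add: acc_eq[OF t] P_def h_def algebra_simps)
      then show ?thesis
        unfolding inner_eta_def using integrable_times_continuous_eta[OF pi f]
          integrable_times_continuous_eta[OF Pi f] integrable_times_continuous_eta[OF hi f]
        by simp
    qed
    have "inner_eta (q t) (\<lambda>x. pdot (t, x)) (\<lambda>x. 1) = (LINT x|leb01. pdot (t, x) * e (t, x))"
      unfolding inner_eta_def by (intro Bochner_Integration.integral_cong refl) (simp add: eta_q[OF t])
    moreover have "inner_eta (q t) (\<lambda>x. pdot (t, x)) (phi (q t)) = (LINT x|leb01. pdot (t, x) * Ph (t, x) * e (t, x))"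
      unfolding inner_eta_def
      by (intro Bochner_Integration.integral_cong refl) (simp add: eta_q[OF t] phi_q[OF t])
    ultimately show "inner_eta (q t) (\<lambda>x. acc (t, x)) (\<lambda>x. 1) = 0
      \<and> inner_eta (q t) (\<lambda>x. acc (t, x)) (phi (q t)) = 0"
      using po proj_cot_1[OF U_slice_int[OF t]] proj_cot_phi[OF U_slice_int[OF t]]
      unfolding main[OF continuous_on_const] main[OF phi_cont] h_def P_def inner_H2_comb_1 inner_H2_comb_phi
      by (simp add: S_energy_def)
  qed
qed

end

section \<open>From a path in the class \<open>C0\<close> to Borel data\<close>

lemma integrable_L2: "f \<in> L2 \<Longrightarrow> integrable leb01 f"
  unfolding L2_def using leb01.integrable_if_square_integrable by blast

lemma L2_borel_version:
  assumes "f \<in> L2"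
  obtains h where "h \<in> borel_measurable borel" "AE x in leb01. f x = h x" "integrable leb01 (\<lambda>x. (h x)\<^sup>2)"
proof -
  have f: "f \<in> borel_measurable leb01" "integrable leb01 (\<lambda>x. (f x)\<^sup>2)"
    using assms unfolding L2_def by blast+
  obtain h where h: "h \<in> borel_measurable borel" "AE x in leb01. f x = h x"
    by (rule borel_version_leb01[OF f(1)])
  have "AE x in leb01. (f x)\<^sup>2 = (h x)\<^sup>2"
    using h(2) by eventually_elim simp
  then have "integrable leb01 (\<lambda>x. (h x)\<^sup>2)"
    by (rule integrable_cong_AE_imp[OF f(2), rotated]) (use borel_measurable_leb01[OF h(1)] in simp)
  with h that show thesis by blast
qed

lemma AE_eq_prim_of_AE_sq:
  fixes h :: "real \<times> real \<Rightarrow> real"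
  assumes h: "h \<in> borel_measurable borel" and ae: "AE z in leb_sq. g (fst z) (snd z) = h z"
  shows "AE x in leb01. \<forall>t\<in>{0..1}. prim (\<lambda>s. g s x) t = prim (\<lambda>s. h (s, x)) t"
proof -
  have "AE x in leb01. AE s in leb01. g s x = h (s, x)"
    by (rule AE_leb_sq_swap) (use ae in simp)
  then show ?thesis
  proof eventually_elim
    fix x assume ae: "AE s in leb01. g s x = h (s, x)"
    then have ae': "AE s in leb01. h (s, x) = g s x" by eventually_elim simp
    show "\<forall>t\<in>{0..1}. prim (\<lambda>s. g s x) t = prim (\<lambda>s. h (s, x)) t"
      using prim_AE[OF borel_measurable_leb01[OF borel_measurable_Pair_real(2)[OF h]] ae'] by simp
  qed
qed

text \<open>Only three objects are replaced by Borel versions: \<open>q\<close> and its first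
  derivative at time 0, and the second derivative on the square. Everything else is rebuilt from
  them by integration and then compared with the given path.\<close>

theorem cotangent_path_C0:
  assumes "(p, q) \<in> C0 p0 q0"
  obtains v0 a0 W where "cotangent_path v0 a0 W p q"
proof -
  have bun: "\<And>t. t \<in> {0..1} \<Longrightarrow> (p t, q t) \<in> cotangent_bundle"
    using assms unfolding C0_def by blast
  obtain q' q'' where q': "H1_deriv q q'" and q'': "H1_deriv q' q''"
    and q'p: "\<And>t. t \<in> {0..1} \<Longrightarrow> AE x in leb01. q' t x = eta (q t) x * p t x"
    using assms unfolding C0_def by blast
  have zero: "(0::real) \<in> {0..1}" by simp
  have L2': "q' 0 \<in> L2" and L2q: "\<And>t. t \<in> {0..1} \<Longrightarrow> q t \<in> L2"
    using q' q'' zero unfolding H1_deriv_def by blast+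
  obtain v0 where v0': "v0 \<in> borel_measurable borel" "AE x in leb01. q' 0 x = v0 x" "integrable leb01 (\<lambda>x. (v0 x)\<^sup>2)"
    by (rule L2_borel_version[OF L2'])
  obtain qh where qh: "qh \<in> borel_measurable borel" "AE x in leb01. q 0 x = qh x" "integrable leb01 (\<lambda>x. (qh x)\<^sup>2)"
    by (rule L2_borel_version[OF L2q[OF zero]])
  have qh_int: "integrable leb01 qh"
    using leb01.integrable_if_square_integrable[OF borel_measurable_leb01[OF qh(1)] qh(3)] .
  have q''m: "(\<lambda>(t, x). q'' t x) \<in> borel_measurable (lebesgue_on unit_sq)"
    and q''i: "integrable (lebesgue_on unit_sq) (\<lambda>(t, x). (q'' t x)\<^sup>2)"
    using q'' unfolding H1_deriv_def by blast+
  obtain W where W': "W \<in> borel_measurable borel" "AE z in leb_sq. (\<lambda>(t, x). q'' t x) z = W z"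
    "AE z in lebesgue_on unit_sq. (\<lambda>(t, x). q'' t x) z = W z"
    by (rule borel_version_unit_sq[OF q''m])
  have W2: "integrable leb_sq (\<lambda>z. (W z)\<^sup>2)"
  proof -
    have "integrable (lebesgue_on unit_sq) (\<lambda>z. (W z)\<^sup>2)"
      using q''i
    proof (rule integrable_cong_AE_imp)
      show "AE z in lebesgue_on unit_sq. (case z of (t, x) \<Rightarrow> (q'' t x)\<^sup>2) = (W z)\<^sup>2"
        using W'(3) by eventually_elim (auto simp: split_beta')
      show "(\<lambda>z. (W z)\<^sup>2) \<in> borel_measurable (lebesgue_on unit_sq)"
        using borel_measurable_lebesgue_on_borel[OF W'(1)] by simp
    qed
    then show ?thesis by (subst integrable_leb_sq_iff) (use W'(1) in auto)
  qed
  have a0': "prim qh \<in> borel_measurable borel"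
  proof -
    have "(\<lambda>z::real \<times> real. qh (snd z)) \<in> borel_measurable borel"
      unfolding borel_prod[symmetric] by (rule measurable_compose[OF measurable_snd qh(1)])
    from borel_measurable_Pair_real(1)[OF borel_measurable_prim_snd[OF this], of 0]
    show ?thesis by simp
  qed
  interpret sobolev_path v0 "prim qh" W
    by standard (fact v0'(1) v0'(3) W'(1) W2 a0' continuous_on_prim[OF qh_int])+
  have q'V: "AE x in leb01. q' t x = V (t, x)" if t: "t \<in> {0..1}" for t
  proof -
    have "AE z in leb_sq. q'' (fst z) (snd z) = W z"
      using W'(2) by (simp add: split_beta')
    from AE_eq_prim_of_AE_sq[OF W'(1) this]
    have "AE x in leb01. prim (\<lambda>s. q'' s x) t = prim (\<lambda>s. W (s, x)) t"
      by eventually_elim (use t in blast)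
    moreover have "AE x in leb01. q' t x = q' 0 x + prim (\<lambda>s. q'' s x) t"
      using q'' t unfolding H1_deriv_def by blast
    ultimately show ?thesis using v0'(2)
      by eventually_elim (simp add: V_def)
  qed
  \<comment> \<open>For each \<open>t\<close> the two agree at almost every \<open>x\<close>, which
    implies nothing on the square unless the set of agreement is measurable. A Borel version of
    \<open>q'\<close> supplies that measurability.\<close>
  have q'V_sq: "AE z in leb_sq. q' (fst z) (snd z) = V z"
  proof -
    have "(\<lambda>(t, x). q' t x) \<in> borel_measurable (lebesgue_on unit_sq)"
      using q' unfolding H1_deriv_def by blast
    from borel_version_unit_sq[OF this]
    obtain h where h: "h \<in> borel_measurable borel" "AE z in leb_sq. (\<lambda>(t, x). q' t x) z = h z"
      by metis
    have h': "AE z in leb_sq. q' (fst z) (snd z) = h z"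
      using h(2) by (simp add: split_beta')
    from leb_sq.AE_pair[OF this] have "AE t in leb01. AE x in leb01. q' t x = h (t, x)" by simp
    then have "AE t in leb01. AE x in leb01. h (t, x) = V (t, x)"
      using AE_space
    proof eventually_elim
      fix t assume a: "AE x in leb01. q' t x = h (t, x)" and "t \<in> space leb01"
      then have t: "t \<in> {0..1}" by simp
      show "AE x in leb01. h (t, x) = V (t, x)"
        using a q'V[OF t] by eventually_elim simp
    qed
    from AE_leb_sqI[OF h(1) V_borel this] h' show ?thesis by eventually_elim simp
  qed
  \<comment> \<open>An identity at every point, although \<open>q t\<close> is known only almost
    everywhere: a primitive sees nothing but the equivalence class.\<close>
  have eta': "eta (q t) x = e (t, x)" if t: "t \<in> {0..1}" and x: "x \<in> {0..1}" for t x
  proof -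
    define w where "w = (\<lambda>u. prim (\<lambda>s. V (s, u)) t)"
    have w_borel: "w \<in> borel_measurable borel"
      using borel_measurable_Pair_real(1)[OF borel_measurable_prim_fst[OF V_borel], of t]
      by (simp add: w_def)
    have "AE u in leb01. prim (\<lambda>s. q' s u) t = w u"
      using AE_eq_prim_of_AE_sq[OF V_borel q'V_sq] by eventually_elim (use t in \<open>simp add: w_def\<close>)
    moreover have "AE u in leb01. q t u = q 0 u + prim (\<lambda>s. q' s u) t"
      using q' t unfolding H1_deriv_def by blast
    ultimately have ae: "AE u in leb01. q t u = qh u + w u"
      using qh(2) by eventually_elim simp
    have "AE u in leb01. q t u - qh u = w u"
      using ae by eventually_elim simp
    from integrable_cong_AE_imp[OF _ borel_measurable_leb01[OF w_borel] this]
    have w_int: "integrable leb01 w"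
      using integrable_L2[OF L2q[OF t]] qh_int by simp
    have "AE u in leb01. qh u + w u = q t u"
      using ae by eventually_elim simp
    then have "prim (q t) x = prim (\<lambda>u. qh u + w u) x"
      using prim_AE[of "\<lambda>u. qh u + w u" "q t" x] borel_measurable_leb01[OF w_borel] borel_measurable_leb01[OF qh(1)] x
      by simp
    also have "\<dots> = prim qh x + prim w x" by (rule prim_add[OF qh_int w_int x])
    also have "prim w x = prim (\<lambda>s. S (s, x)) t"
      unfolding w_def prim_S[OF t x] ..
    finally show ?thesis by (simp add: eta_def e_def)
  qed
  have pV: "AE x in leb01. eta (q t) x * p t x = V (t, x)" if t: "t \<in> {0..1}" for t
    using q'p[OF t] q'V[OF t] by eventually_elim simp
  have "cotangent_path v0 (prim qh) W p q"
    by standard (fact eta' bun pV)+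
  then show thesis by (rule that)
qed

text \<open>The interface to the variational part, which knows the path only through these
  properties.\<close>

theorem covariant_acceleration:
  assumes "(p, q) \<in> C0 p0 q0"
  obtains A where "A \<in> borel_measurable borel" "integrable leb_sq (\<lambda>z. (A z)\<^sup>2)"
    "AE z in leb_sq. cov_acc_flat p q (fst z) (snd z) = A z"
    "AE t in leb01. inner_eta (q t) (\<lambda>x. A (t, x)) (\<lambda>x. 1) = 0
      \<and> inner_eta (q t) (\<lambda>x. A (t, x)) (phi (q t)) = 0"
    "continuous_on unit_sq (\<lambda>z. eta (q (fst z)) (snd z))"
    "\<And>t. t \<in> {0..1} \<Longrightarrow> q t \<in> Q"
proof -
  obtain v0 a0 W where "cotangent_path v0 a0 W p q"
    by (rule cotangent_path_C0[OF assms])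
  then interpret cotangent_path v0 a0 W p q .
  have "continuous_on unit_sq (\<lambda>z. eta (q (fst z)) (snd z))"
    using e_cont by (rule continuous_on_eq) (auto simp: unit_sq_def eta_q)
  moreover have "q t \<in> Q" if "t \<in> {0..1}" for t
    using Q_point[OF that] by (simp add: Q_point_def)
  ultimately show thesis
    using that[OF acc_borel acc_sq cov_acc_flat_AE acc_orthogonal] by blast
qed

section \<open>Linear combinations of measures\<close>

text \<open>Positive measures allow only nonnegative coefficients, and \<open>ennreal\<close> sends
  negative ones to 0. The \<sigma>-algebra is that of \<open>M\<close>, so the lemmas ask that
  \<open>N\<close> share it.\<close>

definition lincomb :: "real \<Rightarrow> 'a measure \<Rightarrow> real \<Rightarrow> 'a measure \<Rightarrow> 'a measure" where
  "lincomb a M b N = measure_of (space M) (sets M) (\<lambda>A. ennreal a * emeasure M A + ennreal b * emeasure N A)"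

lemma sets_lincomb [simp]: "sets (lincomb a M b N) = sets M"
  by (simp add: lincomb_def)

lemma space_lincomb [simp]: "space (lincomb a M b N) = space M"
  by (simp add: lincomb_def)

lemma measurable_lincomb1 [simp]: "measurable (lincomb a M b N) L = measurable M L"
  by (intro measurable_cong_sets) simp_all

lemma emeasure_lincomb:
  assumes "sets N = sets M" "A \<in> sets M"
  shows "emeasure (lincomb a M b N) A = ennreal a * emeasure M A + ennreal b * emeasure N A"
proof (rule emeasure_measure_of[OF lincomb_def])
  show "countably_additive (sets (lincomb a M b N)) (\<lambda>A. ennreal a * emeasure M A + ennreal b * emeasure N A)"
  proof (rule countably_additiveI)
    fix F :: "nat \<Rightarrow> _" assume F: "range F \<subseteq> sets (lincomb a M b N)" "disjoint_family F"
    have "(\<Sum>i. ennreal a * emeasure M (F i) + ennreal b * emeasure N (F i))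
        = (\<Sum>i. ennreal a * emeasure M (F i)) + (\<Sum>i. ennreal b * emeasure N (F i))"
      by (rule suminf_add[symmetric]) auto
    also have "\<dots> = ennreal a * emeasure M (\<Union> (range F)) + ennreal b * emeasure N (\<Union> (range F))"
      using F assms(1) by (simp add: suminf_emeasure)
    finally show "(\<Sum>i. ennreal a * emeasure M (F i) + ennreal b * emeasure N (F i))
      = ennreal a * emeasure M (\<Union> (range F)) + ennreal b * emeasure N (\<Union> (range F))" .
  qed
qed (use assms in \<open>auto simp: positive_def sets.space_closed dest: sets.sets_into_space\<close>)

lemma finite_measure_lincomb:
  assumes "sets N = sets M" "finite_measure M" "finite_measure N"
  shows "finite_measure (lincomb a M b N)"
proof
  have "space N = space M" using assms(1) by (rule sets_eq_imp_space_eq)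
  then show "emeasure (lincomb a M b N) (space (lincomb a M b N)) \<noteq> \<infinity>"
    using finite_measure.emeasure_finite[OF assms(2)] finite_measure.emeasure_finite[OF assms(3)]
    by (subst emeasure_lincomb[OF assms(1)]) (auto simp: ennreal_mult_eq_top_iff)
qed

lemma nn_integral_lincomb:
  assumes "sets N = sets M" "f \<in> borel_measurable M"
  shows "(\<integral>\<^sup>+x. f x \<partial>lincomb a M b N) = ennreal a * (\<integral>\<^sup>+x. f x \<partial>M) + ennreal b * (\<integral>\<^sup>+x. f x \<partial>N)"
  using assms(2)
proof induct
  case (cong f g)
  have "space N = space M" using assms(1) by (rule sets_eq_imp_space_eq)
  then show ?case
    using cong(3,4) nn_integral_cong[of "lincomb a M b N" f g] nn_integral_cong[of M f g] nn_integral_cong[of N f g]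
    by simp
next
  case (set A)
  then show ?case using assms(1) by (simp add: emeasure_lincomb[OF assms(1)])
next
  case (mult u c)
  have "u \<in> borel_measurable N" using mult(2) measurable_cong_sets[OF assms(1) refl] by blast
  then show ?case using mult by (simp add: nn_integral_cmult distrib_left mult_ac)
next
  case (add u v)
  have "u \<in> borel_measurable N" "v \<in> borel_measurable N"
    using add(1,4) measurable_cong_sets[OF assms(1) refl] by blast+
  then show ?case using add by (simp add: nn_integral_add distrib_left add_ac)
next
  case (seq U)
  have UN: "\<And>i. U i \<in> borel_measurable N"
    using seq(1) measurable_cong_sets[OF assms(1) refl] by blast
  have Sx: "Sup (range U) = (\<lambda>x. SUP i. U i x)"
    by (auto simp: fun_eq_iff image_comp)
  have "(\<integral>\<^sup>+x. Sup (range U) x \<partial>lincomb a M b N) = (SUP i. \<integral>\<^sup>+x. U i x \<partial>lincomb a M b N)"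
    unfolding Sx using seq by (intro nn_integral_monotone_convergence_SUP) auto
  also have "\<dots> = (SUP i. ennreal a * (\<integral>\<^sup>+x. U i x \<partial>M) + ennreal b * (\<integral>\<^sup>+x. U i x \<partial>N))"
    using seq by simp
  also have "\<dots> = (SUP i. ennreal a * (\<integral>\<^sup>+x. U i x \<partial>M)) + (SUP i. ennreal b * (\<integral>\<^sup>+x. U i x \<partial>N))"
    by (intro ennreal_SUP_add incseq_def[THEN iffD2] allI impI mult_left_mono nn_integral_mono)
      (use seq(4) in \<open>auto simp: incseq_def le_fun_def\<close>)
  also have "\<dots> = ennreal a * (\<integral>\<^sup>+x. Sup (range U) x \<partial>M) + ennreal b * (\<integral>\<^sup>+x. Sup (range U) x \<partial>N)"
    unfolding Sx using seq UN
    by (simp add: SUP_mult_left_ennreal[symmetric] nn_integral_monotone_convergence_SUP)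
  finally show ?case .
qed

lemma integral_lincomb:
  fixes f :: "'a \<Rightarrow> real"
  assumes s: "sets N = sets M" and ab: "0 \<le> a" "0 \<le> b"
    and M: "integrable M f" and N: "integrable N f"
  shows "(\<integral>x. f x \<partial>lincomb a M b N) = a * (\<integral>x. f x \<partial>M) + b * (\<integral>x. f x \<partial>N)"
proof -
  have *: "(\<integral>\<^sup>+x. ennreal (g x) \<partial>M) < \<infinity>" "(\<integral>\<^sup>+x. ennreal (g x) \<partial>N) < \<infinity>"
    if "g = f \<or> g = (\<lambda>x. - f x)" for g
  proof -
    have "(\<integral>\<^sup>+x. ennreal (g x) \<partial>L) \<le> (\<integral>\<^sup>+x. ennreal (norm (f x)) \<partial>L)" for L
      using that by (intro nn_integral_mono ennreal_leI) auto
    then show "(\<integral>\<^sup>+x. ennreal (g x) \<partial>M) < \<infinity>" "(\<integral>\<^sup>+x. ennreal (g x) \<partial>N) < \<infinity>"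
      using M N unfolding integrable_iff_bounded by (meson le_less_trans)+
  qed
  have i: "integrable (lincomb a M b N) f"
  proof (rule integrableI_bounded)
    have "(\<integral>\<^sup>+x. ennreal (norm (f x)) \<partial>M) < \<infinity>" "(\<integral>\<^sup>+x. ennreal (norm (f x)) \<partial>N) < \<infinity>"
      using M N unfolding integrable_iff_bounded by blast+
    moreover have "(\<lambda>x. ennreal (norm (f x))) \<in> borel_measurable M" using M by auto
    ultimately show "(\<integral>\<^sup>+x. ennreal (norm (f x)) \<partial>lincomb a M b N) < \<infinity>"
      by (simp add: nn_integral_lincomb[OF s] ennreal_mult_less_top)
  qed (use M in simp)
  have n: "enn2real (\<integral>\<^sup>+x. ennreal (g x) \<partial>lincomb a M b N)
      = a * enn2real (\<integral>\<^sup>+x. ennreal (g x) \<partial>M) + b * enn2real (\<integral>\<^sup>+x. ennreal (g x) \<partial>N)"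
    if "g = f \<or> g = (\<lambda>x. - f x)" for g
  proof -
    have "(\<lambda>x. ennreal (g x)) \<in> borel_measurable M" using that M by auto
    from nn_integral_lincomb[OF s this, of a b] *[OF that] ab show ?thesis
      by (simp add: enn2real_plus enn2real_mult ennreal_mult_less_top)
  qed
  show "(\<integral>x. f x \<partial>lincomb a M b N) = a * (\<integral>x. f x \<partial>M) + b * (\<integral>x. f x \<partial>N)"
    using n[of f] n[of "\<lambda>x. - f x"]
    by (simp add: real_lebesgue_integral_def[OF i] real_lebesgue_integral_def[OF M]
        real_lebesgue_integral_def[OF N] algebra_simps)
qed

section \<open>Finite measures on the square and continuous test functions\<close>

lemma space_borel_sq [simp]: "space borel_sq = unit_sq"
  by (simp add: borel_sq_def space_restrict_space)

lemma space_finite_pos: "finite_pos_measure M \<Longrightarrow> space M = unit_sq"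
  using sets_eq_imp_space_eq[of M borel_sq] by (simp add: finite_pos_measure_def)

text \<open>Closed sets form a generator stable under intersection whose indicators are decreasing
  limits of continuous functions, as the uniqueness argument for measures requires.\<close>

lemma sets_borel_sq_closed: "sets borel_sq = sigma_sets unit_sq {C. closed C \<and> C \<subseteq> unit_sq}"
proof
  have sub: "{C. closed C \<and> C \<subseteq> unit_sq} \<subseteq> Pow unit_sq" by auto
  have cl: "closed unit_sq" unfolding unit_sq_def by (intro closed_Times) auto
  have "(\<lambda>x. x) \<in> sigma unit_sq {C. closed C \<and> C \<subseteq> unit_sq} \<rightarrow>\<^sub>M borel"
  proof (rule borel_measurableI)
    fix S :: "(real \<times> real) set" assume S: "open S"
    have "closed (unit_sq - S)" using cl S by (rule closed_Diff)
    then have "unit_sq - S \<in> sigma_sets unit_sq {C. closed C \<and> C \<subseteq> unit_sq}"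
      by (intro sigma_sets.Basic) auto
    then have "unit_sq - (unit_sq - S) \<in> sigma_sets unit_sq {C. closed C \<and> C \<subseteq> unit_sq}"
      by (rule sigma_sets.Compl)
    moreover have "unit_sq - (unit_sq - S) = (\<lambda>x. x) -` S \<inter> unit_sq" by auto
    ultimately show "(\<lambda>x. x) -` S \<inter> space (sigma unit_sq {C. closed C \<and> C \<subseteq> unit_sq})
      \<in> sets (sigma unit_sq {C. closed C \<and> C \<subseteq> unit_sq})"
      using sub by (simp add: space_measure_of_conv sets_measure_of_conv)
  qed
  note m = measurable_sets[OF this]
  show "sets borel_sq \<subseteq> sigma_sets unit_sq {C. closed C \<and> C \<subseteq> unit_sq}"
  proof
    fix A assume "A \<in> sets borel_sq"
    then obtain B where B: "B \<in> sets borel" "A = unit_sq \<inter> B"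
      unfolding borel_sq_def sets_restrict_space by auto
    then show "A \<in> sigma_sets unit_sq {C. closed C \<and> C \<subseteq> unit_sq}"
      using m[OF B(1)] sub by (simp add: space_measure_of_conv sets_measure_of_conv Int_commute)
  qed
  have "{C. closed C \<and> C \<subseteq> unit_sq} \<subseteq> sets borel_sq"
    unfolding borel_sq_def by (auto simp: sets_restrict_space_iff intro: borel_closed)
  from sets.sigma_sets_subset[OF this]
  show "sigma_sets unit_sq {C. closed C \<and> C \<subseteq> unit_sq} \<subseteq> sets borel_sq" by simp
qed

lemma borel_measurable_continuous_borel_sq:
  fixes g :: "real \<times> real \<Rightarrow> real"
  assumes "continuous_on unit_sq g" shows "g \<in> borel_measurable borel_sq"
  unfolding borel_sq_def using assms by (rule borel_measurable_continuous_on_restrict)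

lemma measurable_finite_pos:
  "finite_pos_measure M \<Longrightarrow> measurable M L = measurable borel_sq L"
  unfolding finite_pos_measure_def by (intro measurable_cong_sets) auto

lemma integrable_continuous_finite_pos:
  fixes g :: "real \<times> real \<Rightarrow> real"
  assumes M: "finite_pos_measure M" and g: "continuous_on unit_sq g"
  shows "integrable M g"
proof -
  interpret finite_measure M using M by (simp add: finite_pos_measure_def)
  obtain B where B: "\<And>z. z \<in> unit_sq \<Longrightarrow> \<bar>g z\<bar> \<le> B"
    using bounded_on_unit_sq[OF g] by blast
  show ?thesis
    by (rule integrable_const_bound[where B = B])
      (use B borel_measurable_continuous_borel_sq[OF g] in
        \<open>auto simp: measurable_finite_pos[OF M] space_finite_pos[OF M] intro!: AE_I2\<close>)
qed

text \<open>The indicator of a closed set is the limit of the continuous functions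
  \<open>max 0 (1 - n * infdist z C)\<close>. By dominated convergence, equal integrals give equal
  masses of closed sets, and these determine the measure.\<close>

lemma finite_pos_measure_eqI:
  assumes M: "finite_pos_measure M" and N: "finite_pos_measure N"
    and eq: "\<And>f :: real \<times> real \<Rightarrow> real. continuous_on UNIV f \<Longrightarrow> (\<integral>z. f z \<partial>M) = (\<integral>z. f z \<partial>N)"
  shows "M = N"
proof (rule measure_eqI_generator_eq)
  show "Int_stable {C. closed C \<and> C \<subseteq> unit_sq}"
    by (auto simp: Int_stable_def intro: closed_Int)
  show "sets M = sigma_sets unit_sq {C. closed C \<and> C \<subseteq> unit_sq}"
    "sets N = sigma_sets unit_sq {C. closed C \<and> C \<subseteq> unit_sq}"
    using M N by (simp_all add: finite_pos_measure_def sets_borel_sq_closed)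
  have "closed unit_sq" unfolding unit_sq_def by (intro closed_Times) auto
  then show "range (\<lambda>i::nat. unit_sq) \<subseteq> {C. closed C \<and> C \<subseteq> unit_sq}" by auto
  show "emeasure M ((\<lambda>i::nat. unit_sq) i) \<noteq> \<infinity>" for i
    using M by (simp add: finite_pos_measure_def finite_measure.emeasure_finite)
  show "emeasure M C = emeasure N C" if "C \<in> {C. closed C \<and> C \<subseteq> unit_sq}" for C
  \<comment> \<open>The distance to the empty set is 0 by convention, so the approximating functions
    would be constantly 1.\<close>
  proof (cases "C = {}")
    case False
    have C: "closed C" "C \<subseteq> unit_sq" using that by auto
    define g where "g = (\<lambda>n::nat. \<lambda>z. max 0 (1 - real n * infdist z C))"
    have gc: "continuous_on UNIV (g n)" for n
      unfolding g_def by (intro continuous_intros)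
    have lim: "(\<lambda>n. g n z) \<longlonglongrightarrow> indicator C z" for z
    proof (cases "z \<in> C")
      case True
      then show ?thesis by (simp add: g_def)
    next
      case z: False
      then have pos: "infdist z C > 0"
        using C(1) False in_closed_iff_infdist_zero[of C z] infdist_nonneg[of z C] by simp
      obtain n0 :: nat where n0: "1 < real n0 * infdist z C"
        using reals_Archimedean3[OF pos] by blast
      have "\<forall>\<^sub>F n in sequentially. g n z = 0"
        using eventually_ge_at_top[of n0]
      proof eventually_elim
        fix n assume "n0 \<le> n"
        then have "real n0 * infdist z C \<le> real n * infdist z C"
          using pos by (intro mult_right_mono) auto
        then show "g n z = 0" using n0 by (simp add: g_def)
      qed
      then show ?thesis using z by (simp add: tendsto_eventually)
    qed
    have conv: "(\<lambda>n. \<integral>z. g n z \<partial>L) \<longlonglongrightarrow> measure L C" if L: "finite_pos_measure L" for L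
    proof -
      interpret finite_measure L using L by (simp add: finite_pos_measure_def)
      have CL: "C \<in> sets L"
        using that C L by (simp add: finite_pos_measure_def sets_borel_sq_closed)
      have "(\<lambda>n. \<integral>z. g n z \<partial>L) \<longlonglongrightarrow> (\<integral>z. indicator C z \<partial>L)"
      proof (rule integral_dominated_convergence[where w = "\<lambda>_. 1"])
        show "g n \<in> borel_measurable L" for n
          using borel_measurable_continuous_borel_sq[OF continuous_on_subset[OF gc[of n] subset_UNIV]]
          by (simp add: measurable_finite_pos[OF L])
        show "AE z in L. norm (g n z) \<le> 1" for n
          by (intro AE_I2) (simp add: g_def infdist_nonneg)
      qed (use CL lim in auto)
      then show ?thesis using CL by simp
    qed
    have "measure M C = measure N C"
      using LIMSEQ_unique[OF conv[OF M]] conv[OF N] eq[OF gc] by simp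
    then show ?thesis
      using M N by (simp add: finite_pos_measure_def finite_measure.emeasure_eq_measure)
  qed simp
qed auto

section \<open>Weak time derivatives and disintegration\<close>

text \<open>
  The measure \<open>\<delta>([0,t] \<times> dx) dt\<close>. If \<open>\<Delta>\<close> has weak time derivative \<open>\<delta>\<close>, then
  \<open>\<Delta> = accum (fst \<delta>) - accum (snd \<delta>)\<close>.
\<close>

definition accum :: "(real \<times> real) measure \<Rightarrow> (real \<times> real) measure" where
  "accum \<delta> = distr (density (leb01 \<Otimes>\<^sub>M \<delta>) (indicator {w. fst (snd w) \<le> fst w})) borel_sq
     (\<lambda>w. (fst w, snd (snd w)))"

locale finite_pos =
  fixes \<delta> :: "(real \<times> real) measure"
  assumes finite_pos: "finite_pos_measure \<delta>"
begin

sublocale finite_measure \<delta>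
  using finite_pos by (simp add: finite_pos_measure_def)

sublocale pair: pair_sigma_finite leb01 \<delta> ..

lemma sets_eq: "sets \<delta> = sets borel_sq"
  using finite_pos by (simp add: finite_pos_measure_def)

lemma space_eq: "space \<delta> = unit_sq"
  by (rule space_finite_pos[OF finite_pos])

lemma ident [measurable]: "(\<lambda>z. z) \<in> \<delta> \<rightarrow>\<^sub>M borel"
  unfolding measurable_finite_pos[OF finite_pos] borel_sq_def
  by (rule measurable_restrict_space1) simp

lemma fst_measurable [measurable]: "fst \<in> borel_measurable \<delta>"
  and snd_measurable [measurable]: "snd \<in> borel_measurable \<delta>"
proof -
  have "(fst :: real \<times> real \<Rightarrow> real) \<in> borel_measurable borel"
    "(snd :: real \<times> real \<Rightarrow> real) \<in> borel_measurable borel"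
    unfolding borel_prod[symmetric] by measurable
  from measurable_compose[OF ident this(1)] measurable_compose[OF ident this(2)]
  show "fst \<in> borel_measurable \<delta>" "snd \<in> borel_measurable \<delta>" by simp_all
qed

lemma space_pair: "space (leb01 \<Otimes>\<^sub>M \<delta>) = {0..1} \<times> unit_sq"
  by (simp add: space_pair_measure space_eq)

lemma shift_measurable: "(\<lambda>w. (fst w, snd (snd w))) \<in> leb01 \<Otimes>\<^sub>M \<delta> \<rightarrow>\<^sub>M borel_sq"
  unfolding borel_sq_def
proof (rule measurable_restrict_space2)
  have "(\<lambda>w. (fst w, snd (snd w))) \<in> leb01 \<Otimes>\<^sub>M \<delta> \<rightarrow>\<^sub>M borel \<Otimes>\<^sub>M borel"
    by measurable
  then show "(\<lambda>w. (fst w, snd (snd w))) \<in> leb01 \<Otimes>\<^sub>M \<delta> \<rightarrow>\<^sub>M borel"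
    by (simp add: borel_prod)
qed (auto simp: space_pair unit_sq_def)

lemma before_measurable [measurable]: "Measurable.pred (leb01 \<Otimes>\<^sub>M \<delta>) (\<lambda>w. fst (snd w) \<le> fst w)"
proof -
  have "(\<lambda>w. fst w - fst (snd w)) \<in> borel_measurable (leb01 \<Otimes>\<^sub>M \<delta>)" by measurable
  then have "Measurable.pred (leb01 \<Otimes>\<^sub>M \<delta>) (\<lambda>w. 0 \<le> fst w - fst (snd w))" by measurable
  then show ?thesis by simp
qed

lemma before_indicator_measurable:
  "indicator {w. fst (snd w) \<le> fst w} \<in> borel_measurable (leb01 \<Otimes>\<^sub>M \<delta>)"
  by (simp add: borel_measurable_indicator_iff)

lemma sets_accum [simp]: "sets (accum \<delta>) = sets borel_sq"
  and space_accum [simp]: "space (accum \<delta>) = unit_sq"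
  by (simp_all add: accum_def)

lemma nn_integral_accum:
  assumes f: "f \<in> borel_measurable borel_sq"
  shows "(\<integral>\<^sup>+z. f z \<partial>accum \<delta>)
    = (\<integral>\<^sup>+s. \<integral>\<^sup>+z. indicator {..s} (fst z) * f (s, snd z) \<partial>\<delta> \<partial>leb01)"
proof -
  have fm: "(\<lambda>w. f (fst w, snd (snd w))) \<in> borel_measurable (leb01 \<Otimes>\<^sub>M \<delta>)"
    using measurable_compose[OF shift_measurable f] .
  note bm = before_indicator_measurable
  have "(\<integral>\<^sup>+z. f z \<partial>accum \<delta>)
    = (\<integral>\<^sup>+w. indicator {w. fst (snd w) \<le> fst w} w * f (fst w, snd (snd w)) \<partial>(leb01 \<Otimes>\<^sub>M \<delta>))"
    unfolding accum_def using shift_measurable f fm bm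
    by (simp add: nn_integral_distr nn_integral_density)
  also have "\<dots> = (\<integral>\<^sup>+s. \<integral>\<^sup>+z. indicator {..s} (fst z) * f (s, snd z) \<partial>\<delta> \<partial>leb01)"
    using fm bm by (subst nn_integral_fst[symmetric]) (auto simp: indicator_def intro!: nn_integral_cong)
  finally show ?thesis .
qed

lemma emeasure_accum:
  assumes A: "A \<in> sets borel_sq"
  shows "emeasure (accum \<delta>) A = (\<integral>\<^sup>+s. \<integral>\<^sup>+z. indicator {..s} (fst z) * indicator A (s, snd z) \<partial>\<delta> \<partial>leb01)"
  using nn_integral_accum[of "indicator A"] A by simp

lemma finite_pos_accum: "finite_pos_measure (accum \<delta>)"
proof -
  have top: "unit_sq \<in> sets borel_sq" using sets.top[of borel_sq] by simp
  have "emeasure (accum \<delta>) (space (accum \<delta>)) \<le> (\<integral>\<^sup>+s. \<integral>\<^sup>+z. 1 \<partial>\<delta> \<partial>leb01)"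
    unfolding space_accum emeasure_accum[OF top]
    by (intro nn_integral_mono) (auto split: split_indicator)
  also have "\<dots> < \<infinity>"
  proof -
    have "emeasure \<delta> (space \<delta>) < top"
      using emeasure_finite[of "space \<delta>"] by (metis infinity_ennreal_def less_top)
    then show ?thesis using emeasure_leb01_space by simp
  qed
  finally have "emeasure (accum \<delta>) (space (accum \<delta>)) \<noteq> \<infinity>" by simp
  then have "finite_measure (accum \<delta>)" by (rule finite_measureI)
  then show ?thesis by (simp add: finite_pos_measure_def)
qed

text \<open>After exchanging the order of integration, a point of \<delta> at time
  \<open>fst z\<close> is seen by all later times, so \<open>g\<close> is integrated over
  \<open>{fst z..1}\<close>.\<close>

lemma integral_accum:
  fixes g :: "real \<times> real \<Rightarrow> real"
  assumes g: "continuous_on unit_sq g"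
  shows "(\<integral>z. g z \<partial>accum \<delta>) = (\<integral>z. (LINT s|lebesgue_on {fst z..1}. g (s, snd z)) \<partial>\<delta>)"
proof -
  have gm: "g \<in> borel_measurable borel_sq" by (rule borel_measurable_continuous_borel_sq[OF g])
  have gm': "(\<lambda>w. g (fst w, snd (snd w))) \<in> borel_measurable (leb01 \<Otimes>\<^sub>M \<delta>)"
    using measurable_compose[OF shift_measurable gm] .
  obtain B where B: "\<And>z. z \<in> unit_sq \<Longrightarrow> \<bar>g z\<bar> \<le> B" "B \<ge> 0"
    using bounded_on_unit_sq[OF g] by blast
  define G where "G = (\<lambda>w. indicator {w. fst (snd w) \<le> fst w} w * g (fst w, snd (snd w)))"
  have Gm: "G \<in> borel_measurable (leb01 \<Otimes>\<^sub>M \<delta>)"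
    unfolding G_def using gm' before_indicator_measurable by auto
  have "emeasure (leb01 \<Otimes>\<^sub>M \<delta>) (space (leb01 \<Otimes>\<^sub>M \<delta>)) \<noteq> \<infinity>"
    using emeasure_finite emeasure_leb01_space
    by (simp add: space_pair_measure emeasure_pair_measure_Times ennreal_mult_eq_top_iff)
  then interpret P: finite_measure "leb01 \<Otimes>\<^sub>M \<delta>" by (rule finite_measureI)
  have Gi: "integrable (leb01 \<Otimes>\<^sub>M \<delta>) G"
  proof (rule P.integrable_const_bound[where B = B])
    show "AE w in leb01 \<Otimes>\<^sub>M \<delta>. norm (G w) \<le> B"
      using B by (intro AE_I2) (auto simp: G_def space_pair unit_sq_def split: split_indicator)
  qed (rule Gm)
  have Gi': "integrable (leb01 \<Otimes>\<^sub>M \<delta>) (\<lambda>(s, z). G (s, z))" using Gi by simp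
  have "(\<integral>z. g z \<partial>accum \<delta>) = (\<integral>w. G w \<partial>(leb01 \<Otimes>\<^sub>M \<delta>))"
  proof -
    have d: "(indicator {w. fst (snd w) \<le> fst w} :: real \<times> real \<times> real \<Rightarrow> ennreal)
      = (\<lambda>w. ennreal (indicator {w. fst (snd w) \<le> fst w} w))"
      by (auto simp: fun_eq_iff split: split_indicator)
    show ?thesis
      unfolding accum_def d G_def using shift_measurable gm gm' before_indicator_measurable
      by (simp add: integral_distr integral_density)
  qed
  also have "\<dots> = (\<integral>z. (LINT s|leb01. G (s, z)) \<partial>\<delta>)"
    using pair.integral_snd[OF Gi'] by simp
  also have "\<dots> = (\<integral>z. (LINT s|lebesgue_on {fst z..1}. g (s, snd z)) \<partial>\<delta>)"
  proof (rule Bochner_Integration.integral_cong[OF refl])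
    fix z assume "z \<in> space \<delta>"
    then have "fst z \<in> {0..1}" by (auto simp: space_eq unit_sq_def)
    then show "(LINT s|leb01. G (s, z)) = (LINT s|lebesgue_on {fst z..1}. g (s, snd z))"
      by (subst integral_lebesgue_on_Icc)
        (auto simp: G_def indicator_def intro!: Bochner_Integration.integral_cong)
  qed
  finally show ?thesis .
qed

end

section \<open>Recovering a measure from its weak time derivative\<close>

lemma continuous_on_prim_fst:
  fixes g :: "real \<times> real \<Rightarrow> real"
  assumes g: "continuous_on unit_sq g"
  shows "continuous_on unit_sq (\<lambda>z. prim (\<lambda>s. g (s, snd z)) (fst z))"
  unfolding continuous_on_sequentially comp_def
proof (intro allI ballI impI)
  fix X :: "nat \<Rightarrow> real \<times> real" and z
  assume z: "z \<in> unit_sq" and X: "(\<forall>n. X n \<in> unit_sq) \<and> X \<longlonglongrightarrow> z"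
  obtain B where B: "\<And>z. z \<in> unit_sq \<Longrightarrow> \<bar>g z\<bar> \<le> B" "B \<ge> 0"
    using bounded_on_unit_sq[OF g] by blast
  have in01: "fst y \<in> {0..1}" "snd y \<in> {0..1}" if "y \<in> unit_sq" for y
    using that by (auto simp: unit_sq_def)
  have m: "(\<lambda>s. indicator {0..fst y} s * g (s, snd y)) \<in> borel_measurable leb01" if "y \<in> unit_sq" for y
  proof -
    have "indicat_real {0..fst y} \<in> borel_measurable leb01"
      by (rule borel_measurable_leb01) simp
    moreover have "(\<lambda>s. g (s, snd y)) \<in> borel_measurable leb01"
      using in01[OF that] by (intro borel_measurable_continuous_leb01 continuous_on_unit_sq_slice(2)[OF g])
    ultimately show ?thesis by (rule borel_measurable_times)
  qed
  have conv: "AE s in leb01. (\<lambda>n. indicator {0..fst (X n)} s * g (s, snd (X n)))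
      \<longlonglongrightarrow> indicator {0..fst z} s * g (s, snd z)"
    using AE_leb01_neq[of "fst z"] AE_space
  proof eventually_elim
    fix s assume s: "s \<noteq> fst z" "s \<in> space leb01"
    have lim: "(\<lambda>n. fst (X n)) \<longlonglongrightarrow> fst z" using X by (intro tendsto_fst) simp
    have "\<forall>\<^sub>F n in sequentially. (s \<le> fst (X n)) = (s \<le> fst z)"
    proof (cases "s < fst z")
      case True
      show ?thesis using order_tendstoD(1)[OF lim True]
        by eventually_elim (use True in simp)
    next
      case False
      then have "fst z < s" using s by simp
      from order_tendstoD(2)[OF lim this] show ?thesis
        by eventually_elim (use \<open>fst z < s\<close> in simp)
    qed
    then have "\<forall>\<^sub>F n in sequentially. (indicator {0..fst z} s :: real) = indicator {0..fst (X n)} s"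
      by eventually_elim (use s in \<open>auto simp: indicator_def\<close>)
    then have 1: "(\<lambda>n. indicat_real {0..fst (X n)} s) \<longlonglongrightarrow> indicator {0..fst z} s"
      by (intro tendsto_eventually) (auto elim!: eventually_mono)
    have "(\<lambda>n. g (s, snd (X n))) \<longlonglongrightarrow> g (s, snd z)"
    proof (rule continuous_on_tendsto_compose[OF g])
      show "(\<lambda>n. (s, snd (X n))) \<longlonglongrightarrow> (s, snd z)" using X by (intro tendsto_intros) simp
      show "\<forall>\<^sub>F n in sequentially. (s, snd (X n)) \<in> unit_sq"
        using X s by (intro always_eventually allI) (auto simp: unit_sq_def mem_Times_iff)
    qed (use z s in \<open>auto simp: unit_sq_def\<close>)
    with 1 show "(\<lambda>n. indicator {0..fst (X n)} s * g (s, snd (X n))) \<longlonglongrightarrow> indicator {0..fst z} s * g (s, snd z)"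
      by (rule tendsto_mult)
  qed
  have "(\<lambda>n. LINT s|leb01. indicator {0..fst (X n)} s * g (s, snd (X n)))
    \<longlonglongrightarrow> (LINT s|leb01. indicator {0..fst z} s * g (s, snd z))"
  proof (rule integral_dominated_convergence[OF _ _ _ conv])
    show "integrable leb01 (\<lambda>_. B)" by simp
    show "AE s in leb01. norm (indicator {0..fst (X n)} s * g (s, snd (X n))) \<le> B" for n
      using B X in01(2)[of "X n"] by (intro AE_I2) (auto simp: unit_sq_def split: split_indicator)
  qed (use m X z in auto)
  then show "(\<lambda>n. prim (\<lambda>s. g (s, snd (X n))) (fst (X n))) \<longlonglongrightarrow> prim (\<lambda>s. g (s, snd z)) (fst z)"
    using X z in01(1) by (simp only: prim_eq[OF in01(1)])
qed

text \<open>Subtracting the final value makes the time primitive of \<open>g\<close> vanish at time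
  1. So every continuous function is the time derivative of an admissible test function, and the
  weak equation determines the measure.\<close>

lemma C1_in_time_prim:
  assumes g: "continuous_on unit_sq g"
  shows "C1_in_time (\<lambda>z. prim (\<lambda>s. g (s, snd z)) (fst z) - prim (\<lambda>s. g (s, snd z)) 1) g"
proof -
  have "continuous_on unit_sq (\<lambda>z. (\<lambda>z. prim (\<lambda>s. g (s, snd z)) (fst z)) (1, snd z))"
    by (rule continuous_on_compose2[OF continuous_on_prim_fst[OF g]])
      (auto intro!: continuous_intros simp: unit_sq_def)
  then have 1: "continuous_on unit_sq (\<lambda>z. prim (\<lambda>s. g (s, snd z)) 1)" by simp
  have 2: "continuous_on unit_sq (\<lambda>z. prim (\<lambda>s. g (s, snd z)) (fst z) - prim (\<lambda>s. g (s, snd z)) 1)"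
    by (rule continuous_on_diff[OF continuous_on_prim_fst[OF g] 1])
  have "((\<lambda>t. prim (\<lambda>s. g (s, x)) t - prim (\<lambda>s. g (s, x)) 1) has_real_derivative g (t, x)) (at t within {0..1})"
    if t: "t \<in> {0..1}" and x: "x \<in> {0..1}" for t x
    using DERIV_diff[OF has_real_derivative_prim[OF continuous_on_unit_sq_slice(2)[OF g x] t] DERIV_const]
    by simp
  with 2 g show ?thesis unfolding C1_in_time_def fst_conv snd_conv by blast
qed

lemma weak_dt_accum:
  assumes D: "finite_pos_measure \<Delta>" and w: "weak_dt {1} \<Delta> \<delta>"
  shows "lincomb 1 \<Delta> 1 (accum (snd \<delta>)) = accum (fst \<delta>)"
proof -
  interpret a: finite_pos "fst \<delta>" using w by unfold_locales (simp add: weak_dt_def finite_signed_def)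
  interpret b: finite_pos "snd \<delta>" using w by unfold_locales (simp add: weak_dt_def finite_signed_def)
  have setsD: "sets (accum (snd \<delta>)) = sets \<Delta>" using D by (simp add: finite_pos_measure_def)
  show ?thesis
  proof (rule finite_pos_measure_eqI)
    show "finite_pos_measure (lincomb 1 \<Delta> 1 (accum (snd \<delta>)))"
      using D b.finite_pos_accum finite_measure_lincomb[OF setsD] by (simp add: finite_pos_measure_def)
    show "finite_pos_measure (accum (fst \<delta>))" by (rule a.finite_pos_accum)
    fix g :: "real \<times> real \<Rightarrow> real" assume "continuous_on UNIV g"
    then have g: "continuous_on unit_sq g" by (rule continuous_on_subset) simp
    define f where "f = (\<lambda>z. prim (\<lambda>s. g (s, snd z)) (fst z) - prim (\<lambda>s. g (s, snd z)) 1)"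
    have "C1_in_time f g" unfolding f_def by (rule C1_in_time_prim[OF g])
    moreover have "f (1, x) = 0" for x by (simp add: f_def)
    ultimately have eq: "(\<integral>z. g z \<partial>\<Delta>) + signed_integral \<delta> f = 0"
      using w unfolding weak_dt_def by blast
    have acc: "(\<integral>z. g z \<partial>accum L) = - (\<integral>z. f z \<partial>L)" if L: "finite_pos_measure L" for L
    proof -
      interpret finite_pos L by unfold_locales (rule L)
      have "(\<integral>z. g z \<partial>accum L) = (\<integral>z. (LINT s|lebesgue_on {fst z..1}. g (s, snd z)) \<partial>L)"
        by (rule integral_accum[OF g])
      also have "\<dots> = (\<integral>z. - f z \<partial>L)"
      proof (intro Bochner_Integration.integral_cong refl)
        fix z assume "z \<in> space L"
        then have z: "fst z \<in> {0..1}" "snd z \<in> {0..1}" by (auto simp: space_eq unit_sq_def)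
        show "(LINT s|lebesgue_on {fst z..1}. g (s, snd z)) = - f z"
          unfolding f_def
          using integral_lebesgue_on_upper[OF integrable_continuous_leb01[OF continuous_on_unit_sq_slice(2)[OF g z(2)]] z(1)]
          by simp
      qed
      finally show ?thesis by simp
    qed
    have "(\<integral>z. g z \<partial>lincomb 1 \<Delta> 1 (accum (snd \<delta>))) = (\<integral>z. g z \<partial>\<Delta>) + (\<integral>z. g z \<partial>accum (snd \<delta>))"
      using integral_lincomb[OF setsD, of 1 1 g] integrable_continuous_finite_pos[OF D g]
        integrable_continuous_finite_pos[OF b.finite_pos_accum g] by simp
    also have "\<dots> = (\<integral>z. g z \<partial>accum (fst \<delta>))"
      using eq acc[OF a.finite_pos] acc[OF b.finite_pos] by (simp add: signed_integral_def)
    finally show "(\<integral>z. g z \<partial>lincomb 1 \<Delta> 1 (accum (snd \<delta>))) = (\<integral>z. g z \<partial>accum (fst \<delta>))" .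
  qed
qed

section \<open>Existence and uniqueness of disintegrations\<close>

abbreviation borel01 :: "real measure" where
  "borel01 \<equiv> restrict_space borel {0..1}"

lemma space_borel01: "space borel01 = {0..1}"
  by (simp add: space_restrict_space)

text \<open>A countable generator, so that equalities valid for almost every time on each of its
  sets hold on all of them outside one null set.\<close>

lemma sets_borel01_rational: "sets borel01 = sigma_sets {0..1} ((\<lambda>r. {0..1} \<inter> {..r}) ` \<rat>)"
proof
  have sub: "(\<lambda>r. {0..1::real} \<inter> {..r}) ` \<rat> \<subseteq> Pow {0..1}" by auto
  define L where "L = sigma {0..1::real} ((\<lambda>r. {0..1} \<inter> {..r}) ` \<rat>)"
  have L: "sets L = sigma_sets {0..1} ((\<lambda>r. {0..1} \<inter> {..r}) ` \<rat>)" "space L = {0..1}"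
    using sub by (simp_all add: L_def space_measure_of_conv sets_measure_of_conv)
  have "(\<lambda>x. x) \<in> L \<rightarrow>\<^sub>M borel"
  proof (rule borel_measurableI_less)
    fix y :: real
    have "{x \<in> space L. x < y} = (\<Union>r\<in>\<rat> \<inter> {..<y}. {0..1} \<inter> {..r})"
    proof (intro equalityI subsetI)
      fix x assume "x \<in> {x \<in> space L. x < y}"
      moreover from this obtain r where "r \<in> \<rat>" "x < r" "r < y"
        using Rats_dense_in_real[of x y] by auto
      ultimately show "x \<in> (\<Union>r\<in>\<rat> \<inter> {..<y}. {0..1} \<inter> {..r})"
        unfolding L by (intro UN_I[of r]) auto
    qed (auto simp: L)
    also have "\<dots> \<in> sets L"
      by (intro sets.countable_UN') (auto simp: L intro: countable_rat countable_Int1)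
    finally show "{x \<in> space L. x < y} \<in> sets L" .
  qed
  note m = measurable_sets[OF this]
  show "sets borel01 \<subseteq> sigma_sets {0..1} ((\<lambda>r. {0..1} \<inter> {..r}) ` \<rat>)"
  proof
    fix A :: "real set" assume "A \<in> sets borel01"
    then obtain B where B: "B \<in> sets borel" "A = {0..1} \<inter> B"
      unfolding sets_restrict_space by auto
    then show "A \<in> sigma_sets {0..1} ((\<lambda>r. {0..1} \<inter> {..r}) ` \<rat>)"
      using m[OF B(1)] by (simp add: L Int_commute)
  qed
  have "(\<lambda>r. {0..1::real} \<inter> {..r}) ` \<rat> \<subseteq> sets borel01"
    by (auto simp: sets_restrict_space_iff)
  from sets.sigma_sets_subset[OF this]
  show "sigma_sets {0..1} ((\<lambda>r. {0..1} \<inter> {..r}) ` \<rat>) \<subseteq> sets borel01"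
    by (simp add: space_borel01)
qed

lemma section_measurable:
  assumes t: "t \<in> {0..1}"
  shows "(\<lambda>x. (t, x)) \<in> borel01 \<rightarrow>\<^sub>M borel_sq"
  unfolding borel_sq_def
proof (rule measurable_restrict_space2)
  have "(\<lambda>x. (t, x)) \<in> borel \<rightarrow>\<^sub>M borel \<Otimes>\<^sub>M borel" by measurable
  then have "(\<lambda>x. (t, x)) \<in> borel \<rightarrow>\<^sub>M (borel :: (real \<times> real) measure)" by (simp add: borel_prod)
  then show "(\<lambda>x. (t, x)) \<in> borel01 \<rightarrow>\<^sub>M (borel :: (real \<times> real) measure)"
    by (rule measurable_restrict_space1)
qed (use t in \<open>auto simp: space_borel01 unit_sq_def\<close>)

lemma section_sets:
  assumes "t \<in> {0..1}" "A \<in> sets borel_sq"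
  shows "{x. (t, x) \<in> A} \<in> sets borel01"
proof -
  have "(\<lambda>x. (t, x)) -` A \<inter> space borel01 = {x. (t, x) \<in> A}"
    using sets.sets_into_space[OF assms(2)] by (auto simp: space_borel01 unit_sq_def)
  then show ?thesis using measurable_sets[OF section_measurable[OF assms(1)] assms(2)] by simp
qed

lemma Times_sets_borel_sq:
  assumes "A \<in> sets borel" "B \<in> sets borel01" "A \<subseteq> {0..1}"
  shows "A \<times> B \<in> sets borel_sq"
proof -
  have "B \<in> sets borel" "B \<subseteq> {0..1}"
    using assms(2) by (auto simp: sets_restrict_space_iff)
  then have "A \<times> B \<in> sets (borel \<Otimes>\<^sub>M borel)" "A \<times> B \<subseteq> unit_sq"
    using assms(1,3) by (auto simp: unit_sq_def)
  then show ?thesis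
    unfolding borel_sq_def borel_prod by (simp add: sets_restrict_space_iff)
qed

text \<open>Testing with the set where \<open>h\<close> exceeds 1; finiteness of \<open>M\<close>
  permits cancelling the mass of that set.\<close>

lemma density_le_one:
  assumes M: "finite_measure M" and h: "h \<in> borel_measurable M"
    and le: "\<And>A. A \<in> sets M \<Longrightarrow> emeasure (density M h) A \<le> emeasure M A"
  shows "AE x in M. h x \<le> (1::ennreal)"
proof -
  interpret finite_measure M by (rule M)
  define A where "A = {x \<in> space M. 1 < h x}"
  have A: "A \<in> sets M" unfolding A_def using h by measurable
  have "(\<integral>\<^sup>+x. (h x - 1) * indicator A x \<partial>M) + emeasure M A
      = (\<integral>\<^sup>+x. (h x - 1) * indicator A x + indicator A x \<partial>M)"
    using A h by (subst nn_integral_add) auto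
  also have "\<dots> = (\<integral>\<^sup>+x. h x * indicator A x \<partial>M)"
    by (intro nn_integral_cong) (auto simp: A_def indicator_def less_imp_le diff_add_cancel_ennreal)
  also have "\<dots> \<le> emeasure M A"
    using le[OF A] A h by (simp add: emeasure_density)
  finally have "emeasure M A + (\<integral>\<^sup>+x. (h x - 1) * indicator A x \<partial>M) \<le> emeasure M A + 0"
    by (simp add: add.commute)
  then have "(\<integral>\<^sup>+x. (h x - 1) * indicator A x \<partial>M) = 0"
    using emeasure_finite[of A] by (subst (asm) ennreal_add_left_cancel_le) auto
  then have "AE x in M. (h x - 1) * indicator A x = 0"
    using A h by (subst (asm) nn_integral_0_iff_AE) auto
  then show ?thesis using AE_space
  proof eventually_elim
    fix x assume "(h x - 1) * indicator A x = 0" "x \<in> space M"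
    then show "h x \<le> 1"
      by (cases "x \<in> A") (auto simp: A_def not_less diff_eq_0_iff_ennreal split: split_indicator_asm)
  qed
qed

text \<open>
  Since \<open>\<Delta> \<le> accum (fst \<delta>)\<close>, a density \<open>h \<le> 1\<close> transports the explicit disintegration of
  \<open>accum (fst \<delta>)\<close> to \<open>\<Delta>\<close> and keeps the masses of the slices bounded.
\<close>

theorem disintegration_exists:
  assumes D: "finite_pos_measure \<Delta>" and w: "weak_dt {1} \<Delta> \<delta>"
  obtains \<kappa> where "disintegrates \<Delta> \<kappa>"
    "\<And>t. emeasure (\<kappa> t) {0..1} \<le> emeasure (fst \<delta>) unit_sq"
proof -
  interpret a: finite_pos "fst \<delta>" using w by unfold_locales (simp add: weak_dt_def finite_signed_def)
  interpret b: finite_pos "snd \<delta>" using w by unfold_locales (simp add: weak_dt_def finite_signed_def)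
  define K where "K = accum (fst \<delta>)"
  have Kfin: "finite_measure K" and Ksets: "sets K = sets borel_sq"
    using a.finite_pos_accum by (simp_all add: K_def finite_pos_measure_def)
  interpret K: finite_measure K by (rule Kfin)
  have Dsets: "sets \<Delta> = sets borel_sq" using D by (simp add: finite_pos_measure_def)
  have le: "emeasure \<Delta> A \<le> emeasure K A" if "A \<in> sets borel_sq" for A
    unfolding K_def weak_dt_accum[OF D w, symmetric] using that Dsets
    by (subst emeasure_lincomb) auto
  have "absolutely_continuous K \<Delta>"
    unfolding absolutely_continuous_def
  proof
    fix A assume "A \<in> null_sets K"
    then show "A \<in> null_sets \<Delta>" using le[of A] Ksets Dsets by (auto simp: null_sets_def)
  qed
  then obtain h where h: "h \<in> borel_measurable K" "density K h = \<Delta>"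
    using K.Radon_Nikodym[of \<Delta>] Dsets Ksets by auto
  have h1: "AE z in K. h z \<le> 1"
    by (rule density_le_one[OF Kfin h(1)]) (use h(2) le Ksets in simp)
  \<comment> \<open>The density is at most 1 only almost everywhere. Truncation makes the bound
    pointwise, so the slice masses are bounded at every time; extension by 0 makes it Borel on the
    plane.\<close>
  define g where "g = (\<lambda>z. min (h z) 1 * indicator unit_sq z)"
  have hm: "h \<in> borel_measurable borel_sq"
    using h(1) measurable_cong_sets[OF Ksets refl] by blast
  then have "(\<lambda>z. min (h z) 1) \<in> borel_measurable borel_sq" by measurable
  then have gm: "g \<in> borel_measurable borel"
    unfolding g_def borel_sq_def by (subst (asm) borel_measurable_restrict_space_iff_ennreal) auto
  have gm': "g \<in> borel_measurable borel_sq"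
    unfolding borel_sq_def using gm by (rule measurable_restrict_space1)
  have g_le: "g z \<le> 1" for z by (auto simp: g_def split: split_indicator)
  have Dg: "\<Delta> = density K g"
    unfolding h(2)[symmetric]
  proof (rule density_cong)
    show "AE z in K. h z = g z"
      using h1 AE_space by eventually_elim (auto simp: g_def K_def)
    show "g \<in> borel_measurable K" using gm' measurable_cong_sets[OF Ksets refl] by blast
  qed (rule h(1))
  define k where "k = (\<lambda>t z. indicator {..t} (fst z) * g (t, snd z))"
  have k_joint: "(\<lambda>w. k (fst w) (snd w)) \<in> borel_measurable (borel \<Otimes>\<^sub>M fst \<delta>)"
  proof -
    have "(\<lambda>w. (fst w, snd (snd w))) \<in> (borel :: real measure) \<Otimes>\<^sub>M fst \<delta> \<rightarrow>\<^sub>M (borel :: (real \<times> real) measure)"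
      unfolding borel_prod[symmetric] by measurable
    from measurable_compose[OF this gm]
    have [measurable]: "(\<lambda>w. g (fst w, snd (snd w))) \<in> borel_measurable (borel \<Otimes>\<^sub>M fst \<delta>)" .
    show ?thesis unfolding k_def indicator_def atMost_iff by measurable
  qed
  have km: "k t \<in> borel_measurable (fst \<delta>)" for t
  proof -
    have "(\<lambda>z. (t, z)) \<in> fst \<delta> \<rightarrow>\<^sub>M borel \<Otimes>\<^sub>M fst \<delta>" by measurable
    from measurable_compose[OF this k_joint] show ?thesis by simp
  qed
  define \<kappa> where "\<kappa> = (\<lambda>t. distr (density (fst \<delta>) (k t)) borel01 snd)"
  have snd01: "snd \<in> fst \<delta> \<rightarrow>\<^sub>M borel01"
    by (intro measurable_restrict_space2) (auto simp: a.space_eq unit_sq_def)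
  have em: "emeasure (\<kappa> t) B = (\<integral>\<^sup>+z. k t z * indicator B (snd z) \<partial>fst \<delta>)" if B: "B \<in> sets borel01" for t B
  proof -
    have "emeasure (\<kappa> t) B = emeasure (density (fst \<delta>) (k t)) (snd -` B \<inter> space (fst \<delta>))"
      unfolding \<kappa>_def using snd01 B by (subst emeasure_distr) auto
    also have "\<dots> = (\<integral>\<^sup>+z. k t z * indicator (snd -` B \<inter> space (fst \<delta>)) z \<partial>fst \<delta>)"
      using measurable_sets[OF snd01 B] km by (intro emeasure_density) auto
    also have "\<dots> = (\<integral>\<^sup>+z. k t z * indicator B (snd z) \<partial>fst \<delta>)"
      by (intro nn_integral_cong) (auto split: split_indicator)
    finally show ?thesis .
  qed
  have I01: "{0..1} \<in> sets borel01" using sets.top[of borel01] by (simp add: space_borel01)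
  have bound: "emeasure (\<kappa> t) {0..1} \<le> emeasure (fst \<delta>) unit_sq" for t
  proof -
    have "emeasure (\<kappa> t) {0..1} \<le> (\<integral>\<^sup>+z. 1 \<partial>fst \<delta>)"
      unfolding em[OF I01] using g_le by (intro nn_integral_mono) (auto simp: k_def split: split_indicator)
    then show ?thesis by (simp add: a.space_eq)
  qed
  have "disintegrates \<Delta> \<kappa>"
    unfolding disintegrates_def
  proof (intro conjI allI ballI)
    show "finite_measure (\<kappa> t)" for t
    proof (rule finite_measureI)
      have "emeasure (\<kappa> t) {0..1} \<noteq> \<infinity>"
        using bound[of t] a.emeasure_finite[of unit_sq] by (metis infinity_ennreal_def top_unique)
      then show "emeasure (\<kappa> t) (space (\<kappa> t)) \<noteq> \<infinity>" by (simp add: \<kappa>_def space_borel01)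
    qed
    show "sets (\<kappa> t) = sets borel01" for t by (simp add: \<kappa>_def)
    show "(\<lambda>t. emeasure (\<kappa> t) B) \<in> borel_measurable borel01" if B: "B \<in> sets borel01" for B
    proof -
      have "(\<lambda>z. indicator B (snd z) :: ennreal) \<in> borel_measurable (fst \<delta>)"
        using measurable_compose[OF snd01 borel_measurable_indicator[OF B]] .
      then have [measurable]: "(\<lambda>w. indicator B (snd (snd w)) :: ennreal) \<in> borel_measurable (borel \<Otimes>\<^sub>M fst \<delta>)"
        using measurable_compose[OF measurable_snd] by blast
      have "(\<lambda>w. k (fst w) (snd w) * indicator B (snd (snd w))) \<in> borel_measurable (borel \<Otimes>\<^sub>M fst \<delta>)"
        using k_joint by measurable
      from a.borel_measurable_nn_integral_fst[OF this]
      have "(\<lambda>t. emeasure (\<kappa> t) B) \<in> borel_measurable borel" by (simp add: em[OF B])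
      then show ?thesis by (rule measurable_restrict_space1)
    qed
    fix A assume A: "A \<in> sets borel_sq"
    have gA: "(\<lambda>z. g z * indicator A z) \<in> borel_measurable borel_sq" using gm' A by measurable
    have "emeasure \<Delta> A = (\<integral>\<^sup>+z. g z * indicator A z \<partial>K)"
      unfolding Dg using A Ksets gm' measurable_cong_sets[OF Ksets refl]
      by (intro emeasure_density) auto
    also have "\<dots> = (\<integral>\<^sup>+s. \<integral>\<^sup>+z. indicator {..s} (fst z) * (g (s, snd z) * indicator A (s, snd z)) \<partial>fst \<delta> \<partial>leb01)"
      unfolding K_def by (rule a.nn_integral_accum[OF gA])
    also have "\<dots> = (\<integral>\<^sup>+s. emeasure (\<kappa> s) {x. (s, x) \<in> A} \<partial>leb01)"
    proof (rule nn_integral_cong)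
      fix s assume "s \<in> space leb01"
      then have "s \<in> {0..1}" by simp
      from em[OF section_sets[OF this A], of s]
      show "(\<integral>\<^sup>+z. indicator {..s} (fst z) * (g (s, snd z) * indicator A (s, snd z)) \<partial>fst \<delta>)
        = emeasure (\<kappa> s) {x. (s, x) \<in> A}"
        by (simp add: k_def mult.assoc indicator_def cong: nn_integral_cong)
    qed
    finally show "emeasure \<Delta> A = (\<integral>\<^sup>+s. emeasure (\<kappa> s) {x. (s, x) \<in> A} \<partial>leb01)" .
  qed
  then show thesis using bound by (rule that)
qed

lemma disintegratesD:
  assumes "disintegrates \<Delta> \<kappa>"
  shows "finite_measure (\<kappa> t)" "sets (\<kappa> t) = sets borel01" "space (\<kappa> t) = {0..1}"
    and "B \<in> sets borel01 \<Longrightarrow> (\<lambda>t. emeasure (\<kappa> t) B) \<in> borel_measurable borel01"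
    and "A \<in> sets borel_sq \<Longrightarrow> emeasure \<Delta> A = (\<integral>\<^sup>+t. emeasure (\<kappa> t) {x. (t, x) \<in> A} \<partial>leb01)"
  using assms sets_eq_imp_space_eq[of "\<kappa> t" borel01] unfolding disintegrates_def space_borel01 by blast+

text \<open>The time primitive of the mass of \<open>B\<close> in the slices is a mass of \<Delta>,
  an expression free of \<kappa>. The indicator extends the density by 0, as it is measurable only
  over the unit interval.\<close>

lemma
  assumes D: "finite_pos_measure \<Delta>" and d: "disintegrates \<Delta> \<kappa>" and B: "B \<in> sets borel01"
  shows disintegrates_mass_borel: "(\<lambda>t. indicat_real {0..1} t * measure (\<kappa> t) B) \<in> borel_measurable borel"
    and disintegrates_mass_int: "integrable leb01 (\<lambda>t. indicat_real {0..1} t * measure (\<kappa> t) B)"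
    and disintegrates_mass_prim: "t \<in> {0..1} \<Longrightarrow>
      prim (\<lambda>t. indicat_real {0..1} t * measure (\<kappa> t) B) t = measure \<Delta> ({0..t} \<times> B)"
proof -
  interpret D: finite_pos \<Delta> by unfold_locales (rule D)
  define c where "c = (\<lambda>t. indicat_real {0..1} t * measure (\<kappa> t) B)"
  have "(\<lambda>t. measure (\<kappa> t) B) \<in> borel_measurable borel01"
    unfolding measure_def using disintegratesD(4)[OF d B] by measurable
  then have cb: "c \<in> borel_measurable borel"
    unfolding c_def by (subst (asm) borel_measurable_restrict_space_iff) auto
  then show "(\<lambda>t. indicat_real {0..1} t * measure (\<kappa> t) B) \<in> borel_measurable borel"
    by (simp add: c_def)
  have cm: "c \<in> borel_measurable leb01" by (rule borel_measurable_leb01[OF cb])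
  have B01: "B \<subseteq> {0..1}" using sets.sets_into_space[OF B] by (simp add: space_borel01)
  have nn: "(\<integral>\<^sup>+s. ennreal (indicator {0..t} s * c s) \<partial>leb01) = ennreal (measure \<Delta> ({0..t} \<times> B))"
    if t: "t \<in> {0..1}" for t
  proof -
    have A: "{0..t} \<times> B \<in> sets borel_sq"
      by (rule Times_sets_borel_sq) (use t B in auto)
    have "ennreal (measure \<Delta> ({0..t} \<times> B)) = (\<integral>\<^sup>+s. emeasure (\<kappa> s) {x. (s, x) \<in> {0..t} \<times> B} \<partial>leb01)"
      using disintegratesD(5)[OF d A] D.emeasure_eq_measure by simp
    also have "\<dots> = (\<integral>\<^sup>+s. ennreal (indicator {0..t} s * c s) \<partial>leb01)"
    proof (rule nn_integral_cong)
      fix s assume "s \<in> space leb01"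
      then show "emeasure (\<kappa> s) {x. (s, x) \<in> {0..t} \<times> B} = ennreal (indicator {0..t} s * c s)"
        using finite_measure.emeasure_eq_measure[OF disintegratesD(1)[OF d], of s B]
        by (cases "s \<in> {0..t}") (auto simp: c_def)
    qed
    finally show ?thesis ..
  qed
  have "(\<integral>\<^sup>+s. ennreal (norm (c s)) \<partial>leb01) = (\<integral>\<^sup>+s. ennreal (indicator {0..1} s * c s) \<partial>leb01)"
    by (intro nn_integral_cong) (auto simp: c_def)
  then have ci: "integrable leb01 c"
    using cm nn[of 1] by (intro integrableI_bounded) auto
  then show "integrable leb01 (\<lambda>t. indicat_real {0..1} t * measure (\<kappa> t) B)"
    by (simp add: c_def)
  assume t: "t \<in> {0..1}"
  have "prim c t = enn2real (\<integral>\<^sup>+s. ennreal (indicator {0..t} s * c s) \<partial>leb01)"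
    unfolding prim_eq[OF t]
    by (rule integral_eq_nn_integral)
      (use integrable_indicator_leb01[OF ci, of "{0..t}"] in \<open>auto simp: c_def\<close>)
  also have "\<dots> = measure \<Delta> ({0..t} \<times> B)" unfolding nn[OF t] by simp
  finally show "prim (\<lambda>t. indicat_real {0..1} t * measure (\<kappa> t) B) t = measure \<Delta> ({0..t} \<times> B)"
    by (simp add: c_def)
qed

text \<open>For a fixed set the slice masses have the same time primitive, hence agree at almost
  every time. The rational half-lines give one null set for a generator stable under
  intersection.\<close>

theorem disintegration_unique:
  assumes D: "finite_pos_measure \<Delta>" and d1: "disintegrates \<Delta> \<kappa>" and d2: "disintegrates \<Delta> \<kappa>'"
  shows "AE t in leb01. \<kappa> t = \<kappa>' t"
proof -
  have B: "{0..1} \<inter> {..r} \<in> sets borel01" for r :: real by (simp add: sets_restrict_space_iff)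
  have "AE t in leb01. measure (\<kappa> t) ({0..1} \<inter> {..r}) = measure (\<kappa>' t) ({0..1} \<inter> {..r})" for r
  proof -
    define c where "c = (\<lambda>t. indicat_real {0..1} t * measure (\<kappa> t) ({0..1} \<inter> {..r}))"
    define c' where "c' = (\<lambda>t. indicat_real {0..1} t * measure (\<kappa>' t) ({0..1} \<inter> {..r}))"
    note p = disintegrates_mass_borel[OF D d1 B[of r], folded c_def] disintegrates_mass_borel[OF D d2 B[of r], folded c'_def]
      disintegrates_mass_int[OF D d1 B[of r], folded c_def] disintegrates_mass_int[OF D d2 B[of r], folded c'_def]
    have "AE t in leb01. c t - c' t = 0"
    proof (rule AE_zero_if_prim_zero)
      fix t :: real assume t: "t \<in> {0..1}"
      have "prim (\<lambda>t. c t - c' t) t = prim c t - prim c' t"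
        using integrable_prim[OF p(3) t] integrable_prim[OF p(4) t] by (rule Bochner_Integration.integral_diff)
      also have "\<dots> = 0"
        unfolding c_def c'_def disintegrates_mass_prim[OF D d1 B t] disintegrates_mass_prim[OF D d2 B t] by simp
      finally show "prim (\<lambda>t. c t - c' t) t = 0" .
    qed (use p in auto)
    then show ?thesis using AE_space
      by eventually_elim (simp add: c_def c'_def)
  qed
  then have "AE t in leb01. \<forall>r\<in>\<rat>. measure (\<kappa> t) ({0..1} \<inter> {..r}) = measure (\<kappa>' t) ({0..1} \<inter> {..r})"
    by (intro AE_ball_countable') (auto intro: countable_rat)
  then show ?thesis
  proof eventually_elim
    fix t assume eq: "\<forall>r\<in>\<rat>. measure (\<kappa> t) ({0..1} \<inter> {..r}) = measure (\<kappa>' t) ({0..1} \<inter> {..r})"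
    show "\<kappa> t = \<kappa>' t"
    proof (rule measure_eqI_generator_eq[where E = "(\<lambda>r. {0..1} \<inter> {..r}) ` \<rat>" and \<Omega> = "{0..1}" and A = "\<lambda>_. {0..1} \<inter> {..1}"])
      show "Int_stable ((\<lambda>r. {0..1::real} \<inter> {..r}) ` \<rat>)"
      proof (rule Int_stableI)
        fix a b assume "a \<in> (\<lambda>r. {0..1::real} \<inter> {..r}) ` \<rat>" "b \<in> (\<lambda>r. {0..1::real} \<inter> {..r}) ` \<rat>"
        then obtain r s where rs: "r \<in> \<rat>" "a = {0..1} \<inter> {..r}" "s \<in> \<rat>" "b = {0..1} \<inter> {..s}" by auto
        then have "a \<inter> b = {0..1} \<inter> {..min r s}" "min r s \<in> \<rat>" by (auto simp: min_def)
        then show "a \<inter> b \<in> (\<lambda>r. {0..1::real} \<inter> {..r}) ` \<rat>" by blast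
      qed
      show "emeasure (\<kappa> t) X = emeasure (\<kappa>' t) X" if "X \<in> (\<lambda>r. {0..1} \<inter> {..r}) ` \<rat>" for X
        using that eq finite_measure.emeasure_eq_measure[OF disintegratesD(1)[OF d1]]
          finite_measure.emeasure_eq_measure[OF disintegratesD(1)[OF d2]] by auto
      show "range (\<lambda>_::nat. {0..1} \<inter> {..1::real}) \<subseteq> (\<lambda>r. {0..1} \<inter> {..r}) ` \<rat>"
        by auto
      show "emeasure (\<kappa> t) ({0..1} \<inter> {..1}) \<noteq> \<infinity>" for i :: nat
        using finite_measure.emeasure_finite[OF disintegratesD(1)[OF d1]] by simp
    qed (use disintegratesD(2)[OF d1] disintegratesD(2)[OF d2] in \<open>auto simp: sets_borel01_rational\<close>)
  qed
qed

section \<open>Measurability of integrals against slices\<close>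

lemma measurable_ident_borel01: "(\<lambda>x. x) \<in> leb01 \<rightarrow>\<^sub>M borel01"
  by (rule measurable_restrict_space2[OF _ measurable_leb01_ident]) auto

text \<open>Dynkin's argument starting from measurable rectangles, where finiteness of each
  \<open>K w\<close> turns complements into differences; then approximation by simple
  functions.\<close>

lemma borel_measurable_nn_integral_kernel:
  assumes fin: "\<And>w. w \<in> space L \<Longrightarrow> finite_measure (K w)"
    and sets: "\<And>w. w \<in> space L \<Longrightarrow> sets (K w) = sets N"
    and K: "\<And>B. B \<in> sets N \<Longrightarrow> (\<lambda>w. emeasure (K w) B) \<in> borel_measurable L"
    and f: "f \<in> borel_measurable (L \<Otimes>\<^sub>M N)"
  shows "(\<lambda>w. \<integral>\<^sup>+y. f (w, y) \<partial>K w) \<in> borel_measurable L"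
  using f
proof induct
  case (cong f g)
  have "(\<integral>\<^sup>+y. f (w, y) \<partial>K w) = (\<integral>\<^sup>+y. g (w, y) \<partial>K w)" if w: "w \<in> space L" for w
    using cong(3) w sets_eq_imp_space_eq[OF sets[OF w]]
    by (intro nn_integral_cong) (auto simp: space_pair_measure)
  then show ?case using cong(4) by (simp cong: measurable_cong)
next
  case (set A)
  have sec: "Pair w -` A \<in> sets (K w)" if "w \<in> space L" for w
    using sets_Pair1[OF set] sets[OF that] by simp
  have "(\<lambda>w. emeasure (K w) (Pair w -` A)) \<in> borel_measurable L"
    using set unfolding sets_pair_measure
  proof (induct rule: sigma_sets_induct_disjoint[OF Int_stable_pair_measure_generator pair_measure_closed,
        consumes 1, case_names basic empty compl union])
    case (basic A)
    then obtain X Y where XY: "A = X \<times> Y" "X \<in> sets L" "Y \<in> sets N" by auto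
    have "emeasure (K w) (Pair w -` A) = emeasure (K w) Y * indicator X w" for w
      by (auto simp: XY(1) split: split_indicator)
    then show ?case using K[OF XY(3)] XY(2) by simp
  next
    case empty then show ?case by simp
  next
    case (compl A)
    then have A: "A \<in> sets (L \<Otimes>\<^sub>M N)" by (simp add: sets_pair_measure)
    have "emeasure (K w) (Pair w -` (space L \<times> space N - A)) = emeasure (K w) (space N) - emeasure (K w) (Pair w -` A)"
      if w: "w \<in> space L" for w
    proof -
      have "Pair w -` (space L \<times> space N - A) = space N - Pair w -` A" using w by auto
      moreover have "Pair w -` A \<in> sets (K w)" using sets_Pair1[OF A] sets[OF w] by simp
      moreover have "space (K w) = space N" by (rule sets_eq_imp_space_eq[OF sets[OF w]])
      ultimately show ?thesis
        using emeasure_compl[of "Pair w -` A" "K w"] finite_measure.emeasure_finite[OF fin[OF w]] by simp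
    qed
    moreover have "(\<lambda>w. emeasure (K w) (space N) - emeasure (K w) (Pair w -` A)) \<in> borel_measurable L"
      using compl K[OF sets.top] by measurable
    ultimately show ?case by (simp cong: measurable_cong)
  next
    case (union F)
    then have F: "\<And>i. F i \<in> sets (L \<Otimes>\<^sub>M N)" by (auto simp: sets_pair_measure)
    have "emeasure (K w) (Pair w -` (\<Union> (range F))) = (\<Sum>i. emeasure (K w) (Pair w -` F i))"
      if w: "w \<in> space L" for w
    proof -
      have "Pair w -` (\<Union> (range F)) = (\<Union>i. Pair w -` F i)" by auto
      moreover have "range (\<lambda>i. Pair w -` F i) \<subseteq> sets (K w)"
        using sets_Pair1[OF F] sets[OF w] by auto
      moreover have "disjoint_family (\<lambda>i. Pair w -` F i)"
        using union(1) by (auto simp: disjoint_family_on_def)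
      ultimately show ?thesis by (simp add: suminf_emeasure)
    qed
    moreover have "(\<lambda>w. \<Sum>i. emeasure (K w) (Pair w -` F i)) \<in> borel_measurable L"
      using union(3) by measurable
    ultimately show ?case by (simp cong: measurable_cong)
  qed
  moreover have "(\<integral>\<^sup>+y. indicator A (w, y) \<partial>K w) = emeasure (K w) (Pair w -` A)" if "w \<in> space L" for w
    using nn_integral_indicator[OF sec[OF that]] by (simp add: indicator_def[abs_def])
  ultimately show ?case by (simp cong: measurable_cong)
next
  case (mult u c)
  have "(\<lambda>y. u (w, y)) \<in> borel_measurable (K w)" if "w \<in> space L" for w
    using measurable_Pair2[OF mult(2) that] measurable_cong_sets[OF sets[OF that] refl] by blast
  then have "(\<integral>\<^sup>+y. c * u (w, y) \<partial>K w) = c * (\<integral>\<^sup>+y. u (w, y) \<partial>K w)" if "w \<in> space L" for w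
    using that by (simp add: nn_integral_cmult)
  then show ?case using mult(4) by (simp cong: measurable_cong)
next
  case (add u v)
  have "(\<lambda>y. u (w, y)) \<in> borel_measurable (K w)" "(\<lambda>y. v (w, y)) \<in> borel_measurable (K w)" if "w \<in> space L" for w
    using measurable_Pair2[OF add(1) that] measurable_Pair2[OF add(4) that] measurable_cong_sets[OF sets[OF that] refl]
    by blast+
  then have "(\<integral>\<^sup>+y. v (w, y) + u (w, y) \<partial>K w) = (\<integral>\<^sup>+y. v (w, y) \<partial>K w) + (\<integral>\<^sup>+y. u (w, y) \<partial>K w)" if "w \<in> space L" for w
    using that by (simp add: nn_integral_add)
  then show ?case using add by (simp cong: measurable_cong)
next
  case (seq U)
  have m: "(\<lambda>y. U i (w, y)) \<in> borel_measurable (K w)" if "w \<in> space L" for w i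
    using measurable_Pair2[OF seq(1) that] measurable_cong_sets[OF sets[OF that] refl] by blast
  have "(\<integral>\<^sup>+y. Sup (range U) (w, y) \<partial>K w) = (SUP i. \<integral>\<^sup>+y. U i (w, y) \<partial>K w)" if w: "w \<in> space L" for w
  proof -
    have "(\<lambda>y. Sup (range U) (w, y)) = (\<lambda>y. SUP i. U i (w, y))" by (auto simp: fun_eq_iff image_comp)
    then show ?thesis
      using m[OF w] seq(4)
      by (simp, intro nn_integral_monotone_convergence_SUP) (auto simp: incseq_def le_fun_def)
  qed
  then show ?case using seq(3) by (simp cong: measurable_cong)
qed

lemma disintegrates_leb01:
  assumes "disintegrates \<Delta> \<kappa>" "B \<in> sets borel01"
  shows "(\<lambda>t. emeasure (\<kappa> t) B) \<in> borel_measurable leb01"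
  using measurable_compose[OF measurable_ident_borel01 disintegratesD(4)[OF assms]] .

lemma measurable_pair_borel_sq: "(\<lambda>w. w) \<in> leb01 \<Otimes>\<^sub>M borel01 \<rightarrow>\<^sub>M borel_sq"
  unfolding borel_sq_def
proof (rule measurable_restrict_space2)
  have [measurable]: "(\<lambda>x. x) \<in> borel01 \<rightarrow>\<^sub>M borel" by (rule measurable_restrict_space1) simp
  have "(\<lambda>w. (fst w, snd w)) \<in> leb01 \<Otimes>\<^sub>M borel01 \<rightarrow>\<^sub>M (borel :: (real \<times> real) measure)"
    unfolding borel_prod[symmetric] by measurable
  then show "(\<lambda>w. w) \<in> leb01 \<Otimes>\<^sub>M borel01 \<rightarrow>\<^sub>M (borel :: (real \<times> real) measure)" by simp
qed (auto simp: space_pair_measure unit_sq_def space_borel01)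

lemma disintegrates_section_measurable:
  assumes d: "disintegrates \<Delta> \<kappa>" and A: "A \<in> sets borel_sq"
  shows "(\<lambda>t. emeasure (\<kappa> t) {x. (t, x) \<in> A}) \<in> borel_measurable leb01"
proof -
  have "indicator A \<in> borel_measurable (leb01 \<Otimes>\<^sub>M borel01)"
    using measurable_compose[OF measurable_pair_borel_sq borel_measurable_indicator[OF A]] .
  from borel_measurable_nn_integral_kernel[OF disintegratesD(1,2)[OF d] disintegrates_leb01[OF d] this]
  have "(\<lambda>t. \<integral>\<^sup>+x. indicator A (t, x) \<partial>\<kappa> t) \<in> borel_measurable leb01" .
  moreover have "(\<integral>\<^sup>+x. indicator A (t, x) \<partial>\<kappa> t) = emeasure (\<kappa> t) {x. (t, x) \<in> A}" if "t \<in> space leb01" for t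
  proof -
    have "{x. (t, x) \<in> A} \<in> sets (\<kappa> t)"
      using section_sets[OF _ A, of t] that disintegratesD(2)[OF d] by simp
    from nn_integral_indicator[OF this] show ?thesis by (simp add: indicator_def[abs_def])
  qed
  ultimately show ?thesis by (rule measurable_cong[THEN iffD1, rotated])
qed

lemma disintegrates_lincomb:
  assumes D: "finite_pos_measure \<Delta>" "finite_pos_measure \<mu>"
    and d1: "disintegrates \<Delta> \<kappa>" and d2: "disintegrates \<mu> \<kappa>'"
  shows "disintegrates (lincomb a \<Delta> b \<mu>) (\<lambda>t. lincomb a (\<kappa> t) b (\<kappa>' t))"
  unfolding disintegrates_def
proof (intro conjI allI ballI)
  have s: "sets (\<kappa>' t) = sets (\<kappa> t)" for t using disintegratesD(2)[OF d1] disintegratesD(2)[OF d2] by simp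
  show "finite_measure (lincomb a (\<kappa> t) b (\<kappa>' t))" for t
    by (rule finite_measure_lincomb[OF s disintegratesD(1)[OF d1] disintegratesD(1)[OF d2]])
  show "sets (lincomb a (\<kappa> t) b (\<kappa>' t)) = sets borel01" for t
    using disintegratesD(2)[OF d1] by simp
  have em: "emeasure (lincomb a (\<kappa> t) b (\<kappa>' t)) B = ennreal a * emeasure (\<kappa> t) B + ennreal b * emeasure (\<kappa>' t) B"
    if "B \<in> sets borel01" for B t
    using that disintegratesD(2)[OF d1] by (intro emeasure_lincomb[OF s]) simp
  show "(\<lambda>t. emeasure (lincomb a (\<kappa> t) b (\<kappa>' t)) B) \<in> borel_measurable borel01" if B: "B \<in> sets borel01" for B
    unfolding em[OF B] using disintegratesD(4)[OF d1 B] disintegratesD(4)[OF d2 B] by measurable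
  fix A assume A: "A \<in> sets borel_sq"
  have "emeasure (lincomb a \<Delta> b \<mu>) A = ennreal a * emeasure \<Delta> A + ennreal b * emeasure \<mu> A"
    using D A by (intro emeasure_lincomb) (auto simp: finite_pos_measure_def)
  also have "\<dots> = (\<integral>\<^sup>+t. ennreal a * emeasure (\<kappa> t) {x. (t, x) \<in> A} + ennreal b * emeasure (\<kappa>' t) {x. (t, x) \<in> A} \<partial>leb01)"
    unfolding disintegratesD(5)[OF d1 A] disintegratesD(5)[OF d2 A]
    using disintegrates_section_measurable[OF d1 A] disintegrates_section_measurable[OF d2 A]
    by (simp add: nn_integral_add nn_integral_cmult)
  also have "\<dots> = (\<integral>\<^sup>+t. emeasure (lincomb a (\<kappa> t) b (\<kappa>' t)) {x. (t, x) \<in> A} \<partial>leb01)"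
    by (intro nn_integral_cong) (use em section_sets[OF _ A] in auto)
  finally show "emeasure (lincomb a \<Delta> b \<mu>) A = (\<integral>\<^sup>+t. emeasure (lincomb a (\<kappa> t) b (\<kappa>' t)) {x. (t, x) \<in> A} \<partial>leb01)" .
qed

section \<open>Uniqueness of the weak time derivative\<close>

lemma sets_borel_sq_atMost: "sets borel_sq = sigma_sets unit_sq ((\<inter>) unit_sq ` range (\<lambda>a. {..a}))"
proof -
  have b: "sets (borel :: (real \<times> real) measure) = sigma_sets UNIV (range (\<lambda>a. {..a}))"
    by (subst borel_eq_atMost) (simp add: sets_measure_of_conv)
  show ?thesis
    unfolding borel_sq_def sets_restrict_space b
    by (rule sigma_sets_Int) (use unit_sq_borel b in auto)
qed

definition lower_rect :: "real \<Rightarrow> real \<Rightarrow> (real \<times> real) set" where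
  "lower_rect a c = {z \<in> unit_sq. fst z \<le> a \<and> snd z \<le> c}"

lemma lower_rect_eq: "lower_rect a c = unit_sq \<inter> {..(a, c)}"
  by (auto simp: lower_rect_def less_eq_prod_def)

lemma lower_rect_sets: "lower_rect a c \<in> sets borel_sq"
  unfolding sets_borel_sq_atMost lower_rect_eq by (rule sigma_sets.Basic) blast

lemma lower_rect_mono: "a \<le> b \<Longrightarrow> lower_rect a c \<subseteq> lower_rect b c"
  by (auto simp: lower_rect_def)

lemma emeasure_leb01_Icc:
  assumes "0 \<le> a" "a \<le> b" "b \<le> 1"
  shows "emeasure leb01 {a..b} = ennreal (b - a)"
  using assms by (subst emeasure_restrict_space) auto

lemma mult_left_mono_indicator:
  "(s \<in> A \<Longrightarrow> x \<le> y) \<Longrightarrow> indicator A s * x \<le> indicator A s * (y :: ennreal)"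
  by (cases "s \<in> A") simp_all

text \<open>
  The masses \<open>\<alpha>([0,s] \<times> C)\<close> are monotone and right-continuous in \<open>s\<close>, hence determined by their time
  integrals for \<open>s < 1\<close>; the mass at \<open>s = 1\<close> is invisible to \<open>accum\<close>.
\<close>

lemma accum_inj:
  assumes \<alpha>: "finite_pos_measure \<alpha>" and \<beta>: "finite_pos_measure \<beta>"
    and eq: "accum \<alpha> = accum \<beta>"
    and one: "\<And>A. A \<in> sets borel_sq \<Longrightarrow> A \<subseteq> {1} \<times> {0..1} \<Longrightarrow> measure \<alpha> A = measure \<beta> A"
  shows "\<alpha> = \<beta>"
proof -
  have rect: "emeasure (accum \<gamma>) ({a..b} \<times> ({0..1} \<inter> {..c}))
      = (\<integral>\<^sup>+s. indicator {a..b} s * emeasure \<gamma> (lower_rect s c) \<partial>leb01)"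
    if "finite_pos_measure \<gamma>" "0 \<le> a" "a < b" "b \<le> 1" for \<gamma> a b c
  proof -
    interpret finite_pos \<gamma> by unfold_locales fact
    have A: "{a..b} \<times> ({0..1} \<inter> {..c}) \<in> sets borel_sq"
      by (rule Times_sets_borel_sq) (use that in \<open>auto simp: sets_restrict_space_iff\<close>)
    show ?thesis
      unfolding emeasure_accum[OF A]
    proof (rule nn_integral_cong)
      fix s
      have "(\<integral>\<^sup>+z. indicator {..s} (fst z) * indicator ({a..b} \<times> ({0..1} \<inter> {..c})) (s, snd z) \<partial>\<gamma>)
        = (\<integral>\<^sup>+z. indicator {a..b} s * indicator (lower_rect s c) z \<partial>\<gamma>)"
        by (intro nn_integral_cong) (auto simp: space_eq lower_rect_def unit_sq_def split: split_indicator)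
      also have "\<dots> = indicator {a..b} s * emeasure \<gamma> (lower_rect s c)"
        using lower_rect_sets sets_eq by (subst nn_integral_cmult) auto
      finally show "(\<integral>\<^sup>+z. indicator {..s} (fst z) * indicator ({a..b} \<times> ({0..1} \<inter> {..c})) (s, snd z) \<partial>\<gamma>)
        = indicator {a..b} s * emeasure \<gamma> (lower_rect s c)" .
    qed
  qed
  \<comment> \<open>By monotonicity in time, the average over \<open>{a..b}\<close> lies above the
    value at \<open>a\<close> and below the value at \<open>b\<close>. The averages of the two
    measures coincide.\<close>
  have step: "measure \<gamma> (lower_rect a c) \<le> measure \<gamma>' (lower_rect b c)"
    if g: "finite_pos_measure \<gamma>" "finite_pos_measure \<gamma>'" "accum \<gamma> = accum \<gamma>'"
      and ab: "0 \<le> a" "a < b" "b \<le> 1" for \<gamma> \<gamma>' a b c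
  proof -
    interpret g: finite_pos \<gamma> by unfold_locales fact
    interpret g': finite_pos \<gamma>' by unfold_locales fact
    have ab_sets: "{a..b} \<in> sets leb01"
      using ab by (simp add: sets_restrict_space_iff)
    have "ennreal (b - a) * emeasure \<gamma> (lower_rect a c) = (\<integral>\<^sup>+s. indicator {a..b} s * emeasure \<gamma> (lower_rect a c) \<partial>leb01)"
      using ab ab_sets by (subst nn_integral_multc) (auto simp: emeasure_leb01_Icc)
    also have "\<dots> \<le> (\<integral>\<^sup>+s. indicator {a..b} s * emeasure \<gamma> (lower_rect s c) \<partial>leb01)"
      by (intro nn_integral_mono mult_left_mono_indicator emeasure_mono lower_rect_mono)
        (simp_all add: lower_rect_sets g.sets_eq)
    also have "\<dots> = (\<integral>\<^sup>+s. indicator {a..b} s * emeasure \<gamma>' (lower_rect s c) \<partial>leb01)"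
      using rect[OF g(1) ab] rect[OF g(2) ab] g(3) by simp
    also have "\<dots> \<le> (\<integral>\<^sup>+s. indicator {a..b} s * emeasure \<gamma>' (lower_rect b c) \<partial>leb01)"
      by (intro nn_integral_mono mult_left_mono_indicator emeasure_mono lower_rect_mono)
        (simp_all add: lower_rect_sets g'.sets_eq)
    also have "\<dots> = ennreal (b - a) * emeasure \<gamma>' (lower_rect b c)"
      using ab ab_sets by (subst nn_integral_multc) (auto simp: emeasure_leb01_Icc)
    finally have "ennreal ((b - a) * measure \<gamma> (lower_rect a c)) \<le> ennreal ((b - a) * measure \<gamma>' (lower_rect b c))"
      using ab by (simp add: g.emeasure_eq_measure g'.emeasure_eq_measure ennreal_mult)
    then have "(b - a) * measure \<gamma> (lower_rect a c) \<le> (b - a) * measure \<gamma>' (lower_rect b c)"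
      using ab by (subst (asm) ennreal_le_iff) auto
    then show ?thesis using ab by simp
  qed
  have le: "measure \<gamma> (lower_rect a c) \<le> measure \<gamma>' (lower_rect a c)"
    if g: "finite_pos_measure \<gamma>" "finite_pos_measure \<gamma>'" "accum \<gamma> = accum \<gamma>'" and a: "a < 1" for \<gamma> \<gamma>' a c
  proof (cases "a < 0")
    case True
    then have "lower_rect a c = {}" by (auto simp: lower_rect_def unit_sq_def)
    then show ?thesis by simp
  next
    case False
    interpret g': finite_pos \<gamma>' by unfold_locales fact
    \<comment> \<open>A sequence decreasing to \<open>a\<close> that stays within the unit interval,
      which is possible only because \<open>a < 1\<close>. Continuity from above along it closes the
      gap between \<open>a\<close> and \<open>b\<close>.\<close>
    define b where "b = (\<lambda>n::nat. a + (1 - a) / real (Suc n))"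
    have b: "a < b n" "b n \<le> 1" for n
      using a mult_left_mono[of 1 "real (Suc n)" "1 - a"] by (auto simp: b_def field_simps)
    have b_lim: "b \<longlonglongrightarrow> a + 0"
      unfolding b_def by (intro tendsto_add tendsto_const LIMSEQ_Suc lim_const_over_n)
    have "(\<lambda>n. measure \<gamma>' (lower_rect (b n) c)) \<longlonglongrightarrow> measure \<gamma>' (\<Inter>n. lower_rect (b n) c)"
    proof (rule g'.finite_Lim_measure_decseq)
      show "range (\<lambda>n. lower_rect (b n) c) \<subseteq> sets \<gamma>'" using lower_rect_sets g'.sets_eq by auto
      have "b n \<le> b m" if "m \<le> n" for m n
        using that a unfolding b_def by (intro add_left_mono divide_left_mono) auto
      then show "decseq (\<lambda>n. lower_rect (b n) c)"
        by (force simp: decseq_def lower_rect_def)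
    qed
    moreover have "(\<Inter>n. lower_rect (b n) c) = lower_rect a c"
    proof
      show "lower_rect a c \<subseteq> (\<Inter>n. lower_rect (b n) c)"
        using order_trans[OF _ less_imp_le[OF b(1)]] by (auto simp: lower_rect_def)
      show "(\<Inter>n. lower_rect (b n) c) \<subseteq> lower_rect a c"
      proof
        fix z assume z: "z \<in> (\<Inter>n. lower_rect (b n) c)"
        then have "fst z \<le> b n" for n by (auto simp: lower_rect_def)
        then have "fst z \<le> a" using LIMSEQ_le_const[OF b_lim] by auto
        then show "z \<in> lower_rect a c" using z by (auto simp: lower_rect_def)
      qed
    qed
    ultimately have "(\<lambda>n. measure \<gamma>' (lower_rect (b n) c)) \<longlonglongrightarrow> measure \<gamma>' (lower_rect a c)" by simp
    then show ?thesis
      by (rule LIMSEQ_le_const) (use step[OF g] False b in auto)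
  qed
  have lt: "measure \<alpha> (lower_rect a c) = measure \<beta> (lower_rect a c)" if "a < 1" for a c
    using le[OF \<alpha> \<beta> eq that] le[OF \<beta> \<alpha> eq[symmetric] that] by (rule antisym)
  have all: "measure \<alpha> (lower_rect a c) = measure \<beta> (lower_rect a c)" for a c
  proof (cases "a < 1")
    case False
    \<comment> \<open>The part at time 1 is split off. The rest is exhausted by rectangles ending
      before time 1, where equality is known, and on \<open>E\<close> the hypothesis
      \<open>one\<close> applies.\<close>
    define E where "E = {1::real} \<times> ({0..1} \<inter> {..c})"
    define F where "F = (\<lambda>n::nat. lower_rect (1 - 1 / real (Suc n)) c)"
    have E: "E \<in> sets borel_sq"
      unfolding E_def by (rule Times_sets_borel_sq) (auto simp: sets_restrict_space_iff)
    have un: "lower_rect a c = (\<Union>n. F n) \<union> E"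
    proof
      show "(\<Union>n. F n) \<union> E \<subseteq> lower_rect a c"
        using False by (auto simp: F_def E_def lower_rect_def unit_sq_def)
      show "lower_rect a c \<subseteq> (\<Union>n. F n) \<union> E"
      proof
        fix z assume z: "z \<in> lower_rect a c"
        show "z \<in> (\<Union>n. F n) \<union> E"
        proof (cases "fst z = 1")
          case True
          then show ?thesis using z by (cases z) (auto simp: E_def lower_rect_def unit_sq_def)
        next
          case False
          then have "0 < 1 - fst z" using z by (auto simp: lower_rect_def unit_sq_def)
          then obtain n where "inverse (real (Suc n)) < 1 - fst z"
            using reals_Archimedean by blast
          then have "fst z \<le> 1 - 1 / real (Suc n)" by (simp add: inverse_eq_divide)
          then show ?thesis using z by (auto simp: F_def lower_rect_def)
        qed
      qed
    qed
    have dis: "(\<Union>n. F n) \<inter> E = {}"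
      by (auto simp: F_def E_def lower_rect_def)
    have lim: "(\<lambda>n. measure \<gamma> (F n)) \<longlonglongrightarrow> measure \<gamma> (lower_rect a c) - measure \<gamma> E"
      if "finite_pos_measure \<gamma>" for \<gamma>
    proof -
      interpret finite_pos \<gamma> by unfold_locales fact
      have "(\<lambda>n. measure \<gamma> (F n)) \<longlonglongrightarrow> measure \<gamma> (\<Union>n. F n)"
      proof (rule finite_Lim_measure_incseq)
        show "range F \<subseteq> sets \<gamma>" using lower_rect_sets sets_eq by (auto simp: F_def)
        have "1 - 1 / real (Suc m) \<le> 1 - 1 / real (Suc n)" if "m \<le> n" for m n
          using that by (intro diff_left_mono divide_left_mono) auto
        then show "incseq F" unfolding incseq_def F_def lower_rect_def by fastforce
      qed
      moreover have "measure \<gamma> (lower_rect a c) = measure \<gamma> (\<Union>n. F n) + measure \<gamma> E"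
        unfolding un using dis E lower_rect_sets sets_eq
        by (intro finite_measure_Union) (auto simp: F_def)
      ultimately show ?thesis by simp
    qed
    have "measure \<alpha> (lower_rect a c) - measure \<alpha> E = measure \<beta> (lower_rect a c) - measure \<beta> E"
      using LIMSEQ_unique[OF lim[OF \<alpha>]] lim[OF \<beta>] by (simp add: F_def lt)
    moreover have "measure \<alpha> E = measure \<beta> E"
      by (rule one[OF E]) (auto simp: E_def)
    ultimately show ?thesis by simp
  qed (rule lt)
  interpret a: finite_pos \<alpha> by unfold_locales (rule \<alpha>)
  interpret b: finite_pos \<beta> by unfold_locales (rule \<beta>)
  show ?thesis
  proof (rule measure_eqI_generator_eq[where E = "(\<inter>) unit_sq ` range (\<lambda>a. {..a})" and \<Omega> = unit_sq
        and A = "\<lambda>_. lower_rect 1 1"])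
    show "Int_stable ((\<inter>) unit_sq ` range (\<lambda>a. {..a}))"
    proof (rule Int_stableI)
      fix A B assume "A \<in> (\<inter>) unit_sq ` range (\<lambda>a. {..a})" "B \<in> (\<inter>) unit_sq ` range (\<lambda>a. {..a})"
      then obtain a b where "A = unit_sq \<inter> {..a}" "B = unit_sq \<inter> {..b}" by auto
      then have "A \<inter> B = unit_sq \<inter> {..inf a b}" by auto
      then show "A \<inter> B \<in> (\<inter>) unit_sq ` range (\<lambda>a. {..a})" by blast
    qed
    show "emeasure \<alpha> X = emeasure \<beta> X" if X: "X \<in> (\<inter>) unit_sq ` range (\<lambda>a. {..a})" for X
    proof -
      obtain p where "X = unit_sq \<inter> {..p}" using X by auto
      then have "X = lower_rect (fst p) (snd p)" by (simp add: lower_rect_eq)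
      then show ?thesis using all by (simp add: a.emeasure_eq_measure b.emeasure_eq_measure)
    qed
    show "range (\<lambda>_::nat. lower_rect 1 1) \<subseteq> (\<inter>) unit_sq ` range (\<lambda>a. {..a})"
      unfolding lower_rect_eq by (intro image_subsetI imageI rangeI)
    show "(\<Union>i::nat. lower_rect 1 1) = unit_sq" by (auto simp: lower_rect_def unit_sq_def)
    show "emeasure \<alpha> (lower_rect 1 1) \<noteq> \<infinity>" for i :: nat using a.emeasure_finite by simp
  qed (use a.sets_eq b.sets_eq in \<open>auto simp: sets_borel_sq_atMost\<close>)
qed

lemma finite_pos_lincomb:
  assumes "finite_pos_measure \<alpha>" "finite_pos_measure \<beta>"
  shows "finite_pos_measure (lincomb a \<alpha> b \<beta>)"
  using assms finite_measure_lincomb[of \<beta> \<alpha>] by (simp add: finite_pos_measure_def)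

lemma (in finite_pos) accum_kernel_measurable:
  assumes f: "f \<in> borel_measurable borel_sq"
  shows "(\<lambda>s. \<integral>\<^sup>+z. indicator {..s} (fst z) * f (s, snd z) \<partial>\<delta>) \<in> borel_measurable leb01"
proof -
  have fm: "(\<lambda>w. f (fst w, snd (snd w))) \<in> borel_measurable (leb01 \<Otimes>\<^sub>M \<delta>)"
    using measurable_compose[OF shift_measurable f] .
  note bm = before_indicator_measurable
  have "(\<lambda>w. indicator {w. fst (snd w) \<le> fst w} w * f (fst w, snd (snd w))) \<in> borel_measurable (leb01 \<Otimes>\<^sub>M \<delta>)"
    using fm bm by (intro borel_measurable_times_ennreal)
  from borel_measurable_nn_integral_fst[OF this]
  show ?thesis by (simp add: indicator_def)
qed

lemma accum_lincomb:
  assumes \<alpha>: "finite_pos_measure \<alpha>" and \<beta>: "finite_pos_measure \<beta>"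
  shows "accum (lincomb a \<alpha> b \<beta>) = lincomb a (accum \<alpha>) b (accum \<beta>)"
proof (rule measure_eqI)
  interpret \<alpha>: finite_pos \<alpha> by unfold_locales (rule \<alpha>)
  interpret \<beta>: finite_pos \<beta> by unfold_locales (rule \<beta>)
  interpret \<gamma>: finite_pos "lincomb a \<alpha> b \<beta>" by unfold_locales (rule finite_pos_lincomb[OF \<alpha> \<beta>])
  have s: "sets \<beta> = sets \<alpha>" using \<alpha>.sets_eq \<beta>.sets_eq by simp
  show "sets (accum (lincomb a \<alpha> b \<beta>)) = sets (lincomb a (accum \<alpha>) b (accum \<beta>))" by simp
  fix A assume "A \<in> sets (accum (lincomb a \<alpha> b \<beta>))"
  then have A: "A \<in> sets borel_sq" by simp
  define k where "k = (\<lambda>s z. indicator {..s} (fst z) * indicator A (s, snd z) :: ennreal)"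
  have km: "k s \<in> borel_measurable \<alpha>" if s: "s \<in> space leb01" for s
  proof -
    have "(\<lambda>z. (s, z)) \<in> \<alpha> \<rightarrow>\<^sub>M leb01 \<Otimes>\<^sub>M \<alpha>" using s by measurable
    from measurable_compose[OF this \<alpha>.shift_measurable]
    have "(\<lambda>z. (s, snd z)) \<in> \<alpha> \<rightarrow>\<^sub>M borel_sq" by simp
    from measurable_compose[OF this borel_measurable_indicator[OF A]]
    have [measurable]: "(\<lambda>z. indicator A (s, snd z) :: ennreal) \<in> borel_measurable \<alpha>" .
    show ?thesis unfolding k_def indicator_def[of "{..s}"] atMost_iff by measurable
  qed
  have "emeasure (accum (lincomb a \<alpha> b \<beta>)) A = (\<integral>\<^sup>+s. \<integral>\<^sup>+z. k s z \<partial>lincomb a \<alpha> b \<beta> \<partial>leb01)"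
    unfolding k_def by (rule \<gamma>.emeasure_accum[OF A])
  also have "\<dots> = (\<integral>\<^sup>+s. ennreal a * (\<integral>\<^sup>+z. k s z \<partial>\<alpha>) + ennreal b * (\<integral>\<^sup>+z. k s z \<partial>\<beta>) \<partial>leb01)"
    by (intro nn_integral_cong nn_integral_lincomb[OF s] km)
  also have "\<dots> = ennreal a * emeasure (accum \<alpha>) A + ennreal b * emeasure (accum \<beta>) A"
    unfolding \<alpha>.emeasure_accum[OF A] \<beta>.emeasure_accum[OF A] k_def
    using \<alpha>.accum_kernel_measurable[OF borel_measurable_indicator[OF A]]
      \<beta>.accum_kernel_measurable[OF borel_measurable_indicator[OF A]]
    by (simp add: nn_integral_add nn_integral_cmult)
  also have "\<dots> = emeasure (lincomb a (accum \<alpha>) b (accum \<beta>)) A"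
    using A by (intro emeasure_lincomb[symmetric]) auto
  finally show "emeasure (accum (lincomb a \<alpha> b \<beta>)) A = emeasure (lincomb a (accum \<alpha>) b (accum \<beta>)) A" .
qed

lemma measure_lincomb:
  assumes "sets N = sets M" "finite_measure M" "finite_measure N" "0 \<le> a" "0 \<le> b" "A \<in> sets M"
  shows "measure (lincomb a M b N) A = a * measure M A + b * measure N A"
proof -
  have "emeasure (lincomb a M b N) A = ennreal (a * measure M A + b * measure N A)"
    unfolding emeasure_lincomb[OF assms(1,6)] finite_measure.emeasure_eq_measure[OF assms(2)]
      finite_measure.emeasure_eq_measure[OF assms(3)]
    using assms(4,5) by (simp add: ennreal_mult)
  then show ?thesis
    by (rule measure_eq_emeasure_eq_ennreal[rotated]) (use assms(4,5) in simp)
qed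

text \<open>Equality of two differences of positive measures, written without subtraction because
  the representing pairs are not unique. Both sides have the same \<open>accum\<close>, namely
  \<Delta> plus the accumulated negative parts of both derivatives, and the normalisation at time 1
  supplies the remaining hypothesis of \<open>accum_inj\<close>.\<close>

theorem weak_dt_unique:
  assumes D: "finite_pos_measure \<Delta>" and w: "weak_dt {1} \<Delta> \<delta>" and w': "weak_dt {1} \<Delta> \<delta>'"
  shows "lincomb 1 (fst \<delta>) 1 (snd \<delta>') = lincomb 1 (fst \<delta>') 1 (snd \<delta>)"
proof -
  have f: "finite_pos_measure (fst \<delta>)" "finite_pos_measure (snd \<delta>)"
    "finite_pos_measure (fst \<delta>')" "finite_pos_measure (snd \<delta>')"
    using w w' by (simp_all add: weak_dt_def finite_signed_def)
  have fm: "finite_measure (fst \<delta>)" "finite_measure (snd \<delta>)" "finite_measure (fst \<delta>')" "finite_measure (snd \<delta>')"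
    and st: "sets (fst \<delta>) = sets borel_sq" "sets (snd \<delta>) = sets borel_sq"
    "sets (fst \<delta>') = sets borel_sq" "sets (snd \<delta>') = sets borel_sq"
    and sD: "sets \<Delta> = sets borel_sq"
    using f D by (simp_all add: finite_pos_measure_def)
  show ?thesis
  proof (rule accum_inj)
    show "accum (lincomb 1 (fst \<delta>) 1 (snd \<delta>')) = accum (lincomb 1 (fst \<delta>') 1 (snd \<delta>))"
      unfolding accum_lincomb[OF f(1,4)] accum_lincomb[OF f(3,2)]
        weak_dt_accum[OF D w, symmetric] weak_dt_accum[OF D w', symmetric]
    proof (rule measure_eqI)
      fix A assume "A \<in> sets (lincomb 1 (lincomb 1 \<Delta> 1 (accum (snd \<delta>))) 1 (accum (snd \<delta>')))"
      then have A: "A \<in> sets \<Delta>" by simp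
      show "emeasure (lincomb 1 (lincomb 1 \<Delta> 1 (accum (snd \<delta>))) 1 (accum (snd \<delta>'))) A
        = emeasure (lincomb 1 (lincomb 1 \<Delta> 1 (accum (snd \<delta>'))) 1 (accum (snd \<delta>))) A"
        using A sD by (simp add: emeasure_lincomb add_ac accum_def)
    qed simp
    fix A assume A: "A \<in> sets borel_sq" "A \<subseteq> {1} \<times> {0..1}"
    have "measure (fst \<delta>) A = measure (snd \<delta>) A" "measure (fst \<delta>') A = measure (snd \<delta>') A"
      using w w' A unfolding weak_dt_def by blast+
    then show "measure (lincomb 1 (fst \<delta>) 1 (snd \<delta>')) A = measure (lincomb 1 (fst \<delta>') 1 (snd \<delta>)) A"
      using A fm st by (simp add: measure_lincomb)
  qed (use f finite_pos_lincomb in auto)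
qed

section \<open>The cone \<open>M\<^sub>0\<close>\<close>

text \<open>The represented signed measure has no mass at the times in \<open>Z\<close>. For a
  derivative in the sense \<open>weak_dt {1}\<close>, mass at time 0 would be the initial value of
  the measure.\<close>

abbreviation balanced :: "real set \<Rightarrow> signed_measure \<Rightarrow> bool" where
  "balanced Z \<delta> \<equiv> \<forall>A\<in>sets borel_sq. A \<subseteq> Z \<times> {0..1} \<longrightarrow> measure (fst \<delta>) A = measure (snd \<delta>) A"

lemma C1_in_time_cutoff:
  assumes f: "C1_in_time f f'"
  shows "C1_in_time (\<lambda>z. f z * (1 - (1 - fst z) ^ n))
    (\<lambda>z. f' z * (1 - (1 - fst z) ^ n) + f z * (real n * (1 - fst z) ^ (n - 1)))"
proof -
  have c: "continuous_on unit_sq f" "continuous_on unit_sq f'"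
    and d: "\<And>t x. t \<in> {0..1} \<Longrightarrow> x \<in> {0..1} \<Longrightarrow>
      ((\<lambda>s. f (s, x)) has_real_derivative f' (t, x)) (at t within {0..1})"
    using f unfolding C1_in_time_def by blast+
  have "((\<lambda>s. f (s, x) * (1 - (1 - s) ^ n)) has_real_derivative
      f' (t, x) * (1 - (1 - t) ^ n) + f (t, x) * (real n * (1 - t) ^ (n - 1))) (at t within {0..1})"
    if "t \<in> {0..1}" "x \<in> {0..1}" for t x
    by (rule derivative_eq_intros d[OF that] refl)+ (simp add: algebra_simps)
  moreover have "continuous_on unit_sq (\<lambda>z. f z * (1 - (1 - fst z) ^ n))"
    "continuous_on unit_sq (\<lambda>z. f' z * (1 - (1 - fst z) ^ n) + f z * (real n * (1 - fst z) ^ (n - 1)))"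
    by (intro continuous_intros c)+
  ultimately show ?thesis unfolding C1_in_time_def fst_conv by blast
qed

lemma Z_Times_sets: "Z \<in> sets borel \<Longrightarrow> Z \<subseteq> {0..1} \<Longrightarrow> Z \<times> {0..1} \<in> sets borel_sq"
  using Times_sets_borel_sq[of Z "{0..1}"] sets.top[of borel01] by (simp add: space_borel01)

text \<open>
  The factors \<open>1 - (1 - t)\<^sup>n\<close> vanish at \<open>t = 0\<close> and increase to \<open>1\<close> for \<open>t > 0\<close>, so test functions
  vanishing at both times approximate those vanishing at \<open>t = 1\<close> only.
\<close>

lemma signed_integral_cutoff:
  assumes \<delta>: "finite_signed \<delta>" and bal: "balanced {0} \<delta>" and f: "continuous_on unit_sq f"
  shows "(\<lambda>n. signed_integral \<delta> (\<lambda>z. f z * (1 - (1 - fst z) ^ n))) \<longlonglongrightarrow> signed_integral \<delta> f"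
proof -
  define E where "E = {0::real} \<times> {0..1::real}"
  have E: "E \<in> sets borel_sq" unfolding E_def by (rule Z_Times_sets) auto
  have lim: "(\<lambda>n. \<integral>z. f z * (1 - (1 - fst z) ^ n) \<partial>L) \<longlonglongrightarrow> (\<integral>z. f z \<partial>L) - (\<integral>z. indicator E z * f z \<partial>L)"
    if L: "finite_pos_measure L" for L
  proof -
    interpret finite_pos L by unfold_locales (rule L)
    have fi: "integrable L f" by (rule integrable_continuous_finite_pos[OF L f])
    have Ei: "integrable L (\<lambda>z. indicator E z * f z)"
      using integrable_mult_indicator[OF _ fi, of E] E sets_eq by simp
    have "(\<lambda>n. \<integral>z. f z * (1 - (1 - fst z) ^ n) \<partial>L) \<longlonglongrightarrow> (\<integral>z. f z - indicator E z * f z \<partial>L)"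
    proof (rule integral_dominated_convergence[where w = "\<lambda>z. \<bar>f z\<bar>"])
      show "AE z in L. (\<lambda>n. f z * (1 - (1 - fst z) ^ n)) \<longlonglongrightarrow> f z - indicator E z * f z"
      proof (intro AE_I2)
        fix z assume "z \<in> space L"
        then have z: "z \<in> unit_sq" by (simp add: space_eq)
        show "(\<lambda>n. f z * (1 - (1 - fst z) ^ n)) \<longlonglongrightarrow> f z - indicator E z * f z"
        proof (cases "fst z = 0")
          case True
          then have "z \<in> E" using z by (cases z) (auto simp: E_def unit_sq_def)
          then show ?thesis using True by simp
        next
          case False
          then have "0 \<le> 1 - fst z" "1 - fst z < 1" using z by (auto simp: unit_sq_def)
          then have "(\<lambda>n. (1 - fst z) ^ n) \<longlonglongrightarrow> 0" by (rule LIMSEQ_realpow_zero)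
          then have "(\<lambda>n. f z * (1 - (1 - fst z) ^ n)) \<longlonglongrightarrow> f z * (1 - 0)"
            by (intro tendsto_mult tendsto_diff tendsto_const)
          moreover have "z \<notin> E" using False by (auto simp: E_def)
          ultimately show ?thesis by simp
        qed
      qed
      show "AE z in L. norm (f z * (1 - (1 - fst z) ^ n)) \<le> \<bar>f z\<bar>" for n
      proof (intro AE_I2)
        fix z assume "z \<in> space L"
        then have "0 \<le> (1 - fst z) ^ n" "(1 - fst z) ^ n \<le> 1"
          by (auto simp: space_eq unit_sq_def intro!: power_le_one)
        then have "\<bar>1 - (1 - fst z) ^ n\<bar> \<le> 1" by simp
        from mult_left_mono[OF this, of "\<bar>f z\<bar>"]
        show "norm (f z * (1 - (1 - fst z) ^ n)) \<le> \<bar>f z\<bar>" by (simp add: abs_mult)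
      qed
    qed (use fi Ei in auto)
    then show ?thesis using fi Ei by simp
  qed
  have fin: "finite_pos_measure (fst \<delta>)" "finite_pos_measure (snd \<delta>)"
    using \<delta> by (simp_all add: finite_signed_def)
  \<comment> \<open>The cutoffs lose the contribution of time 0 in the limit;
    \<open>balanced {0}\<close> makes the losses of the two parts cancel.\<close>
  have E_eq: "(\<integral>z. indicator E z * f z \<partial>fst \<delta>) = (\<integral>z. indicator E z * f z \<partial>snd \<delta>)"
  proof -
    have "density (fst \<delta>) (indicator E) = density (snd \<delta>) (indicator E)"
    proof (rule measure_eqI)
      show "sets (density (fst \<delta>) (indicator E)) = sets (density (snd \<delta>) (indicator E))"
        using fin by (simp add: finite_pos_measure_def)
      fix A assume "A \<in> sets (density (fst \<delta>) (indicator E))"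
      then have A: "A \<in> sets borel_sq" using fin by (simp add: finite_pos_measure_def)
      have d: "emeasure (density L (indicator E)) A = ennreal (measure L (E \<inter> A))" if L: "finite_pos_measure L" for L
      proof -
        interpret finite_pos L by unfold_locales (rule L)
        show ?thesis using A E sets_eq by (simp add: emeasure_restricted emeasure_eq_measure)
      qed
      have "measure (fst \<delta>) (E \<inter> A) = measure (snd \<delta>) (E \<inter> A)"
        using bal A E by (auto simp: E_def)
      then show "emeasure (density (fst \<delta>) (indicator E)) A = emeasure (density (snd \<delta>) (indicator E)) A"
        unfolding d[OF fin(1)] d[OF fin(2)] by simp
    qed
    moreover have "(\<integral>z. indicator E z * f z \<partial>L) = (\<integral>z. f z \<partial>density L (indicator E))" if L: "finite_pos_measure L" for L
    proof -
      have i: "(indicator E :: _ \<Rightarrow> ennreal) = (\<lambda>z. ennreal (indicator E z))"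
        by (auto simp: fun_eq_iff split: split_indicator)
      have "f \<in> borel_measurable L" using integrable_continuous_finite_pos[OF L f] by simp
      moreover have "E \<in> sets L" using E L by (simp add: finite_pos_measure_def)
      ultimately show ?thesis unfolding i by (simp add: integral_density)
    qed
    ultimately show ?thesis using fin by simp
  qed
  show ?thesis
    unfolding signed_integral_def
    using tendsto_diff[OF lim[OF fin(1)] lim[OF fin(2)]] by (simp add: E_eq)
qed

text \<open>One derivative without initial mass controls all others: the cutoff test functions
  vanish at both times, so any derivative in the open interval agrees with \<delta> on them, and
  neither charges time 0 in the limit.\<close>

lemma M0_I:
  assumes D: "finite_pos_measure \<Delta>" and w: "weak_dt {1} \<Delta> \<delta>" and bal: "balanced {0} \<delta>"
  shows "\<Delta> \<in> M0"
proof -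
  have "weak_dt {1} \<Delta> \<delta>'" if w': "weak_dt {0, 1} \<Delta> \<delta>'" for \<delta>'
  proof -
    have fin: "finite_signed \<delta>" "finite_signed \<delta>'" using w w' by (simp_all add: weak_dt_def)
    have bal': "A \<in> sets borel_sq \<Longrightarrow> A \<subseteq> {0, 1} \<times> {0..1} \<Longrightarrow> measure (fst \<delta>') A = measure (snd \<delta>') A" for A
      using w' unfolding weak_dt_def by blast
    have t: "(\<integral>z. g' z \<partial>\<Delta>) + signed_integral \<delta> g = 0"
      if "C1_in_time g g'" "\<forall>x\<in>{0..1}. g (1, x) = 0" for g g'
      using w that unfolding weak_dt_def by blast
    have t': "(\<integral>z. g' z \<partial>\<Delta>) + signed_integral \<delta>' g = 0"
      if "C1_in_time g g'" "\<forall>x\<in>{0..1}. g (1, x) = 0" "\<forall>x\<in>{0..1}. g (0, x) = 0" for g g'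
      using w' that unfolding weak_dt_def by blast
    have "(\<integral>z. f' z \<partial>\<Delta>) + signed_integral \<delta>' f = 0"
      if f: "C1_in_time f f'" "\<forall>x\<in>{0..1}. f (1, x) = 0" for f f'
    proof -
      have c: "continuous_on unit_sq f" using f(1) by (simp add: C1_in_time_def)
      have eq: "signed_integral \<delta>' (\<lambda>z. f z * (1 - (1 - fst z) ^ n)) = signed_integral \<delta> (\<lambda>z. f z * (1 - (1 - fst z) ^ n))" for n
        using t[OF C1_in_time_cutoff[OF f(1), of n]] t'[OF C1_in_time_cutoff[OF f(1), of n]] f(2) by simp
      have "balanced {0} \<delta>'" using bal' by auto
      from signed_integral_cutoff[OF fin(2) this c]
      have "(\<lambda>n. signed_integral \<delta> (\<lambda>z. f z * (1 - (1 - fst z) ^ n))) \<longlonglongrightarrow> signed_integral \<delta>' f"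
        unfolding eq .
      from LIMSEQ_unique[OF this signed_integral_cutoff[OF fin(1) bal c]]
      have "signed_integral \<delta>' f = signed_integral \<delta> f" .
      then show ?thesis using t[OF f] by simp
    qed
    moreover have "balanced {1} \<delta>'" using bal' by auto
    ultimately show ?thesis using fin(2) unfolding weak_dt_def by blast
  qed
  then show ?thesis using D by (simp add: M0_def)
qed

text \<open>Test functions vanishing at time 0 do not see what a derivative does there. Erasing that
  part leaves a derivative in the open interval, and membership in \<open>M0\<close> promotes it to
  test functions that do not vanish at time 0.\<close>

lemma M0_E:
  assumes D: "\<Delta> \<in> M0" and "dt_is_measure \<Delta>"
  obtains \<delta> where "weak_dt {1} \<Delta> \<delta>" "balanced {0} \<delta>"
proof -
  obtain \<delta> where w: "weak_dt {1} \<Delta> \<delta>" using assms(2) unfolding dt_is_measure_def by blast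
  define E where "E = unit_sq - {0::real} \<times> {0..1::real}"
  have E0: "{0} \<times> {0..1} \<in> sets borel_sq" by (rule Z_Times_sets) auto
  have E: "E \<in> sets borel_sq"
    unfolding E_def using sets.compl_sets[OF E0] by simp
  have fin: "finite_pos_measure (fst \<delta>)" "finite_pos_measure (snd \<delta>)"
    using w by (simp_all add: weak_dt_def finite_signed_def)
  define R where "R = (\<lambda>L::(real \<times> real) measure. density L (indicator E))"
  have R: "finite_pos_measure (R L)" "A \<in> sets borel_sq \<Longrightarrow> measure (R L) A = measure L (E \<inter> A)"
    "continuous_on unit_sq f \<Longrightarrow> (\<integral>z. f z \<partial>R L) = (\<integral>z. indicator E z * f z \<partial>L)"
    if L: "finite_pos_measure L" for L A and f :: "real \<times> real \<Rightarrow> real"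
  proof -
    interpret finite_pos L by unfold_locales (rule L)
    have em: "emeasure (R L) A = emeasure L (E \<inter> A)" if "A \<in> sets borel_sq" for A
      unfolding R_def using that E sets_eq by (simp add: emeasure_restricted)
    then show "A \<in> sets borel_sq \<Longrightarrow> measure (R L) A = measure L (E \<inter> A)" by (simp add: measure_def)
    have "space (R L) = unit_sq" by (simp add: R_def space_eq)
    then have "emeasure (R L) (space (R L)) \<noteq> \<infinity>"
      using em[OF sets.top] emeasure_finite by simp
    then show "finite_pos_measure (R L)"
      using sets_eq by (auto simp: finite_pos_measure_def R_def intro: finite_measureI)
    assume f: "continuous_on unit_sq f"
    have i: "(indicator E :: _ \<Rightarrow> ennreal) = (\<lambda>z. ennreal (indicator E z))"
      by (auto simp: fun_eq_iff split: split_indicator)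
    have "f \<in> borel_measurable L" using integrable_continuous_finite_pos[OF L f] by simp
    then show "(\<integral>z. f z \<partial>R L) = (\<integral>z. indicator E z * f z \<partial>L)"
      unfolding R_def i using E sets_eq by (simp add: integral_density)
  qed
  define \<delta>' where "\<delta>' = (R (fst \<delta>), R (snd \<delta>))"
  have "weak_dt {0, 1} \<Delta> \<delta>'"
    unfolding weak_dt_def
  proof (intro conjI ballI impI allI)
    show "finite_signed \<delta>'" using R(1) fin by (simp add: finite_signed_def \<delta>'_def)
    fix A assume A: "A \<in> sets borel_sq" "A \<subseteq> {0, 1} \<times> {0..1}"
    then have "E \<inter> A \<in> sets borel_sq" "E \<inter> A \<subseteq> {1} \<times> {0..1}" using E by (auto simp: E_def)
    then have "measure (fst \<delta>) (E \<inter> A) = measure (snd \<delta>) (E \<inter> A)"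
      using w unfolding weak_dt_def by blast
    then show "measure (fst \<delta>') A = measure (snd \<delta>') A"
      using R(2) fin A(1) by (simp add: \<delta>'_def)
  next
    fix f f' :: "real \<times> real \<Rightarrow> real"
    assume f: "C1_in_time f f' \<and> (\<forall>t\<in>{0, 1}. \<forall>x\<in>{0..1}. f (t, x) = 0)"
    have c: "continuous_on unit_sq f" using f by (simp add: C1_in_time_def)
    have "(\<integral>z. f z \<partial>R L) = (\<integral>z. f z \<partial>L)" if L: "finite_pos_measure L" for L
      unfolding R(3)[OF L c]
      by (rule Bochner_Integration.integral_cong[OF refl])
        (use f in \<open>auto simp: E_def space_finite_pos[OF L] unit_sq_def split: split_indicator\<close>)
    then have "signed_integral \<delta>' f = signed_integral \<delta> f"
      using fin by (simp add: signed_integral_def \<delta>'_def)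
    moreover have "(\<integral>z. f' z \<partial>\<Delta>) + signed_integral \<delta> f = 0"
      using w f unfolding weak_dt_def by blast
    ultimately show "(\<integral>z. f' z \<partial>\<Delta>) + signed_integral \<delta>' f = 0" by simp
  qed
  then have "weak_dt {1} \<Delta> \<delta>'" using D unfolding M0_def by blast
  moreover have "balanced {0} \<delta>'"
  proof (intro ballI impI)
    fix A assume A: "A \<in> sets borel_sq" "A \<subseteq> {0} \<times> {0..1}"
    then have "E \<inter> A = {}" by (auto simp: E_def)
    then show "measure (fst \<delta>') A = measure (snd \<delta>') A"
      using R(2) fin A(1) by (simp add: \<delta>'_def)
  qed
  ultimately show thesis by (rule that)
qed

definition slincomb :: "real \<Rightarrow> signed_measure \<Rightarrow> real \<Rightarrow> signed_measure \<Rightarrow> signed_measure" where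
  "slincomb a \<delta> b \<epsilon> = (lincomb a (fst \<delta>) b (fst \<epsilon>), lincomb a (snd \<delta>) b (snd \<epsilon>))"

lemma balanced_slincomb:
  assumes "finite_signed \<delta>" "finite_signed \<epsilon>" "balanced Z \<delta>" "balanced Z \<epsilon>" "0 \<le> a" "0 \<le> b"
  shows "balanced Z (slincomb a \<delta> b \<epsilon>)"
  using assms by (auto simp: slincomb_def finite_signed_def finite_pos_measure_def measure_lincomb)

lemma weak_dt_lincomb:
  assumes D: "finite_pos_measure \<Delta>" "finite_pos_measure \<mu>" and w: "weak_dt Z \<Delta> \<delta>" "weak_dt Z \<mu> \<epsilon>"
    and ab: "0 \<le> a" "0 \<le> b"
  shows "weak_dt Z (lincomb a \<Delta> b \<mu>) (slincomb a \<delta> b \<epsilon>)"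
proof -
  have fs: "finite_signed \<delta>" "finite_signed \<epsilon>" and bal: "balanced Z \<delta>" "balanced Z \<epsilon>"
    using w unfolding weak_dt_def by blast+
  have f: "finite_pos_measure (fst \<delta>)" "finite_pos_measure (snd \<delta>)" "finite_pos_measure (fst \<epsilon>)" "finite_pos_measure (snd \<epsilon>)"
    using fs by (simp_all add: finite_signed_def)
  have int: "(\<integral>z. g z \<partial>lincomb a M b N) = a * (\<integral>z. g z \<partial>M) + b * (\<integral>z. g z \<partial>N)"
    if "finite_pos_measure M" "finite_pos_measure N" "continuous_on unit_sq g" for M N and g :: "real \<times> real \<Rightarrow> real"
    using that ab by (intro integral_lincomb integrable_continuous_finite_pos) (auto simp: finite_pos_measure_def)
  have "(\<integral>z. g' z \<partial>lincomb a \<Delta> b \<mu>) + signed_integral (slincomb a \<delta> b \<epsilon>) g = 0"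
    if g: "C1_in_time g g'" "\<forall>t\<in>Z. \<forall>x\<in>{0..1}. g (t, x) = 0" for g g'
  proof -
    have c: "continuous_on unit_sq g" "continuous_on unit_sq g'" using g(1) by (simp_all add: C1_in_time_def)
    have e: "(\<integral>z. g' z \<partial>\<Delta>) + signed_integral \<delta> g = 0" "(\<integral>z. g' z \<partial>\<mu>) + signed_integral \<epsilon> g = 0"
      using w g unfolding weak_dt_def by blast+
    have "(\<integral>z. g' z \<partial>lincomb a \<Delta> b \<mu>) + signed_integral (slincomb a \<delta> b \<epsilon>) g
      = a * ((\<integral>z. g' z \<partial>\<Delta>) + signed_integral \<delta> g) + b * ((\<integral>z. g' z \<partial>\<mu>) + signed_integral \<epsilon> g)"
      using int[OF D c(2)] int[OF f(1,3) c(1)] int[OF f(2,4) c(1)]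
      by (simp add: signed_integral_def slincomb_def algebra_simps)
    then show ?thesis using e by simp
  qed
  moreover have "finite_signed (slincomb a \<delta> b \<epsilon>)"
    using f by (simp add: finite_signed_def slincomb_def finite_pos_lincomb)
  moreover have "balanced Z (slincomb a \<delta> b \<epsilon>)" by (rule balanced_slincomb[OF fs bal ab])
  ultimately show ?thesis unfolding weak_dt_def by blast
qed

lemma M0_finite_pos: "\<Delta> \<in> M0 \<Longrightarrow> finite_pos_measure \<Delta>"
  by (simp add: M0_def)

text \<open>The implication defining \<open>M0\<close> does not pass to sums directly. Its
  equivalent, a derivative without mass at time 0, does.\<close>

lemma M0_lincomb:
  assumes D: "\<Delta> \<in> M0" "dt_is_measure \<Delta>" and m: "\<mu> \<in> M0" "dt_is_measure \<mu>" and ab: "0 \<le> a" "0 \<le> b"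
  shows "lincomb a \<Delta> b \<mu> \<in> M0" "dt_is_measure (lincomb a \<Delta> b \<mu>)"
proof -
  obtain \<delta> where d: "weak_dt {1} \<Delta> \<delta>" "balanced {0} \<delta>" by (rule M0_E[OF D])
  obtain \<epsilon> where e: "weak_dt {1} \<mu> \<epsilon>" "balanced {0} \<epsilon>" by (rule M0_E[OF m])
  note f = M0_finite_pos[OF D(1)] M0_finite_pos[OF m(1)]
  note w = weak_dt_lincomb[OF f d(1) e(1) ab]
  show "dt_is_measure (lincomb a \<Delta> b \<mu>)" using w unfolding dt_is_measure_def by blast
  have "finite_signed \<delta>" "finite_signed \<epsilon>" using d(1) e(1) by (simp_all add: weak_dt_def)
  then show "lincomb a \<Delta> b \<mu> \<in> M0"
    using M0_I[OF finite_pos_lincomb[OF f] w] balanced_slincomb[OF _ _ d(2) e(2) ab] by blast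
qed

lemma finite_pos_null: "finite_pos_measure (null_measure borel_sq)"
  by (auto simp: finite_pos_measure_def intro: finite_measureI)

lemma weak_dt_null: "weak_dt Z (null_measure borel_sq) (null_measure borel_sq, null_measure borel_sq)"
  by (simp add: weak_dt_def finite_signed_def finite_pos_null signed_integral_def)

lemma null_in_M0: "null_measure borel_sq \<in> M0" "dt_is_measure (null_measure borel_sq)"
  using M0_I[OF finite_pos_null weak_dt_null] weak_dt_null unfolding dt_is_measure_def by (simp, blast)

section \<open>The Fisher-Rao functional\<close>

lemma borel_measurable_fr_integrand [measurable]:
  assumes [measurable]: "X \<in> borel_measurable M" "Y \<in> borel_measurable M"
  shows "(\<lambda>z. fr_integrand (X z) (Y z)) \<in> borel_measurable M"
  unfolding fr_integrand_def by measurable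

text \<open>Homogeneity includes \<open>c = 0\<close> thanks to the conventions r(0,0) = 0 and 0
  times \<infinity> equal to 0. This matters where a dominating density vanishes.\<close>

lemma fr_integrand_scale:
  assumes "c \<ge> 0" shows "fr_integrand (c * x) (c * y) = ennreal c * fr_integrand x y"
proof (cases "c = 0")
  case False
  then have c: "c > 0" using assms by simp
  show ?thesis
  proof (cases "x > 0")
    case True
    have "1/4 * ((c * y)\<^sup>2 / (c * x)) = c * (1/4 * (y\<^sup>2 / x))"
      using c by (simp add: power2_eq_square)
    then show ?thesis
      using True c by (simp add: fr_integrand_def ennreal_mult[symmetric] del: times_divide_eq_right times_divide_eq_left)
  next
    case False
    then have "\<not> c * x > 0" using c by (simp add: zero_less_mult_iff)
    then show ?thesis
      using False c by (auto simp: fr_integrand_def ennreal_mult_top)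
  qed
qed (simp add: fr_integrand_def)

text \<open>For positive arguments the defect is a square divided by a positive number. At the
  boundary either one summand is zero or the right-hand side is infinite.\<close>

lemma fr_integrand_subadditive:
  assumes "0 \<le> x" "0 \<le> x'"
  shows "fr_integrand (x + x') (y + y') \<le> fr_integrand x y + fr_integrand x' y'"
proof -
  consider "x > 0" "x' > 0" | "x = 0" "y = 0" | "x' = 0" "y' = 0" | "x = 0" "y \<noteq> 0" | "x' = 0" "y' \<noteq> 0"
    using assms by fastforce
  then show ?thesis
  proof cases
    case 1
    have "(y + y')\<^sup>2 / (x + x') \<le> y\<^sup>2 / x + y'\<^sup>2 / x'"
    proof -
      have "y\<^sup>2 / x + y'\<^sup>2 / x' - (y + y')\<^sup>2 / (x + x') = (x' * y - x * y')\<^sup>2 / (x * x' * (x + x'))"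
        using 1 by (simp add: field_simps power2_eq_square)
      also have "\<dots> \<ge> 0" using 1 by simp
      finally show ?thesis by simp
    qed
    then have "1/4 * ((y + y')\<^sup>2 / (x + x')) \<le> 1/4 * (y\<^sup>2 / x) + 1/4 * (y'\<^sup>2 / x')"
      by linarith
    then have "ennreal (1/4 * ((y + y')\<^sup>2 / (x + x'))) \<le> ennreal (1/4 * (y\<^sup>2 / x) + 1/4 * (y'\<^sup>2 / x'))"
      by (rule ennreal_leI)
    also have "\<dots> = ennreal (1/4 * (y\<^sup>2 / x)) + ennreal (1/4 * (y'\<^sup>2 / x'))"
      using 1 by (intro ennreal_plus) auto
    finally show ?thesis
      unfolding fr_integrand_def using 1 by (simp only: add_pos_pos if_True)
  qed (auto simp: fr_integrand_def)
qed

lemma fr_integrand_convex: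
  assumes "0 \<le> x" "0 \<le> x'" "0 \<le> a" "0 \<le> b"
  shows "fr_integrand (a * x + b * x') (a * y + b * y')
    \<le> ennreal a * fr_integrand x y + ennreal b * fr_integrand x' y'"
proof -
  have "fr_integrand (a * x + b * x') (a * y + b * y')
      \<le> fr_integrand (a * x) (a * y) + fr_integrand (b * x') (b * y')"
    using assms by (intro fr_integrand_subadditive) auto
  also have "\<dots> \<le> ennreal a * fr_integrand x y + ennreal b * fr_integrand x' y'"
    using assms by (simp add: fr_integrand_scale)
  finally show ?thesis .
qed

text \<open>Finiteness of \<nu> makes its density finite almost everywhere; real values are wanted
  since densities of positive and negative parts will be subtracted.\<close>

lemma density_real_exists:
  assumes \<rho>: "finite_pos_measure \<rho>" and \<nu>: "finite_pos_measure \<nu>" and ac: "absolutely_continuous \<rho> \<nu>"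
  obtains g where "g \<in> borel_measurable borel_sq" "\<And>z. 0 \<le> g z" "\<nu> = density \<rho> (\<lambda>z. ennreal (g z))"
proof -
  interpret r: finite_pos \<rho> by unfold_locales (rule \<rho>)
  interpret n: finite_pos \<nu> by unfold_locales (rule \<nu>)
  obtain h where h: "h \<in> borel_measurable \<rho>" "density \<rho> h = \<nu>"
    using r.Radon_Nikodym[OF ac] r.sets_eq n.sets_eq by auto
  have "(\<integral>\<^sup>+z. h z \<partial>\<rho>) = emeasure \<nu> (space \<nu>)"
    unfolding h(2)[symmetric] using h(1) by (simp add: emeasure_density cong: nn_integral_cong)
  then have "(\<integral>\<^sup>+z. h z \<partial>\<rho>) \<noteq> \<infinity>" using n.emeasure_finite by simp
  then have "AE z in \<rho>. h z \<noteq> \<infinity>" by (rule nn_integral_PInf_AE[OF h(1)])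
  then have "AE z in \<rho>. h z = ennreal (enn2real (h z))"
    by eventually_elim (simp add: less_top)
  then have "density \<rho> h = density \<rho> (\<lambda>z. ennreal (enn2real (h z)))"
    using h(1) by (intro density_cong) auto
  moreover have "(\<lambda>z. enn2real (h z)) \<in> borel_measurable borel_sq"
    using h(1) unfolding measurable_finite_pos[OF \<rho>] by measurable
  ultimately show thesis using h(2) by (intro that[of "\<lambda>z. enn2real (h z)"]) auto
qed

lemma absolutely_continuous_of_le:
  assumes "sets \<nu> = sets \<rho>" "\<And>A. A \<in> sets \<rho> \<Longrightarrow> emeasure \<nu> A \<le> emeasure \<rho> A"
  shows "absolutely_continuous \<rho> \<nu>"
  unfolding absolutely_continuous_def
proof
  fix A assume "A \<in> null_sets \<rho>"
  then show "A \<in> null_sets \<nu>" using assms(1) assms(2)[of A] by (auto simp: null_sets_def)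
qed

text \<open>Frees the functional from the supremum in its definition. With \<open>h\<close> the
  density of that supremum relative to \<rho>, the chain rule gives \<open>h\<close> times each
  Radon-Nikodym derivative as the given density, and homogeneity of the integrand absorbs the factor
  \<open>h\<close>.\<close>

theorem fisher_rao_density:
  assumes \<rho>: "finite_pos_measure \<rho>"
    and m: "X \<in> borel_measurable borel_sq" "Y \<in> borel_measurable borel_sq" "Y' \<in> borel_measurable borel_sq"
    and nonneg: "\<And>z. 0 \<le> X z" "\<And>z. 0 \<le> Y z" "\<And>z. 0 \<le> Y' z"
    and fin: "finite_pos_measure \<mu>" "finite_signed \<delta>"
    and dens: "\<mu> = density \<rho> (\<lambda>z. ennreal (X z))" "fst \<delta> = density \<rho> (\<lambda>z. ennreal (Y z))"
      "snd \<delta> = density \<rho> (\<lambda>z. ennreal (Y' z))"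
    and f: "f \<in> borel_measurable borel_sq"
  shows "fisher_rao f (signed_of \<mu>) \<delta> = (\<integral>\<^sup>+z. fr_integrand (X z) (Y z - Y' z) * ennreal (f z) \<partial>\<rho>)"
proof -
  have fd: "finite_pos_measure (fst \<delta>)" "finite_pos_measure (snd \<delta>)"
    using fin(2) by (simp_all add: finite_signed_def)
  interpret r: finite_pos \<rho> by unfold_locales (rule \<rho>)
  have sets': "sets \<mu> = sets borel_sq" "sets (fst \<delta>) = sets borel_sq" "sets (snd \<delta>) = sets borel_sq"
    using fin fd by (simp_all add: finite_pos_measure_def)
  define \<sigma> where "\<sigma> = sup (sup \<mu> (null_measure \<mu>)) (sup (fst \<delta>) (snd \<delta>))"
  \<comment> \<open>The supremum is controlled from above by the sum of the measures, which yields
    its finiteness and its absolute continuity.\<close>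
  define s where "s = lincomb 1 \<mu> 1 (lincomb 1 (fst \<delta>) 1 (snd \<delta>))"
  have s_sets: "sets s = sets borel_sq" by (simp add: s_def sets')
  have s_em: "emeasure s A = emeasure \<mu> A + (emeasure (fst \<delta>) A + emeasure (snd \<delta>) A)" if "A \<in> sets borel_sq" for A
    unfolding s_def using that sets' by (simp add: emeasure_lincomb)
  have \<sigma>_sets: "sets \<sigma> = sets borel_sq"
    unfolding \<sigma>_def by (intro sets_sup) (simp_all add: sets')
  have le_s: "\<sigma> \<le> s"
    unfolding \<sigma>_def
    by (intro sup_least; subst le_measure) (auto simp: sets' s_sets s_em add_increasing add_increasing2)
  have \<sigma>_le: "emeasure \<sigma> A \<le> emeasure s A" for A
    using le_measureD3[OF le_s] \<sigma>_sets s_sets by simp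
  have s_fin: "finite_pos_measure s"
    unfolding s_def by (intro finite_pos_lincomb fin fd)
  have \<sigma>_fin: "finite_pos_measure \<sigma>"
  proof -
    have "emeasure \<sigma> (space \<sigma>) \<noteq> \<infinity>"
      using \<sigma>_le[of "space \<sigma>"] s_fin finite_measure.emeasure_finite[of s "space \<sigma>"]
      by (auto simp: finite_pos_measure_def top_unique)
    then show ?thesis using \<sigma>_sets by (auto simp: finite_pos_measure_def intro: finite_measureI)
  qed
  interpret \<sigma>: finite_pos \<sigma> by unfold_locales (rule \<sigma>_fin)
  have ac: "absolutely_continuous \<rho> \<sigma>"
    unfolding absolutely_continuous_def
  proof
    fix A assume A: "A \<in> null_sets \<rho>"
    have "absolutely_continuous \<rho> \<mu>" "absolutely_continuous \<rho> (fst \<delta>)" "absolutely_continuous \<rho> (snd \<delta>)"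
      unfolding dens using m by (auto intro!: absolutely_continuousI_density simp: measurable_finite_pos[OF \<rho>])
    then have "A \<in> null_sets \<mu>" "A \<in> null_sets (fst \<delta>)" "A \<in> null_sets (snd \<delta>)"
      using A by (auto simp: absolutely_continuous_def)
    then have "emeasure s A = 0" using sets' by (subst s_em) (auto simp: null_sets_def)
    then show "A \<in> null_sets \<sigma>" using \<sigma>_le[of A] A \<sigma>_sets r.sets_eq by (auto simp: null_sets_def)
  qed
  obtain h where h: "h \<in> borel_measurable borel_sq" "\<And>z. 0 \<le> h z" "\<sigma> = density \<rho> (\<lambda>z. ennreal (h z))"
    by (rule density_real_exists[OF \<rho> \<sigma>_fin ac], blast)
  have hm: "(\<lambda>z. ennreal (h z)) \<in> borel_measurable \<rho>"
    using h(1) unfolding measurable_finite_pos[OF \<rho>] by measurable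
  have rn: "AE z in \<rho>. ennreal (h z) * RN_deriv \<sigma> \<nu> z = ennreal (g z)"
    if \<nu>: "finite_pos_measure \<nu>" "\<nu> \<le> \<sigma>" and g: "g \<in> borel_measurable borel_sq" "\<nu> = density \<rho> (\<lambda>z. ennreal (g z))"
    for \<nu> and g :: "real \<times> real \<Rightarrow> real"
  proof -
    have ns: "sets \<nu> = sets \<sigma>" using \<nu>(1) \<sigma>_sets by (simp add: finite_pos_measure_def)
    have "absolutely_continuous \<sigma> \<nu>"
      using le_measureD3[OF \<nu>(2) ns] by (intro absolutely_continuous_of_le[OF ns])
    from \<sigma>.density_RN_deriv[OF this ns] have "density \<sigma> (RN_deriv \<sigma> \<nu>) = \<nu>" .
    moreover have rm: "RN_deriv \<sigma> \<nu> \<in> borel_measurable \<rho>"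
      using borel_measurable_RN_deriv[of \<sigma> \<nu>] measurable_finite_pos[OF \<rho>] measurable_finite_pos[OF \<sigma>_fin] by metis
    ultimately have "density \<rho> (\<lambda>z. ennreal (h z) * RN_deriv \<sigma> \<nu> z) = density \<rho> (\<lambda>z. ennreal (g z))"
      using density_density_eq[OF hm rm] h(3) g(2) by simp
    moreover have gm: "(\<lambda>z. ennreal (g z)) \<in> borel_measurable \<rho>"
      using g(1) unfolding measurable_finite_pos[OF \<rho>] by measurable
    moreover have "sigma_finite_measure (density \<rho> (\<lambda>z. ennreal (h z) * RN_deriv \<sigma> \<nu> z))"
      using calculation(1) \<nu>(1) g(2) by (simp add: finite_pos_measure_def finite_measure.axioms(1))
    ultimately show ?thesis
      using hm rm by (subst (asm) sigma_finite_density_unique) auto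
  qed
  have le: "\<mu> \<le> \<sigma>" "null_measure \<mu> \<le> \<sigma>" "fst \<delta> \<le> \<sigma>" "snd \<delta> \<le> \<sigma>"
    unfolding \<sigma>_def by (simp_all add: le_supI1 le_supI2)
  have null: "null_measure \<mu> = density \<rho> (\<lambda>z. ennreal 0)" "finite_pos_measure (null_measure \<mu>)"
  proof -
    show "null_measure \<mu> = density \<rho> (\<lambda>z. ennreal 0)"
      by (rule measure_eqI) (auto simp: sets' r.sets_eq emeasure_density)
    show "finite_pos_measure (null_measure \<mu>)"
      by (auto simp: finite_pos_measure_def sets' intro: finite_measureI)
  qed
  have rnm: "RN_deriv \<sigma> \<nu> \<in> borel_measurable borel_sq" for \<nu>
    using borel_measurable_RN_deriv[of \<sigma> \<nu>] measurable_finite_pos[OF \<sigma>_fin] by metis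
  have "fisher_rao f (signed_of \<mu>) \<delta> = (\<integral>\<^sup>+z. fr_integrand (signed_density \<sigma> (\<mu>, null_measure \<mu>) z) (signed_density \<sigma> \<delta> z) * ennreal (f z) \<partial>\<sigma>)"
    unfolding fisher_rao_def signed_of_def Let_def fst_conv snd_conv \<sigma>_def ..
  also have "\<dots> = (\<integral>\<^sup>+z. ennreal (h z) * (fr_integrand (signed_density \<sigma> (\<mu>, null_measure \<mu>) z) (signed_density \<sigma> \<delta> z) * ennreal (f z)) \<partial>\<rho>)"
  proof -
    have "(\<lambda>z. fr_integrand (signed_density \<sigma> (\<mu>, null_measure \<mu>) z) (signed_density \<sigma> \<delta> z) * ennreal (f z)) \<in> borel_measurable borel_sq"
      unfolding signed_density_def using rnm f by measurable
    then have "(\<lambda>z. fr_integrand (signed_density \<sigma> (\<mu>, null_measure \<mu>) z) (signed_density \<sigma> \<delta> z) * ennreal (f z)) \<in> borel_measurable \<rho>"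
      unfolding measurable_finite_pos[OF \<rho>] .
    moreover have "(\<integral>\<^sup>+z. k z \<partial>\<sigma>) = (\<integral>\<^sup>+z. ennreal (h z) * k z \<partial>\<rho>)" if "k \<in> borel_measurable \<rho>" for k
      by (subst h(3)) (rule nn_integral_density[OF hm that])
    ultimately show ?thesis by blast
  qed
  also have "\<dots> = (\<integral>\<^sup>+z. fr_integrand (X z) (Y z - Y' z) * ennreal (f z) \<partial>\<rho>)"
  proof (rule nn_integral_cong_AE)
    show "AE z in \<rho>. ennreal (h z) * (fr_integrand (signed_density \<sigma> (\<mu>, null_measure \<mu>) z) (signed_density \<sigma> \<delta> z) * ennreal (f z))
      = fr_integrand (X z) (Y z - Y' z) * ennreal (f z)"
      using rn[OF fin(1) le(1) m(1) dens(1)] rn[OF null(2) le(2) borel_measurable_const null(1)]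
        rn[OF fd(1) le(3) m(2) dens(2)] rn[OF fd(2) le(4) m(3) dens(3)]
    proof eventually_elim
      fix z
      assume e: "ennreal (h z) * RN_deriv \<sigma> \<mu> z = ennreal (X z)"
        "ennreal (h z) * RN_deriv \<sigma> (null_measure \<mu>) z = ennreal 0"
        "ennreal (h z) * RN_deriv \<sigma> (fst \<delta>) z = ennreal (Y z)"
        "ennreal (h z) * RN_deriv \<sigma> (snd \<delta>) z = ennreal (Y' z)"
      have q: "h z * enn2real x = c" if "ennreal (h z) * x = ennreal c" "0 \<le> c" for x c
        using arg_cong[OF that(1), of enn2real] that(2) h(2)[of z] by (simp add: enn2real_mult)
      have X: "h z * signed_density \<sigma> (\<mu>, null_measure \<mu>) z = X z"
        and Y: "h z * signed_density \<sigma> \<delta> z = Y z - Y' z"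
        unfolding signed_density_def using q[OF e(1)] q[OF e(2)] q[OF e(3)] q[OF e(4)] nonneg
        by (simp_all add: right_diff_distrib)
      show "ennreal (h z) * (fr_integrand (signed_density \<sigma> (\<mu>, null_measure \<mu>) z) (signed_density \<sigma> \<delta> z) * ennreal (f z))
        = fr_integrand (X z) (Y z - Y' z) * ennreal (f z)"
        unfolding X[symmetric] Y[symmetric] fr_integrand_scale[OF h(2)] by (simp add: mult.assoc)
    qed
  qed
  finally show ?thesis .
qed

lemma density_lincomb:
  assumes g: "g \<in> borel_measurable M" "g' \<in> borel_measurable M" and nn: "\<And>z. 0 \<le> g z" "\<And>z. 0 \<le> g' z"
    and ab: "0 \<le> a" "0 \<le> b"
  shows "lincomb a (density M (\<lambda>z. ennreal (g z))) b (density M (\<lambda>z. ennreal (g' z)))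
    = density M (\<lambda>z. ennreal (a * g z + b * g' z))"
proof (rule measure_eqI)
  fix A assume "A \<in> sets (lincomb a (density M (\<lambda>z. ennreal (g z))) b (density M (\<lambda>z. ennreal (g' z))))"
  then have A: "A \<in> sets M" by simp
  have "emeasure (density M (\<lambda>z. ennreal (a * g z + b * g' z))) A
    = (\<integral>\<^sup>+z. ennreal a * (ennreal (g z) * indicator A z) + ennreal b * (ennreal (g' z) * indicator A z) \<partial>M)"
    using A g nn ab
    by (subst emeasure_density) (auto intro!: nn_integral_cong simp: ennreal_mult distrib_right mult.assoc split: split_indicator)
  also have "\<dots> = emeasure (lincomb a (density M (\<lambda>z. ennreal (g z))) b (density M (\<lambda>z. ennreal (g' z)))) A"
    using A g by (simp add: emeasure_lincomb emeasure_density nn_integral_add nn_integral_cmult)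
  finally show "emeasure (lincomb a (density M (\<lambda>z. ennreal (g z))) b (density M (\<lambda>z. ennreal (g' z)))) A
    = emeasure (density M (\<lambda>z. ennreal (a * g z + b * g' z))) A" ..
qed simp

lemma dt_weak_dt: "dt_is_measure \<Delta> \<Longrightarrow> weak_dt {1} \<Delta> (dt \<Delta>)"
  unfolding dt_is_measure_def dt_def by (rule someI_ex)

lemma density_eq_AE:
  assumes g: "g \<in> borel_measurable M" "g' \<in> borel_measurable M" and fin: "finite_measure (density M (\<lambda>z. ennreal (g z)))"
    and nn: "\<And>z. 0 \<le> g z" "\<And>z. 0 \<le> g' z"
    and eq: "density M (\<lambda>z. ennreal (g z)) = density M (\<lambda>z. ennreal (g' z))"
  shows "AE z in M. g z = g' z"
proof -
  have "AE z in M. ennreal (g z) = ennreal (g' z)"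
    using eq g sigma_finite_density_unique[of "\<lambda>z. ennreal (g z)" M "\<lambda>z. ennreal (g' z)"]
      finite_measure.axioms(1)[OF fin] by auto
  then show ?thesis by eventually_elim (use nn in simp)
qed

text \<open>Relative to one dominating measure for all the measures involved, including both parts
  of the chosen derivative of the combination, the claim is the pointwise convexity of the
  integrand. Homogeneity is included, as \<open>a\<close> and \<open>b\<close> need not sum to
  1.\<close>

theorem FR_dt_convex:
  assumes D: "\<Delta> \<in> M0" "dt_is_measure \<Delta>" and m: "\<mu> \<in> M0" "dt_is_measure \<mu>" and ab: "0 \<le> a" "0 \<le> b"
    and eta: "continuous_on unit_sq (\<lambda>z. eta (q (fst z)) (snd z))"
  shows "FR_dt q (lincomb a \<Delta> b \<mu>) \<le> ennreal a * FR_dt q \<Delta> + ennreal b * FR_dt q \<mu>"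
proof -
  define L where "L = lincomb a \<Delta> b \<mu>"
  have L: "L \<in> M0" "dt_is_measure L" unfolding L_def by (rule M0_lincomb[OF D m ab])+
  note w = dt_weak_dt[OF D(2)] dt_weak_dt[OF m(2)] dt_weak_dt[OF L(2)]
  have fD: "finite_pos_measure \<Delta>" and fm: "finite_pos_measure \<mu>" and fL: "finite_pos_measure L"
    using D m L by (simp_all add: M0_finite_pos)
  have fs: "finite_signed (dt \<Delta>)" "finite_signed (dt \<mu>)" "finite_signed (dt L)"
    using w by (simp_all add: weak_dt_def)
  then have f: "finite_pos_measure (fst (dt \<Delta>))" "finite_pos_measure (snd (dt \<Delta>))"
    "finite_pos_measure (fst (dt \<mu>))" "finite_pos_measure (snd (dt \<mu>))"
    "finite_pos_measure (fst (dt L))" "finite_pos_measure (snd (dt L))"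
    by (simp_all add: finite_signed_def)
  define \<rho> where "\<rho> = lincomb 1 (lincomb 1 \<Delta> 1 \<mu>) 1 (lincomb 1 (lincomb 1 (fst (dt \<Delta>)) 1 (snd (dt \<Delta>))) 1
    (lincomb 1 (lincomb 1 (fst (dt \<mu>)) 1 (snd (dt \<mu>))) 1 (lincomb 1 (fst (dt L)) 1 (snd (dt L)))))"
  have \<rho>: "finite_pos_measure \<rho>" unfolding \<rho>_def by (intro finite_pos_lincomb fD fm f)
  have sets: "sets \<Delta> = sets borel_sq" "sets \<mu> = sets borel_sq" "sets (fst (dt \<Delta>)) = sets borel_sq"
    "sets (snd (dt \<Delta>)) = sets borel_sq" "sets (fst (dt \<mu>)) = sets borel_sq" "sets (snd (dt \<mu>)) = sets borel_sq"
    "sets (fst (dt L)) = sets borel_sq" "sets (snd (dt L)) = sets borel_sq"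
    using fD fm f by (simp_all add: finite_pos_measure_def)
  have \<rho>_sets: "sets \<rho> = sets borel_sq" using \<rho> by (simp add: finite_pos_measure_def)
  have \<rho>_em: "emeasure \<rho> A = emeasure \<Delta> A + emeasure \<mu> A + (emeasure (fst (dt \<Delta>)) A + emeasure (snd (dt \<Delta>)) A
      + (emeasure (fst (dt \<mu>)) A + emeasure (snd (dt \<mu>)) A + (emeasure (fst (dt L)) A + emeasure (snd (dt L)) A)))"
    if "A \<in> sets borel_sq" for A
    unfolding \<rho>_def using that by (simp add: emeasure_lincomb sets)
  have ac: "absolutely_continuous \<rho> \<nu>" if "\<nu> \<in> {\<Delta>, \<mu>, fst (dt \<Delta>), snd (dt \<Delta>), fst (dt \<mu>), snd (dt \<mu>), fst (dt L), snd (dt L)}" for \<nu>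
  proof (rule absolutely_continuous_of_le)
    show "sets \<nu> = sets \<rho>" using that by (auto simp: sets \<rho>_sets)
    fix A assume "A \<in> sets \<rho>"
    then have "A \<in> sets borel_sq" by (simp add: \<rho>_sets)
    from \<rho>_em[OF this] show "emeasure \<nu> A \<le> emeasure \<rho> A"
      using that by (auto simp: add_increasing add_increasing2)
  qed
  obtain x where x: "x \<in> borel_measurable borel_sq" "\<And>z. 0 \<le> x z" "\<Delta> = density \<rho> (\<lambda>z. ennreal (x z))"
    by (rule density_real_exists[OF \<rho> fD ac], simp, blast)
  obtain x' where x': "x' \<in> borel_measurable borel_sq" "\<And>z. 0 \<le> x' z" "\<mu> = density \<rho> (\<lambda>z. ennreal (x' z))"
    by (rule density_real_exists[OF \<rho> fm ac], simp, blast)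
  obtain y1 where y1: "y1 \<in> borel_measurable borel_sq" "\<And>z. 0 \<le> y1 z" "fst (dt \<Delta>) = density \<rho> (\<lambda>z. ennreal (y1 z))"
    by (rule density_real_exists[OF \<rho> f(1) ac], simp, blast)
  obtain y2 where y2: "y2 \<in> borel_measurable borel_sq" "\<And>z. 0 \<le> y2 z" "snd (dt \<Delta>) = density \<rho> (\<lambda>z. ennreal (y2 z))"
    by (rule density_real_exists[OF \<rho> f(2) ac], simp, blast)
  obtain z1 where z1: "z1 \<in> borel_measurable borel_sq" "\<And>z. 0 \<le> z1 z" "fst (dt \<mu>) = density \<rho> (\<lambda>z. ennreal (z1 z))"
    by (rule density_real_exists[OF \<rho> f(3) ac], simp, blast)
  obtain z2 where z2: "z2 \<in> borel_measurable borel_sq" "\<And>z. 0 \<le> z2 z" "snd (dt \<mu>) = density \<rho> (\<lambda>z. ennreal (z2 z))"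
    by (rule density_real_exists[OF \<rho> f(4) ac], simp, blast)
  obtain g1 where g1: "g1 \<in> borel_measurable borel_sq" "\<And>z. 0 \<le> g1 z" "fst (dt L) = density \<rho> (\<lambda>z. ennreal (g1 z))"
    by (rule density_real_exists[OF \<rho> f(5) ac], simp, blast)
  obtain g2 where g2: "g2 \<in> borel_measurable borel_sq" "\<And>z. 0 \<le> g2 z" "snd (dt L) = density \<rho> (\<lambda>z. ennreal (g2 z))"
    by (rule density_real_exists[OF \<rho> f(6) ac], simp, blast)
  note meas = x(1) x'(1) y1(1) y2(1) z1(1) z2(1) g1(1) g2(1)
  note meas' = meas[unfolded measurable_finite_pos[OF \<rho>, symmetric]]
  define F where "F = (\<lambda>(t, x). eta (q t) x)"
  have F: "F \<in> borel_measurable borel_sq"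
    using borel_measurable_continuous_borel_sq[OF eta] by (simp add: F_def split_beta')
  have F': "F \<in> borel_measurable \<rho>" using F unfolding measurable_finite_pos[OF \<rho>] .
  have L_dens: "L = density \<rho> (\<lambda>z. ennreal (a * x z + b * x' z))"
    unfolding L_def by (subst x(3), subst x'(3), rule density_lincomb) (use meas' x(2) x'(2) ab in auto)
  \<comment> \<open>\<open>dt L\<close> is chosen independently of \<open>dt \<Delta>\<close> and
    \<open>dt \<mu>\<close>. Uniqueness compares only the signed measures, hence only differences of
    densities, and this is what the integrand depends on.\<close>
  have AE_dt: "AE z in \<rho>. g1 z - g2 z = a * (y1 z - y2 z) + b * (z1 z - z2 z)"
  proof -
    have "weak_dt {1} L (slincomb a (dt \<Delta>) b (dt \<mu>))"
      unfolding L_def by (rule weak_dt_lincomb[OF fD fm w(1,2) ab])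
    from weak_dt_unique[OF fL w(3) this]
    have "lincomb 1 (fst (dt L)) 1 (lincomb a (snd (dt \<Delta>)) b (snd (dt \<mu>)))
      = lincomb 1 (lincomb a (fst (dt \<Delta>)) b (fst (dt \<mu>))) 1 (snd (dt L))"
      by (simp add: slincomb_def)
    moreover have "lincomb a (snd (dt \<Delta>)) b (snd (dt \<mu>)) = density \<rho> (\<lambda>z. ennreal (a * y2 z + b * z2 z))"
      unfolding y2(3) z2(3) by (rule density_lincomb) (use meas' y2(2) z2(2) ab in auto)
    moreover have "lincomb a (fst (dt \<Delta>)) b (fst (dt \<mu>)) = density \<rho> (\<lambda>z. ennreal (a * y1 z + b * z1 z))"
      unfolding y1(3) z1(3) by (rule density_lincomb) (use meas' y1(2) z1(2) ab in auto)
    moreover have g1': "lincomb 1 (fst (dt L)) 1 (density \<rho> (\<lambda>z. ennreal (a * y2 z + b * z2 z)))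
        = density \<rho> (\<lambda>z. ennreal (1 * g1 z + 1 * (a * y2 z + b * z2 z)))"
      unfolding g1(3) by (rule density_lincomb) (use meas' g1(2) y2(2) z2(2) ab in auto)
    moreover have "lincomb 1 (density \<rho> (\<lambda>z. ennreal (a * y1 z + b * z1 z))) 1 (snd (dt L))
        = density \<rho> (\<lambda>z. ennreal (1 * (a * y1 z + b * z1 z) + 1 * g2 z))"
      unfolding g2(3) by (rule density_lincomb) (use meas' g2(2) y1(2) z1(2) ab in auto)
    ultimately have eq: "density \<rho> (\<lambda>z. ennreal (1 * g1 z + 1 * (a * y2 z + b * z2 z)))
      = density \<rho> (\<lambda>z. ennreal (1 * (a * y1 z + b * z1 z) + 1 * g2 z))"
      and g1'': "lincomb 1 (fst (dt L)) 1 (lincomb a (snd (dt \<Delta>)) b (snd (dt \<mu>)))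
        = density \<rho> (\<lambda>z. ennreal (1 * g1 z + 1 * (a * y2 z + b * z2 z)))"
      by (simp_all only:)
    have "finite_pos_measure (lincomb 1 (fst (dt L)) 1 (lincomb a (snd (dt \<Delta>)) b (snd (dt \<mu>))))"
      by (intro finite_pos_lincomb f)
    then have "finite_measure (density \<rho> (\<lambda>z. ennreal (1 * g1 z + 1 * (a * y2 z + b * z2 z))))"
      unfolding g1'' finite_pos_measure_def by blast
    from density_eq_AE[OF _ _ this _ _ eq]
    have "AE z in \<rho>. 1 * g1 z + 1 * (a * y2 z + b * z2 z) = 1 * (a * y1 z + b * z1 z) + 1 * g2 z"
      using meas' g1(2) g2(2) y1(2) y2(2) z1(2) z2(2) ab by simp
    then show ?thesis by eventually_elim (simp add: algebra_simps)
  qed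
  have FRD: "FR_dt q \<Delta> = (\<integral>\<^sup>+z. fr_integrand (x z) (y1 z - y2 z) * ennreal (F z) \<partial>\<rho>)"
    unfolding FR_dt_def F_def[symmetric] using D(2)
      fisher_rao_density[OF \<rho> x(1) y1(1) y2(1) x(2) y1(2) y2(2) fD fs(1) x(3) y1(3) y2(3) F] by simp
  have FRm: "FR_dt q \<mu> = (\<integral>\<^sup>+z. fr_integrand (x' z) (z1 z - z2 z) * ennreal (F z) \<partial>\<rho>)"
    unfolding FR_dt_def F_def[symmetric] using m(2)
      fisher_rao_density[OF \<rho> x'(1) z1(1) z2(1) x'(2) z1(2) z2(2) fm fs(2) x'(3) z1(3) z2(3) F] by simp
  have xx: "(\<lambda>z. a * x z + b * x' z) \<in> borel_measurable borel_sq" "\<And>z. 0 \<le> a * x z + b * x' z"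
    using x x' ab by auto
  have "FR_dt q L = (\<integral>\<^sup>+z. fr_integrand (a * x z + b * x' z) (g1 z - g2 z) * ennreal (F z) \<partial>\<rho>)"
    unfolding FR_dt_def F_def[symmetric] using L(2)
      fisher_rao_density[OF \<rho> xx(1) g1(1) g2(1) xx(2) g1(2) g2(2) fL fs(3) L_dens g1(3) g2(3) F] by simp
  also have "\<dots> \<le> (\<integral>\<^sup>+z. ennreal a * (fr_integrand (x z) (y1 z - y2 z) * ennreal (F z))
      + ennreal b * (fr_integrand (x' z) (z1 z - z2 z) * ennreal (F z)) \<partial>\<rho>)"
  proof (rule nn_integral_mono_AE)
    show "AE z in \<rho>. fr_integrand (a * x z + b * x' z) (g1 z - g2 z) * ennreal (F z)
      \<le> ennreal a * (fr_integrand (x z) (y1 z - y2 z) * ennreal (F z))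
      + ennreal b * (fr_integrand (x' z) (z1 z - z2 z) * ennreal (F z))"
      using AE_dt
    proof eventually_elim
      fix z assume e: "g1 z - g2 z = a * (y1 z - y2 z) + b * (z1 z - z2 z)"
      from mult_right_mono[OF fr_integrand_convex[OF x(2) x'(2) ab, of z z "y1 z - y2 z" "z1 z - z2 z"], of "ennreal (F z)"]
      show "fr_integrand (a * x z + b * x' z) (g1 z - g2 z) * ennreal (F z)
        \<le> ennreal a * (fr_integrand (x z) (y1 z - y2 z) * ennreal (F z))
        + ennreal b * (fr_integrand (x' z) (z1 z - z2 z) * ennreal (F z))"
        unfolding e by (simp add: distrib_right mult.assoc)
    qed
  qed
  also have "\<dots> = ennreal a * FR_dt q \<Delta> + ennreal b * FR_dt q \<mu>"
    unfolding FRD FRm using meas' F' by (simp add: nn_integral_add nn_integral_cmult)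
  finally show ?thesis unfolding L_def .
qed

text \<open>Convexity with both coefficients 0; in \<open>ennreal\<close> the bound is 0 even before
  the value is known to be finite.\<close>

lemma FR_dt_null:
  assumes "continuous_on unit_sq (\<lambda>z. eta (q (fst z)) (snd z))"
  shows "FR_dt q (null_measure borel_sq) = 0"
proof -
  have "lincomb 0 (null_measure borel_sq) 0 (null_measure borel_sq) = null_measure borel_sq"
    by (rule measure_eqI) (simp_all add: emeasure_lincomb)
  then show ?thesis
    using FR_dt_convex[OF null_in_M0 null_in_M0 order_refl order_refl assms] by simp
qed

section \<open>First variation\<close>

definition admissible :: "(real \<times> real) measure \<Rightarrow> bool" where
  "admissible \<mu> \<longleftrightarrow> \<mu> \<in> M0 \<and> dt_is_measure \<mu>"

lemma admissible_finite_pos: "admissible \<mu> \<Longrightarrow> finite_pos_measure \<mu>"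
  by (simp add: admissible_def M0_finite_pos)

lemma admissible_lincomb: "admissible \<Delta> \<Longrightarrow> admissible \<mu> \<Longrightarrow> 0 \<le> a \<Longrightarrow> 0 \<le> b \<Longrightarrow> admissible (lincomb a \<Delta> b \<mu>)"
  unfolding admissible_def using M0_lincomb by blast

text \<open>\<open>slice\<close> is an arbitrary disintegration, so the mass bound of the
  constructed one is transferred by uniqueness and survives only almost everywhere in time.\<close>

lemma admissible_slice:
  assumes "admissible \<mu>"
  shows "disintegrates \<mu> (slice \<mu>)"
    and "\<exists>M. AE t in leb01. measure (slice \<mu> t) {0..1} \<le> M"
proof -
  have w: "weak_dt {1} \<mu> (dt \<mu>)" and f: "finite_pos_measure \<mu>"
    using assms admissible_finite_pos by (auto simp: admissible_def dt_weak_dt)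
  obtain \<kappa> where k: "disintegrates \<mu> \<kappa>" "\<And>t. emeasure (\<kappa> t) {0..1} \<le> emeasure (fst (dt \<mu>)) unit_sq"
    by (rule disintegration_exists[OF f w], blast)
  show d: "disintegrates \<mu> (slice \<mu>)"
    unfolding slice_def by (rule someI[of "disintegrates \<mu>"]) (rule k(1))
  have fd: "finite_measure (fst (dt \<mu>))"
    using w by (simp add: weak_dt_def finite_signed_def finite_pos_measure_def)
  have "AE t in leb01. slice \<mu> t = \<kappa> t" by (rule disintegration_unique[OF f d k(1)])
  then have "AE t in leb01. measure (slice \<mu> t) {0..1} \<le> measure (fst (dt \<mu>)) unit_sq"
  proof eventually_elim
    fix t assume "slice \<mu> t = \<kappa> t"
    then show "measure (slice \<mu> t) {0..1} \<le> measure (fst (dt \<mu>)) unit_sq"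
      using k(2)[of t] finite_measure.emeasure_eq_measure[OF disintegratesD(1)[OF k(1)], of t]
        finite_measure.emeasure_eq_measure[OF fd] by simp
  qed
  then show "\<exists>M. AE t in leb01. measure (slice \<mu> t) {0..1} \<le> M" by blast
qed

lemma slice_lincomb:
  assumes "admissible \<Delta>" "admissible \<mu>" "0 \<le> a" "0 \<le> b"
  shows "AE t in leb01. slice (lincomb a \<Delta> b \<mu>) t = lincomb a (slice \<Delta> t) b (slice \<mu> t)"
  by (rule disintegration_unique[OF admissible_finite_pos[OF admissible_lincomb[OF assms]] admissible_slice(1)[OF admissible_lincomb[OF assms]]
        disintegrates_lincomb[OF admissible_finite_pos[OF assms(1)] admissible_finite_pos[OF assms(2)]
          admissible_slice(1)[OF assms(1)] admissible_slice(1)[OF assms(2)]]])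

lemma AE_leb_sq_fst:
  assumes "AE t in leb01. P t" shows "AE z in leb_sq. P (fst z)"
proof -
  obtain N where N: "N \<in> null_sets leb01" "{t \<in> space leb01. \<not> P t} \<subseteq> N"
    using assms unfolding eventually_ae_filter by auto
  have "N \<times> {0..1} \<in> null_sets leb_sq"
  proof -
    have "emeasure leb_sq (N \<times> {0..1}) = emeasure leb01 N * emeasure leb01 {0..1}"
      using N(1) sets.top[of leb01] by (intro leb01.emeasure_pair_measure_Times) auto
    moreover have "N \<times> {0..1} \<in> sets leb_sq"
      using N(1) sets.top[of leb01] by (intro pair_measureI) auto
    ultimately show ?thesis using N(1) by (auto simp: null_sets_def)
  qed
  moreover have "{z \<in> space leb_sq. \<not> P (fst z)} \<subseteq> N \<times> {0..1}"
    using N(2) by (auto simp: space_leb_sq)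
  ultimately show ?thesis by (rule AE_I')
qed

locale acceleration =
  fixes p q :: "real \<Rightarrow> real \<Rightarrow> real" and A :: "real \<times> real \<Rightarrow> real"
  assumes A_borel: "A \<in> borel_measurable borel"
    and A_sq: "integrable leb_sq (\<lambda>z. (A z)\<^sup>2)"
    and cov_A: "AE z in leb_sq. cov_acc_flat p q (fst z) (snd z) = A z"
    and A_orth: "AE t in leb01. inner_eta (q t) (\<lambda>x. A (t, x)) (\<lambda>x. 1) = 0
      \<and> inner_eta (q t) (\<lambda>x. A (t, x)) (phi (q t)) = 0"
    and eta_cont_sq: "continuous_on unit_sq (\<lambda>z. eta (q (fst z)) (snd z))"
    and q_Q: "\<And>t. t \<in> {0..1} \<Longrightarrow> q t \<in> Q"
begin

definition "E z = eta (q (fst z)) (snd z)"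
definition "\<Phi> z = phi (q (fst z)) (snd z)"
definition "U \<mu> z = U_meas \<mu> q (fst z) (snd z)"
definition "B \<mu> z = proj_cot (q (fst z)) (U_meas \<mu> q (fst z)) (snd z)"

lemma E_cont: "continuous_on unit_sq E"
  using eta_cont_sq by (simp add: E_def[abs_def])

lemma E_pos: "0 < E z"
  by (simp add: E_def eta_pos)

lemma E_bound: obtains M where "\<And>t x. t \<in> {0..1} \<Longrightarrow> x \<in> {0..1} \<Longrightarrow> E (t, x) \<le> M" "0 \<le> M"
proof -
  obtain M where "\<And>z. z \<in> unit_sq \<Longrightarrow> \<bar>E z\<bar> \<le> M" "M \<ge> 0" using bounded_on_unit_sq[OF E_cont] by blast
  then show thesis by (intro that[of M]) (auto simp: unit_sq_def abs_le_iff)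
qed

lemma Q_point: "t \<in> {0..1} \<Longrightarrow> Q_point (q t)"
  by (simp add: Q_point_def q_Q)

lemma E_measurable [measurable]: "E \<in> borel_measurable leb_sq"
  by (rule borel_measurable_continuous_leb_sq[OF E_cont])

lemma \<Phi>_bound: "t \<in> {0..1} \<Longrightarrow> x \<in> {0..1} \<Longrightarrow> 0 \<le> \<Phi> (t, x) \<and> \<Phi> (t, x) \<le> 1"
proof -
  assume t: "t \<in> {0..1}" and x: "x \<in> {0..1}"
  interpret Q_point "q t" by (rule Q_point[OF t])
  have "phi (q t) x \<in> phi (q t) ` {0..1}" using x by blast
  then show "0 \<le> \<Phi> (t, x) \<and> \<Phi> (t, x) \<le> 1" using phi_image[of 1] phi_1 by (simp add: \<Phi>_def)
qed

lemma \<Phi>_measurable [measurable]: "\<Phi> \<in> borel_measurable leb_sq"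
proof -
  define e where "e = (\<lambda>z. if z \<in> unit_sq then E z else 0)"
  have "e \<in> borel_measurable borel"
    unfolding e_def using E_cont by (intro borel_measurable_continuous_on_if) auto
  from borel_measurable_leb_sq[OF borel_measurable_prim_snd[OF this]]
  have m: "(\<lambda>z. prim (\<lambda>u. e (fst z, u)) (snd z)) \<in> borel_measurable leb_sq" .
  have "prim (\<lambda>u. e (fst z, u)) (snd z) = \<Phi> z" if "z \<in> space leb_sq" for z
    unfolding \<Phi>_def phi_def
    by (rule Bochner_Integration.integral_cong[OF refl])
      (use that in \<open>auto simp: e_def E_def space_leb_sq unit_sq_def\<close>)
  then show ?thesis using m by (rule measurable_cong[THEN iffD1])
qed

section \<open>Measurability, bounds and linearity of \<open>U\<close> and of its projection\<close>

lemma slice_eta_measurable: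
  assumes "admissible \<mu>" "t \<in> {0..1}"
  shows "eta (q t) \<in> borel_measurable (slice \<mu> t)"
proof -
  have "eta (q t) \<in> borel_measurable borel01"
    by (rule borel_measurable_continuous_on_restrict[OF Q_point.eta_cont[OF Q_point[OF assms(2)]]])
  then show ?thesis
    using measurable_cong_sets[OF disintegratesD(2)[OF admissible_slice(1)[OF assms(1)]] refl] by blast
qed

lemma slice_indicator_measurable:
  assumes "admissible \<mu>" shows "indicat_real {x..1} \<in> borel_measurable (slice \<mu> t)"
proof -
  have "indicat_real {x..1} \<in> borel_measurable borel01" by (rule measurable_restrict_space1) simp
  then show ?thesis
    using measurable_cong_sets[OF disintegratesD(2)[OF admissible_slice(1)[OF assms]] refl] by blast
qed

lemma U_integrand_integrable:
  assumes g: "admissible \<mu>" and t: "t \<in> {0..1}"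
  shows "integrable (slice \<mu> t) (\<lambda>y. indicator {x..1} y * eta (q t) y)"
proof -
  interpret finite_measure "slice \<mu> t" by (rule disintegratesD(1)[OF admissible_slice(1)[OF g]])
  obtain M where M: "\<And>t x. t \<in> {0..1} \<Longrightarrow> x \<in> {0..1} \<Longrightarrow> E (t, x) \<le> M" "0 \<le> M" using E_bound by blast
  show ?thesis
  proof (rule integrable_const_bound[where B = M])
    show "(\<lambda>y. indicator {x..1} y * eta (q t) y) \<in> borel_measurable (slice \<mu> t)"
      using slice_indicator_measurable[OF g] slice_eta_measurable[OF g t] by (rule borel_measurable_times)
    show "AE y in slice \<mu> t. norm (indicator {x..1} y * eta (q t) y) \<le> M"
    proof (intro AE_I2)
      fix y assume "y \<in> space (slice \<mu> t)"
      then have y: "y \<in> {0..1}" using disintegratesD(3)[OF admissible_slice(1)[OF g]] by simp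
      then show "norm (indicator {x..1} y * eta (q t) y) \<le> M"
        using M(1)[OF t y] M(2) E_pos[of "(t, y)"] by (auto simp: E_def split: split_indicator)
    qed
  qed
qed

lemma U_eq: "U \<mu> (t, x) = 1/2 * (LINT y|slice \<mu> t. indicator {x..1} y * eta (q t) y)"
  by (simp add: U_def U_meas_def set_lebesgue_integral_def)

lemma U_nonneg: "0 \<le> U \<mu> (t, x)"
  unfolding U_eq using eta_pos[of "q t"]
  by (intro mult_nonneg_nonneg Bochner_Integration.integral_nonneg) (auto simp: less_imp_le)

text \<open>The slices form a measurable kernel in time and the lower integration limit is a further
  parameter, so the kernel lemma is applied with the square as parameter space.\<close>

lemma U_measurable:
  assumes g: "admissible \<mu>" shows "U \<mu> \<in> borel_measurable leb_sq"
proof -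
  note d = admissible_slice(1)[OF g]
  have b01: "(\<lambda>x. x) \<in> borel01 \<rightarrow>\<^sub>M borel" by (rule measurable_restrict_space1) simp
  have "(\<lambda>v. (fst (fst v), snd v)) \<in> leb_sq \<Otimes>\<^sub>M borel01 \<rightarrow>\<^sub>M leb01 \<Otimes>\<^sub>M borel01" by measurable
  from measurable_compose[OF measurable_compose[OF this measurable_pair_borel_sq]
      borel_measurable_continuous_borel_sq[OF E_cont]]
  have [measurable]: "(\<lambda>v. E (fst (fst v), snd v)) \<in> borel_measurable (leb_sq \<Otimes>\<^sub>M borel01)" .
  have [measurable]: "(\<lambda>v. snd v) \<in> leb_sq \<Otimes>\<^sub>M borel01 \<rightarrow>\<^sub>M borel"
    by (rule measurable_compose[OF measurable_snd b01])
  have [measurable]: "(\<lambda>v. snd (fst v)) \<in> leb_sq \<Otimes>\<^sub>M borel01 \<rightarrow>\<^sub>M borel" by measurable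
  have f: "(\<lambda>v. indicator {snd (fst v)..1} (snd v) * ennreal (E (fst (fst v), snd v)))
    \<in> borel_measurable (leb_sq \<Otimes>\<^sub>M borel01)"
    unfolding indicator_def atLeastAtMost_iff by measurable
  have "(\<lambda>w. \<integral>\<^sup>+y. indicator {snd (fst (w, y))..1} (snd (w, y)) * ennreal (E (fst (fst (w, y)), snd (w, y))) \<partial>slice \<mu> (fst w))
    \<in> borel_measurable leb_sq"
    by (rule borel_measurable_nn_integral_kernel[OF disintegratesD(1)[OF d] disintegratesD(2)[OF d] _ f])
      (use measurable_compose[OF measurable_fst disintegrates_leb01[OF d]] in auto)
  then have "(\<lambda>w. 1/2 * enn2real (\<integral>\<^sup>+y. indicator {snd w..1} y * ennreal (E (fst w, y)) \<partial>slice \<mu> (fst w))) \<in> borel_measurable leb_sq"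
    by simp
  moreover have "1/2 * enn2real (\<integral>\<^sup>+y. indicator {snd w..1} y * ennreal (E (fst w, y)) \<partial>slice \<mu> (fst w)) = U \<mu> w"
    if "w \<in> space leb_sq" for w
  proof -
    obtain t x where w: "w = (t, x)" by (cases w)
    have t: "t \<in> {0..1}" using that by (simp add: w space_leb_sq)
    have "(LINT y|slice \<mu> t. indicator {x..1} y * eta (q t) y)
      = enn2real (\<integral>\<^sup>+y. ennreal (indicator {x..1} y * eta (q t) y) \<partial>slice \<mu> t)"
      using borel_measurable_integrable[OF U_integrand_integrable[OF g t]] eta_pos[of "q t"]
      by (intro integral_eq_nn_integral) (auto simp: less_imp_le)
    also have "(\<integral>\<^sup>+y. ennreal (indicator {x..1} y * eta (q t) y) \<partial>slice \<mu> t)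
      = (\<integral>\<^sup>+y. indicator {x..1} y * ennreal (E (t, y)) \<partial>slice \<mu> t)"
      by (intro nn_integral_cong) (auto simp: E_def split: split_indicator)
    finally show ?thesis unfolding w U_eq by simp
  qed
  ultimately show ?thesis by (rule measurable_cong[THEN iffD1, rotated])
qed

text \<open>The place where the derivative being a measure enters: it bounds the slice masses, and
  \<eta> is bounded by continuity.\<close>

lemma U_bounded:
  assumes g: "admissible \<mu>"
  obtains C where "AE t in leb01. \<forall>x. U \<mu> (t, x) \<le> C" "0 \<le> C"
proof -
  note d = admissible_slice(1)[OF g]
  obtain N where N: "AE t in leb01. measure (slice \<mu> t) {0..1} \<le> N" using admissible_slice(2)[OF g] by blast
  obtain M where M: "\<And>t x. t \<in> {0..1} \<Longrightarrow> x \<in> {0..1} \<Longrightarrow> E (t, x) \<le> M" "0 \<le> M" using E_bound by blast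
  have "AE t in leb01. \<forall>x. U \<mu> (t, x) \<le> M * \<bar>N\<bar>"
    using N AE_space
  proof eventually_elim
    fix t assume n: "measure (slice \<mu> t) {0..1} \<le> N" and "t \<in> space leb01"
    then have t: "t \<in> {0..1}" by simp
    interpret finite_measure "slice \<mu> t" by (rule disintegratesD(1)[OF d])
    have sp: "space (slice \<mu> t) = {0..1}" by (rule disintegratesD(3)[OF d])
    show "\<forall>x. U \<mu> (t, x) \<le> M * \<bar>N\<bar>"
    proof
      fix x
      have "(LINT y|slice \<mu> t. indicator {x..1} y * eta (q t) y) \<le> (LINT y|slice \<mu> t. M)"
      proof (rule integral_mono[OF U_integrand_integrable[OF g t]])
        fix y assume "y \<in> space (slice \<mu> t)"
        then have y: "y \<in> {0..1}" by (simp add: sp)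
        then show "indicator {x..1} y * eta (q t) y \<le> M"
          using M(1)[OF t y] M(2) by (auto simp: E_def split: split_indicator)
      qed simp
      also have "\<dots> = M * measure (slice \<mu> t) {0..1}" by (simp add: sp)
      also have "\<dots> \<le> M * \<bar>N\<bar>" using n M(2) by (intro mult_left_mono) auto
      finally show "U \<mu> (t, x) \<le> M * \<bar>N\<bar>"
        using U_nonneg[of \<mu> t x] unfolding U_eq by linarith
    qed
  qed
  then show thesis using M(2) by (intro that[of "M * \<bar>N\<bar>"]) auto
qed

lemma U_slice_measurable: "admissible \<mu> \<Longrightarrow> t \<in> {0..1} \<Longrightarrow> (\<lambda>x. U \<mu> (t, x)) \<in> borel_measurable leb01"
  using measurable_Pair2[OF U_measurable, of \<mu> t] by simp

lemma integrable_mult_U: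
  assumes g: "admissible \<mu>" and t: "t \<in> {0..1}" and b: "\<forall>x. U \<mu> (t, x) \<le> C" and f: "integrable leb01 f"
  shows "integrable leb01 (\<lambda>x. f x * U \<mu> (t, x))"
proof (rule Bochner_Integration.integrable_bound)
  show "integrable leb01 (\<lambda>x. f x * C)" using f by simp
  show "(\<lambda>x. f x * U \<mu> (t, x)) \<in> borel_measurable leb01"
    using f U_slice_measurable[OF g t] by auto
  show "AE x in leb01. norm (f x * U \<mu> (t, x)) \<le> norm (f x * C)"
  proof (intro AE_I2)
    fix x
    have "\<bar>U \<mu> (t, x)\<bar> \<le> \<bar>C\<bar>" using spec[OF b, of x] U_nonneg[of \<mu> t x] by linarith
    then show "norm (f x * U \<mu> (t, x)) \<le> norm (f x * C)" by (simp add: abs_mult mult_left_mono)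
  qed
qed

definition "cU \<mu> t = inner_eta (q t) (U_meas \<mu> q t) (\<lambda>x. 1)"
definition "cU\<phi> \<mu> t = inner_eta (q t) (U_meas \<mu> q t) (phi (q t))"

lemma B_eq: "B \<mu> z = U \<mu> z - (4 * cU \<mu> (fst z) - 6 * cU\<phi> \<mu> (fst z))
    - (12 * cU\<phi> \<mu> (fst z) - 6 * cU \<mu> (fst z)) * \<Phi> z"
  by (simp add: B_def proj_cot_def H2_comb_eq U_def \<Phi>_def cU_def cU\<phi>_def)

lemma cU_eq: "cU \<mu> t = (LINT x|leb01. U \<mu> (t, x) * E (t, x))"
  "cU\<phi> \<mu> t = (LINT x|leb01. U \<mu> (t, x) * \<Phi> (t, x) * E (t, x))"
  by (simp_all add: cU_def cU\<phi>_def inner_eta_def U_def E_def \<Phi>_def)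

lemma B_measurable:
  assumes g: "admissible \<mu>" shows "B \<mu> \<in> borel_measurable leb_sq"
proof -
  have [measurable]: "U \<mu> \<in> borel_measurable leb_sq" by (rule U_measurable[OF g])
  have "cU \<mu> \<in> borel_measurable leb01" "cU\<phi> \<mu> \<in> borel_measurable leb01"
    unfolding cU_eq[abs_def] by (intro leb01.borel_measurable_lebesgue_integral; simp; measurable)+
  from measurable_compose[OF measurable_fst this(1)] measurable_compose[OF measurable_fst this(2)]
  have [measurable]: "(\<lambda>z. cU \<mu> (fst z)) \<in> borel_measurable leb_sq" "(\<lambda>z. cU\<phi> \<mu> (fst z)) \<in> borel_measurable leb_sq" .
  show ?thesis unfolding B_eq[abs_def] by measurable
qed

text \<open>Both moments of \<open>U\<close> are at most \<open>C * M\<close> in absolute value and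
  \<phi> lies between 0 and 1; the constants are 10 = 4 + 6 and 18 = 12 + 6 from the inverse of
  \<open>H2\<close>.\<close>

lemma B_bounded:
  assumes g: "admissible \<mu>"
  obtains C where "AE z in leb_sq. \<bar>B \<mu> z\<bar> \<le> C"
proof -
  obtain C where C: "AE t in leb01. \<forall>x. U \<mu> (t, x) \<le> C" "0 \<le> C" by (rule U_bounded[OF g])
  obtain M where M: "\<And>t x. t \<in> {0..1} \<Longrightarrow> x \<in> {0..1} \<Longrightarrow> E (t, x) \<le> M" "0 \<le> M" using E_bound by blast
  have "AE z in leb_sq. \<bar>B \<mu> z\<bar> \<le> C + 10 * (C * M) + 18 * (C * M)"
    using AE_leb_sq_fst[OF C(1)] AE_space
  proof eventually_elim
    fix z assume b: "\<forall>x. U \<mu> (fst z, x) \<le> C" and "z \<in> space leb_sq"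
    then obtain t x where z: "z = (t, x)" and t: "t \<in> {0..1}" and x: "x \<in> {0..1}" by (auto simp: space_leb_sq)
    have ub: "U \<mu> (t, y) \<le> C" for y using b z by simp
    have c1: "\<bar>cU \<mu> t\<bar> \<le> C * M"
      unfolding cU_eq
    proof (rule abs_integral_leb01_le)
      fix y :: real assume y: "y \<in> {0..1}"
      show "\<bar>U \<mu> (t, y) * E (t, y)\<bar> \<le> C * M"
        using ub[of y] U_nonneg[of \<mu> t y] M(1)[OF t y] E_pos[of "(t, y)"] C(2)
        by (simp add: abs_mult abs_of_pos mult_mono)
    qed
    have c2: "\<bar>cU\<phi> \<mu> t\<bar> \<le> C * M"
      unfolding cU_eq
    proof (rule abs_integral_leb01_le)
      fix y :: real assume y: "y \<in> {0..1}"
      have "U \<mu> (t, y) * \<Phi> (t, y) * E (t, y) \<le> C * 1 * M"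
        using ub[of y] U_nonneg[of \<mu> t y] M(1)[OF t y] E_pos[of "(t, y)"] \<Phi>_bound[OF t y] C(2)
        by (intro mult_mono) auto
      moreover have "0 \<le> U \<mu> (t, y) * \<Phi> (t, y) * E (t, y)"
        using U_nonneg[of \<mu> t y] E_pos[of "(t, y)"] \<Phi>_bound[OF t y] by simp
      ultimately show "\<bar>U \<mu> (t, y) * \<Phi> (t, y) * E (t, y)\<bar> \<le> C * M" by simp
    qed
    have "\<bar>(12 * cU\<phi> \<mu> t - 6 * cU \<mu> t) * \<Phi> (t, x)\<bar> \<le> \<bar>12 * cU\<phi> \<mu> t - 6 * cU \<mu> t\<bar> * 1"
      unfolding abs_mult using \<Phi>_bound[OF t x] by (intro mult_left_mono) auto
    also have "\<dots> \<le> 18 * (C * M)"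
      using c1 c2 unfolding abs_le_iff mult_1_right by linarith
    finally have c3: "\<bar>(12 * cU\<phi> \<mu> t - 6 * cU \<mu> t) * \<Phi> (t, x)\<bar> \<le> 18 * (C * M)" .
    then show "\<bar>B \<mu> z\<bar> \<le> C + 10 * (C * M) + 18 * (C * M)"
      using c1 c2 c3 ub[of x] U_nonneg[of \<mu> t x] unfolding B_eq z fst_conv abs_le_iff by linarith
  qed
  then show thesis by (rule that)
qed

lemma A_measurable: "A \<in> borel_measurable leb_sq"
  by (rule borel_measurable_leb_sq[OF A_borel])

lemma B_sq:
  assumes g: "admissible \<mu>" shows "integrable leb_sq (\<lambda>z. (B \<mu> z)\<^sup>2)"
proof -
  obtain C where C: "AE z in leb_sq. \<bar>B \<mu> z\<bar> \<le> C" by (rule B_bounded[OF g])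
  show ?thesis
  proof (rule leb_sq.integrable_const_bound[where B = "C\<^sup>2"])
    show "AE z in leb_sq. norm ((B \<mu> z)\<^sup>2) \<le> C\<^sup>2"
      using C by eventually_elim (simp add: abs_le_square_iff[symmetric])
    show "(\<lambda>z. (B \<mu> z)\<^sup>2) \<in> borel_measurable leb_sq" using B_measurable[OF g] by simp
  qed
qed

text \<open>Linearity holds only almost everywhere, because the slices of the combination are chosen
  independently of those of the summands.\<close>

lemma B_lincomb:
  assumes g: "admissible \<Delta>" "admissible \<mu>" and ab: "0 \<le> a" "0 \<le> b"
  shows "AE z in leb_sq. B (lincomb a \<Delta> b \<mu>) z = a * B \<Delta> z + b * B \<mu> z"
proof -
  obtain C where C: "AE t in leb01. \<forall>x. U \<Delta> (t, x) \<le> C" by (rule U_bounded[OF g(1)])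
  obtain C' where C': "AE t in leb01. \<forall>x. U \<mu> (t, x) \<le> C'" by (rule U_bounded[OF g(2)])
  show ?thesis
    using AE_leb_sq_fst[OF slice_lincomb[OF g ab]] AE_leb_sq_fst[OF C] AE_leb_sq_fst[OF C'] AE_space
  proof eventually_elim
    fix z assume s: "slice (lincomb a \<Delta> b \<mu>) (fst z) = lincomb a (slice \<Delta> (fst z)) b (slice \<mu> (fst z))"
      and c: "\<forall>x. U \<Delta> (fst z, x) \<le> C" "\<forall>x. U \<mu> (fst z, x) \<le> C'" and "z \<in> space leb_sq"
    then obtain t x where z: "z = (t, x)" and t: "t \<in> {0..1}" by (auto simp: space_leb_sq)
    have ss: "sets (slice \<mu> t) = sets (slice \<Delta> t)"
      using disintegratesD(2)[OF admissible_slice(1)[OF g(1)]] disintegratesD(2)[OF admissible_slice(1)[OF g(2)]] by simp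
    have U: "U (lincomb a \<Delta> b \<mu>) (t, y) = a * U \<Delta> (t, y) + b * U \<mu> (t, y)" for y
      using s[unfolded z fst_conv] unfolding U_eq
      by (simp only: integral_lincomb[OF ss ab U_integrand_integrable[OF g(1) t] U_integrand_integrable[OF g(2) t]])
        (simp add: algebra_simps)
    interpret Q_point "q t" by (rule Q_point[OF t])
    have Ei: "integrable leb01 (\<lambda>x. E (t, x))" "integrable leb01 (\<lambda>x. \<Phi> (t, x) * E (t, x))"
      unfolding E_def \<Phi>_def by (auto intro!: integrable_continuous_leb01 continuous_on_mult eta_cont phi_cont)
    note i = integrable_mult_U[OF g(1) t c(1)[unfolded z fst_conv]] integrable_mult_U[OF g(2) t c(2)[unfolded z fst_conv]]
    have "cU (lincomb a \<Delta> b \<mu>) t = (LINT x|leb01. a * (E (t, x) * U \<Delta> (t, x)) + b * (E (t, x) * U \<mu> (t, x)))"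
      unfolding cU_eq U by (intro Bochner_Integration.integral_cong) (auto simp: algebra_simps)
    then have 1: "cU (lincomb a \<Delta> b \<mu>) t = a * cU \<Delta> t + b * cU \<mu> t"
      unfolding cU_eq using i(1)[OF Ei(1)] i(2)[OF Ei(1)] by (simp add: mult.commute)
    have "cU\<phi> (lincomb a \<Delta> b \<mu>) t = (LINT x|leb01. a * (\<Phi> (t, x) * E (t, x) * U \<Delta> (t, x)) + b * (\<Phi> (t, x) * E (t, x) * U \<mu> (t, x)))"
      unfolding cU_eq U by (intro Bochner_Integration.integral_cong) (auto simp: algebra_simps)
    also have "\<dots> = a * (LINT x|leb01. \<Phi> (t, x) * E (t, x) * U \<Delta> (t, x)) + b * (LINT x|leb01. \<Phi> (t, x) * E (t, x) * U \<mu> (t, x))"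
      using i(1)[OF Ei(2)] i(2)[OF Ei(2)] by simp
    also have "\<dots> = a * cU\<phi> \<Delta> t + b * cU\<phi> \<mu> t"
      unfolding cU_eq by (simp only: ac_simps)
    finally have 2: "cU\<phi> (lincomb a \<Delta> b \<mu>) t = a * cU\<phi> \<Delta> t + b * cU\<phi> \<mu> t" .
    show "B (lincomb a \<Delta> b \<mu>) z = a * B \<Delta> z + b * B \<mu> z"
      unfolding B_eq z fst_conv U 1 2 by (simp add: algebra_simps)
  qed
qed

section \<open>The quadratic term and its expansion\<close>

definition "J \<mu> = (LINT z|leb_sq. E z * (A z + B \<mu> z)\<^sup>2)"

lemma
  assumes f: "f \<in> borel_measurable leb_sq" "integrable leb_sq (\<lambda>z. (f z)\<^sup>2)"
    and g: "g \<in> borel_measurable leb_sq" "integrable leb_sq (\<lambda>z. (g z)\<^sup>2)"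
  shows E_mult_integrable: "integrable leb_sq (\<lambda>z. E z * (f z * g z :: real))"
  using integrable_mult_continuous_leb_sq[OF integrable_mult_square_integrable[OF f(1) g(1) f(2) g(2)] E_cont]
  by (simp add: mult.commute)

lemma residual_square_integrable:
  assumes g: "admissible \<mu>"
  shows "(\<lambda>z. A z + B \<mu> z) \<in> borel_measurable leb_sq" "integrable leb_sq (\<lambda>z. (A z + B \<mu> z)\<^sup>2)"
  using A_measurable B_measurable[OF g] A_sq B_sq[OF g] by (auto intro: square_integrable_add)

lemma acceleration_energy:
  assumes g: "admissible \<mu>"
  shows "(\<integral>\<^sup>+t. sqnorm_eta (q t) (\<lambda>x. cov_acc_flat p q t x + proj_cot (q t) (U_meas \<mu> q t) x) \<partial>leb01) = ennreal (J \<mu>)"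
proof -
  have m: "(\<lambda>z. ennreal (E z * (A z + B \<mu> z)\<^sup>2)) \<in> borel_measurable leb_sq"
    using residual_square_integrable(1)[OF g] by measurable
  have "(\<integral>\<^sup>+t. sqnorm_eta (q t) (\<lambda>x. cov_acc_flat p q t x + proj_cot (q t) (U_meas \<mu> q t) x) \<partial>leb01)
    = (\<integral>\<^sup>+t. \<integral>\<^sup>+x. ennreal (E (t, x) * (A (t, x) + B \<mu> (t, x))\<^sup>2) \<partial>leb01 \<partial>leb01)"
  proof (rule nn_integral_cong_AE)
    show "AE t in leb01. sqnorm_eta (q t) (\<lambda>x. cov_acc_flat p q t x + proj_cot (q t) (U_meas \<mu> q t) x)
      = (\<integral>\<^sup>+x. ennreal (E (t, x) * (A (t, x) + B \<mu> (t, x))\<^sup>2) \<partial>leb01)"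
      using leb_sq.AE_pair[OF cov_A]
    proof eventually_elim
      fix t assume "AE x in leb01. cov_acc_flat p q (fst (t, x)) (snd (t, x)) = A (t, x)"
      then show "sqnorm_eta (q t) (\<lambda>x. cov_acc_flat p q t x + proj_cot (q t) (U_meas \<mu> q t) x)
        = (\<integral>\<^sup>+x. ennreal (E (t, x) * (A (t, x) + B \<mu> (t, x))\<^sup>2) \<partial>leb01)"
        unfolding sqnorm_eta_def by (intro nn_integral_cong_AE, eventually_elim) (simp add: E_def B_def)
    qed
  qed
  also have "\<dots> = (\<integral>\<^sup>+z. ennreal (E z * (A z + B \<mu> z)\<^sup>2) \<partial>leb_sq)"
    by (rule leb01.nn_integral_fst[OF m])
  also have "\<dots> = ennreal (J \<mu>)"
    unfolding J_def
  proof (rule nn_integral_eq_integral)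
    show "integrable leb_sq (\<lambda>z. E z * (A z + B \<mu> z)\<^sup>2)"
      using E_mult_integrable[OF residual_square_integrable[OF g] residual_square_integrable[OF g]] by (simp add: power2_eq_square)
  qed (use E_pos in \<open>auto simp: less_imp_le\<close>)
  finally show ?thesis .
qed

lemma functional_eq:
  assumes g: "admissible \<mu>"
  shows "relaxed_functional P \<mu> p q = enn2ereal (FR_dt q \<mu> + ennreal (J \<mu>)) + ereal (P (p 1) (q 1))"
  unfolding relaxed_functional_def acceleration_energy[OF g] ..

definition "weight \<Delta> t x = eta (q t) x * (LINT y|lebesgue_on {0..x}.
  cov_acc p q t y + eta (q t) y * proj_cot (q t) (U_meas \<Delta> q t) y)"

text \<open>The identity is proved at almost every fixed time, where the residual \<open>G\<close>
  is orthogonal to 1 and \<phi>. The factor 2 from differentiating the square cancels the 1/2 in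
  \<open>U\<close>, and Fubini over the region below the diagonal exchanges the upper integral
  against the slice for the primitive in the weight.\<close>

lemma slice_pairing:
  assumes D: "admissible \<Delta>" and g: "admissible \<mu>"
  shows "AE t in leb01. (LINT y|slice \<mu> t. weight \<Delta> t y)
    = 2 * (LINT x|leb01. E (t, x) * ((A (t, x) + B \<Delta> (t, x)) * B \<mu> (t, x)))"
proof -
  obtain C where C: "AE t in leb01. \<forall>x. U \<mu> (t, x) \<le> C" by (rule U_bounded[OF g])
  obtain C' where C': "AE t in leb01. \<forall>x. U \<Delta> (t, x) \<le> C'" by (rule U_bounded[OF D])
  have Ai: "integrable leb_sq A"
    using leb_sq.integrable_if_square_integrable[OF A_measurable A_sq] .
  show ?thesis
    using leb_sq.AE_pair[OF cov_A] A_orth C C' leb_sq.AE_integrable_fst'[OF Ai] AE_space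
  proof eventually_elim
    fix t
    assume cA: "AE x in leb01. cov_acc_flat p q (fst (t, x)) (snd (t, x)) = A (t, x)"
      and orth: "inner_eta (q t) (\<lambda>x. A (t, x)) (\<lambda>x. 1) = 0 \<and> inner_eta (q t) (\<lambda>x. A (t, x)) (phi (q t)) = 0"
      and ub: "\<forall>x. U \<mu> (t, x) \<le> C" and ub': "\<forall>x. U \<Delta> (t, x) \<le> C'"
      and At: "integrable leb01 (\<lambda>x. A (t, x))" and "t \<in> space leb01"
    then have t: "t \<in> {0..1}" by simp
    interpret Q_point "q t" by (rule Q_point[OF t])
    have Ui: "integrable leb01 (U_meas \<Delta> q t)"
      using integrable_mult_U[OF D t ub', of "\<lambda>_. 1"] by (simp add: U_def)
    define G where "G = (\<lambda>x. A (t, x) + B \<Delta> (t, x))"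
    have Bi: "integrable leb01 (\<lambda>x. B \<Delta> (t, x))"
      unfolding B_def fst_conv snd_conv proj_cot_eq
      by (intro Bochner_Integration.integrable_diff Ui integrable_continuous_leb01 H2_comb_cont)
    have Gi: "integrable leb01 G" unfolding G_def using At Bi by simp
    have G_inner: "inner_eta (q t) G f = inner_eta (q t) (\<lambda>x. A (t, x)) f + inner_eta (q t) (proj_cot (q t) (U_meas \<Delta> q t)) f"
      if f: "continuous_on {0..1} f" for f
    proof -
      have B: "(\<lambda>x. B \<Delta> (t, x)) = proj_cot (q t) (U_meas \<Delta> q t)" by (simp add: B_def fun_eq_iff)
      show ?thesis
        using integrable_times_continuous_eta[OF At f] integrable_times_continuous_eta[OF Bi f]
        unfolding inner_eta_def G_def B[symmetric] by (simp add: distrib_right)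
    qed
    have G1: "inner_eta (q t) G (\<lambda>x. 1) = 0" and G2: "inner_eta (q t) G (phi (q t)) = 0"
      using G_inner[OF continuous_on_const] G_inner[OF phi_cont] orth proj_cot_1[OF Ui] proj_cot_phi[OF Ui] by simp_all
    have GE: "integrable leb01 (\<lambda>x. G x * eta (q t) x)"
      by (rule integrable_mult_continuous_leb01[OF Gi eta_cont])
    have GUi: "integrable leb01 (\<lambda>x. G x * U_meas \<mu> q t x * eta (q t) x)"
      using integrable_mult_U[OF g t ub GE] by (simp add: U_def mult.assoc mult.commute[of "eta (q t) _"])
    have GB: "(LINT x|leb01. E (t, x) * (G x * B \<mu> (t, x))) = (LINT x|leb01. G x * eta (q t) x * U \<mu> (t, x))"
    proof -
      have "(LINT x|leb01. E (t, x) * (G x * B \<mu> (t, x))) = inner_eta (q t) G (proj_cot (q t) (U_meas \<mu> q t))"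
        unfolding inner_eta_def E_def B_def fst_conv snd_conv by (simp only: ac_simps)
      also have "\<dots> = inner_eta (q t) G (U_meas \<mu> q t)"
        by (rule inner_proj_cot[OF Gi GUi G1 G2])
      also have "\<dots> = (LINT x|leb01. G x * eta (q t) x * U \<mu> (t, x))"
        unfolding inner_eta_def U_def fst_conv snd_conv by (simp only: ac_simps)
      finally show ?thesis .
    qed
    \<comment> \<open>Required at every \<open>y\<close>, since the slice may charge Lebesgue null
      sets. This is possible because the weight is a continuous factor times a primitive, which
      ignores changes of its integrand on null sets.\<close>
    have w: "weight \<Delta> t y = eta (q t) y * prim (\<lambda>x. G x * eta (q t) x) y" if y: "y \<in> {0..1}" for y
    proof -
      have "AE x in leb01. G x * eta (q t) x = cov_acc p q t x + eta (q t) x * proj_cot (q t) (U_meas \<Delta> q t) x"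
        using cA by eventually_elim (simp add: G_def cov_acc_def B_def algebra_simps)
      from prim_AE[OF borel_measurable_integrable[OF GE] this y]
      show ?thesis by (simp add: weight_def)
    qed
    define \<kappa> where "\<kappa> = slice \<mu> t"
    have ks: "sets \<kappa> = sets borel01" and ksp: "space \<kappa> = {0..1}" and kf: "finite_measure \<kappa>"
      using disintegratesD[OF admissible_slice(1)[OF g]] by (simp_all add: \<kappa>_def)
    interpret k: finite_measure \<kappa> by (rule kf)
    interpret P: pair_sigma_finite leb01 \<kappa> ..
    define h where "h = (\<lambda>v. G (fst v) * eta (q t) (fst v) * (indicator {fst v..1} (snd v) * eta (q t) (snd v)))"
    have em: "eta (q t) \<in> borel_measurable \<kappa>"
      unfolding \<kappa>_def by (rule slice_eta_measurable[OF g t])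
    have ei: "integrable \<kappa> (eta (q t))"
    proof -
      have "integrable \<kappa> (\<lambda>y. indicator {0..1} y * eta (q t) y)"
        unfolding \<kappa>_def by (rule U_integrand_integrable[OF g t])
      then show ?thesis
        by (rule Bochner_Integration.integrable_cong[THEN iffD1, rotated 2]) (auto simp: ksp)
    qed
    \<comment> \<open>Without the indicator the integrand is a product of functions of one variable
      each; it dominates \<open>h\<close>.\<close>
    have h0: "integrable (leb01 \<Otimes>\<^sub>M \<kappa>) (\<lambda>v. G (fst v) * eta (q t) (fst v) * eta (q t) (snd v))"
    proof (rule P.Fubini_integrable)
      show "(\<lambda>v. G (fst v) * eta (q t) (fst v) * eta (q t) (snd v)) \<in> borel_measurable (leb01 \<Otimes>\<^sub>M \<kappa>)"
        by (rule borel_measurable_times[OF measurable_compose[OF measurable_fst borel_measurable_integrable[OF GE]]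
              measurable_compose[OF measurable_snd em]])
    qed (use integrable_abs[OF GE] GE ei in \<open>auto simp: abs_mult\<close>)
    have hm: "(\<lambda>v. indicat_real {fst v..1} (snd v)) \<in> borel_measurable (leb01 \<Otimes>\<^sub>M \<kappa>)"
    proof -
      have "(\<lambda>x. x) \<in> \<kappa> \<rightarrow>\<^sub>M borel"
        using measurable_restrict_space1[of "\<lambda>x::real. x" borel borel "{0..1}"] measurable_cong_sets[OF ks refl] by auto
      note [measurable] = measurable_compose[OF measurable_snd this]
      show ?thesis unfolding indicator_def atLeastAtMost_iff by measurable
    qed
    have hi: "integrable (leb01 \<Otimes>\<^sub>M \<kappa>) h"
    proof (rule Bochner_Integration.integrable_bound[OF h0])
      show "h \<in> borel_measurable (leb01 \<Otimes>\<^sub>M \<kappa>)"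
        unfolding h_def
        by (rule borel_measurable_times[OF measurable_compose[OF measurable_fst borel_measurable_integrable[OF GE]]
              borel_measurable_times[OF hm measurable_compose[OF measurable_snd em]]])
    qed (auto simp: h_def split: split_indicator)
    then have hi': "integrable (leb01 \<Otimes>\<^sub>M \<kappa>) (\<lambda>(x, y). h (x, y))" by simp
    have "(LINT x|leb01. G x * eta (q t) x * U \<mu> (t, x)) = (LINT x|leb01. LINT y|\<kappa>. 1/2 * h (x, y))"
      unfolding h_def U_eq \<kappa>_def fst_conv snd_conv by simp
    also have "\<dots> = (LINT y|\<kappa>. LINT x|leb01. 1/2 * h (x, y))"
      using P.Fubini_integral[of "\<lambda>x y. 1/2 * h (x, y)"] hi' by (simp add: split_beta')
    also have "\<dots> = (LINT y|\<kappa>. 1/2 * weight \<Delta> t y)"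
    proof (rule Bochner_Integration.integral_cong[OF refl])
      fix y assume "y \<in> space \<kappa>"
      then have y: "y \<in> {0..1}" by (simp add: ksp)
      have "(LINT x|leb01. 1/2 * h (x, y)) = (LINT x|leb01. 1/2 * eta (q t) y * (indicator {0..y} x * (G x * eta (q t) x)))"
        using y by (intro Bochner_Integration.integral_cong) (auto simp: h_def split: split_indicator)
      also have "\<dots> = 1/2 * weight \<Delta> t y"
        unfolding w[OF y] prim_eq[OF y] by simp
      finally show "(LINT x|leb01. 1/2 * h (x, y)) = 1/2 * weight \<Delta> t y" .
    qed
    finally have "(LINT x|leb01. G x * eta (q t) x * U \<mu> (t, x)) = 1/2 * (LINT y|\<kappa>. weight \<Delta> t y)" by simp
    then show "(LINT y|slice \<mu> t. weight \<Delta> t y)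
      = 2 * (LINT x|leb01. E (t, x) * ((A (t, x) + B \<Delta> (t, x)) * B \<mu> (t, x)))"
      using GB unfolding \<kappa>_def G_def by simp
  qed
qed

text \<open>The weight contains the chosen \<open>time_deriv\<close>, so measurability in time of
  its slice integrals is inherited from the almost everywhere equal integral of \<open>k\<close>, by
  completeness.\<close>

lemma pairing_eq:
  assumes D: "admissible \<Delta>" and g: "admissible \<mu>"
  shows "pairing \<mu> (weight \<Delta>) = 2 * (LINT z|leb_sq. E z * ((A z + B \<Delta> z) * B \<mu> z))"
proof -
  define k where "k = (\<lambda>z. E z * ((A z + B \<Delta> z) * B \<mu> z))"
  have ki: "integrable leb_sq k"
    unfolding k_def by (rule E_mult_integrable[OF residual_square_integrable[OF D] B_measurable[OF g] B_sq[OF g]])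
  have i: "integrable leb01 (\<lambda>t. 2 * (LINT x|leb01. k (t, x)))"
    using leb_sq.integrable_fst'[OF ki] by simp
  have ae: "AE t in leb01. 2 * (LINT x|leb01. k (t, x)) = (LINT y|slice \<mu> t. weight \<Delta> t y)"
    using slice_pairing[OF D g] by eventually_elim (simp add: k_def)
  have "pairing \<mu> (weight \<Delta>) = (LINT t|leb01. 2 * (LINT x|leb01. k (t, x)))"
    unfolding pairing_def
    by (rule integral_cong_AE[symmetric])
      (use ae borel_measurable_integrable[OF i] borel_measurable_AE_leb01[OF borel_measurable_integrable[OF i] ae] in auto)
  also have "\<dots> = 2 * (LINT z|leb_sq. k z)"
    using leb_sq.integral_fst'[OF ki] by simp
  finally show ?thesis by (simp add: k_def)
qed

text \<open>Since \<open>B\<close> is linear, the residual changes by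
  \<open>(a - 1) * B \<Delta> + b * B \<mu>\<close>. The cross terms with the old residual are
  pairings by \<open>pairing_eq\<close>. The expansion is exact, so it gives the derivative along
  rays as well as the global comparison.\<close>

lemma J_expansion:
  assumes D: "admissible \<Delta>" and g: "admissible \<mu>" and ab: "0 \<le> a" "0 \<le> b"
  shows "J (lincomb a \<Delta> b \<mu>) = J \<Delta> + (a - 1) * pairing \<Delta> (weight \<Delta>) + b * pairing \<mu> (weight \<Delta>)
    + (LINT z|leb_sq. E z * ((a - 1) * B \<Delta> z + b * B \<mu> z)\<^sup>2)"
proof -
  define F where "F = (\<lambda>z. A z + B \<Delta> z)"
  define X where "X = B \<Delta>"
  define Y where "Y = B \<mu>"
  have F: "F \<in> borel_measurable leb_sq" "integrable leb_sq (\<lambda>z. (F z)\<^sup>2)"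
    using residual_square_integrable[OF D] by (simp_all add: F_def)
  note X = B_measurable[OF D, folded X_def] B_sq[OF D, folded X_def]
    and Y = B_measurable[OF g, folded Y_def] B_sq[OF g, folded Y_def]
  have i: "integrable leb_sq (\<lambda>z. E z * (F z * F z))" "integrable leb_sq (\<lambda>z. E z * (F z * X z))"
    "integrable leb_sq (\<lambda>z. E z * (F z * Y z))" "integrable leb_sq (\<lambda>z. E z * (X z * X z))"
    "integrable leb_sq (\<lambda>z. E z * (X z * Y z))" "integrable leb_sq (\<lambda>z. E z * (Y z * Y z))"
    using E_mult_integrable[OF F F] E_mult_integrable[OF F X] E_mult_integrable[OF F Y]
      E_mult_integrable[OF X X] E_mult_integrable[OF X Y] E_mult_integrable[OF Y Y] .
  have R: "(\<lambda>z. (a - 1) * X z + b * Y z) \<in> borel_measurable leb_sq" using X Y by auto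
  have Lm: "B (lincomb a \<Delta> b \<mu>) \<in> borel_measurable leb_sq" by (rule B_measurable[OF admissible_lincomb[OF D g ab]])
  have "J (lincomb a \<Delta> b \<mu>) = (LINT z|leb_sq. E z * (F z + ((a - 1) * X z + b * Y z))\<^sup>2)"
    unfolding J_def
  proof (rule integral_cong_AE)
    show "AE z in leb_sq. E z * (A z + B (lincomb a \<Delta> b \<mu>) z)\<^sup>2 = E z * (F z + ((a - 1) * X z + b * Y z))\<^sup>2"
      using B_lincomb[OF D g ab] by eventually_elim (simp add: F_def X_def Y_def algebra_simps)
  qed (use A_measurable Lm F R in auto)
  also have "\<dots> = (LINT z|leb_sq. E z * (F z * F z) + 2 * (a - 1) * (E z * (F z * X z)) + 2 * b * (E z * (F z * Y z))
      + ((a - 1)\<^sup>2 * (E z * (X z * X z)) + 2 * (a - 1) * b * (E z * (X z * Y z)) + b\<^sup>2 * (E z * (Y z * Y z))))"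
    by (intro Bochner_Integration.integral_cong refl) (simp add: power2_eq_square algebra_simps)
  also have "\<dots> = (LINT z|leb_sq. E z * (F z * F z)) + 2 * (a - 1) * (LINT z|leb_sq. E z * (F z * X z))
      + 2 * b * (LINT z|leb_sq. E z * (F z * Y z))
      + (LINT z|leb_sq. (a - 1)\<^sup>2 * (E z * (X z * X z)) + 2 * (a - 1) * b * (E z * (X z * Y z)) + b\<^sup>2 * (E z * (Y z * Y z)))"
    using i by simp
  also have "(LINT z|leb_sq. (a - 1)\<^sup>2 * (E z * (X z * X z)) + 2 * (a - 1) * b * (E z * (X z * Y z)) + b\<^sup>2 * (E z * (Y z * Y z)))
      = (LINT z|leb_sq. E z * ((a - 1) * X z + b * Y z)\<^sup>2)"
    by (intro Bochner_Integration.integral_cong refl) (simp add: power2_eq_square algebra_simps)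
  also have "(LINT z|leb_sq. E z * (F z * F z)) = J \<Delta>"
    by (simp add: J_def F_def power2_eq_square)
  finally show ?thesis
    unfolding pairing_eq[OF D D] pairing_eq[OF D g] F_def X_def Y_def by (simp add: algebra_simps)
qed

end

section \<open>Optimality conditions\<close>

lemma linear_term_nonneg:
  fixes k r :: real
  assumes "\<And>\<epsilon>. 0 < \<epsilon> \<Longrightarrow> \<epsilon> \<le> 1 \<Longrightarrow> 0 \<le> \<epsilon> * k + \<epsilon>\<^sup>2 * r"
  shows "0 \<le> k"
proof (rule tendsto_lowerbound)
  have "((\<lambda>\<epsilon>. k + \<epsilon> * r) \<longlongrightarrow> k + 0 * r) (at_right 0)"
    by (intro tendsto_intros)
  then show "((\<lambda>\<epsilon>. k + \<epsilon> * r) \<longlongrightarrow> k) (at_right 0)" by simp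
  have "\<forall>\<^sub>F \<epsilon> in at_right 0. \<epsilon> \<in> {0<..<1::real}"
    by (rule eventually_at_right_real) simp
  then show "\<forall>\<^sub>F \<epsilon> in at_right 0. 0 \<le> k + \<epsilon> * r"
  proof eventually_elim
    fix \<epsilon> :: real assume e: "\<epsilon> \<in> {0<..<1}"
    then have "0 \<le> \<epsilon> * (k + \<epsilon> * r)"
      using assms[of \<epsilon>] by (simp add: power2_eq_square algebra_simps)
    then show "0 \<le> k + \<epsilon> * r" using e by (simp add: zero_le_mult_iff)
  qed
qed simp

lemma admissible_null: "admissible (null_measure borel_sq)"
  by (simp add: admissible_def null_in_M0)

context acceleration
begin

lemma J_nonneg: "0 \<le> J \<mu>"
  unfolding J_def using E_pos by (intro Bochner_Integration.integral_nonneg) (simp add: less_imp_le)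

lemma FR_convex:
  "admissible \<Delta> \<Longrightarrow> admissible \<mu> \<Longrightarrow> 0 \<le> a \<Longrightarrow> 0 \<le> b \<Longrightarrow>
    FR_dt q (lincomb a \<Delta> b \<mu>) \<le> ennreal a * FR_dt q \<Delta> + ennreal b * FR_dt q \<mu>"
  unfolding admissible_def using FR_dt_convex[OF _ _ _ _ _ _ eta_cont_sq] by blast

lemma FR_infinite: "\<not> dt_is_measure \<mu> \<Longrightarrow> relaxed_functional P \<mu> p q = \<infinity>"
  by (simp add: relaxed_functional_def FR_dt_def)

lemma functional_real:
  assumes "admissible \<mu>" "FR_dt q \<mu> = ennreal N" "0 \<le> N"
  shows "relaxed_functional P \<mu> p q = ereal (N + J \<mu> + P (p 1) (q 1))"
  unfolding functional_eq[OF assms(1)] assms(2) using assms(3) J_nonneg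
  by (simp add: ennreal_plus[symmetric] enn2ereal_ennreal del: ennreal_plus)

lemma functional_infinite:
  assumes "FR_dt q \<mu> = \<infinity>" shows "relaxed_functional P \<mu> p q = \<infinity>"
  by (simp add: relaxed_functional_def assms)

text \<open>The first variation along the rays \<open>(1 + \<epsilon> s) \<Delta> + \<epsilon> b \<mu>\<close> gives both conditions:
  \<open>s = \<plusminus>1, b = 0\<close> the equality and \<open>s = 0, b = 1\<close> the inequality.\<close>

lemma first_variation:
  assumes D: "admissible \<Delta>" and g: "admissible \<mu>"
    and N: "FR_dt q \<Delta> = ennreal N" "0 \<le> N" and M: "FR_dt q \<mu> = ennreal M" "0 \<le> M"
    and min: "\<And>\<nu>. \<nu> \<in> M0 \<Longrightarrow> relaxed_functional P \<Delta> p q \<le> relaxed_functional P \<nu> p q"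
    and s: "-1 \<le> s" and b: "0 \<le> b"
  shows "0 \<le> s * (N + pairing \<Delta> (weight \<Delta>)) + b * (M + pairing \<mu> (weight \<Delta>))"
proof (rule linear_term_nonneg)
  fix \<epsilon> :: real assume e: "0 < \<epsilon>" "\<epsilon> \<le> 1"
  define L where "L = lincomb (1 + \<epsilon> * s) \<Delta> (\<epsilon> * b) \<mu>"
  define R where "R = (LINT z|leb_sq. E z * (s * B \<Delta> z + b * B \<mu> z)\<^sup>2)"
  \<comment> \<open>With \<epsilon> at most 1, the bound -1 on \<open>s\<close> keeps the
    perturbation inside the cone.\<close>
  have ab: "0 \<le> 1 + \<epsilon> * s" "0 \<le> \<epsilon> * b"
    using e b mult_left_mono[OF s, of \<epsilon>] by auto
  have gL: "admissible L" unfolding L_def by (rule admissible_lincomb[OF D g ab])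
  have le: "FR_dt q L \<le> ennreal ((1 + \<epsilon> * s) * N + \<epsilon> * b * M)"
    using FR_convex[OF D g ab] N M ab by (simp add: L_def ennreal_mult)
  then have "FR_dt q L < top" using le_less_trans ennreal_less_top by blast
  then obtain K where K: "FR_dt q L = ennreal K" "0 \<le> K"
    by (cases "FR_dt q L") auto
  have K_le: "K \<le> (1 + \<epsilon> * s) * N + \<epsilon> * b * M"
    using le ab N(2) M(2) unfolding K(1) by (subst (asm) ennreal_le_iff) auto
  have "N + J \<Delta> \<le> K + J L"
    using min[of L] gL functional_real[OF D N] functional_real[OF gL K] by (simp add: admissible_def)
  also have "J L = J \<Delta> + \<epsilon> * s * pairing \<Delta> (weight \<Delta>) + \<epsilon> * b * pairing \<mu> (weight \<Delta>)
      + (LINT z|leb_sq. E z * (\<epsilon> * s * B \<Delta> z + \<epsilon> * b * B \<mu> z)\<^sup>2)"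
    unfolding L_def J_expansion[OF D g ab] by simp
  also have "(LINT z|leb_sq. E z * (\<epsilon> * s * B \<Delta> z + \<epsilon> * b * B \<mu> z)\<^sup>2)
      = (LINT z|leb_sq. \<epsilon>\<^sup>2 * (E z * (s * B \<Delta> z + b * B \<mu> z)\<^sup>2))"
    by (intro Bochner_Integration.integral_cong refl) (simp add: power2_eq_square algebra_simps)
  also have "\<dots> = \<epsilon>\<^sup>2 * R" unfolding R_def by simp
  finally show "0 \<le> \<epsilon> * (s * (N + pairing \<Delta> (weight \<Delta>)) + b * (M + pairing \<mu> (weight \<Delta>)))
      + \<epsilon>\<^sup>2 * (LINT z|leb_sq. E z * (s * B \<Delta> z + b * B \<mu> z)\<^sup>2)"
    using K_le unfolding R_def[symmetric] by (simp add: algebra_simps)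
qed

lemma pairing_minus: "pairing \<mu> (\<lambda>t x. - w t x) = - pairing \<mu> w"
  by (simp add: pairing_def)

text \<open>The null measure has finite cost, so a minimizer has a finite Fisher-Rao term and a
  measure as time derivative; only then do its slices and the expansion along rays make
  sense.\<close>

lemma minimizer_necessary:
  assumes D: "\<Delta> \<in> M0"
    and min: "\<And>\<nu>. \<nu> \<in> M0 \<Longrightarrow> relaxed_functional P \<Delta> p q \<le> relaxed_functional P \<nu> p q"
  shows "\<forall>\<mu>\<in>M0. dt_is_measure \<mu> \<longrightarrow> enn2ereal (FR_dt q \<mu>) \<ge> ereal (pairing \<mu> (\<lambda>t x. - weight \<Delta> t x))"
    and "enn2ereal (FR_dt q \<Delta>) + ereal (pairing \<Delta> (weight \<Delta>)) = 0"
proof -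
  have "relaxed_functional P (null_measure borel_sq) p q < \<infinity>"
    using functional_real[OF admissible_null, of 0] FR_dt_null[OF eta_cont_sq] by simp
  then have "relaxed_functional P \<Delta> p q < \<infinity>"
    using min[OF null_in_M0(1)] le_less_trans by blast
  then have fin: "dt_is_measure \<Delta>" "FR_dt q \<Delta> \<noteq> \<infinity>"
    using FR_infinite functional_infinite by force+
  then have gD: "admissible \<Delta>" using D by (simp add: admissible_def)
  obtain N where N: "FR_dt q \<Delta> = ennreal N" "0 \<le> N"
    using fin(2) by (cases "FR_dt q \<Delta>") auto
  have "N + pairing \<Delta> (weight \<Delta>) = 0"
    using first_variation[OF gD gD N N min, of 1 0] first_variation[OF gD gD N N min, of "-1" 0] by simp
  then show "enn2ereal (FR_dt q \<Delta>) + ereal (pairing \<Delta> (weight \<Delta>)) = 0"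
    unfolding N(1) using N(2) by (simp add: enn2ereal_ennreal)
  show "\<forall>\<mu>\<in>M0. dt_is_measure \<mu> \<longrightarrow> enn2ereal (FR_dt q \<mu>) \<ge> ereal (pairing \<mu> (\<lambda>t x. - weight \<Delta> t x))"
  proof (intro ballI impI)
    fix \<mu> assume "\<mu> \<in> M0" "dt_is_measure \<mu>"
    then have g: "admissible \<mu>" by (simp add: admissible_def)
    show "enn2ereal (FR_dt q \<mu>) \<ge> ereal (pairing \<mu> (\<lambda>t x. - weight \<Delta> t x))"
    proof (cases "FR_dt q \<mu>")
      case (real M)
      have "0 \<le> M + pairing \<mu> (weight \<Delta>)"
        using first_variation[OF gD g N real(2,1) min, of 0 1] real by simp
      then show ?thesis
        using real by (simp add: pairing_minus enn2ereal_ennreal)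
    qed simp
  qed
qed

text \<open>With \<open>a = 0\<close> and \<open>b = 1\<close> the expansion compares \<Delta> with
  \<nu> directly. The remainder is a nonnegative square, and the linear terms are settled by the
  inequality at \<nu> and the equality at \<Delta>.\<close>

lemma minimizer_sufficient:
  assumes D: "\<Delta> \<in> M0"
    and ineq: "\<And>\<mu>. \<mu> \<in> M0 \<Longrightarrow> dt_is_measure \<mu> \<Longrightarrow>
      enn2ereal (FR_dt q \<mu>) \<ge> ereal (pairing \<mu> (\<lambda>t x. - weight \<Delta> t x))"
    and eq: "enn2ereal (FR_dt q \<Delta>) + ereal (pairing \<Delta> (weight \<Delta>)) = 0"
    and m: "\<nu> \<in> M0"
  shows "relaxed_functional P \<Delta> p q \<le> relaxed_functional P \<nu> p q"
proof (cases "dt_is_measure \<nu> \<and> FR_dt q \<nu> \<noteq> \<infinity>")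
  case False
  then have "relaxed_functional P \<nu> p q = \<infinity>" using FR_infinite functional_infinite by blast
  then show ?thesis by simp
next
  case True
  then have g: "admissible \<nu>" using m by (simp add: admissible_def)
  \<comment> \<open>An infinite value plus a real number would not be 0.\<close>
  have finD: "FR_dt q \<Delta> \<noteq> \<infinity>" using eq by auto
  then have "dt_is_measure \<Delta>" by (auto simp: FR_dt_def split: if_splits)
  then have gD: "admissible \<Delta>" using D by (simp add: admissible_def)
  obtain N where N: "FR_dt q \<Delta> = ennreal N" "0 \<le> N" using finD by (cases "FR_dt q \<Delta>") auto
  obtain M where M: "FR_dt q \<nu> = ennreal M" "0 \<le> M" using True by (cases "FR_dt q \<nu>") auto
  have N_eq: "N + pairing \<Delta> (weight \<Delta>) = 0"
    using eq N by (simp add: enn2ereal_ennreal)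
  have M_ge: "- pairing \<nu> (weight \<Delta>) \<le> M"
    using ineq[OF m] True M by (simp add: pairing_minus enn2ereal_ennreal)
  \<comment> \<open>Writing \<nu> as a combination with coefficient 0 brings the competitor into the
    form of the expansion without signed differences of measures.\<close>
  have "lincomb 0 \<Delta> 1 \<nu> = \<nu>"
    using admissible_finite_pos[OF gD] admissible_finite_pos[OF g]
    by (intro measure_eqI) (simp_all add: finite_pos_measure_def emeasure_lincomb)
  moreover define R where "R = (LINT z|leb_sq. E z * ((0 - 1) * B \<Delta> z + 1 * B \<nu> z)\<^sup>2)"
  ultimately have "J \<nu> = J \<Delta> - pairing \<Delta> (weight \<Delta>) + pairing \<nu> (weight \<Delta>) + R"
    using J_expansion[OF gD g, of 0 1] unfolding R_def by simp
  moreover have "0 \<le> R"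
    unfolding R_def using E_pos by (intro Bochner_Integration.integral_nonneg) (simp add: less_imp_le)
  ultimately have "N + J \<Delta> \<le> M + J \<nu>" using N_eq M_ge by linarith
  then show ?thesis
    unfolding functional_real[OF gD N] functional_real[OF g M] by simp
qed

end

theorem theorem7p3:
  fixes P :: "(real \<Rightarrow> real) \<Rightarrow> (real \<Rightarrow> real) \<Rightarrow> real"
    and p0 q0 :: "real \<Rightarrow> real"
    and p q :: "real \<Rightarrow> real \<Rightarrow> real"
    and \<Delta> :: "(real \<times> real) measure"
    and w :: "real \<Rightarrow> real \<Rightarrow> real"
  assumes "q0 \<in> Q" and "p0 \<in> cotangent q0"
    and "(p, q) \<in> C0 p0 q0"
    and "\<Delta> \<in> M0"
    and "w = (\<lambda>t x. eta (q t) x * (LINT y|lebesgue_on {0..x}.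
      cov_acc p q t y + eta (q t) y * proj_cot (q t) (U_meas \<Delta> q t) y))"
  shows "is_arg_min (\<lambda>\<nu>. relaxed_functional P \<nu> p q) (\<lambda>\<nu>. \<nu> \<in> M0) \<Delta> \<longleftrightarrow>
    (\<forall>\<mu>\<in>M0. dt_is_measure \<mu> \<longrightarrow>
        enn2ereal (FR_dt q \<mu>) \<ge> ereal (pairing \<mu> (\<lambda>t x. - w t x))) \<and>
    enn2ereal (FR_dt q \<Delta>) + ereal (pairing \<Delta> w) = 0"
  proof -
  obtain A where A: "A \<in> borel_measurable borel" "integrable leb_sq (\<lambda>z. (A z)\<^sup>2)"
    "AE z in leb_sq. cov_acc_flat p q (fst z) (snd z) = A z"
    "AE t in leb01. inner_eta (q t) (\<lambda>x. A (t, x)) (\<lambda>x. 1) = 0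
      \<and> inner_eta (q t) (\<lambda>x. A (t, x)) (phi (q t)) = 0"
    "continuous_on unit_sq (\<lambda>z. eta (q (fst z)) (snd z))"
    "\<And>t. t \<in> {0..1} \<Longrightarrow> q t \<in> Q"
    by (rule covariant_acceleration[OF assms(3)], blast)
  interpret acceleration p q A
    by standard (fact A)+
  have w: "w = weight \<Delta>"
    unfolding assms(5) by (intro ext) (simp only: weight_def)
  have "is_arg_min (\<lambda>\<nu>. relaxed_functional P \<nu> p q) (\<lambda>\<nu>. \<nu> \<in> M0) \<Delta> \<longleftrightarrow>
      (\<forall>\<nu>\<in>M0. relaxed_functional P \<Delta> p q \<le> relaxed_functional P \<nu> p q)"
    using assms(4) by (auto simp: is_arg_min_linorder)
  also have "\<dots> \<longleftrightarrow> (\<forall>\<mu>\<in>M0. dt_is_measure \<mu> \<longrightarrow>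
        enn2ereal (FR_dt q \<mu>) \<ge> ereal (pairing \<mu> (\<lambda>t x. - w t x))) \<and>
      enn2ereal (FR_dt q \<Delta>) + ereal (pairing \<Delta> w) = 0"
    unfolding w using minimizer_necessary[OF assms(4)] minimizer_sufficient[OF assms(4)] by blast
  finally show ?thesis .
qed


end
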